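(* Let $q$ be an odd prime power. Let $r$ be an odd integer at least $3$ and let $s$ be a positive integer relatively prime to $r$. Let $F$ be the rational function field $\mathbb{F}_q(x)$. Suppose that $$B_r(F) > \left\lfloor \frac{3+\lceil 2(2B_s(F)+1)^{1/2}\rceil}{r-2}\right\rfloor .$$ Then $$A(q^{rs}) \ge \frac{\sqrt{2}\,(r-2)}{r-1}\sqrt{s}\,q^{s/2} + \mathrm{O}(1).$$
   Context: $B_t(F)$ denotes the number of places of degree $t$ of the function field $F$. For a prime power $Q$ and an integer $g\ge 0$, $N_Q(g)$ is the maximum number of rational places (places of degree $1$) of a global function field of genus $g$ with full constant field $\mathbb{F}_Q$, and $A(Q)=\limsup_{g\to\infty} N_Q(g)/g$. The notation $f(q)=\mathrm{O}(g(q))$ means that there is a constant $M>0$ such that $|f(q)|\le M|g(q)|$ for all sufficiently large $q$; here $r$ and $s$ are fixed and $q$ varies over the odd prime powers satisfying the hypothesis. *)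

theory Defs
  imports
    Complex_Main
    "HOL-Library.Extended_Real"
    "HOL-Library.Liminf_Limsup"
    "HOL-Library.Landau_Symbols"
    "HOL-Number_Theory.Prime_Powers"
    "HOL-Algebra.Generated_Fields"
    "HOL-Algebra.Finite_Extensions"
begin

text \<open>
  Function fields of one variable \<open>R/K\<close>, following Stichtenoth: a field \<open>R\<close> with a subfield \<open>K\<close>,
  where some \<open>x\<close> is transcendental over \<open>K\<close> and \<open>R\<close> is a finite extension of \<open>K(x)\<close>. The notions
  below are meant for such pairs; the locale \<^term>\<open>ring\<close> only supplies the notation.
\<close>

definition function_field :: "('a, 'b) ring_scheme \<Rightarrow> 'a set \<Rightarrow> bool" where
  "function_field F K \<longleftrightarrow> field F \<and> subfield K F \<and>
     (\<exists>x \<in> carrier F. ring.transcendental F K x \<and>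
        ring.finite_dimension F (generate_field F (insert x K)) (carrier F))"

definition full_constant_field :: "('a, 'b) ring_scheme \<Rightarrow> 'a set \<Rightarrow> bool" where
  "full_constant_field F K \<longleftrightarrow> {z \<in> carrier F. ring.algebraic F K z} = K"

definition global_function_field :: "('a, 'b) ring_scheme \<Rightarrow> 'a set \<Rightarrow> bool" where
  "global_function_field F K \<longleftrightarrow> function_field F K \<and> full_constant_field F K \<and> finite K"

definition rational_function_field :: "('a, 'b) ring_scheme \<Rightarrow> 'a set \<Rightarrow> bool" where
  "rational_function_field F K \<longleftrightarrow> field F \<and> subfield K F \<and>
     (\<exists>x \<in> carrier F. ring.transcendental F K x \<and> carrier F = generate_field F (insert x K))"


subsection \<open>Places\<close>

definition (in ring) valuation_ring :: "'a set \<Rightarrow> 'a set \<Rightarrow> bool" where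
  "valuation_ring K V \<longleftrightarrow> subring V R \<and> K \<subset> V \<and> V \<subset> carrier R \<and>
     (\<forall>z \<in> carrier R - {\<zero>}. z \<in> V \<or> inv z \<in> V)"

definition (in ring) places :: "'a set \<Rightarrow> 'a set set" where
  "places K = {P. \<exists>V. valuation_ring K V \<and> maximalideal P (R\<lparr>carrier := V\<rparr>)}"

text \<open>The place \<open>P\<close> determines its valuation ring: a nonzero \<open>z\<close> is outside the valuation ring
  iff its inverse is in \<open>P\<close>.\<close>

definition (in ring) ring_of_place :: "'a set \<Rightarrow> ('a, 'b) ring_scheme" where
  "ring_of_place P = R\<lparr>carrier := {z \<in> carrier R. z = \<zero> \<or> inv z \<notin> P}\<rparr>"

definition (in ring) residue_field :: "'a set \<Rightarrow> 'a set ring" where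
  "residue_field P = ring_of_place P Quot P"

text \<open>The image of \<open>K\<close> in the residue class field is the field of scalars.\<close>

definition (in ring) place_degree :: "'a set \<Rightarrow> 'a set \<Rightarrow> nat" where
  "place_degree K P =
     ring.dim (residue_field P) ((\<lambda>k. P +>\<^bsub>ring_of_place P\<^esub> k) ` K) (carrier (residue_field P))"

definition (in ring) num_places :: "'a set \<Rightarrow> nat \<Rightarrow> nat" where
  "num_places K t = card {P \<in> places K. place_degree K P = t}"

text \<open>The normalized valuation at \<open>P\<close>, for nonzero arguments only: \<open>z = t\<^sup>n u\<close> with \<open>t\<close> a local
  parameter (a generator of \<open>P\<close>) and \<open>u\<close> a unit of the valuation ring. The exponent may be
  negative, so the power is taken in \<open>R\<close>.\<close>

definition (in ring) place_valuation :: "'a set \<Rightarrow> 'a \<Rightarrow> int" where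
  "place_valuation P z = (THE n. \<exists>t \<in> P. \<exists>u \<in> Units (ring_of_place P).
     P = PIdl\<^bsub>ring_of_place P\<^esub> t \<and> z = t [^] n \<otimes> u)"


subsection \<open>Divisors and the genus\<close>

definition (in ring) divisors :: "'a set \<Rightarrow> ('a set \<Rightarrow> int) set" where
  "divisors K = {D. finite {P. D P \<noteq> 0} \<and> {P. D P \<noteq> 0} \<subseteq> places K}"

definition (in ring) divisor_degree :: "'a set \<Rightarrow> ('a set \<Rightarrow> int) \<Rightarrow> int" where
  "divisor_degree K D = (\<Sum>P | D P \<noteq> 0. D P * int (place_degree K P))"

definition (in ring) Riemann_Roch_space :: "'a set \<Rightarrow> ('a set \<Rightarrow> int) \<Rightarrow> 'a set" where
  "Riemann_Roch_space K D =
     {z \<in> carrier R. z = \<zero> \<or> (\<forall>P \<in> places K. place_valuation P z \<ge> - D P)}"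

text \<open>Stichtenoth's definition; the maximum exists by Riemann's theorem.\<close>

definition (in ring) genus :: "'a set \<Rightarrow> int" where
  "genus K = (GREATEST n. \<exists>D \<in> divisors K.
     n = divisor_degree K D - int (dim K (Riemann_Roch_space K D)) + 1)"


subsection \<open>Asymptotics of the number of rational places\<close>

text \<open>Every global function field is countable, so up to isomorphism it is carried by a set of
  natural numbers, and quantifying over \<^typ>\<open>nat ring\<close> covers all of them. For \<open>Q\<close> a prime power
  the supremum is a maximum: there is a field of each genus, and the Hasse-Weil bound limits the
  number of rational places.\<close>

definition max_rational_places :: "nat \<Rightarrow> nat \<Rightarrow> ereal" where
  "max_rational_places Q g = (SUP (F, K) \<in> {(F :: nat ring, K).
     global_function_field F K \<and> card K = Q \<and> ring.genus F K = int g}.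
       ereal (real (ring.num_places F K 1)))"

definition Ihara_A :: "nat \<Rightarrow> ereal" where
  "Ihara_A Q = limsup (\<lambda>g. max_rational_places Q g / ereal (real g))"

end

theory Submission
  imports Defs "HOL-Algebra.Algebraic_Closure" "HOL-Computational_Algebra.Formal_Power_Series"
begin

text \<open>Put \<open>l = q\<^sup>s\<close> and \<open>Q = l\<^sup>r\<close>. The bound comes from the tower of Artin-Schreier extensions of the rational
  function field \<open>GF(Q)(t)\<close> with
  \<open>x\<^sub>i\<^sub>+\<^sub>1\<^sup>l - x\<^sub>i\<^sub>+\<^sub>1 = c (x\<^sub>i - t y\<^sub>i)\<close> and
  \<open>y\<^sub>i\<^sub>+\<^sub>1\<^sup>l - y\<^sub>i\<^sub>+\<^sub>1 = c (x\<^sub>i / t - y\<^sub>i)\<close>,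
  where \<open>x\<^sub>0 = y\<^sub>0 = 1\<close> and \<open>c = b\<^sup>l - b \<noteq> 0\<close> for some \<open>b\<close> in the constant field.

  Only \<open>t = 0\<close> and \<open>t = \<infinity>\<close> ramify, and mildly: a level of degree \<open>n\<close> over \<open>GF(Q)(t)\<close> has a
  basis over it with poles at most those of \<open>t\<close> above infinity, and a unipotently related basis with
  poles at most those of \<open>1/t\<close> above zero. Gluing the two lattices yields so many functions with
  bounded poles that the genus is at most \<open>n + 1\<close>, by Riemann's inequality.

  Each of the \<open>l - 1\<close> points \<open>t = a\<close> with \<open>a\<^sup>l = a \<noteq> 0\<close> splits completely: \<open>x\<^sub>i - a y\<^sub>i\<close> takes values
  in \<open>GF(l)\<close> there, so that all \<open>x\<^sub>i\<close> and \<open>y\<^sub>i\<close> are power series in \<open>t - a\<close> with constant coefficients.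
  The degrees are unbounded, since the values of the \<open>y\<^sub>i\<close> at a pole of \<open>t\<close> are distinct. Hence
  \<open>A(Q) \<ge> l - 2\<close>, and \<open>l - sqrt (2 s l) + s/2\<close> is a square.\<close>

section \<open>Subfields of a commutative ring with a different unit\<close>

text \<open>Write the recursion as F(v_(i+1)) - v_(i+1) = c N v_i with v_i = (x_i, y_i), where F
  raises coordinates to the l-th power and N is the column (1, 1/t) times the row (1, -t), a
  nilpotent matrix of rank one. At t = a in GF(l) the row (1, -a) annihilates N and is fixed by F;
  this is why x_i - a y_i takes values in GF(l). Over infinity the obstacle is that the x_i have
  poles and the two recursions are coupled. The quotient R of the generating series of x and y
  removes it: R satisfies a Riccati equation whose quadratic terms become K-linear in the earlier
  coefficients modulo regular functions, so that the Artin-Schreier generators can be straightened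
  one by one. Exchanging x with y and t with 1/t turns infinity into zero and inverts R. The exact
  degree of a level is never computed: a candidate basis is pruned to an independent one, and its
  length is bounded below by counting residues. As K is finite, dimensions, degrees of places and
  indices are all treated as cardinalities of finite sets, and a constant factor lost in such a
  count is removed by taking high powers.\<close>

text \<open>A field is represented as a subset of a commutative ring whose unit \<open>e\<close> is only an
  idempotent of that ring. Fields of all characteristics then live in one product ring, and the
  arithmetic of the type class \<^class>\<open>comm_ring_1\<close> is available. In particular \<open>x ^ 0\<close> is the unit of
  the ambient ring, not \<open>e\<close>.\<close>

definition esubring :: "'a::comm_ring_1 \<Rightarrow> 'a set \<Rightarrow> bool" where
  "esubring e R \<longleftrightarrow> e \<in> R \<and> (\<forall>x\<in>R. e * x = x \<and> - x \<in> R) \<and> (\<forall>x\<in>R. \<forall>y\<in>R. x + y \<in> R \<and> x * y \<in> R)"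

definition efield :: "'a::comm_ring_1 \<Rightarrow> 'a set \<Rightarrow> bool" where
  "efield e F \<longleftrightarrow> e \<noteq> 0 \<and> esubring e F \<and> (\<forall>x\<in>F. x \<noteq> 0 \<longrightarrow> (\<exists>y\<in>F. x * y = e))"

text \<open>In the ambient ring \<open>x * y = e\<close> may have many solutions;
  \<open>e * y = y\<close> singles out one. No field is mentioned, so the inverse of an element is
  the same in all subfields. Zero is sent to zero to keep inversion total.\<close>

definition iv :: "'a::comm_ring_1 \<Rightarrow> 'a \<Rightarrow> 'a" where
  "iv e x = (if x = 0 then 0 else THE y. x * y = e \<and> e * y = y)"

lemma esubringD:
  assumes "esubring e R"
  shows "e \<in> R" "\<And>x. x \<in> R \<Longrightarrow> e * x = x" "\<And>x. x \<in> R \<Longrightarrow> x * e = x" "\<And>x. x \<in> R \<Longrightarrow> - x \<in> R"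
    "\<And>x y. x \<in> R \<Longrightarrow> y \<in> R \<Longrightarrow> x + y \<in> R" "\<And>x y. x \<in> R \<Longrightarrow> y \<in> R \<Longrightarrow> x * y \<in> R"
    "\<And>x y. x \<in> R \<Longrightarrow> y \<in> R \<Longrightarrow> x - y \<in> R" "0 \<in> R"
proof -
  show *: "e \<in> R" "\<And>x. x \<in> R \<Longrightarrow> e * x = x" "\<And>x. x \<in> R \<Longrightarrow> - x \<in> R"
    "\<And>x y. x \<in> R \<Longrightarrow> y \<in> R \<Longrightarrow> x + y \<in> R" "\<And>x y. x \<in> R \<Longrightarrow> y \<in> R \<Longrightarrow> x * y \<in> R"
    using assms by (auto simp: esubring_def)
  show "\<And>x. x \<in> R \<Longrightarrow> x * e = x" using * by (simp add: mult.commute)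
  show "x - y \<in> R" if "x \<in> R" "y \<in> R" for x y
    using *(4)[OF that(1) *(3)[OF that(2)]] by simp
  from this[OF *(1) *(1)] show "0 \<in> R" by simp
qed

text \<open>Powers come multiplied by an element of the ring, often just \<open>e\<close>, because
  \<open>x ^ 0\<close> is the ambient unit and may lie outside.\<close>

lemma esubring_power_mult:
  assumes "esubring e R" "x \<in> R" "y \<in> R"
  shows "x ^ k * y \<in> R"
  by (induction k) (auto simp: mult.assoc intro: esubringD[OF assms(1)] assms)

lemma esubring_power:
  assumes "esubring e R" "x \<in> R" "k > 0"
  shows "x ^ k \<in> R"
  using esubring_power_mult[OF assms(1,2,2), of "k - 1"] assms(3) by (cases k) (auto simp: mult.commute)

lemma esubring_sum:
  assumes "esubring e R" "\<And>i. i \<in> A \<Longrightarrow> f i \<in> R"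
  shows "sum f A \<in> R"
  using assms(2) by (induction A rule: infinite_finite_induct) (auto intro: esubringD[OF assms(1)])

lemma esubring_prod:
  assumes "esubring e R" "\<And>i. i \<in> A \<Longrightarrow> f i \<in> R" "y \<in> R"
  shows "prod f A * y \<in> R"
  using assms(2) by (induction A rule: infinite_finite_induct)
    (auto simp: mult.assoc assms(3) intro: esubringD[OF assms(1)])

lemma unit_power_mult:
  assumes "esubring e R" "x \<in> R"
  shows "e ^ k * x = x"
  by (induction k) (auto simp: mult.assoc esubringD[OF assms(1)] assms)

lemma efield_esubring: "efield e F \<Longrightarrow> esubring e F"
  by (simp add: efield_def)

lemma efield_unit_nz: "efield e F \<Longrightarrow> e \<noteq> 0"
  by (simp add: efield_def)

lemmas efieldD = esubringD[OF efield_esubring]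

lemma iv_eqI:
  assumes "x * y = e" "e * y = y" "x \<noteq> 0"
  shows "iv e x = y"
proof -
  have "z = y" if "x * z = e \<and> e * z = z" for z
  proof -
    have "z = (x * y) * z" using that assms by simp
    also have "\<dots> = (x * z) * y" by (simp add: mult_ac)
    finally show ?thesis using that assms by simp
  qed
  hence "(THE y. x * y = e \<and> e * y = y) = y" using assms(1,2) by (intro the_equality) blast+
  thus ?thesis unfolding iv_def using assms(3) by simp
qed

lemma iv_zero [simp]: "iv e 0 = 0"
  by (simp add: iv_def)

lemma efield_iv:
  assumes "efield e F" "x \<in> F" "x \<noteq> 0"
  shows "iv e x \<in> F" "x * iv e x = e" "iv e x * x = e" "iv e x \<noteq> 0"
proof -
  obtain y where y: "y \<in> F" "x * y = e" using assms by (auto simp: efield_def)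
  have "iv e x = y" by (rule iv_eqI) (use y assms efieldD[OF assms(1)] in auto)
  thus "iv e x \<in> F" "x * iv e x = e" "iv e x * x = e" "iv e x \<noteq> 0"
    using y efield_unit_nz[OF assms(1)] by (auto simp: mult.commute)
qed

lemma efield_iv_closed: "efield e F \<Longrightarrow> x \<in> F \<Longrightarrow> iv e x \<in> F"
  using efield_iv(1)[of e F x] efieldD(8)[of e F] by (cases "x = 0") auto

lemma efield_no_zero_div:
  assumes "efield e F" "x \<in> F" "y \<in> F" "x * y = 0"
  shows "x = 0 \<or> y = 0"
proof (rule ccontr)
  assume "\<not> ?thesis"
  hence "y = iv e x * (x * y)" using efield_iv[OF assms(1,2)] efieldD[OF assms(1)] assms(3)
    by (simp add: mult.assoc[symmetric])
  with assms(4) \<open>\<not> ?thesis\<close> show False by simp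
qed

lemma efield_mult_nz: "efield e F \<Longrightarrow> x \<in> F \<Longrightarrow> y \<in> F \<Longrightarrow> x \<noteq> 0 \<Longrightarrow> y \<noteq> 0 \<Longrightarrow> x * y \<noteq> 0"
  using efield_no_zero_div by blast

lemma efield_cancel:
  assumes "efield e F" "x \<in> F" "y \<in> F" "z \<in> F" "x \<noteq> 0" "x * y = x * z"
  shows "y = z"
  using efield_no_zero_div[OF assms(1,2), of "y - z"] assms efieldD[OF assms(1)]
  by (auto simp: algebra_simps)

lemma efield_power_mult_nz:
  assumes "efield e F" "x \<in> F" "x \<noteq> 0" "y \<in> F" "y \<noteq> 0"
  shows "x ^ k * y \<noteq> 0"
proof (induction k)
  case (Suc k)
  have "x * (x ^ k * y) \<noteq> 0"
    by (rule efield_mult_nz[OF assms(1,2)])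
      (use Suc assms esubring_power_mult[OF efield_esubring] in auto)
  thus ?case by (simp add: mult.assoc)
qed (use assms in auto)

lemma efield_power_nz:
  assumes "efield e F" "x \<in> F" "x \<noteq> 0"
  shows "x ^ k \<noteq> 0"
  by (metis assms efield_power_mult_nz mult_zero_left)

lemma efield_prod_nz:
  assumes "efield e F" "\<And>i. i \<in> A \<Longrightarrow> f i \<in> F \<and> f i \<noteq> 0" "y \<in> F" "y \<noteq> 0"
  shows "prod f A * y \<noteq> 0"
  using assms(2)
proof (induction A rule: infinite_finite_induct)
  case (insert i A)
  have "f i * (prod f A * y) \<noteq> 0"
    by (rule efield_mult_nz[OF assms(1)])
      (use insert assms esubring_prod[OF efield_esubring[OF assms(1)], of A f y] in auto)
  thus ?case using insert by (simp add: mult.assoc)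
qed (use assms in auto)

lemma iv_iv:
  assumes "efield e F" "x \<in> F"
  shows "iv e (iv e x) = x"
proof (cases "x = 0")
  case False
  show ?thesis by (rule iv_eqI) (use False efield_iv[OF assms] efieldD[OF assms(1)] assms in auto)
qed simp

lemma iv_mult:
  assumes "efield e F" "x \<in> F" "y \<in> F"
  shows "iv e (x * y) = iv e x * iv e y"
proof (cases "x = 0 \<or> y = 0")
  case False
  hence "x * iv e x = e" "y * iv e y = e" "iv e x \<in> F" "iv e y \<in> F"
    using efield_iv assms by blast+
  moreover have "x * y * (iv e x * iv e y) = (x * iv e x) * (y * iv e y)" by (simp add: mult_ac)
  ultimately show ?thesis
    using False efield_mult_nz[OF assms] efieldD(1,2,6)[OF assms(1)] by (intro iv_eqI) simp_all
qed auto

lemma iv_unit [simp]: "efield e F \<Longrightarrow> iv e e = e"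
  by (rule iv_eqI) (auto simp: efieldD efield_unit_nz)

lemma iv_power:
  assumes "efield e F" "x \<in> F" "k > 0"
  shows "iv e (x ^ k) = iv e x ^ k"
  using assms(3)
proof (induction k rule: nat_induct_non_zero)
  case (Suc k)
  thus ?case using iv_mult[OF assms(1,2), of "x ^ k"] esubring_power[OF efield_esubring[OF assms(1)] assms(2)] by simp
qed simp

lemma efield_power_iv:
  assumes "efield e F" "x \<in> F" "x \<noteq> 0" "y \<in> F"
  shows "x ^ k * (iv e x ^ k * y) = y"
proof -
  have "x ^ k * (iv e x ^ k * y) = (x * iv e x) ^ k * y" by (simp add: mult.assoc power_mult_distrib)
  thus ?thesis using efield_iv[OF assms(1-3)] unit_power_mult[OF efield_esubring] assms by simp
qed

lemma efield_finite:
  assumes "esubring e R" "finite R" "R \<subseteq> F" "efield e F"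
  shows "efield e R"
  unfolding efield_def
proof (intro conjI ballI impI)
  fix x assume x: "x \<in> R" "x \<noteq> 0"
  have "inj_on ((*) x) R" using efield_cancel[OF assms(4)] x assms(3) by (intro inj_onI) (meson subsetD)
  hence "(*) x ` R = R" using x(1) assms(2) esubringD(6)[OF assms(1)] by (intro endo_inj_surj) auto
  thus "\<exists>y\<in>R. x * y = e" using esubringD(1)[OF assms(1)] by (metis imageE)
qed (use assms efield_unit_nz in auto)

section \<open>Polynomials and fractions\<close>

text \<open>Values at \<open>s\<close> of the polynomials of degree less than \<open>d\<close> over \<open>K\<close>.\<close>

primrec polys_below :: "'a::comm_ring_1 set \<Rightarrow> 'a \<Rightarrow> nat \<Rightarrow> 'a set" where
  "polys_below K s 0 = {0}"
| "polys_below K s (Suc d) = {a + s * p |a p. a \<in> K \<and> p \<in> polys_below K s d}"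

definition polys :: "'a::comm_ring_1 set \<Rightarrow> 'a \<Rightarrow> 'a set" where
  "polys K s = (\<Union>d. polys_below K s d)"

lemma polys_below_SucI: "a \<in> K \<Longrightarrow> p \<in> polys_below K s d \<Longrightarrow> a + s * p \<in> polys_below K s (Suc d)"
  by auto

lemma polys_below_SucE:
  assumes "p \<in> polys_below K s (Suc d)"
  obtains a p' where "p = a + s * p'" "a \<in> K" "p' \<in> polys_below K s d"
  using assms by auto

declare polys_below.simps(2) [simp del]

context
  fixes e :: "'a::comm_ring_1" and K :: "'a set" and s :: 'a
  assumes K: "esubring e K"
begin

lemma polys_below_zero: "0 \<in> polys_below K s d"
  by (induction d) (use polys_below_SucI[of 0 K 0] esubringD(8)[OF K] in auto)

lemma polys_below_add: "p \<in> polys_below K s d \<Longrightarrow> r \<in> polys_below K s d \<Longrightarrow> p + r \<in> polys_below K s d"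
proof (induction d arbitrary: p r)
  case (Suc d)
  from Suc.prems(1) obtain a p' where p: "p = a + s * p'" "a \<in> K" "p' \<in> polys_below K s d"
    by (rule polys_below_SucE)
  from Suc.prems(2) obtain b r' where r: "r = b + s * r'" "b \<in> K" "r' \<in> polys_below K s d"
    by (rule polys_below_SucE)
  have "p + r = (a + b) + s * (p' + r')" using p r by (simp add: algebra_simps)
  thus ?case using polys_below_SucI Suc.IH p r esubringD(5)[OF K] by metis
qed auto

lemma polys_below_scale: "c \<in> K \<Longrightarrow> p \<in> polys_below K s d \<Longrightarrow> c * p \<in> polys_below K s d"
proof (induction d arbitrary: p)
  case (Suc d)
  from Suc.prems(2) obtain a p' where p: "p = a + s * p'" "a \<in> K" "p' \<in> polys_below K s d"
    by (rule polys_below_SucE)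
  have "c * p = (c * a) + s * (c * p')" using p by (simp add: algebra_simps)
  thus ?case using polys_below_SucI Suc p esubringD(6)[OF K] by metis
qed auto

lemma polys_below_uminus: "p \<in> polys_below K s d \<Longrightarrow> - p \<in> polys_below K s d"
proof (induction d arbitrary: p)
  case (Suc d)
  from Suc.prems obtain a p' where p: "p = a + s * p'" "a \<in> K" "p' \<in> polys_below K s d"
    by (rule polys_below_SucE)
  have "- p = (- a) + s * (- p')" using p by (simp add: algebra_simps)
  thus ?case using polys_below_SucI Suc p esubringD(4)[OF K] by metis
qed auto

lemma polys_below_diff: "p \<in> polys_below K s d \<Longrightarrow> r \<in> polys_below K s d \<Longrightarrow> p - r \<in> polys_below K s d"
  using polys_below_add[of p d "- r"] polys_below_uminus[of r d] by simp

lemma polys_below_shift: "p \<in> polys_below K s d \<Longrightarrow> s * p \<in> polys_below K s (Suc d)"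
  using polys_below_SucI[of 0 K p] esubringD(8)[OF K] by simp

lemma polys_below_const: "a \<in> K \<Longrightarrow> a \<in> polys_below K s (Suc d)"
  using polys_below_SucI[OF _ polys_below_zero[of d]] by fastforce

lemma polys_below_Suc: "p \<in> polys_below K s d \<Longrightarrow> p \<in> polys_below K s (Suc d)"
proof (induction d arbitrary: p)
  case 0 thus ?case using polys_below_zero[of "Suc 0"] by auto
next
  case (Suc d)
  from Suc.prems obtain a p' where p: "p = a + s * p'" "a \<in> K" "p' \<in> polys_below K s d"
    by (rule polys_below_SucE)
  thus ?case using Suc.IH polys_below_SucI by blast
qed

lemma polys_below_mono: "d \<le> d' \<Longrightarrow> polys_below K s d \<subseteq> polys_below K s d'"
  by (induction d' rule: dec_induct) (use polys_below_Suc in auto)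

text \<open>The index of \<open>polys_below\<close> exceeds the degree bound by one, so
  \<open>a\<close> and \<open>Suc b\<close> combine to \<open>a + b\<close>.\<close>

lemma polys_below_mult:
  "p \<in> polys_below K s a \<Longrightarrow> r \<in> polys_below K s (Suc b) \<Longrightarrow> p * r \<in> polys_below K s (a + b)"
proof (induction a arbitrary: p)
  case 0 thus ?case using polys_below_zero[of b] by auto
next
  case (Suc a)
  from Suc.prems(1) obtain k p' where p: "p = k + s * p'" "k \<in> K" "p' \<in> polys_below K s a"
    by (rule polys_below_SucE)
  have "k * r \<in> polys_below K s (Suc a + b)"
    using polys_below_scale[OF p(2) Suc.prems(2)] polys_below_mono[of "Suc b" "Suc a + b"] by (simp add: subset_iff)
  moreover have "s * (p' * r) \<in> polys_below K s (Suc a + b)"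
    using polys_below_shift[OF Suc.IH[OF p(3) Suc.prems(2)]] by simp
  ultimately show ?case using polys_below_add[of "k * r" _ "s * (p' * r)"] p(1)
    by (simp add: algebra_simps)
qed

lemma polys_below_var_power: "a \<in> K \<Longrightarrow> s ^ k * a \<in> polys_below K s (Suc k)"
  by (induction k) (simp_all add: mult.assoc polys_below_const polys_below_shift)

lemma polys_below_finite: "finite K \<Longrightarrow> finite (polys_below K s d) \<and> card (polys_below K s d) \<le> card K ^ d"
proof (induction d)
  case (Suc d)
  have eq: "polys_below K s (Suc d) = (\<lambda>(a, p). a + s * p) ` (K \<times> polys_below K s d)"
    by (auto simp: polys_below.simps(2))
  have "card (polys_below K s (Suc d)) \<le> card (K \<times> polys_below K s d)"
    unfolding eq by (rule card_image_le) (use Suc in auto)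
  also have "\<dots> \<le> card K * card K ^ d" using Suc by (simp add: card_cartesian_product)
  finally show ?case using Suc unfolding eq by auto
qed auto

lemma polysI: "p \<in> polys_below K s d \<Longrightarrow> p \<in> polys K s"
  by (auto simp: polys_def)

lemma polys_induct [consumes 1, case_names zero step]:
  assumes "p \<in> polys K s" "P 0" "\<And>a p. a \<in> K \<Longrightarrow> p \<in> polys K s \<Longrightarrow> P p \<Longrightarrow> P (a + s * p)"
  shows "P p"
proof -
  obtain d where "p \<in> polys_below K s d" using assms(1) by (auto simp: polys_def)
  thus ?thesis
  proof (induction d arbitrary: p)
    case (Suc d)
    thus ?case using assms(3) polysI by (metis polys_below_SucE)
  qed (use assms(2) in auto)
qed

lemma polys_const: "a \<in> K \<Longrightarrow> a \<in> polys K s"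
  using polys_below_const polysI by blast

lemma polys_step: "a \<in> K \<Longrightarrow> p \<in> polys K s \<Longrightarrow> a + s * p \<in> polys K s"
  unfolding polys_def using polys_below_SucI by blast

lemma polys_common:
  assumes "p \<in> polys K s" "r \<in> polys K s"
  obtains d where "p \<in> polys_below K s (Suc d)" "r \<in> polys_below K s (Suc d)"
proof -
  obtain a b where "p \<in> polys_below K s a" "r \<in> polys_below K s b" using assms by (auto simp: polys_def)
  moreover have "a \<le> Suc (max a b)" "b \<le> Suc (max a b)" by auto
  ultimately show thesis using that polys_below_mono by blast
qed

lemma polys_subset:
  assumes "esubring e R" "K \<subseteq> R" "s \<in> R"
  shows "polys K s \<subseteq> R"
proof
  fix p assume "p \<in> polys K s" thus "p \<in> R"
    by (induction rule: polys_induct) (use assms esubringD[OF assms(1)] in auto)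
qed

lemma polys_esubring:
  assumes "e * s = s"
  shows "esubring e (polys K s)"
  unfolding esubring_def
proof (intro conjI ballI)
  show "e \<in> polys K s" using polys_const esubringD[OF K] by blast
  fix x assume x: "x \<in> polys K s"
  show "e * x = x" using x
  proof (induction rule: polys_induct)
    case (step a p)
    have "e * (a + s * p) = e * a + (e * s) * p" by (simp add: algebra_simps)
    thus ?case using esubringD(2)[OF K step(1)] assms by simp
  qed simp
  obtain d where "x \<in> polys_below K s d" using x by (auto simp: polys_def)
  thus "- x \<in> polys K s" using polys_below_uminus polysI by blast
  fix y assume y: "y \<in> polys K s"
  obtain d where "x \<in> polys_below K s (Suc d)" "y \<in> polys_below K s (Suc d)" using polys_common[OF x y] .
  thus "x + y \<in> polys K s" "x * y \<in> polys K s" using polys_below_add polys_below_mult polysI by blast+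
qed

lemma polys_var: "e * s = s \<Longrightarrow> s \<in> polys K s"
  using polys_step[OF esubringD(8)[OF K] polys_const[OF esubringD(1)[OF K]]] by (simp add: mult.commute)

end

definition fractions :: "'a::comm_ring_1 \<Rightarrow> 'a set \<Rightarrow> 'a set" where
  "fractions e R = {f * iv e g |f g. f \<in> R \<and> g \<in> R \<and> g \<noteq> 0}"

lemma fractionsI: "f \<in> R \<Longrightarrow> g \<in> R \<Longrightarrow> g \<noteq> 0 \<Longrightarrow> f * iv e g \<in> fractions e R"
  by (auto simp: fractions_def)

context
  fixes e :: "'a::comm_ring_1" and L R :: "'a set"
  assumes L: "efield e L" and R: "esubring e R" and RL: "R \<subseteq> L"
begin

lemma fractions_subset: "F \<subseteq> L \<Longrightarrow> efield e F \<Longrightarrow> R \<subseteq> F \<Longrightarrow> fractions e R \<subseteq> F"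
  using efield_iv(1)[of e F] efieldD(6)[of e F] by (auto simp: fractions_def subset_iff)

lemma fractions_incl: "R \<subseteq> fractions e R"
  using fractionsI[OF _ esubringD(1)[OF R] efield_unit_nz[OF L]] esubringD[OF R] iv_unit[OF L] by (metis subsetI)

lemma fractions_efield: "efield e (fractions e R)"
  unfolding efield_def esubring_def
proof (intro conjI ballI impI)
  note RD = esubringD[OF R] and LD = efieldD[OF L]
  show "e \<noteq> 0" using efield_unit_nz L by blast
  show "e \<in> fractions e R" using fractions_incl RD by blast
  fix x assume "x \<in> fractions e R"
  then obtain f g where x: "x = f * iv e g" "f \<in> R" "g \<in> R" "g \<noteq> 0" by (auto simp: fractions_def)
  hence xL: "f \<in> L" "g \<in> L" using RL by auto
  note ig = efield_iv[OF L xL(2) x(4)]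
  show "e * x = x" using x LD xL ig by (simp add: mult.assoc[symmetric])
  show "- x \<in> fractions e R" using x RD fractionsI[of "- f" R g e] by auto
  show "\<exists>y\<in>fractions e R. x * y = e" if "x \<noteq> 0"
  proof
    have f: "f \<noteq> 0" using that x by auto
    show "g * iv e f \<in> fractions e R" using f x by (auto intro: fractionsI)
    have "x * (g * iv e f) = (f * iv e f) * (iv e g * g)" using x by (simp add: mult_ac)
    thus "x * (g * iv e f) = e" using efield_iv(2)[OF L xL(1) f] ig(3) LD(1,2) by simp
  qed
  fix y assume "y \<in> fractions e R"
  then obtain f' g' where y: "y = f' * iv e g'" "f' \<in> R" "g' \<in> R" "g' \<noteq> 0" by (auto simp: fractions_def)
  hence yL: "f' \<in> L" "g' \<in> L" using RL by auto
  note ig' = efield_iv[OF L yL(2) y(4)]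
  have gg: "g * g' \<noteq> 0" "g * g' \<in> R" "iv e (g * g') = iv e g * iv e g'"
    using efield_mult_nz[OF L] xL yL x y RD iv_mult[OF L] by auto
  have "x * y = f * f' * iv e (g * g')" using x y gg by (simp add: mult_ac)
  thus "x * y \<in> fractions e R" using fractionsI[of "f * f'" R "g * g'" e] x(2) y(2) gg(1,2) RD(6) by simp
  have "(f * g' + f' * g) * iv e (g * g') = (f * iv e g) * (g' * iv e g') + (f' * iv e g') * (g * iv e g)"
    unfolding gg by (simp add: algebra_simps)
  hence "x + y = (f * g' + f' * g) * iv e (g * g')"
    using x y ig ig' LD xL yL by simp
  thus "x + y \<in> fractions e R" using fractionsI[of "f * g' + f' * g" R "g * g'" e] x y gg RD by auto
qed

end

section \<open>Spans\<close>

text \<open>The coefficient set is arbitrary: besides fields and rings it will be a set of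
  polynomials of bounded degree or another additive group.\<close>

primrec lspan :: "'a::comm_ring_1 set \<Rightarrow> 'a list \<Rightarrow> 'a set" where
  "lspan E [] = {0}"
| "lspan E (w # ws) = {a * w + z |a z. a \<in> E \<and> z \<in> lspan E ws}"

lemma lspan_ConsI: "a \<in> E \<Longrightarrow> z \<in> lspan E ws \<Longrightarrow> a * w + z \<in> lspan E (w # ws)"
  by auto

lemma lspan_ConsE:
  assumes "x \<in> lspan E (w # ws)"
  obtains a z where "x = a * w + z" "a \<in> E" "z \<in> lspan E ws"
  using assms by auto

declare lspan.simps(2) [simp del]

lemma lspan_zero: "0 \<in> E \<Longrightarrow> 0 \<in> lspan E ws"
  by (induction ws) (use lspan_ConsI[of 0] in fastforce)+

lemma lspan_add:
  assumes "\<And>a b. a \<in> E \<Longrightarrow> b \<in> E \<Longrightarrow> a + b \<in> E"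
  shows "x \<in> lspan E ws \<Longrightarrow> y \<in> lspan E ws \<Longrightarrow> x + y \<in> lspan E ws"
proof (induction ws arbitrary: x y)
  case (Cons w ws)
  from Cons.prems(1) obtain a z where x: "x = a * w + z" "a \<in> E" "z \<in> lspan E ws" by (rule lspan_ConsE)
  from Cons.prems(2) obtain b u where y: "y = b * w + u" "b \<in> E" "u \<in> lspan E ws" by (rule lspan_ConsE)
  have "x + y = (a + b) * w + (z + u)" using x y by (simp add: algebra_simps)
  thus ?case using lspan_ConsI[OF assms[OF x(2) y(2)] Cons.IH[OF x(3) y(3)]] by simp
qed simp

lemma lspan_scale:
  assumes "\<And>a. a \<in> E \<Longrightarrow> c * a \<in> E'"
  shows "x \<in> lspan E ws \<Longrightarrow> c * x \<in> lspan E' ws"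
proof (induction ws arbitrary: x)
  case (Cons w ws)
  from Cons.prems obtain a z where x: "x = a * w + z" "a \<in> E" "z \<in> lspan E ws" by (rule lspan_ConsE)
  have "c * x = (c * a) * w + c * z" using x by (simp add: algebra_simps)
  thus ?case using lspan_ConsI[OF assms[OF x(2)] Cons.IH[OF x(3)]] by simp
qed simp

lemma lspan_mono: "E \<subseteq> E' \<Longrightarrow> lspan E ws \<subseteq> lspan E' ws"
proof (induction ws)
  case (Cons w ws)
  thus ?case by (auto elim!: lspan_ConsE intro!: lspan_ConsI)
qed simp

lemma lspan_subset_Cons: "0 \<in> E \<Longrightarrow> lspan E ws \<subseteq> lspan E (w # ws)"
  using lspan_ConsI[of 0 E _ ws w] by auto

lemma lspan_subset:
  assumes "esubring e R" "E \<subseteq> R" "set ws \<subseteq> R"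
  shows "lspan E ws \<subseteq> R"
  using assms(3)
proof (induction ws)
  case (Cons w ws)
  thus ?case using assms(2) by (auto elim!: lspan_ConsE intro!: esubringD(5,6)[OF assms(1)])
qed (use esubringD(8)[OF assms(1)] in simp)

lemma lspan_map_mult: "x \<in> lspan E ws \<Longrightarrow> c * x \<in> lspan E (map ((*) c) ws)"
proof (induction ws arbitrary: x)
  case (Cons w ws)
  from Cons.prems obtain a z where x: "x = a * w + z" "a \<in> E" "z \<in> lspan E ws" by (rule lspan_ConsE)
  have "c * x = a * (c * w) + c * z" using x by (simp add: algebra_simps)
  thus ?case using lspan_ConsI[OF x(2) Cons.IH[OF x(3)], of "c * w"] by simp
qed simp

lemma lspan_finite: "finite E \<Longrightarrow> finite (lspan E ws) \<and> card (lspan E ws) \<le> card E ^ length ws"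
proof (induction ws)
  case (Cons w ws)
  have eq: "lspan E (w # ws) = (\<lambda>(a, z). a * w + z) ` (E \<times> lspan E ws)" by (auto simp: lspan.simps(2))
  have "card (lspan E (w # ws)) \<le> card (E \<times> lspan E ws)"
    unfolding eq by (rule card_image_le) (use Cons in auto)
  also have "\<dots> \<le> card E * card E ^ length ws" using Cons by (simp add: card_cartesian_product)
  finally show ?case using Cons unfolding eq by auto
qed simp

context
  fixes e :: "'a::comm_ring_1" and E :: "'a set"
  assumes E: "esubring e E"
begin

lemma lspan_esubring_add: "x \<in> lspan E ws \<Longrightarrow> y \<in> lspan E ws \<Longrightarrow> x + y \<in> lspan E ws"
  by (rule lspan_add) (auto intro: esubringD(5)[OF E])

lemma lspan_esubring_scale: "c \<in> E \<Longrightarrow> x \<in> lspan E ws \<Longrightarrow> c * x \<in> lspan E ws"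
  by (rule lspan_scale) (auto intro: esubringD(6)[OF E])

lemma lspan_esubring_uminus: "x \<in> lspan E ws \<Longrightarrow> - x \<in> lspan E ws"
  using lspan_scale[of E "- 1" E x ws] esubringD(4)[OF E] by simp

lemma lspan_esubring_diff: "x \<in> lspan E ws \<Longrightarrow> y \<in> lspan E ws \<Longrightarrow> x - y \<in> lspan E ws"
  using lspan_esubring_add[of x ws "- y"] lspan_esubring_uminus[of y ws] by simp

lemma lspan_esubring_zero: "0 \<in> lspan E ws"
  by (rule lspan_zero[OF esubringD(8)[OF E]])

lemma lspan_member: "w \<in> set ws \<Longrightarrow> e * w = w \<Longrightarrow> w \<in> lspan E ws"
proof (induction ws)
  case (Cons u ws)
  show ?case
  proof (cases "w = u")
    case True
    thus ?thesis using lspan_ConsI[OF esubringD(1)[OF E] lspan_esubring_zero[of ws], of u] Cons.prems by simp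
  next
    case False
    thus ?thesis using Cons lspan_subset_Cons[OF esubringD(8)[OF E]] by auto
  qed
qed simp

lemma lspan_trans: "set zs \<subseteq> lspan E ws \<Longrightarrow> lspan E zs \<subseteq> lspan E ws"
proof (induction zs)
  case (Cons z zs)
  thus ?case by (auto elim!: lspan_ConsE intro!: lspan_esubring_add lspan_esubring_scale)
qed (use lspan_esubring_zero in simp)

end

section \<open>Linear independence, and algebraic relations obtained from finite spans\<close>

primrec indep :: "'a::comm_ring_1 set \<Rightarrow> 'a list \<Rightarrow> bool" where
  "indep E [] = True"
| "indep E (w # ws) = (w \<notin> lspan E ws \<and> indep E ws)"

text \<open>One step of Gaussian elimination. The pivot \<open>w + y\<close> lies in the span of
  \<open>zs\<close> and involves \<open>w\<close> with coefficient one; subtracting its multiples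
  clears \<open>w\<close> from every other vector, and only one vector is lost.\<close>

lemma indep_exchange:
  assumes E: "efield e E" and w: "e * w = w"
  shows "indep E zs \<Longrightarrow> set zs \<subseteq> lspan E (w # ws) \<Longrightarrow> \<forall>z\<in>set zs. e * z = z \<Longrightarrow> set zs \<subseteq> lspan E ws \<or>
    (\<exists>zs' y. indep E zs' \<and> set zs' \<subseteq> lspan E ws \<and> set zs' \<subseteq> lspan E zs \<and> Suc (length zs') = length zs \<and>
       (\<forall>z\<in>set zs'. e * z = z) \<and> e * y = y \<and> y \<in> lspan E ws \<and> w + y \<in> lspan E zs)"
proof (induction zs)
  case (Cons z zs)
  note E' = efield_esubring[OF E]
  have z: "e * z = z" "z \<notin> lspan E zs" using Cons.prems by auto
  have mem: "z \<in> lspan E (z # zs)" "lspan E zs \<subseteq> lspan E (z # zs)"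
    using lspan_member[OF E', of z "z # zs"] z(1) lspan_subset_Cons[OF esubringD(8)[OF E']] by auto
  have "z \<in> lspan E (w # ws)" using Cons.prems(2) by simp
  then obtain a y0 where y0: "z = a * w + y0" "a \<in> E" "y0 \<in> lspan E ws" by (rule lspan_ConsE)
  have "e * (a * w) = a * w" using w by (metis mult.left_commute)
  hence ey0: "e * y0 = y0" using y0(1) z(1) by (simp add: distrib_left)
  consider (A) "set zs \<subseteq> lspan E ws" | (B) zs' y where "indep E zs'" "set zs' \<subseteq> lspan E ws"
      "set zs' \<subseteq> lspan E zs" "Suc (length zs') = length zs" "\<forall>z\<in>set zs'. e * z = z" "e * y = y"
      "y \<in> lspan E ws" "w + y \<in> lspan E zs"
    using Cons.IH Cons.prems by auto
  thus ?case
  proof cases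
    case A
    show ?thesis
    proof (cases "a = 0")
      case True
      thus ?thesis using A y0 by auto
    next
      case False
      note iva = efield_iv[OF E y0(2) False]
      have "iv e a * z = (iv e a * a) * w + iv e a * y0" unfolding y0(1) by (simp add: algebra_simps)
      hence "w + iv e a * y0 = iv e a * z" using iva(3) w by simp
      hence "w + iv e a * y0 \<in> lspan E (z # zs)" using lspan_esubring_scale[OF E' iva(1) mem(1)] by simp
      moreover have "iv e a * y0 \<in> lspan E ws" by (rule lspan_esubring_scale[OF E' iva(1) y0(3)])
      moreover have "e * (iv e a * y0) = iv e a * y0" using ey0 by (metis mult.left_commute)
      moreover have "set zs \<subseteq> lspan E (z # zs)" using mem(2) Cons.prems(3) lspan_member[OF E'] by fastforce
      ultimately show ?thesis using A Cons.prems by (intro disjI2 exI[of _ zs]) auto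
    qed
  next
    case B
    define z' where "z' = z - a * (w + y)"
    have "z' = y0 - a * y" using y0(1) by (simp add: z'_def algebra_simps)
    hence z'ws: "z' \<in> lspan E ws"
      using lspan_esubring_diff[OF E' y0(3) lspan_esubring_scale[OF E' y0(2) B(7)]] by simp
    have aw: "a * (w + y) \<in> lspan E zs" by (rule lspan_esubring_scale[OF E' y0(2) B(8)])
    have "z' \<notin> lspan E zs'"
    proof
      assume "z' \<in> lspan E zs'"
      hence "z' + a * (w + y) \<in> lspan E zs"
        using lspan_trans[OF E' B(3)] aw lspan_esubring_add[OF E'] by blast
      thus False using z(2) by (simp add: z'_def)
    qed
    moreover have "z' \<in> lspan E (z # zs)"
      unfolding z'_def using lspan_esubring_diff[OF E' mem(1)] aw mem(2) by blast
    moreover have "e * (a * (w + y)) = a * (w + y)" using w B(6) by (metis mult.left_commute distrib_left)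
    hence "e * z' = z'" using z(1) by (simp add: z'_def right_diff_distrib)
    ultimately show ?thesis
      using B z'ws mem(2) by (intro disjI2 exI[of _ "z' # zs'"] exI[of _ y]) auto
  qed
qed auto

lemma indep_length_le:
  assumes E: "efield e E"
  shows "indep E zs \<Longrightarrow> set zs \<subseteq> lspan E ws \<Longrightarrow> \<forall>z\<in>set zs. e * z = z \<Longrightarrow> \<forall>w\<in>set ws. e * w = w \<Longrightarrow>
    length zs \<le> length ws"
proof (induction ws arbitrary: zs)
  case Nil
  show ?case
  proof (cases zs)
    case (Cons z zs')
    thus ?thesis using Nil lspan_esubring_zero[OF efield_esubring[OF E], of zs'] by auto
  qed simp
next
  case (Cons w ws)
  have "e * w = w" using Cons.prems by simp
  from indep_exchange[OF E this Cons.prems(1-3)] show ?case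
  proof
    assume "set zs \<subseteq> lspan E ws"
    thus ?thesis using Cons.IH[of zs] Cons.prems by simp
  next
    assume "\<exists>zs' y. indep E zs' \<and> set zs' \<subseteq> lspan E ws \<and> set zs' \<subseteq> lspan E zs \<and> Suc (length zs') = length zs \<and>
       (\<forall>z\<in>set zs'. e * z = z) \<and> e * y = y \<and> y \<in> lspan E ws \<and> w + y \<in> lspan E zs"
    then obtain zs' where "indep E zs'" "set zs' \<subseteq> lspan E ws" "Suc (length zs') = length zs"
      "\<forall>z\<in>set zs'. e * z = z" by blast
    thus ?thesis using Cons.IH[of zs'] Cons.prems by simp
  qed
qed

text \<open>Otherwise each power of \<open>z\<close> is outside the span of the lower ones, and
  arbitrarily many independent powers would fit into the span of \<open>ws\<close>.\<close>

lemma monic_relation: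
  assumes E: "efield e E" and z: "e * z = z" and ws: "\<forall>w\<in>set ws. e * w = w"
    and powers: "\<And>k. z ^ k * e \<in> lspan E ws"
  shows "\<exists>i. z ^ i * e \<in> polys_below E z i"
proof (rule ccontr)
  assume not: "\<not> ?thesis"
  note E' = efield_esubring[OF E]
  define pw where "pw i = map (\<lambda>j. z ^ j * e) (rev [0..<i])" for i
  have pw: "pw (Suc i) = z ^ i * e # pw i" for i by (simp add: pw_def)
  have sub: "lspan E (pw i) \<subseteq> polys_below E z i" for i
  proof (induction i)
    case (Suc i)
    show ?case unfolding pw
    proof
      fix x assume "x \<in> lspan E (z ^ i * e # pw i)"
      then obtain a y where x: "x = a * (z ^ i * e) + y" "a \<in> E" "y \<in> lspan E (pw i)" by (rule lspan_ConsE)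
      have "a * (z ^ i * e) = z ^ i * (a * e)" by (simp add: mult_ac)
      hence "a * (z ^ i * e) = z ^ i * a" using esubringD(3)[OF E' x(2)] by simp
      thus "x \<in> polys_below E z (Suc i)"
        using x Suc polys_below_var_power[OF E' x(2), of z i] polys_below_Suc[OF E'] polys_below_add[OF E']
        by (metis subsetD)
    qed
  qed (simp add: pw_def)
  have "indep E (pw i)" for i
  proof (induction i)
    case (Suc i) thus ?case using not sub[of i] by (auto simp: pw)
  qed (simp add: pw_def)
  moreover have "e * (z ^ j * e) = z ^ j * e" for j using esubringD(2)[OF E' esubringD(1)[OF E']]
    by (metis mult.left_commute)
  moreover have "set (pw i) \<subseteq> lspan E ws" for i using powers by (auto simp: pw_def)
  moreover have "length (pw i) = i" for i by (simp add: pw_def)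
  moreover have "\<forall>x\<in>set (pw i). e * x = x" for i using calculation(2) by (auto simp: pw_def)
  ultimately have "length (pw (Suc (length ws))) \<le> length ws"
    using ws by (intro indep_length_le[OF E])
  thus False by (simp add: pw_def)
qed

text \<open>In a monic relation of least degree the constant term is nonzero, since otherwise a
  factor \<open>z\<close> could be cancelled. Thus \<open>z\<close> divides a nonzero constant in
  the ring it generates.\<close>

lemma monic_relation_constant:
  assumes L: "efield e L" and E: "efield e E" "E \<subseteq> L" and z: "z \<in> L" "z \<noteq> 0"
    and monic: "\<exists>i. z ^ i * e \<in> polys_below E z i"
  shows "\<exists>a\<in>E. \<exists>p\<in>polys E z. a \<noteq> 0 \<and> a = z * p"
proof -
  note E' = efield_esubring[OF E(1)] and L' = efield_esubring[OF L]
  define P where "P i \<longleftrightarrow> z ^ i * e \<in> polys_below E z i" for i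
  have "\<exists>i. P i" unfolding P_def by (rule monic)
  define i where "i = (LEAST i. P i)"
  have i: "P i" "\<And>j. j < i \<Longrightarrow> \<not> P j" unfolding i_def using \<open>\<exists>i. P i\<close> LeastI_ex not_less_Least by auto
  have "i \<noteq> 0" using i(1) efield_unit_nz[OF L] unfolding P_def by (cases i) auto
  then obtain j where j: "i = Suc j" using not0_implies_Suc by blast
  have "z ^ i * e \<in> polys_below E z (Suc j)" using i(1) by (simp add: P_def j)
  then obtain a p' where a: "z ^ i * e = a + z * p'" "a \<in> E" "p' \<in> polys_below E z j"
    by (rule polys_below_SucE)
  have p'L: "p' \<in> L" using polys_subset[OF E' L' E(2) z(1)] polysI[OF E' a(3)] by blast
  have zj: "z ^ j * e \<in> L" by (rule esubring_power_mult[OF L' z(1) esubringD(1)[OF L']])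
  have eq: "z * (z ^ j * e) = a + z * p'" using a(1) j by (simp add: mult.assoc)
  have "a \<noteq> 0"
  proof
    assume "a = 0"
    hence "z ^ j * e = p'" using efield_cancel[OF L z(1) zj p'L z(2)] eq by simp
    thus False using i(2)[of j] a(3) j by (simp add: P_def)
  qed
  have "z ^ j * e \<in> polys E z"
    using polys_below_var_power[OF E' esubringD(1)[OF E']] polysI[OF E'] by blast
  hence "z ^ j * e - p' \<in> polys E z"
    using polysI[OF E' a(3)] esubringD(7)[OF polys_esubring[OF E']] esubringD(2)[OF L' z(1)] by blast
  moreover have "a = z * (z ^ j * e - p')" using eq by (simp add: algebra_simps)
  ultimately show ?thesis using a(2) \<open>a \<noteq> 0\<close> by blast
qed

lemma nonzero_constant_relation:
  assumes L: "efield e L" and E: "efield e E" "E \<subseteq> L" and z: "z \<in> L" "z \<noteq> 0" and ws: "set ws \<subseteq> L"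
    and powers: "\<And>k. z ^ k * e \<in> lspan E ws"
  shows "\<exists>a\<in>E. \<exists>p\<in>polys E z. a \<noteq> 0 \<and> a = z * p"
  by (rule monic_relation_constant[OF L E z monic_relation[OF E(1) _ _ powers]])
    (use z ws efieldD(2)[OF L] in auto)

section \<open>Common denominators\<close>

context
  fixes e :: "'a::comm_ring_1" and L R :: "'a set"
  assumes L: "efield e L" and R: "esubring e R" and RL: "R \<subseteq> L"
begin

lemma fractions_clear:
  assumes "x \<in> fractions e R"
  obtains h where "h \<in> R" "h \<noteq> 0" "h * x \<in> R"
proof -
  obtain f g where x: "x = f * iv e g" "f \<in> R" "g \<in> R" "g \<noteq> 0" using assms by (auto simp: fractions_def)
  have "g * x = (g * iv e g) * f" using x by (simp add: mult_ac)
  moreover have "g * iv e g = e" using efield_iv(2)[OF L, of g] x RL by auto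
  ultimately have "g * x = f" using esubringD(2)[OF R x(2)] by simp
  thus thesis using that x by blast
qed

lemma polys_below_clear:
  "p \<in> polys_below (fractions e R) z d \<Longrightarrow> \<exists>h\<in>R. h \<noteq> 0 \<and> h * p \<in> polys_below R z d"
proof (induction d arbitrary: p)
  case 0 thus ?case using esubringD(1)[OF R] efield_unit_nz[OF L] by auto
next
  case (Suc d)
  from Suc.prems obtain a p' where p: "p = a + z * p'" "a \<in> fractions e R" "p' \<in> polys_below (fractions e R) z d"
    by (rule polys_below_SucE)
  obtain h where h: "h \<in> R" "h \<noteq> 0" "h * p' \<in> polys_below R z d" using Suc.IH[OF p(3)] by blast
  obtain g where g: "g \<in> R" "g \<noteq> 0" "g * a \<in> R" using fractions_clear[OF p(2)] .
  have "(h * g) * p = h * (g * a) + z * (g * (h * p'))" using p(1) by (simp add: algebra_simps)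
  moreover have "h * (g * a) + z * (g * (h * p')) \<in> polys_below R z (Suc d)"
    by (rule polys_below_SucI[OF esubringD(6)[OF R h(1) g(3)] polys_below_scale[OF R g(1) h(3)]])
  ultimately show ?case using efield_mult_nz[OF L] h g RL esubringD(6)[OF R] by (metis subsetD)
qed

lemma lspan_clear:
  "x \<in> lspan (fractions e R) ws \<Longrightarrow> \<exists>h\<in>R. h \<noteq> 0 \<and> h * x \<in> lspan R ws"
proof (induction ws arbitrary: x)
  case Nil thus ?case using esubringD(1)[OF R] efield_unit_nz[OF L] by auto
next
  case (Cons w ws)
  from Cons.prems obtain a z where x: "x = a * w + z" "a \<in> fractions e R" "z \<in> lspan (fractions e R) ws"
    by (rule lspan_ConsE)
  obtain h where h: "h \<in> R" "h \<noteq> 0" "h * z \<in> lspan R ws" using Cons.IH[OF x(3)] by blast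
  obtain g where g: "g \<in> R" "g \<noteq> 0" "g * a \<in> R" using fractions_clear[OF x(2)] .
  have "(h * g) * x = (h * (g * a)) * w + g * (h * z)" using x(1) by (simp add: algebra_simps)
  moreover have "(h * (g * a)) * w + g * (h * z) \<in> lspan R (w # ws)"
    by (rule lspan_ConsI[OF esubringD(6)[OF R h(1) g(3)] lspan_esubring_scale[OF R g(1) h(3)]])
  ultimately show ?case using efield_mult_nz[OF L] h g RL esubringD(6)[OF R] by (metis subsetD)
qed

lemma lspan_clear_finite:
  assumes "finite T" "T \<subseteq> lspan (fractions e R) ws"
  shows "\<exists>h\<in>R. h \<noteq> 0 \<and> (\<forall>x\<in>T. h * x \<in> lspan R ws)"
  using assms
proof (induction T)
  case empty thus ?case using esubringD(1)[OF R] efield_unit_nz[OF L] by auto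
next
  case (insert x T)
  then obtain h where h: "h \<in> R" "h \<noteq> 0" "\<forall>x\<in>T. h * x \<in> lspan R ws" by auto
  have "x \<in> lspan (fractions e R) ws" using insert by simp
  then obtain g where g: "g \<in> R" "g \<noteq> 0" "g * x \<in> lspan R ws" using lspan_clear by blast
  have "(h * g) * x \<in> lspan R ws"
    using lspan_esubring_scale[OF R h(1) g(3)] by (simp add: mult.assoc)
  moreover have "(h * g) * y \<in> lspan R ws" if "y \<in> T" for y
    using lspan_esubring_scale[OF R g(1) bspec[OF h(3) that]] by (simp only: mult_ac)
  ultimately have "\<forall>y\<in>insert x T. (h * g) * y \<in> lspan R ws" by simp
  thus ?case using efield_mult_nz[OF L] h g RL esubringD(6)[OF R] by (metis subsetD)
qed

end

lemma lspan_polys_bounded: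
  assumes K: "esubring e K"
  shows "x \<in> lspan (polys K s) ws \<Longrightarrow> \<exists>B. x \<in> lspan (polys_below K s B) ws"
proof (induction ws arbitrary: x)
  case (Cons w ws)
  from Cons.prems obtain a z where x: "x = a * w + z" "a \<in> polys K s" "z \<in> lspan (polys K s) ws"
    by (rule lspan_ConsE)
  obtain B where B: "z \<in> lspan (polys_below K s B) ws" using Cons.IH x by blast
  obtain C where C: "a \<in> polys_below K s C" using x by (auto simp: polys_def)
  have "a \<in> polys_below K s (max B C)" using polys_below_mono[OF K, of C "max B C" s] C by auto
  moreover have "z \<in> lspan (polys_below K s (max B C)) ws"
    using lspan_mono[OF polys_below_mono[OF K, of B "max B C" s]] B by auto
  ultimately show ?case using x(1) lspan_ConsI by blast
qed auto

lemma lspan_polys_bounded_finite: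
  assumes K: "esubring e K"
  shows "finite T \<Longrightarrow> T \<subseteq> lspan (polys K s) ws \<Longrightarrow> \<exists>B. T \<subseteq> lspan (polys_below K s B) ws"
proof (induction T rule: finite_induct)
  case (insert x T)
  have "x \<in> lspan (polys K s) ws" using insert by simp
  from lspan_polys_bounded[OF K this] obtain C where "x \<in> lspan (polys_below K s C) ws" ..
  moreover obtain B where "T \<subseteq> lspan (polys_below K s B) ws" using insert by auto
  ultimately have B: "T \<subseteq> lspan (polys_below K s B) ws" "x \<in> lspan (polys_below K s C) ws" by auto
  have "lspan (polys_below K s B) ws \<subseteq> lspan (polys_below K s (max B C)) ws"
    "lspan (polys_below K s C) ws \<subseteq> lspan (polys_below K s (max B C)) ws"
    by (intro lspan_mono polys_below_mono[OF K]; simp)+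
  thus ?case using B by blast
qed auto

section \<open>Index bounds\<close>

text \<open>For an ideal \<open>I\<close> these are sets of pairwise incongruent elements, so their
  sizes bound the index of \<open>I\<close> from below. Quotient rings are thereby avoided.\<close>

definition separated :: "'a::comm_ring_1 set \<Rightarrow> 'a set \<Rightarrow> bool" where
  "separated I T \<longleftrightarrow> (\<forall>a\<in>T. \<forall>b\<in>T. a - b \<in> I \<longrightarrow> a = b)"

lemma separatedD: "separated I T \<Longrightarrow> a \<in> T \<Longrightarrow> b \<in> T \<Longrightarrow> a - b \<in> I \<Longrightarrow> a = b"
  by (auto simp: separated_def)

lemma separated_antimono: "separated I T \<Longrightarrow> J \<subseteq> I \<Longrightarrow> separated J T"
  by (auto simp: separated_def)

lemma digits_unique:
  assumes L: "efield e L" and R: "esubring e R" "R \<subseteq> L" and x: "x \<in> R" "x \<noteq> 0"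
    and T: "T \<subseteq> R" "separated ((*) x ` R) T" and "a \<in> T" "b \<in> T" "z \<in> R" "z' \<in> R" "a + x * z = b + x * z'"
  shows "a = b \<and> z = z'"
proof -
  have "a - b = x * (z' - z)" using assms(12) by (simp add: algebra_simps)
  hence "a = b" using separatedD[OF T(2)] assms esubringD(7)[OF R(1)] by blast
  moreover from this have "x * z = x * z'" using assms by simp
  ultimately show ?thesis using efield_cancel[OF L, of x z z'] assms by blast
qed

text \<open>Expansions in powers of \<open>x\<close> with \<open>m\<close> digits from
  \<open>T\<close>: comparing the digits from the lowest on, two expansions congruent modulo
  \<open>x ^ m\<close> agree. Here \<open>polys_below\<close> is used with the digit set in place of
  a field.\<close>

lemma digit_sums:
  assumes L: "efield e L" and R: "esubring e R" "R \<subseteq> L" and x: "x \<in> R" "x \<noteq> 0"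
    and T: "finite T" "T \<subseteq> R" "separated ((*) x ` R) T"
  shows "polys_below T x m \<subseteq> R \<and> finite (polys_below T x m) \<and> card (polys_below T x m) = card T ^ m \<and>
    separated ((*) (x ^ m) ` R) (polys_below T x m)"
proof (induction m)
  case 0
  show ?case using esubringD(8)[OF R(1)] by (auto simp: separated_def)
next
  case (Suc m)
  let ?f = "\<lambda>(a, z). a + x * z"
  have eq: "polys_below T x (Suc m) = ?f ` (T \<times> polys_below T x m)"
    by (auto simp: polys_below.simps(2))
  have uniq: "a = b \<and> z = z'" if "a \<in> T" "b \<in> T" "z \<in> R" "z' \<in> R" "a + x * z = b + x * z'" for a b z z'
    using digits_unique[OF L R x T(2,3)] that by blast
  have "inj_on ?f (T \<times> polys_below T x m)"
  proof (intro inj_onI, clarify)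
    fix a z b z' assume "a \<in> T" "b \<in> T" "z \<in> polys_below T x m" "z' \<in> polys_below T x m"
      and eq: "a + x * z = b + x * z'"
    with Suc show "a = b \<and> z = z'" by (intro uniq) auto
  qed
  hence "card (polys_below T x (Suc m)) = card T ^ Suc m"
    unfolding eq using Suc by (simp add: card_image card_cartesian_product)
  moreover have "polys_below T x (Suc m) \<subseteq> R"
    unfolding eq using Suc T(2) x(1) by (auto intro!: esubringD(5,6)[OF R(1)])
  moreover have "finite (polys_below T x (Suc m))" unfolding eq using Suc T(1) by simp
  moreover have "separated ((*) (x ^ Suc m) ` R) (polys_below T x (Suc m))"
    unfolding separated_def
  proof (intro ballI impI)
    fix y y' assume "y \<in> polys_below T x (Suc m)" "y' \<in> polys_below T x (Suc m)" and d: "y - y' \<in> (*) (x ^ Suc m) ` R"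
    then obtain a z b z' where y: "y = a + x * z" "a \<in> T" "z \<in> polys_below T x m"
      "y' = b + x * z'" "b \<in> T" "z' \<in> polys_below T x m" by (meson polys_below_SucE)
    obtain r where r: "r \<in> R" "y - y' = x ^ Suc m * r" using d by auto
    have zR: "z \<in> R" "z' \<in> R" using y Suc by auto
    have xr: "x ^ m * r \<in> R" using esubring_power_mult[OF R(1) x(1) r(1)] .
    have "a + x * z = b + x * (z' + x ^ m * r)" using r y by (simp add: algebra_simps)
    hence "a = b" "z = z' + x ^ m * r"
      using uniq[of a b z "z' + x ^ m * r"] y zR xr esubringD(5)[OF R(1)] by blast+
    moreover from this have "z = z'" using separatedD[of "(*) (x ^ m) ` R" "polys_below T x m" z z'] Suc y r(1) by simp
    ultimately show "y = y'" using y by simp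
  qed
  ultimately show ?case by blast
qed

text \<open>A constant factor cannot make up for a larger base when \<open>m\<close> grows.\<close>

lemma le_if_powers_bounded:
  fixes t c N :: nat
  assumes "\<And>m. t ^ m \<le> c * N ^ m"
  shows "t \<le> N"
proof (rule ccontr)
  assume "\<not> ?thesis"
  hence t: "t > N" by simp
  show False
  proof (cases "N = 0")
    case True
    thus False using assms[of 1] t by simp
  next
    case False
    define b where "b = real t / real N"
    have "b > 1" using t False by (simp add: b_def)
    then obtain m where "real c < b ^ m" using real_arch_pow by blast
    hence "real c * real N ^ m < real t ^ m" using False by (simp add: b_def power_divide field_simps)
    hence "real (c * N ^ m) < real (t ^ m)" by simp
    hence "c * N ^ m < t ^ m" by (simp only: of_nat_less_iff)
    thus False using assms[of m] by simp
  qed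
qed

locale base_field =
  fixes e :: "'a::comm_ring_1" and L K :: "'a set"
  assumes L: "efield e L" and K: "efield e K" and KL: "K \<subseteq> L" and finK: "finite K"
begin

lemmas L' = efield_esubring[OF L]
lemmas K' = efield_esubring[OF K]
lemmas LD = esubringD[OF L']
lemmas KD = esubringD[OF K']

lemma card_K: "card K \<ge> 2"
proof -
  have "{0, e} \<subseteq> K" using KD by simp
  thus ?thesis using card_mono[OF finK, of "{0, e}"] efield_unit_nz[OF L] by simp
qed

end

text \<open>The list \<open>ws\<close> need not be independent, so \<open>length ws\<close> is an
  upper bound for the degree of \<open>L\<close> over K(s).\<close>

locale spanned_field = base_field e L K for e :: "'a::comm_ring_1" and L K +
  fixes s :: 'a and ws :: "'a list"
  assumes s: "s \<in> L" and ws: "set ws \<subseteq> L" and span: "L = lspan (fractions e (polys K s)) ws"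
begin

abbreviation "E \<equiv> fractions e (polys K s)"

lemma polys_L: "polys K s \<subseteq> L"
  by (rule polys_subset[OF K' L' KL s])

lemma polys_ring: "esubring e (polys K s)"
  by (rule polys_esubring[OF K']) (use LD s in simp)

lemma E: "efield e E"
  by (rule fractions_efield[OF L polys_ring polys_L])

lemma E_L: "E \<subseteq> L"
  by (rule fractions_subset[OF L polys_ring polys_L _ L polys_L]) simp

lemma K_E: "K \<subseteq> E"
  using fractions_incl[OF L polys_ring polys_L] polys_const[OF K'] by blast

lemma s_E: "s \<in> E"
  using fractions_incl[OF L polys_ring polys_L] polys_var[OF K', of s] LD s by auto

text \<open>A counting form of the fact that the zeros of a polynomial of degree \<open>d\<close>
  have total degree at most \<open>d\<close> times the field degree. Digit expansions of length
  \<open>m\<close> give \<open>card T ^ m\<close> elements, which after multiplication by one common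
  denominator have coefficients of degree about \<open>d * m\<close>. The bounded excess disappears
  as \<open>m\<close> grows.\<close>

lemma index_bound:
  assumes R: "esubring e R" "R \<subseteq> L" and x: "x \<in> R" "x \<noteq> 0" "x \<in> polys_below K s (Suc d)"
    and T: "finite T" "T \<subseteq> R" "separated ((*) x ` R) T"
  shows "card T \<le> card K ^ (d * length ws)"
proof -
  have TL: "T \<subseteq> lspan E ws" using T R span by auto
  obtain h where h: "h \<in> polys K s" "h \<noteq> 0" "\<forall>x\<in>T. h * x \<in> lspan (polys K s) ws"
    using lspan_clear_finite[OF L polys_ring polys_L T(1) TL] by blast
  have hL: "h \<in> L" using h polys_L by auto
  have "\<exists>B. (*) h ` T \<subseteq> lspan (polys_below K s B) ws"
    by (rule lspan_polys_bounded_finite[OF K']) (use T h in auto)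
  then obtain B where B: "(*) h ` T \<subseteq> lspan (polys_below K s B) ws" by blast
  \<comment> \<open>\<open>B\<close> bounds the coefficients of the digits after clearing
    denominators; every further digit raises the degree by at most \<open>d\<close>.\<close>
  let ?S = "\<lambda>m. lspan (polys_below K s (B + d * m)) ws"
  have digits: "(*) h ` polys_below T x m \<subseteq> ?S m" for m
  proof (induction m)
    case 0
    show ?case using lspan_zero[OF polys_below_zero[OF K']] by auto
  next
    case (Suc m)
    show ?case
    proof (intro image_subsetI)
      fix y assume "y \<in> polys_below T x (Suc m)"
      then obtain a z where y: "y = a + x * z" "a \<in> T" "z \<in> polys_below T x m" by (rule polys_below_SucE)
      have "h * a \<in> ?S (Suc m)"
        using subsetD[OF lspan_mono[OF polys_below_mono[OF K', of B "B + d * Suc m" s]], of "h * a" ws] B y(2) by auto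
      moreover have "x * (h * z) \<in> ?S (Suc m)"
      proof (rule lspan_scale)
        show "h * z \<in> ?S m" using Suc y by blast
        show "x * a \<in> polys_below K s (B + d * Suc m)" if "a \<in> polys_below K s (B + d * m)" for a
          using polys_below_mult[OF K' that x(3)] by (simp add: algebra_simps)
      qed
      ultimately have "h * a + x * (h * z) \<in> ?S (Suc m)"
        by (rule lspan_add[OF polys_below_add[OF K'], rotated 2])
      thus "h * y \<in> ?S (Suc m)" by (simp add: y algebra_simps)
    qed
  qed
  have "card T ^ m \<le> (card K ^ (B * length ws)) * (card K ^ (d * length ws)) ^ m" for m
  proof -
    note D = digit_sums[OF L R x(1,2) T, of m]
    have fin: "finite (polys_below K s (B + d * m))" "card (polys_below K s (B + d * m)) \<le> card K ^ (B + d * m)"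
      using polys_below_finite[OF K' finK] by auto
    have "inj_on ((*) h) (polys_below T x m)"
      using efield_cancel[OF L hL _ _ h(2)] D R by (intro inj_onI) blast
    hence "card T ^ m = card ((*) h ` polys_below T x m)" using D by (simp add: card_image)
    also have "\<dots> \<le> card (?S m)" using digits[of m] lspan_finite[OF fin(1)] by (intro card_mono) auto
    also have "\<dots> \<le> card (polys_below K s (B + d * m)) ^ length ws" using lspan_finite[OF fin(1)] by blast
    also have "\<dots> \<le> (card K ^ (B + d * m)) ^ length ws" using fin(2) by (rule power_mono) simp
    finally show ?thesis by (simp add: power_add power_mult_distrib power_mult[symmetric] mult_ac)
  qed
  thus ?thesis by (rule le_if_powers_bounded)
qed

end

text \<open>Makes results that need \<open>s\<close> to be regular available at the poles of
  \<open>s\<close>.\<close>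

lemma spanned_field_flip:
  assumes "spanned_field e L K s ws" "s \<noteq> 0"
  shows "spanned_field e L K (iv e s) ws"
proof -
  interpret spanned_field e L K s ws by fact
  note ivs = efield_iv[OF L s assms(2)]
  have sub: "polys K (iv e s) \<subseteq> E"
    by (rule polys_subset[OF K' efield_esubring[OF E] K_E efield_iv(1)[OF E s_E assms(2)]])
  have ring: "esubring e (polys K (iv e s))" "polys K (iv e s) \<subseteq> L"
    using polys_esubring[OF K'] polys_subset[OF K' L' KL ivs(1)] LD ivs by auto
  have 1: "fractions e (polys K (iv e s)) \<subseteq> E"
    by (rule fractions_subset[OF L ring E_L E sub])
  note F = fractions_efield[OF L ring]
  have i: "iv e s \<in> fractions e (polys K (iv e s))"
    using fractions_incl[OF L ring] polys_var[OF K', of "iv e s"] LD ivs by auto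
  hence "s \<in> fractions e (polys K (iv e s))" using efield_iv(1)[OF F i ivs(4)] iv_iv[OF L s] by simp
  hence "polys K s \<subseteq> fractions e (polys K (iv e s))"
    using polys_subset[OF K' efield_esubring[OF F]] fractions_incl[OF L ring] polys_const[OF K'] by blast
  hence "E \<subseteq> fractions e (polys K (iv e s))"
    using fractions_subset[OF L polys_ring polys_L _ F] 1 E_L by blast
  hence "E = fractions e (polys K (iv e s))" using 1 by auto
  thus ?thesis using span ivs(1) ws s by unfold_locales auto
qed

section \<open>Valuation rings\<close>

context base_field
begin

definition vring :: "'a set \<Rightarrow> bool" where
  "vring V \<longleftrightarrow> esubring e V \<and> K \<subseteq> V \<and> V \<subseteq> L \<and> V \<noteq> L \<and> (\<forall>z\<in>L. z \<noteq> 0 \<longrightarrow> z \<in> V \<or> iv e z \<in> V)"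

definition units :: "'a set \<Rightarrow> 'a set" where
  "units V = {z \<in> V. z \<noteq> 0 \<and> iv e z \<in> V}"

definition maxid :: "'a set \<Rightarrow> 'a set" where
  "maxid V = V - units V"

lemma vringD:
  assumes "vring V"
  shows "esubring e V" "K \<subseteq> V" "V \<subseteq> L" "V \<noteq> L" "\<And>z. z \<in> L \<Longrightarrow> z \<notin> V \<Longrightarrow> iv e z \<in> V"
  using assms by (auto simp: vring_def esubringD(8))

lemmas vring_sub = subsetD[OF vringD(3)]
lemmas vring_ring = esubringD[OF vringD(1)]

lemma unitsD:
  assumes "vring V" "u \<in> units V"
  shows "u \<in> V" "u \<in> L" "u \<noteq> 0" "iv e u \<in> V" "iv e u \<in> units V"
  using assms efield_iv[OF L, of u] iv_iv[OF L, of u] vring_sub by (auto simp: units_def)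

lemma units_mult: "vring V \<Longrightarrow> u \<in> units V \<Longrightarrow> u' \<in> units V \<Longrightarrow> u * u' \<in> units V"
  using efield_mult_nz[OF L] iv_mult[OF L] vring_ring(6) by (simp add: units_def vring_sub)

lemma unit_in_units: "vring V \<Longrightarrow> e \<in> units V"
  using vring_ring(1) efield_unit_nz[OF L] iv_unit[OF L] by (simp add: units_def)

lemma maxid_sub: "maxid V \<subseteq> V"
  by (auto simp: maxid_def)

lemma maxid_zero: "vring V \<Longrightarrow> 0 \<in> maxid V"
  using vring_ring(8) by (simp add: maxid_def units_def)

lemma unit_notin_maxid: "vring V \<Longrightarrow> e \<notin> maxid V"
  using unit_in_units by (simp add: maxid_def)

lemma maxid_iff: "vring V \<Longrightarrow> z \<in> L \<Longrightarrow> z \<in> maxid V \<longleftrightarrow> z = 0 \<or> iv e z \<notin> V"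
  using vringD(5)[of V z] vringD(5)[of V "iv e z"] iv_iv[OF L, of z] efield_iv_closed[OF L, of z] vring_ring(8)[of V]
  by (auto simp: maxid_def units_def)

lemma iv_in_maxid: "vring V \<Longrightarrow> z \<in> L \<Longrightarrow> z \<notin> V \<Longrightarrow> iv e z \<in> maxid V"
  using maxid_iff[of V "iv e z"] iv_iv[OF L, of z] efield_iv_closed[OF L, of z] by simp

lemma maxid_mult:
  assumes "vring V" "z \<in> maxid V" "w \<in> V"
  shows "z * w \<in> maxid V"
proof (rule ccontr)
  assume "z * w \<notin> maxid V"
  moreover have zV: "z \<in> V" using assms maxid_sub by auto
  ultimately have "z * w \<in> units V" using vring_ring(6)[OF assms(1)] assms by (simp add: maxid_def)
  hence u: "z * w \<noteq> 0" "iv e (z * w) \<in> V" by (auto simp: units_def)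
  have zL: "z \<in> L" "w \<in> L" using zV assms vring_sub by auto
  have wz: "w \<noteq> 0" "z \<noteq> 0" using u by auto
  have "iv e (z * w) * w = iv e z * (iv e w * w)" using iv_mult[OF L zL] by (simp add: mult_ac)
  hence "iv e z = iv e (z * w) * w" using efield_iv[OF L zL(2) wz(1)] efield_iv[OF L zL(1) wz(2)] LD by simp
  hence "iv e z \<in> V" using vring_ring(6)[OF assms(1) u(2) assms(3)] by simp
  thus False using assms(2) zV wz by (auto simp: maxid_def units_def)
qed

text \<open>One of the quotients w/z and z/w lies in \<open>V\<close>, so the sum is a multiple in
  \<open>V\<close> of \<open>z\<close> or of \<open>w\<close>.\<close>

lemma maxid_add:
  assumes "vring V" "z \<in> maxid V" "w \<in> maxid V"
  shows "z + w \<in> maxid V"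
proof -
  have *: "z + w \<in> maxid V" if "z \<in> maxid V" "w \<in> maxid V" "z \<noteq> 0" "w * iv e z \<in> V" for z w
  proof -
    have zL: "z \<in> L" "z \<in> V" "w \<in> V" "w \<in> L" using that maxid_sub vring_sub[OF assms(1)] by auto
    have "z * (e + w * iv e z) = z * e + w * (z * iv e z)" by (simp add: algebra_simps)
    hence "z * (e + w * iv e z) = z + w" using efield_iv(2)[OF L zL(1) that(3)] LD zL by simp
    thus ?thesis using maxid_mult[OF assms(1) that(1)] vring_ring[OF assms(1)] that(4) by metis
  qed
  show ?thesis
  proof (cases "z = 0 \<or> w = 0")
    case False
    have L2: "z \<in> L" "w \<in> L" using assms maxid_sub vring_sub by auto
    have "iv e (w * iv e z) = z * iv e w"
      using iv_mult[OF L L2(2) efield_iv_closed[OF L L2(1)]] iv_iv[OF L L2(1)] by (simp add: mult_ac)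
    moreover have "w * iv e z \<in> L" using LD(6)[OF L2(2) efield_iv_closed[OF L L2(1)]] .
    ultimately consider "w * iv e z \<in> V" | "z * iv e w \<in> V" using vringD(5)[OF assms(1)] by metis
    thus ?thesis using *[of z w] *[of w z] False assms by cases (auto simp: add.commute)
  qed (use assms in auto)
qed

lemma maxid_uminus: "vring V \<Longrightarrow> z \<in> maxid V \<Longrightarrow> - z \<in> maxid V"
  using maxid_mult[of V z "- e"] vring_ring(1,4)[of V] vring_ring(3)[of V z] subsetD[OF maxid_sub] by simp

lemma maxid_diff: "vring V \<Longrightarrow> z \<in> maxid V \<Longrightarrow> w \<in> maxid V \<Longrightarrow> z - w \<in> maxid V"
  using maxid_add[of V z "- w"] maxid_uminus by simp

lemma units_add_maxid: "vring V \<Longrightarrow> u \<in> units V \<Longrightarrow> z \<in> maxid V \<Longrightarrow> u + z \<in> units V"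
proof -
  assume a: "vring V" "u \<in> units V" "z \<in> maxid V"
  have "u \<notin> maxid V" using a by (auto simp: maxid_def)
  hence "u + z \<notin> maxid V" using maxid_diff[of V "u + z" z] a by auto
  thus ?thesis using a vring_ring(5) maxid_sub by (auto simp: maxid_def units_def)
qed

lemma K_units: "vring V \<Longrightarrow> c \<in> K \<Longrightarrow> c \<noteq> 0 \<Longrightarrow> c \<in> units V"
  using vringD(2) efield_iv(1)[OF K] by (auto simp: units_def)

lemma K_maxid: "vring V \<Longrightarrow> c \<in> K \<Longrightarrow> c \<in> maxid V \<Longrightarrow> c = 0"
  using K_units by (auto simp: maxid_def)

lemma maxid_nontrivial: "vring V \<Longrightarrow> \<exists>t\<in>maxid V. t \<noteq> 0"
proof -
  assume V: "vring V"
  then obtain z where z: "z \<in> L" "z \<notin> V" using vringD(3,4) by blast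
  hence "z \<noteq> 0" using vring_ring(8)[OF V] by auto
  thus ?thesis using iv_in_maxid[OF V z] efield_iv(4)[OF L z(1)] by blast
qed

lemma maxid_power: "vring V \<Longrightarrow> z ^ k \<in> maxid V \<Longrightarrow> k > 0 \<Longrightarrow> z \<in> V \<Longrightarrow> z \<in> maxid V"
proof (rule ccontr)
  assume a: "vring V" "z ^ k \<in> maxid V" "k > 0" "z \<in> V" "z \<notin> maxid V"
  hence "z \<in> units V" by (auto simp: maxid_def)
  from a(3) this have "z ^ k \<in> units V"
    by (induction k rule: nat_induct_non_zero) (use units_mult[OF a(1)] in auto)
  thus False using a(2) by (auto simp: maxid_def)
qed

text \<open>Valuation rings are integrally closed; only Artin-Schreier equations are needed.\<close>

lemma vring_artin_schreier:
  assumes V: "vring V" and z: "z \<in> L" and q: "q \<ge> 2" and eq: "z ^ q - z \<in> V"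
  shows "z \<in> V"
proof (rule ccontr)
  assume nz: "z \<notin> V"
  note m = iv_in_maxid[OF V z nz]
  have z0: "z \<noteq> 0" using nz vring_ring(8)[OF V] by auto
  obtain k where k: "q = Suc (Suc k)" using q by (metis add_2_eq_Suc le_Suc_ex)
  have ivV: "iv e z \<in> V" using m maxid_sub by auto
  have step: "iv e z ^ j * (z ^ j * x) = x" if "x \<in> L" for x j
    using efield_power_iv[OF L _ _ that, of "iv e z" j] efield_iv[OF L z z0] iv_iv[OF L z] by simp
  have "iv e z ^ Suc k * (z ^ q - z) = iv e z ^ Suc k * (z ^ Suc k * z) - iv e z ^ k * (iv e z * z)"
    by (simp add: k algebra_simps)
  also have "\<dots> = z - iv e z ^ k * e" using step[OF z, of "Suc k"] efield_iv[OF L z z0] by simp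
  finally have "z = iv e z ^ Suc k * (z ^ q - z) + iv e z ^ k * e" by (simp add: algebra_simps)
  moreover have "iv e z ^ Suc k * (z ^ q - z) + iv e z ^ k * e \<in> V"
    by (intro vring_ring(5)[OF V] esubring_power_mult[OF vringD(1)[OF V]] ivV eq vring_ring(1)[OF V])
  ultimately show False using nz by simp
qed

lemma vring_power:
  assumes V: "vring V" and z: "z \<in> L" and q: "q > 0" and eq: "z ^ q \<in> V"
  shows "z \<in> V"
proof (rule ccontr)
  assume nz: "z \<notin> V"
  note m = iv_in_maxid[OF V z nz]
  have z0: "z \<noteq> 0" using nz vring_ring(8)[OF V] by auto
  obtain k where k: "q = Suc k" using q gr0_conv_Suc by blast
  have ivV: "iv e z \<in> V" using m maxid_sub by auto
  have "iv e z ^ k * z ^ q = iv e z ^ k * (z ^ k * z)" by (simp add: k mult_ac)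
  also have "\<dots> = z"
    using efield_power_iv[OF L _ _ z, of "iv e z" k] efield_iv[OF L z z0] iv_iv[OF L z] by simp
  finally show False using esubring_power_mult[OF vringD(1)[OF V] ivV eq, of k] nz by simp
qed

end

section \<open>Discreteness of the valuation rings\<close>

context spanned_field
begin

lemma power_span: "z \<in> L \<Longrightarrow> z ^ k * e \<in> lspan E ws"
  using esubring_power_mult[OF L', of z e k] LD span by metis

text \<open>The algebraic relation of \<open>z\<close> over K(s) exhibits a nonzero element of K(s)
  as a multiple of \<open>z\<close>; clearing denominators makes it a polynomial and keeps the
  cofactor in \<open>V\<close>.\<close>

lemma divides_polynomial_aux:
  assumes V: "esubring e V" "K \<subseteq> V" "V \<subseteq> L" "s \<in> V" and z: "z \<in> V" "z \<noteq> 0"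
  shows "\<exists>x\<in>polys K s. x \<noteq> 0 \<and> x \<in> (*) z ` V"
proof -
  obtain a p where a: "a \<in> E" "p \<in> polys E z" "a \<noteq> 0" "a = z * p"
    using nonzero_constant_relation[OF L E E_L _ z(2) ws power_span] z V by blast
  have pV: "polys K s \<subseteq> V" by (rule polys_subset[OF K' V(1,2,4)])
  obtain d where "p \<in> polys_below E z d" using a by (auto simp: polys_def)
  then obtain h where h: "h \<in> polys K s" "h \<noteq> 0" "h * p \<in> polys_below (polys K s) z d"
    using polys_below_clear[OF L polys_ring polys_L] by blast
  obtain g where g: "g \<in> polys K s" "g \<noteq> 0" "g * a \<in> polys K s"
    using fractions_clear[OF L polys_ring polys_L a(1)] .
  have hpV: "h * p \<in> V"
    using polys_subset[OF polys_ring V(1) pV z(1)] polysI[OF polys_ring h(3)] by blast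
  have eq: "h * (g * a) = z * (g * (h * p))" using a(4) by (simp add: mult_ac)
  have "h * (g * a) \<noteq> 0" using efield_mult_nz[OF L] h g a E_L polys_L by (meson subsetD LD(6))
  moreover have "h * (g * a) \<in> polys K s" using h g esubringD(6)[OF polys_ring] by blast
  moreover have "h * (g * a) \<in> (*) z ` V" using eq hpV g pV esubringD(6)[OF V(1)] by blast
  ultimately show ?thesis by blast
qed

lemma bounded_index_aux:
  assumes V: "esubring e V" "K \<subseteq> V" "V \<subseteq> L" "s \<in> V" and z: "z \<in> V" "z \<noteq> 0"
  shows "\<exists>N. \<forall>T. finite T \<longrightarrow> T \<subseteq> V \<longrightarrow> separated ((*) z ` V) T \<longrightarrow> card T \<le> N"
proof -
  obtain x where x: "x \<in> polys K s" "x \<noteq> 0" "x \<in> (*) z ` V" using divides_polynomial_aux[OF assms] by blast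
  obtain d where d: "x \<in> polys_below K s (Suc d)" using x polys_below_Suc[OF K'] by (auto simp: polys_def)
  have xV: "x \<in> V" using x(1) polys_subset[OF K' V(1,2,4)] by blast
  have "(*) x ` V \<subseteq> (*) z ` V"
    using x(3) esubringD(6)[OF V(1)] by (auto simp: mult.assoc)
  thus ?thesis using index_bound[OF V(1,3) xV x(2) d] separated_antimono by meson
qed

end

text \<open>The ring contains \<open>s\<close> or its inverse, and \<open>L\<close> is spanned by
  \<open>ws\<close> over the field generated by either, so a polynomial multiple of \<open>z\<close>
  is available in both cases.\<close>

lemma (in spanned_field) bounded_index:
  assumes V: "vring V" and z: "z \<in> V" "z \<noteq> 0"
  shows "\<exists>N. \<forall>T. finite T \<longrightarrow> T \<subseteq> V \<longrightarrow> separated ((*) z ` V) T \<longrightarrow> card T \<le> N"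
proof (cases "s \<in> V")
  case True
  thus ?thesis using bounded_index_aux vringD[OF V] z by blast
next
  case False
  hence "s \<noteq> 0" "iv e s \<in> V" using vring_ring(8)[OF V] vringD(5)[OF V s] by auto
  thus ?thesis
    using spanned_field.bounded_index_aux[OF spanned_field_flip[OF spanned_field_axioms]] vringD[OF V] z by blast
qed

context spanned_field
begin

text \<open>The number of residue classes of \<open>V\<close> modulo \<open>z\<close>; the maximum
  exists by \<open>bounded_index\<close>.\<close>

definition index :: "'a set \<Rightarrow> 'a \<Rightarrow> nat" where
  "index V z = (GREATEST k. \<exists>T. finite T \<and> T \<subseteq> V \<and> separated ((*) z ` V) T \<and> card T = k)"

lemma index_attained:
  assumes "vring V" "z \<in> V" "z \<noteq> 0"
  shows "\<exists>T. finite T \<and> T \<subseteq> V \<and> separated ((*) z ` V) T \<and> card T = index V z"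
proof -
  obtain N where N: "\<And>T. finite T \<Longrightarrow> T \<subseteq> V \<Longrightarrow> separated ((*) z ` V) T \<Longrightarrow> card T \<le> N"
    using bounded_index[OF assms] by blast
  let ?P = "\<lambda>k. \<exists>T. finite T \<and> T \<subseteq> V \<and> separated ((*) z ` V) T \<and> card T = k"
  have "separated ((*) z ` V) {}" by (simp add: separated_def)
  hence "?P 0" by (intro exI[of _ "{}"]) simp
  moreover have "k \<le> N" if "?P k" for k using that N by blast
  ultimately show ?thesis unfolding index_def by (rule GreatestI_nat)
qed

lemma index_le:
  assumes "vring V" "z \<in> V" "z \<noteq> 0" "finite T" "T \<subseteq> V" "separated ((*) z ` V) T"
  shows "card T \<le> index V z"
proof -
  obtain N where N: "\<And>T. finite T \<Longrightarrow> T \<subseteq> V \<Longrightarrow> separated ((*) z ` V) T \<Longrightarrow> card T \<le> N"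
    using bounded_index[OF assms(1-3)] by blast
  show ?thesis unfolding index_def
    by (rule Greatest_le_nat[where b = N]) (use assms N in auto)
qed

text \<open>Take \<open>t\<close> in the maximal ideal with the fewest residue classes. If
  \<open>u\<close> were not a multiple of \<open>t\<close>, then \<open>t\<close> would be a
  multiple of \<open>u\<close>, and there would be strictly more classes modulo \<open>t\<close>
  than modulo \<open>u\<close>.\<close>

lemma uniformizer_exists:
  assumes V: "vring V"
  shows "\<exists>t. t \<in> maxid V \<and> t \<noteq> 0 \<and> maxid V = (*) t ` V"
proof -
  obtain t0 where "t0 \<in> maxid V \<and> t0 \<noteq> 0" using maxid_nontrivial[OF V] by blast
  then obtain t where t: "t \<in> maxid V" "t \<noteq> 0" and min: "\<And>u. u \<in> maxid V \<Longrightarrow> u \<noteq> 0 \<Longrightarrow> index V t \<le> index V u"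
    using ex_has_least_nat[of "\<lambda>t. t \<in> maxid V \<and> t \<noteq> 0" t0 "index V"] by blast
  have tV: "t \<in> V" "t \<in> L" using t maxid_sub vring_sub[OF V] by auto
  have "u \<in> (*) t ` V" if u: "u \<in> maxid V" for u
  proof (rule ccontr)
    assume nu: "u \<notin> (*) t ` V"
    have uV: "u \<in> V" "u \<in> L" using u maxid_sub vring_sub[OF V] by auto
    have u0: "u \<noteq> 0" using nu vring_ring(8)[OF V] by (metis image_eqI mult_zero_right)
    have ut: "u * iv e t \<in> L" using LD(6)[OF uV(2) efield_iv_closed[OF L tV(2)]] .
    have "t * (u * iv e t) = u * (t * iv e t)" by (simp add: mult_ac)
    hence "u = t * (u * iv e t)" using efield_iv(2)[OF L tV(2) t(2)] LD uV by simp
    hence "u * iv e t \<notin> V" using nu by blast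
    hence "iv e (u * iv e t) \<in> V" using vringD(5)[OF V ut] by blast
    moreover have "iv e (u * iv e t) = iv e u * t"
      using iv_mult[OF L uV(2) efield_iv_closed[OF L tV(2)]] iv_iv[OF L tV(2)] by simp
    ultimately have tu: "iv e u * t \<in> V" by simp
    have "u * (iv e u * t) = (u * iv e u) * t" by (simp add: mult_ac)
    hence t_eq: "t = u * (iv e u * t)" using efield_iv(2)[OF L uV(2) u0] LD tV by simp
    have sub: "(*) t ` V \<subseteq> (*) u ` V"
    proof (intro image_subsetI)
      fix x assume "x \<in> V"
      hence "iv e u * t * x \<in> V" using vring_ring(6)[OF V tu] by blast
      moreover have "t * x = u * (iv e u * t * x)" using arg_cong[OF t_eq, of "\<lambda>y. y * x"] by (simp add: mult.assoc)
      ultimately show "t * x \<in> (*) u ` V" by blast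
    qed
    obtain T where T: "finite T" "T \<subseteq> V" "separated ((*) u ` V) T" "card T = index V u"
      using index_attained[OF V uV(1) u0] by blast
    have "separated ((*) u ` V) {0}" by (simp add: separated_def)
    hence "index V u \<ge> 1" using index_le[OF V uV(1) u0, of "{0}"] vring_ring(8)[OF V] by simp
    then obtain a where a: "a \<in> T" using T(4) by fastforce
    \<comment> \<open>\<open>a + u\<close> is congruent to \<open>a\<close> modulo \<open>u\<close>
      but not modulo \<open>t\<close>, so it opens a new class.\<close>
    define T' where "T' = insert (a + u) T"
    have uu: "u \<in> (*) u ` V" using vring_ring(1,3)[OF V] uV by force
    have "a + u \<notin> T"
    proof
      assume "a + u \<in> T"
      hence "a + u = a" using separatedD[OF T(3) \<open>a + u \<in> T\<close> a] uu by simp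
      thus False using u0 by simp
    qed
    have sep: "separated ((*) t ` V) T'"
      unfolding T'_def separated_def
    proof (intro ballI impI)
      have ideal: "x + y \<in> (*) t ` V" "- x \<in> (*) t ` V" if "x \<in> (*) t ` V" "y \<in> (*) t ` V" for x y
        using that vring_ring(4,5)[OF V] by (auto simp: distrib_left[symmetric] simp flip: mult_minus_right)
      have key: "False" if "b \<in> T" "a + u - b \<in> (*) t ` V" for b
      proof -
        have "a - b = (a + u - b) - u" by simp
        moreover have "x - u \<in> (*) u ` V" if "x \<in> (*) t ` V" for x
        proof -
          obtain v where v: "v \<in> V" "x = u * v" using sub \<open>x \<in> (*) t ` V\<close> by blast
          hence "x - u = u * (v - e)" using LD(3)[OF uV(2)] by (simp add: algebra_simps)
          thus ?thesis using v vring_ring(7,1)[OF V] by blast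
        qed
        ultimately have "a - b \<in> (*) u ` V" using that(2) by metis
        hence "a = b" using separatedD[OF T(3) a that(1)] by blast
        hence "u \<in> (*) t ` V" using that(2) by simp
        thus False using nu by simp
      qed
      fix x y assume x: "x \<in> insert (a + u) T" and y: "y \<in> insert (a + u) T" and d: "x - y \<in> (*) t ` V"
      have "y - x \<in> (*) t ` V" using ideal(2)[OF d d] by simp
      thus "x = y" using x y d key separatedD[OF separated_antimono[OF T(3) sub]] by auto
    qed
    have "card T' \<le> index V t"
      using index_le[OF V tV(1) t(2) _ _ sep] T a uV vring_ring(5)[OF V] by (auto simp: T'_def)
    hence "Suc (index V u) \<le> index V t" using T \<open>a + u \<notin> T\<close> by (simp add: T'_def)
    thus False using min[OF u u0] by simp
  qed
  moreover have "(*) t ` V \<subseteq> maxid V" using maxid_mult[OF V t(1)] by blast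
  ultimately show ?thesis using t by blast
qed

definition unif :: "'a set \<Rightarrow> 'a" where
  "unif V = (SOME t. t \<in> maxid V \<and> t \<noteq> 0 \<and> maxid V = (*) t ` V)"

lemma unif:
  assumes "vring V"
  shows "unif V \<in> maxid V" "unif V \<noteq> 0" "maxid V = (*) (unif V) ` V" "unif V \<in> V" "unif V \<in> L"
  using someI_ex[OF uniformizer_exists[OF assms]] maxid_sub vring_sub[OF assms] unfolding unif_def by auto

text \<open>If \<open>z\<close> were divisible by every power of the uniformizer, the
  \<open>2 ^ k\<close> expansions with digits \<open>0\<close> and \<open>e\<close> would be
  incongruent modulo \<open>z\<close> for every \<open>k\<close>, against the finiteness of the
  index.\<close>

lemma unif_decomposition:
  assumes V: "vring V" and z: "z \<in> V" "z \<noteq> 0"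
  shows "\<exists>k. \<exists>u\<in>units V. z = unif V ^ k * u"
proof (rule ccontr)
  assume no: "\<not> ?thesis"
  note t = unif[OF V]
  have div: "\<exists>w\<in>V. z = unif V ^ k * w" for k
  proof (induction k)
    case (Suc k)
    then obtain w where w: "w \<in> V" "z = unif V ^ k * w" by blast
    hence "w \<in> maxid V" using no by (auto simp: maxid_def)
    then obtain w' where "w' \<in> V" "w = unif V * w'" using t(3) by blast
    thus ?case using w(2) by (intro bexI[of _ w']) (simp_all add: mult_ac)
  qed (use z in auto)
  have "separated ((*) (unif V) ` V) {0, e}"
    using unit_notin_maxid[OF V] maxid_uminus[OF V, of "- e"] t(3) by (auto simp: separated_def)
  moreover have "{0, e} \<subseteq> V" using vring_ring[OF V] by simp
  ultimately have D: "polys_below {0, e} (unif V) k \<subseteq> V \<and> finite (polys_below {0, e} (unif V) k) \<and>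
      card (polys_below {0, e} (unif V) k) = card {0, e} ^ k \<and>
      separated ((*) (unif V ^ k) ` V) (polys_below {0, e} (unif V) k)" for k
    using digit_sums[OF L vringD(1,3)[OF V] t(4,2), of "{0, e}"] by simp
  define k where "k = index V z"
  have "(*) z ` V \<subseteq> (*) (unif V ^ k) ` V"
    using div[of k] vring_ring(6)[OF V] by (auto simp: mult.assoc)
  hence "card {0, e} ^ k \<le> index V z" using index_le[OF V z, of "polys_below {0, e} (unif V) k"]
    D[of k] separated_antimono by metis
  moreover have "card {0, e} = 2" using efield_unit_nz[OF L] by simp
  ultimately have "2 ^ k \<le> k" by (simp add: k_def)
  thus False using less_exp[of k] by simp
qed

end

section \<open>Normalized valuations and weak approximation\<close>

context spanned_field
begin

text \<open>The factor \<open>e\<close> turns the zeroth power into the unit of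
  \<open>L\<close>.\<close>

definition upow :: "'a set \<Rightarrow> int \<Rightarrow> 'a" where
  "upow V n = (if n \<ge> 0 then unif V ^ nat n * e else iv e (unif V) ^ nat (- n) * e)"

text \<open>The value at \<open>0\<close> is unspecified, since \<open>0\<close> has no such
  decomposition; this is why zero is a separate case in what follows.\<close>

definition val :: "'a set \<Rightarrow> 'a \<Rightarrow> int" where
  "val V z = (THE n. \<exists>u\<in>units V. z = upow V n * u)"

context
  fixes V assumes V: "vring V"
begin

lemma upow_diff: "upow V (int a - int b) = unif V ^ a * (iv e (unif V) ^ b * e)"
proof (cases "a \<ge> b")
  case True
  have "unif V ^ a * (iv e (unif V) ^ b * e) = unif V ^ (a - b) * (unif V ^ b * (iv e (unif V) ^ b * e))"
    using True by (simp add: mult.assoc[symmetric] power_add[symmetric])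
  also have "\<dots> = unif V ^ (a - b) * e" using efield_power_iv[OF L unif(5,2)[OF V] LD(1)] by simp
  finally show ?thesis using True by (simp add: upow_def nat_diff_distrib' of_nat_diff)
next
  case False
  have t: "iv e (unif V) \<in> L" "iv e (unif V) \<noteq> 0" using efield_iv[OF L unif(5,2)[OF V]] by auto
  have "unif V ^ a * (iv e (unif V) ^ b * e) =
      iv e (unif V) ^ (b - a) * (iv e (unif V) ^ a * (iv e (iv e (unif V)) ^ a * e))"
    using False iv_iv[OF L unif(5)[OF V]] by (simp add: mult_ac power_add[symmetric])
  also have "\<dots> = iv e (unif V) ^ (b - a) * e" using efield_power_iv[OF L t LD(1)] by simp
  finally show ?thesis using False by (simp add: upow_def nat_diff_distrib')
qed

lemma upow_nat: "upow V (int k) = unif V ^ k * e"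
  by (simp add: upow_def)

lemma upow_0: "upow V 0 = e"
  by (simp add: upow_def)

lemma upow_L: "upow V n \<in> L"
  using esubring_power_mult[OF L' _ LD(1)] unif(5)[OF V] efield_iv_closed[OF L] by (auto simp: upow_def)

lemma upow_add: "upow V (m + n) = upow V m * upow V n"
proof -
  obtain a b where m: "m = int a - int b" by (metis int_diff_cases)
  obtain c d where n: "n = int c - int d" by (metis int_diff_cases)
  have "upow V (m + n) = upow V (int (a + c) - int (b + d))" by (simp add: m n algebra_simps)
  also have "\<dots> = (unif V ^ a * (iv e (unif V) ^ b * e)) * (unif V ^ c * (iv e (unif V) ^ d * e))"
    unfolding upow_diff using LD(2)[OF LD(1)] by (simp add: power_add mult_ac) (simp add: mult.assoc[symmetric])
  finally show ?thesis by (simp only: m n upow_diff)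
qed

lemma upow_neg: "upow V n * upow V (- n) = e"
  using upow_add[of n "- n"] upow_0 by simp

lemma upow_nz: "upow V n \<noteq> 0"
  using upow_neg[of n] efield_unit_nz[OF L] by auto

lemma upow_pos: "n > 0 \<Longrightarrow> upow V n \<in> maxid V"
proof -
  assume n: "n > 0"
  then obtain k where k: "n = int (Suc k)" by (metis Suc_pred' zero_less_imp_eq_int)
  have "unif V ^ k * e \<in> V" by (rule esubring_power_mult[OF vringD(1)[OF V] unif(4)[OF V] vring_ring(1)[OF V]])
  from maxid_mult[OF V unif(1)[OF V] this] show ?thesis by (simp add: k upow_nat mult.assoc del: of_nat_Suc)
qed

lemma val_unique:
  assumes "u \<in> units V" "u' \<in> units V" "upow V m * u = upow V n * u'"
  shows "m = n"
proof -
  have *: False if "m < n" "u \<in> units V" "u' \<in> units V" "upow V m * u = upow V n * u'" for m n u u'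
  proof -
    have "(upow V (- m) * upow V m) * u = (upow V (- m) * upow V n) * u'" using that(4) by (simp add: mult.assoc)
    hence "u = upow V (n - m) * u'"
      using upow_neg[of "- m"] LD(2) unitsD(2)[OF V that(2)] upow_add[of "- m" n] by simp
    moreover have "upow V (n - m) * u' \<in> maxid V" using maxid_mult[OF V upow_pos] unitsD[OF V that(3)] that(1) by simp
    ultimately show False using that(2) by (simp add: maxid_def)
  qed
  show ?thesis using *[of m n u u'] *[of n m u' u] assms by (cases m n rule: linorder_cases) auto
qed

lemma val_eqI: "u \<in> units V \<Longrightarrow> z = upow V n * u \<Longrightarrow> val V z = n"
  unfolding val_def using val_unique by (intro the_equality) blast+

lemma val_decomposition:
  assumes z: "z \<in> L" "z \<noteq> 0"
  obtains u where "u \<in> units V" "z = upow V (val V z) * u"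
proof -
  have *: "\<exists>n. \<exists>u\<in>units V. z = upow V n * u" if z: "z \<in> V" "z \<noteq> 0" for z
  proof -
    obtain k u where u: "u \<in> units V" "z = unif V ^ k * u" using unif_decomposition[OF V z] by blast
    have "z = upow V (int k) * u" using u LD(2)[OF unitsD(2)[OF V u(1)]] by (simp add: upow_nat mult.assoc)
    thus ?thesis using u by blast
  qed
  have "\<exists>n. \<exists>u\<in>units V. z = upow V n * u"
  proof (cases "z \<in> V")
    case True thus ?thesis using * z by blast
  next
    case False
    then obtain n u where u: "u \<in> units V" "iv e z = upow V n * u"
      using *[of "iv e z"] vringD(5)[OF V z(1)] efield_iv[OF L z] by blast
    have "iv e (upow V n) = upow V (- n)"
      by (rule iv_eqI) (use upow_neg LD(2) upow_L upow_nz in auto)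
    hence "z = upow V (- n) * iv e u"
      using iv_iv[OF L z(1)] iv_mult[OF L upow_L unitsD(2)[OF V u(1)]] u(2) by metis
    thus ?thesis using unitsD(5)[OF V u(1)] by blast
  qed
  then obtain n u where "u \<in> units V" "z = upow V n * u" by blast
  thus thesis using that val_eqI by metis
qed

lemma val_mult:
  assumes z: "z \<in> L" "z \<noteq> 0" and w: "w \<in> L" "w \<noteq> 0"
  shows "val V (z * w) = val V z + val V w"
proof -
  obtain u where u: "u \<in> units V" "z = upow V (val V z) * u" using val_decomposition[OF z] .
  obtain u' where u': "u' \<in> units V" "w = upow V (val V w) * u'" using val_decomposition[OF w] .
  have "z * w = (upow V (val V z) * u) * (upow V (val V w) * u')" using u(2) u'(2) by simp
  also have "\<dots> = upow V (val V z + val V w) * (u * u')" by (simp add: upow_add mult_ac)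
  finally show ?thesis using val_eqI units_mult[OF V u(1) u'(1)] by blast
qed

lemma val_units: "u \<in> units V \<Longrightarrow> val V u = 0"
  by (rule val_eqI) (use upow_0 LD(2) unitsD(2)[OF V] in auto)

lemma val_unit: "val V e = 0"
  using val_units unit_in_units[OF V] by blast

lemma val_upow: "val V (upow V n) = n"
  by (rule val_eqI[OF unit_in_units[OF V]]) (use LD(3) upow_L in simp)

lemma val_iv: "z \<in> L \<Longrightarrow> z \<noteq> 0 \<Longrightarrow> val V (iv e z) = - val V z"
  using val_mult[of z "iv e z"] efield_iv[OF L, of z] val_unit by simp

lemma val_nonneg:
  assumes z: "z \<in> L" "z \<noteq> 0"
  shows "val V z \<ge> 0 \<longleftrightarrow> z \<in> V"
proof -
  obtain u where u: "u \<in> units V" "z = upow V (val V z) * u" using val_decomposition[OF z] .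
  have "z \<in> V" if "val V z \<ge> 0"
  proof -
    define k where "k = nat (val V z)"
    have k: "val V z = int k" using that by (simp add: k_def)
    have "unif V ^ k * e \<in> V" by (rule esubring_power_mult[OF vringD(1)[OF V] unif(4)[OF V] vring_ring(1)[OF V]])
    hence "upow V (val V z) \<in> V" by (simp add: k upow_nat)
    thus ?thesis using u vring_ring(6)[OF V] unitsD(1)[OF V] by metis
  qed
  moreover have "val V z \<ge> 0" if "z \<in> V"
  proof (rule ccontr)
    assume "\<not> ?thesis"
    hence "upow V (- val V z) * z \<in> maxid V" using maxid_mult[OF V upow_pos that] by simp
    moreover have "upow V (- val V z) * z = (upow V (- val V z) * upow V (val V z)) * u" using u(2) by (simp add: mult.assoc)
    hence "upow V (- val V z) * z = u" using upow_neg[of "- val V z"] LD(2) unitsD(2)[OF V u(1)] by simp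
    ultimately show False using u(1) by (simp add: maxid_def)
  qed
  ultimately show ?thesis by blast
qed

lemma val_pos:
  assumes z: "z \<in> L" "z \<noteq> 0"
  shows "val V z > 0 \<longleftrightarrow> z \<in> maxid V"
  using maxid_iff[OF V z(1)] val_nonneg[OF efield_iv(1,4)[OF L z]] val_iv[OF z] z by auto

lemma val_K: "c \<in> K \<Longrightarrow> c \<noteq> 0 \<Longrightarrow> val V c = 0"
  using val_units K_units[OF V] by blast

lemma val_power:
  assumes z: "z \<in> L" "z \<noteq> 0" and w: "w \<in> L" "w \<noteq> 0"
  shows "val V (z ^ k * w) = int k * val V z + val V w"
proof (induction k)
  case (Suc k)
  have "z ^ k * w \<in> L" "z ^ k * w \<noteq> 0"
    using esubring_power_mult[OF L' z(1) w(1)] efield_power_mult_nz[OF L z w] by auto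
  from val_mult[OF z this] show ?case using Suc by (simp add: mult.assoc algebra_simps)
qed simp

lemma val_uminus: "z \<in> L \<Longrightarrow> z \<noteq> 0 \<Longrightarrow> val V (- z) = val V z"
proof -
  assume z: "z \<in> L" "z \<noteq> 0"
  have "- e \<in> K" "- e \<noteq> 0" using KD efield_unit_nz[OF L] by auto
  hence "val V (- e * z) = val V z" using val_mult[of "- e" z] val_K[of "- e"] z KL by auto
  thus ?thesis using LD(2)[OF z(1)] by simp
qed

lemma val_add:
  assumes z: "z \<in> L" "z \<noteq> 0" "val V z \<ge> m" and w: "w \<in> L" "w \<noteq> 0" "val V w \<ge> m" and zw: "z + w \<noteq> 0"
  shows "val V (z + w) \<ge> m"
proof -
  have zwL: "z + w \<in> L" using LD(5)[OF z(1) w(1)] .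
  have *: "x * upow V (- m) \<in> V \<longleftrightarrow> val V x \<ge> m" if "x \<in> L" "x \<noteq> 0" for x
    using val_nonneg[of "x * upow V (- m)"] val_mult[OF that upow_L upow_nz, of "- m"] val_upow
      efield_mult_nz[OF L that(1) upow_L that(2) upow_nz] LD(6)[OF that(1) upow_L] by auto
  have "(z + w) * upow V (- m) \<in> V"
    using *[OF z(1,2)] *[OF w(1,2)] z(3) w(3) vring_ring(5)[OF V] by (simp add: distrib_right)
  thus ?thesis using *[OF zwL zw] by blast
qed

lemma val_add_eq:
  assumes z: "z \<in> L" "z \<noteq> 0" and w: "w \<in> L" "w = 0 \<or> val V z < val V w"
  shows "z + w \<noteq> 0 \<and> val V (z + w) = val V z"
proof (cases "w = 0")
  case True
  thus ?thesis using z by simp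
next
  case False
  hence w: "w \<in> L" "w \<noteq> 0" "val V z < val V w" using w by auto
  have 0: "z + w \<noteq> 0"
  proof
    assume "z + w = 0"
    hence "w = - z" by (metis add.inverse_unique)
    thus False using w val_uminus[OF z] by simp
  qed
  have "val V (z + w) \<ge> val V z" using val_add[OF z _ w(1,2) _ 0] w(3) by simp
  moreover have False if "val V (z + w) > val V z"
  proof -
    have "- w \<in> L" "- w \<noteq> 0" "val V (- w) \<ge> val V z + 1" using LD w val_uminus by auto
    from val_add[OF LD(5)[OF z(1) w(1)] 0 _ this] that z show False by simp
  qed
  ultimately show ?thesis using 0 by fastforce
qed

lemma val_ge_iff:
  assumes z: "z \<in> L"
  shows "z \<in> (*) (unif V ^ k) ` V \<longleftrightarrow> z = 0 \<or> val V z \<ge> int k"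
proof
  assume "z \<in> (*) (unif V ^ k) ` V"
  then obtain v where v: "v \<in> V" "z = unif V ^ k * v" by blast
  show "z = 0 \<or> val V z \<ge> int k"
  proof (cases "v = 0")
    case False
    have "v \<in> L" using v vring_sub[OF V] by blast
    hence "val V z = int k * val V (unif V) + val V v" using val_power[OF unif(5,2)[OF V] _ False] v by simp
    moreover have "val V (unif V) > 0" using val_pos[OF unif(5,2)[OF V]] unif(1)[OF V] by simp
    moreover have "val V v \<ge> 0" using val_nonneg \<open>v \<in> L\<close> False v by simp
    ultimately show ?thesis using mult_left_mono[of 1 "val V (unif V)" "int k"] by simp
  qed (use v in simp)
next
  assume "z = 0 \<or> val V z \<ge> int k"
  thus "z \<in> (*) (unif V ^ k) ` V"
  proof
    assume "z = 0" thus ?thesis using vring_ring(8)[OF V] by force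
  next
    assume k: "val V z \<ge> int k"
    show ?thesis
    proof (cases "z = 0")
      case True thus ?thesis using vring_ring(8)[OF V] by force
    next
      case False
      have "z * upow V (- int k) \<in> V"
        using val_nonneg[of "z * upow V (- int k)"] val_mult[OF z False upow_L upow_nz] val_upow k
          LD(6)[OF z upow_L] efield_mult_nz[OF L z upow_L False upow_nz] by simp
      moreover have "unif V ^ k * (z * upow V (- int k)) = (unif V ^ k * (e * z)) * upow V (- int k)"
        using LD(2)[OF z] by (simp add: mult_ac)
      hence "unif V ^ k * (z * upow V (- int k)) = (upow V (int k) * upow V (- int k)) * z"
        by (simp only: upow_nat mult_ac)
      hence "z = unif V ^ k * (z * upow V (- int k))" using upow_neg[of "int k"] LD(2)[OF z] by simp
      ultimately show ?thesis by blast
    qed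
  qed
qed

definition residues :: nat where
  "residues = index V (unif V)"

text \<open>A separated set of maximal size meets every class, as it could be enlarged
  otherwise.\<close>

lemma residue_transversal:
  "\<exists>T. finite T \<and> T \<subseteq> V \<and> separated (maxid V) T \<and> card T = residues \<and> (\<forall>v\<in>V. \<exists>a\<in>T. v - a \<in> maxid V)"
proof -
  note t = unif[OF V]
  obtain T where T: "finite T" "T \<subseteq> V" "separated (maxid V) T" "card T = residues"
    using index_attained[OF V t(4,2)] unfolding residues_def t(3)[symmetric] by blast
  have "\<exists>a\<in>T. v - a \<in> maxid V" if v: "v \<in> V" for v
  proof (rule ccontr)
    assume no: "\<not> ?thesis"
    have "v \<notin> T" using no maxid_zero[OF V] by auto
    have "separated (maxid V) (insert v T)"
      unfolding separated_def
    proof (intro ballI impI)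
      fix a b assume "a \<in> insert v T" "b \<in> insert v T" "a - b \<in> maxid V"
      moreover from this have "b - a \<in> maxid V" using maxid_uminus[OF V, of "a - b"] by simp
      ultimately show "a = b" using no separatedD[OF T(3)] by auto
    qed
    hence "card (insert v T) \<le> residues"
      using index_le[OF V t(4,2), of "insert v T"] T v unfolding residues_def t(3)[symmetric] by simp
    thus False using T \<open>v \<notin> T\<close> by simp
  qed
  thus ?thesis using T by blast
qed

end

text \<open>The valuations have rank one. If the larger ring contains some \<open>u\<close> of
  negative valuation, every \<open>z\<close> is a power of \<open>u\<close> times an element of
  \<open>V\<close>, and the larger ring would be all of \<open>L\<close>.\<close>

lemma vring_subset_eq:
  assumes V: "vring V" "vring V'" and sub: "V \<subseteq> V'"
  shows "V = V'"
proof (rule ccontr)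
  assume "V \<noteq> V'"
  then obtain u where u: "u \<in> V'" "u \<notin> V" using sub by blast
  have uL: "u \<in> L" "u \<noteq> 0" using u vring_sub[OF V(2)] vring_ring(8)[OF V(1)] by auto
  have vu: "val V u < 0" using val_nonneg[OF V(1) uL] u by simp
  have "z \<in> V'" if z: "z \<in> L" for z
  proof (cases "z = 0")
    case False
    define m where "m = nat \<bar>val V z\<bar>"
    have iu: "iv e u \<in> L" "iv e u \<noteq> 0" using efield_iv[OF L uL] by auto
    have "val V (iv e u ^ m * z) = int m * (- val V u) + val V z"
      using val_power[OF V(1) iu z False] val_iv[OF V(1) uL] by simp
    moreover have "int m * (- val V u) \<ge> int m * 1" by (rule mult_left_mono) (use vu in auto)
    ultimately have "val V (iv e u ^ m * z) \<ge> 0" by (simp add: m_def)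
    hence "iv e u ^ m * z \<in> V'"
      using sub val_nonneg[OF V(1) esubring_power_mult[OF L' iu(1) z] efield_power_mult_nz[OF L iu z False]] by blast
    hence "u ^ m * (iv e u ^ m * z) \<in> V'" by (rule esubring_power_mult[OF vringD(1)[OF V(2)] u(1)])
    thus ?thesis using efield_power_iv[OF L uL z] by simp
  qed (use vring_ring(8)[OF V(2)] in simp)
  thus False using vringD(3,4)[OF V(2)] by blast
qed

text \<open>Places are added one at a time; poles at the old places must survive the correction at
  the new one.\<close>

lemma separating_element:
  assumes "finite S" "vring V0" "\<And>V. V \<in> S \<Longrightarrow> vring V" "V0 \<notin> S"
  shows "\<exists>a\<in>maxid V0. \<forall>V\<in>S. a \<notin> V"
  using assms(1,3,4)
proof (induction S)
  case empty
  show ?case using maxid_zero[OF assms(2)] by auto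
next
  case (insert V S)
  obtain a where a: "a \<in> maxid V0" "\<forall>V\<in>S. a \<notin> V" using insert by auto
  have V: "vring V" "V \<noteq> V0" using insert by auto
  show ?case
  proof (cases "a \<in> V")
    case False thus ?thesis using a by blast
  next
    case aV: True
    obtain u where u: "u \<in> V0" "u \<notin> V" using vring_subset_eq[OF assms(2) V(1)] V by blast
    obtain w where w: "w \<in> V" "w \<notin> V0" using vring_subset_eq[OF V(1) assms(2)] V by blast
    have uL: "u \<in> L" "w \<in> L" using u w vring_sub[OF V(1)] vring_sub[OF assms(2)] by auto
    have nz: "u \<noteq> 0" "w \<noteq> 0" using u w vring_ring(8)[OF V(1)] vring_ring(8)[OF assms(2)] by auto
    \<comment> \<open>Neither ring contains the other, so a quotient of two witnesses vanishes at
      \<open>V0\<close> and has a pole at \<open>V\<close>.\<close>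
    define b where "b = iv e w * u"
    have b0: "b \<in> maxid V0" unfolding b_def using maxid_mult[OF assms(2) iv_in_maxid[OF assms(2) uL(2) w(2)] u(1)] .
    have bL: "b \<in> L" "b \<noteq> 0" unfolding b_def
      using efield_iv[OF L uL(2) nz(2)] uL nz LD(6) efield_mult_nz[OF L] by auto
    have bV: "b \<notin> V"
    proof
      assume "b \<in> V"
      hence "w * b \<in> V" using vring_ring(6)[OF V(1) w(1)] by blast
      moreover have "w * b = u" unfolding b_def
        using efield_iv(2)[OF L uL(2) nz(2)] LD(2)[OF uL(1)] by (simp add: mult.assoc[symmetric])
      ultimately show False using u by simp
    qed
    have aL: "a \<in> L" using aV vring_sub[OF V(1)] by blast
    \<comment> \<open>\<open>M\<close> exceeds the absolute valuation of \<open>a\<close> at every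
      place of \<open>S\<close>, so \<open>b ^ M\<close> dominates \<open>a\<close> wherever
      \<open>b\<close> has a pole; where \<open>b\<close> is regular, the pole of \<open>a\<close>
      persists.\<close>
    define M where "M = Suc (\<Sum>V'\<in>S. nat \<bar>val V' a\<bar>)"
    have M: "M > 0" by (simp add: M_def)
    have bM: "b ^ M \<in> L" "b ^ M \<noteq> 0" using esubring_power[OF L' bL(1), of M] efield_power_nz[OF L bL, of M] by (simp_all add: M_def)
    have valM: "val V' (b ^ M) = int M * val V' b" if "vring V'" for V'
      using val_power[OF that bL LD(1) efield_unit_nz[OF L], of M] val_unit[OF that] LD(3)[OF bM(1)] by simp
    show ?thesis
    proof (intro bexI ballI)
      have "b ^ Suc k \<in> maxid V0" for k
        by (induction k) (use b0 maxid_mult[OF assms(2) b0] maxid_sub in auto)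
      hence "b ^ M \<in> maxid V0" by (simp only: M_def)
      thus "a + b ^ M \<in> maxid V0" using maxid_add[OF assms(2) a(1)] by blast
      fix V' assume "V' \<in> insert V S"
      hence V': "vring V'" using insert by auto
      show "a + b ^ M \<notin> V'"
      proof
        assume ab: "a + b ^ M \<in> V'"
        show False
        proof (cases "b \<in> V'")
          case True
          hence "b ^ M \<in> V'" using esubring_power[OF vringD(1)[OF V'], of b M] by (simp add: M_def)
          with vring_ring(7)[OF V' ab] have "a + b ^ M - b ^ M \<in> V'" by blast
          hence "a \<in> V'" by simp
          thus False using a \<open>V' \<in> insert V S\<close> bV True by auto
        next
          case False
          hence vb: "val V' b < 0" using val_nonneg[OF V' bL] by simp
          have neg: "val V' (b ^ M) < 0" using valM[OF V'] vb M by (simp add: mult_less_0_iff)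
          have "a = 0 \<or> val V' (b ^ M) < val V' a"
          proof (cases "V' \<in> S")
            case True
            have "nat \<bar>val V' a\<bar> \<le> (\<Sum>V'\<in>S. nat \<bar>val V' a\<bar>)" by (rule member_le_sum) (use True insert in auto)
            hence "\<bar>val V' a\<bar> < int M" unfolding M_def by linarith
            moreover have "int M * val V' b \<le> int M * (- 1)" by (rule mult_left_mono) (use vb in auto)
            ultimately have "int M * val V' b < val V' a" by linarith
            thus ?thesis using valM[OF V'] by simp
          next
            case False
            hence "a \<in> V'" using aV \<open>V' \<in> insert V S\<close> by auto
            thus ?thesis using val_nonneg[OF V' aL] neg by (cases "a = 0") auto
          qed
          hence "b ^ M + a \<noteq> 0 \<and> val V' (b ^ M + a) = val V' (b ^ M)" by (rule val_add_eq[OF V' bM aL])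
          thus False using neg ab val_nonneg[OF V', of "b ^ M + a"] LD(5)[OF bM(1) aL] by (simp add: add.commute)
        qed
      qed
    qed
  qed
qed

text \<open>With \<open>a\<close> vanishing at \<open>V0\<close> and having poles at the other
  places, the inverse of \<open>e + a ^ M\<close> is close to \<open>e\<close> at \<open>V0\<close>
  and close to \<open>0\<close> elsewhere.\<close>

lemma approximate_one:
  assumes S: "finite S" "\<And>V. V \<in> S \<Longrightarrow> vring V" "V0 \<in> S" and M: "M > 0"
  shows "\<exists>z\<in>L. z - e \<in> (*) (unif V0 ^ M) ` V0 \<and> (\<forall>V\<in>S - {V0}. z \<in> (*) (unif V ^ M) ` V)"
proof -
  have V0: "vring V0" using S by blast
  obtain a where a: "a \<in> maxid V0" "\<forall>V\<in>S - {V0}. a \<notin> V"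
    using separating_element[of "S - {V0}" V0] S by auto
  have aL: "a \<in> L" using a maxid_sub vring_sub[OF V0] by blast
  have aM: "a ^ M \<in> L" using esubring_power[OF L' aL M] .
  have aM0: "a ^ M \<in> maxid V0" using M a(1)
    by (induction M rule: nat_induct_non_zero) (auto intro: maxid_mult[OF V0] simp: maxid_sub[THEN subsetD])
  have un: "e + a ^ M \<in> units V0" by (rule units_add_maxid[OF V0 unit_in_units[OF V0] aM0])
  define z where "z = iv e (e + a ^ M)"
  note eL = unitsD(2,3)[OF V0 un]
  note z = efield_iv[OF L eL, folded z_def]
  have "z * (e + a ^ M) = z + a ^ M * z" using LD(3)[OF z(1)] by (simp add: algebra_simps)
  hence ze: "z - e = - (a ^ M * z)" using z(3) by (simp add: algebra_simps)
  have zL: "z - e \<in> L" using LD(7)[OF z(1) LD(1)] .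
  have "z - e \<in> (*) (unif V0 ^ M) ` V0"
  proof (cases "a = 0")
    case True
    hence "z - e = 0" using ze M by (simp add: power_0_left)
    thus ?thesis using val_ge_iff[OF V0 zL] by simp
  next
    case False
    have "val V0 (a ^ M * z) = int M * val V0 a + 0"
      using val_power[OF V0 aL False z(1,4)] val_iv[OF V0 eL] val_units[OF V0 un] by (simp add: z_def)
    moreover have "val V0 a > 0" using val_pos[OF V0 aL False] a by simp
    ultimately have "val V0 (a ^ M * z) \<ge> int M" using mult_left_mono[of 1 "val V0 a" "int M"] by simp
    hence "z - e = 0 \<or> val V0 (z - e) \<ge> int M"
      using ze val_uminus[OF V0 LD(6)[OF aM z(1)]] by (cases "a ^ M * z = 0") auto
    thus ?thesis using val_ge_iff[OF V0 zL] by blast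
  qed
  moreover have "z \<in> (*) (unif V ^ M) ` V" if V: "V \<in> S - {V0}" for V
  proof -
    have V': "vring V" using S V by blast
    have a0: "a \<noteq> 0" using a V vring_ring(8)[OF V'] by auto
    have va: "val V a < 0" using val_nonneg[OF V' aL a0] a V by auto
    have vM: "val V (a ^ M) = int M * val V a"
      using val_power[OF V' aL a0 LD(1) efield_unit_nz[OF L], of M] val_unit[OF V'] LD(3)[OF aM] by simp
    have le: "int M * val V a \<le> int M * (- 1)" by (rule mult_left_mono) (use va in auto)
    have "val V (a ^ M + e) = val V (a ^ M)"
      using val_add_eq[OF V' aM efield_power_nz[OF L aL a0] LD(1)] vM val_unit[OF V'] le M by simp
    hence "val V z = - (int M * val V a)" using val_iv[OF V' eL] vM by (simp add: z_def add.commute)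
    thus ?thesis using val_ge_iff[OF V' z(1)] le by simp
  qed
  ultimately show ?thesis using z(1) by blast
qed

lemma unif_power_ideal:
  assumes "vring V" "x \<in> (*) (unif V ^ k) ` V" "y \<in> (*) (unif V ^ k) ` V"
  shows "x + y \<in> (*) (unif V ^ k) ` V" "x - y \<in> (*) (unif V ^ k) ` V" "w \<in> V \<Longrightarrow> w * x \<in> (*) (unif V ^ k) ` V"
proof -
  obtain a b where "x = unif V ^ k * a" "a \<in> V" "y = unif V ^ k * b" "b \<in> V" using assms by auto
  moreover from this have "x + y = unif V ^ k * (a + b)" "x - y = unif V ^ k * (a - b)" "w * x = unif V ^ k * (w * a)"
    by (simp_all add: algebra_simps)
  ultimately show "x + y \<in> (*) (unif V ^ k) ` V" "x - y \<in> (*) (unif V ^ k) ` V" "w \<in> V \<Longrightarrow> w * x \<in> (*) (unif V ^ k) ` V"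
    using vring_ring(5-7)[OF assms(1)] by blast+
qed

lemma unif_power_ideal_sum:
  assumes "vring V" "\<And>i. i \<in> A \<Longrightarrow> f i \<in> (*) (unif V ^ k) ` V"
  shows "sum f A \<in> (*) (unif V ^ k) ` V"
proof -
  have "0 \<in> (*) (unif V ^ k) ` V" using vring_ring(8)[OF assms(1)] by force
  thus ?thesis using assms(2)
    by (induction A rule: infinite_finite_induct) (simp_all add: unif_power_ideal(1)[OF assms(1)])
qed

lemma weak_approximation:
  assumes S: "finite S" "\<And>V. V \<in> S \<Longrightarrow> vring V" and r: "\<And>V. V \<in> S \<Longrightarrow> r V \<in> V"
  shows "\<exists>z\<in>L. \<forall>V\<in>S. z - r V \<in> (*) (unif V ^ k V) ` V"
proof -
  \<comment> \<open>The precision covers every prescribed order and, in addition, the possible poles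
    of \<open>r V\<close> at the other places.\<close>
  define M where "M V = Suc ((\<Sum>V'\<in>S. k V') + (\<Sum>V'\<in>S. nat \<bar>val V' (r V)\<bar>))" for V
  have kM: "k V' \<le> M V" if "V' \<in> S" for V V'
    using member_le_sum[of V' S k] S that by (simp add: M_def)
  have vM: "int (k V') - val V' (r V) \<le> int (M V)" if "V' \<in> S" for V V'
  proof -
    have "k V' \<le> (\<Sum>V'\<in>S. k V')" "nat \<bar>val V' (r V)\<bar> \<le> (\<Sum>V'\<in>S. nat \<bar>val V' (r V)\<bar>)"
      using that S by (auto intro!: member_le_sum)
    hence "int (k V') - val V' (r V) \<le> int ((\<Sum>V'\<in>S. k V') + (\<Sum>V'\<in>S. nat \<bar>val V' (r V)\<bar>))" by linarith
    thus ?thesis unfolding M_def by linarith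
  qed
  have rL: "r V \<in> L" if "V \<in> S" for V using r S that vring_sub by blast
  have "\<forall>V\<in>S. \<exists>z\<in>L. z - e \<in> (*) (unif V ^ M V) ` V \<and> (\<forall>V'\<in>S - {V}. z \<in> (*) (unif V' ^ M V) ` V')"
    using approximate_one[OF S(1) S(2)] by (simp add: M_def del: power_Suc)
  then obtain z where z: "\<And>V. V \<in> S \<Longrightarrow> z V \<in> L" "\<And>V. V \<in> S \<Longrightarrow> z V - e \<in> (*) (unif V ^ M V) ` V"
    "\<And>V V'. V \<in> S \<Longrightarrow> V' \<in> S - {V} \<Longrightarrow> z V \<in> (*) (unif V' ^ M V) ` V'" by metis
  define x where "x = (\<Sum>V\<in>S. r V * z V)"
  have "x - r V \<in> (*) (unif V ^ k V) ` V" if V: "V \<in> S" for V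
  proof -
    note V' = S(2)[OF V]
    have "x - r V = (\<Sum>V'\<in>S - {V}. r V' * z V') + r V * (z V - e)"
      using V S LD(3)[OF rL[OF V]] by (simp add: x_def sum.remove algebra_simps)
    moreover have "r V * (z V - e) \<in> (*) (unif V ^ k V) ` V"
    proof -
      have zL: "z V - e \<in> L" using LD(7)[OF z(1)[OF V] LD(1)] .
      have "z V - e \<in> (*) (unif V ^ k V) ` V"
        using z(2)[OF V] val_ge_iff[OF V' zL, of "M V"] val_ge_iff[OF V' zL, of "k V"] kM[OF V, of V] by auto
      thus ?thesis using unif_power_ideal(3)[OF V'] r[OF V] by blast
    qed
    moreover have "r V1 * z V1 \<in> (*) (unif V ^ k V) ` V" if V1: "V1 \<in> S - {V}" for V1
    proof -
      have m: "z V1 \<in> L" "r V1 \<in> L" "V \<in> S - {V1}" using V1 V z(1) rL by auto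
      have "z V1 = 0 \<or> val V (z V1) \<ge> int (M V1)" using z(3)[of V1 V] V1 m val_ge_iff[OF V' m(1)] by auto
      hence "r V1 * z V1 = 0 \<or> val V (r V1 * z V1) \<ge> int (k V)"
        using val_mult[OF V' m(2) _ m(1)] vM[OF V, of V1] by (cases "r V1 = 0"; cases "z V1 = 0") auto
      thus ?thesis using val_ge_iff[OF V' LD(6)[OF m(2,1)]] by blast
    qed
    hence "(\<Sum>V'\<in>S - {V}. r V' * z V') \<in> (*) (unif V ^ k V) ` V"
      by (intro unif_power_ideal_sum[OF V']) simp
    ultimately show ?thesis using unif_power_ideal(1)[OF V'] by simp
  qed
  moreover have "x \<in> L" unfolding x_def by (rule esubring_sum[OF L']) (use LD(6) rL z(1) in blast)
  ultimately show ?thesis by blast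
qed

end

section \<open>Existence of valuation rings\<close>

text \<open>The recursive form exposes the constant coefficient; this splits off the leading
  one.\<close>

lemma polys_below_top:
  assumes K: "esubring e K"
  shows "p \<in> polys_below K s (Suc n) \<Longrightarrow> \<exists>r\<in>polys_below K s n. \<exists>a\<in>K. p = r + s ^ n * a"
proof (induction n arbitrary: p)
  case 0
  then obtain a p' where "p = a + s * p'" "a \<in> K" "p' \<in> polys_below K s 0" by (rule polys_below_SucE)
  thus ?case by auto
next
  case (Suc n)
  from Suc.prems obtain a p' where p: "p = a + s * p'" "a \<in> K" "p' \<in> polys_below K s (Suc n)" by (rule polys_below_SucE)
  obtain r b where r: "r \<in> polys_below K s n" "b \<in> K" "p' = r + s ^ n * b" using Suc.IH[OF p(3)] by blast
  have "p = (a + s * r) + s ^ Suc n * b" using p(1) r(3) by (simp add: algebra_simps)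
  thus ?case using polys_below_SucI[OF p(2) r(1)] r(2) by blast
qed

context base_field
begin

text \<open>The reciprocal polynomial: \<open>u ^ n\<close> times a polynomial of degree at most
  \<open>n\<close> in 1/u is a polynomial in \<open>u\<close>.\<close>

lemma polys_below_reverse:
  assumes M: "esubring e M" "M \<subseteq> L" and u: "u \<in> L" "u \<noteq> 0"
  shows "p \<in> polys_below M (iv e u) m \<Longrightarrow> m \<le> Suc n \<Longrightarrow> u ^ n * p \<in> polys_below M u (Suc n)"
proof (induction m arbitrary: p n)
  case 0
  thus ?case using polys_below_zero[OF M(1), of u "Suc n"] by simp
next
  case (Suc m)
  from Suc.prems(1) obtain a p' where p: "p = a + iv e u * p'" "a \<in> M" "p' \<in> polys_below M (iv e u) m"
    by (rule polys_below_SucE)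
  have eq: "u ^ n * p = u ^ n * a + u ^ n * (iv e u * p')" using p(1) by (simp add: distrib_left)
  have "u ^ n * (iv e u * p') \<in> polys_below M u (Suc n)"
  proof (cases n)
    case 0
    thus ?thesis using Suc.prems p polys_below_zero[OF M(1), of u "Suc n"] by simp
  next
    case (Suc k)
    have p'L: "p' \<in> L" using polys_subset[OF M(1) L' M(2) efield_iv(1)[OF L u]] polysI[OF M(1) p(3)] by blast
    have "u ^ n * (iv e u * p') = u ^ k * ((u * iv e u) * p')" by (simp add: Suc mult_ac)
    hence "u ^ n * (iv e u * p') = u ^ k * p'" using efield_iv(2)[OF L u] LD(2)[OF p'L] by simp
    thus ?thesis using Suc.IH[OF p(3), of k] Suc.prems(2) Suc polys_below_Suc[OF M(1)] by simp
  qed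
  thus ?case unfolding eq using polys_below_add[OF M(1) polys_below_var_power[OF M(1) p(2)]] by blast
qed

text \<open>A maximal ring among those containing \<open>R\<close> but not \<open>z\<close> is a valuation ring.\<close>

lemma pole_exists:
  assumes z: "z \<in> L" "z \<noteq> 0" and R: "esubring e R" "K \<subseteq> R" "R \<subseteq> L" "iv e z \<in> R" "z \<notin> R"
  shows "\<exists>V. vring V \<and> R \<subseteq> V \<and> z \<notin> V"
proof -
  define \<A> where "\<A> = {A. esubring e A \<and> R \<subseteq> A \<and> A \<subseteq> L \<and> z \<notin> A}"
  have "\<exists>M\<in>\<A>. \<forall>Y\<in>\<A>. M \<subseteq> Y \<longrightarrow> Y = M"
  proof (rule subset_Zorn_nonempty)
    show "\<A> \<noteq> {}" using R by (auto simp: \<A>_def)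
    fix C assume C: "C \<noteq> {}" "subset.chain \<A> C"
    have sub: "A \<in> \<A>" if "A \<in> C" for A using C that by (auto simp: subset.chain_def)
    have "esubring e (\<Union>C)"
      unfolding esubring_def
    proof (intro conjI ballI)
      obtain A where "A \<in> C" using C by blast
      hence "e \<in> A" using sub esubringD(1)[of e A] by (simp add: \<A>_def)
      thus "e \<in> \<Union>C" using \<open>A \<in> C\<close> by blast
      fix x assume "x \<in> \<Union>C"
      then obtain A where A: "A \<in> C" "x \<in> A" by blast
      hence Ar: "esubring e A" using sub by (auto simp: \<A>_def)
      show "e * x = x" "- x \<in> \<Union>C" using esubringD[OF Ar] A by auto
      fix y assume "y \<in> \<Union>C"
      then obtain B where B: "B \<in> C" "y \<in> B" by blast
      hence "A \<subseteq> B \<or> B \<subseteq> A" using A C by (auto simp: subset.chain_def)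
      then obtain D where D: "D \<in> C" "x \<in> D" "y \<in> D" using A B by blast
      hence "esubring e D" using sub by (auto simp: \<A>_def)
      thus "x + y \<in> \<Union>C" "x * y \<in> \<Union>C" using D esubringD(5,6) by blast+
    qed
    thus "\<Union>C \<in> \<A>" using C sub by (fastforce simp: \<A>_def)
  qed
  then obtain M where M: "M \<in> \<A>" and max: "\<And>Y. Y \<in> \<A> \<Longrightarrow> M \<subseteq> Y \<Longrightarrow> Y = M" by blast
  have Mr: "esubring e M" "R \<subseteq> M" "M \<subseteq> L" "z \<notin> M" using M by (auto simp: \<A>_def)
  note MD = esubringD[OF Mr(1)]
  have ivz: "iv e z \<in> M" using R Mr by blast
  \<comment> \<open>By maximality of \<open>M\<close>, adjoining any further element produces
    \<open>z\<close>.\<close>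
  have adjoin: "z \<in> polys M u" if u: "u \<in> L" "u \<notin> M" for u
  proof (rule ccontr)
    assume "z \<notin> polys M u"
    moreover have "M \<subseteq> polys M u" using polys_const[OF Mr(1)] by blast
    ultimately have "polys M u = M"
      using max polys_esubring[OF Mr(1) LD(2)[OF u(1)]] polys_subset[OF Mr(1) L' Mr(3) u(1)] Mr(2)
      by (auto simp: \<A>_def)
    thus False using polys_var[OF Mr(1) LD(2)[OF u(1)]] u by simp
  qed
  \<comment> \<open>For y = e - b/z one has z y = z - b, so multiplication by \<open>y\<close> fixes
    \<open>z\<close> modulo \<open>M\<close>. If 1/y were outside \<open>M\<close>, then
    \<open>z\<close> would be a polynomial in 1/y, some \<open>y ^ d * z\<close> would lie in
    \<open>M\<close>, and so would \<open>z\<close>.\<close>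
  have unit: "e - b * iv e z \<noteq> 0 \<and> iv e (e - b * iv e z) \<in> M" if b: "b \<in> M" for b
  proof
    define y where "y = e - b * iv e z"
    have yM: "y \<in> M" using MD(7)[OF MD(1) MD(6)[OF b ivz]] by (simp add: y_def)
    have "b \<in> L" using b Mr by blast
    have "z * y = z * e - b * (z * iv e z)" by (simp add: y_def algebra_simps)
    hence zy: "z * y = z - b" using efield_iv(2)[OF L z] LD(3) z \<open>b \<in> L\<close> by simp
    thus y0: "e - b * iv e z \<noteq> 0" using b Mr by (auto simp: y_def[symmetric])
    show "iv e (e - b * iv e z) \<in> M"
    proof (rule ccontr)
      assume no: "iv e (e - b * iv e z) \<notin> M"
      have yL: "y \<in> L" "y \<noteq> 0" using yM Mr y0 by (auto simp: y_def)
      have "iv e y \<in> L" using efield_iv[OF L yL] by blast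
      hence "z \<in> polys M (iv e y)" using adjoin no by (simp add: y_def)
      then obtain d where d: "z \<in> polys_below M (iv e y) d" by (auto simp: polys_def)
      have "p \<in> polys_below M (iv e y) d \<Longrightarrow> y ^ d * p \<in> M" for p d
      proof (induction d arbitrary: p)
        case (Suc d)
        from Suc.prems obtain a p' where p: "p = a + iv e y * p'" "a \<in> M" "p' \<in> polys_below M (iv e y) d"
          by (rule polys_below_SucE)
        have p'L: "p' \<in> L"
          using polys_subset[OF Mr(1) L' Mr(3) \<open>iv e y \<in> L\<close>] polysI[OF Mr(1) p(3)] by blast
        have "y ^ Suc d * p = y ^ Suc d * a + y ^ d * ((y * iv e y) * p')" by (simp add: p algebra_simps)
        hence "y ^ Suc d * p = y ^ Suc d * a + y ^ d * p'" using efield_iv(2)[OF L yL] LD(2)[OF p'L] by simp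
        thus ?case using MD(5)[OF esubring_power_mult[OF Mr(1) yM p(2)] Suc.IH[OF p(3)], of "Suc d"] by simp
      qed (use MD in simp)
      hence 1: "y ^ d * z \<in> M" using d by blast
      have 2: "y ^ d * z - z \<in> M" for d
      proof (induction d)
        case (Suc d)
        have eq: "y ^ Suc d * z - z = (y ^ d * z - z) * y + (z * y - z)" by (simp add: algebra_simps)
        have "z * y - z \<in> M" using zy MD(4)[OF b] by simp
        thus ?case unfolding eq by (rule MD(5)[OF MD(6)[OF Suc yM]])
      qed (use MD in simp)
      have "y ^ d * z - (y ^ d * z - z) \<in> M" by (rule MD(7)[OF 1 2])
      thus False using Mr by simp
    qed
  qed
  \<comment> \<open>The expression in 1/u has its constant term removed with the help of the unit
    just found. Writing the leading term of the other expression as a multiple of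
    \<open>iv e z * z\<close> and inserting the first expression for \<open>z\<close> lowers the
    degree in \<open>u\<close>.\<close>
  have reduce: "\<exists>n'<n. z \<in> polys_below M u n'"
    if u: "u \<in> L" "u \<noteq> 0" and n: "z \<in> polys_below M u n" and m: "z \<in> polys_below M (iv e u) m" and "m \<le> n" for u n m
  proof -
    obtain n1 where n1: "n = Suc n1" using n z(2) by (cases n) auto
    obtain m1 where m1: "m = Suc m1" using m z(2) by (cases m) auto
    obtain b p where b: "z = b + iv e u * p" "b \<in> M" "p \<in> polys_below M (iv e u) m1"
      using m unfolding m1 by (rule polys_below_SucE)
    define w where "w = iv e (e - b * iv e z)"
    have bL: "b \<in> L" using b Mr by blast
    have wM: "w \<in> M" "w \<in> L" using unit[OF b(2)] Mr by (auto simp: w_def)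
    have eL: "e - b * iv e z \<in> L" using LD(7)[OF LD(1) LD(6)[OF bL efield_iv(1)[OF L z]]] .
    have "z * (e - b * iv e z) = z * e - b * (z * iv e z)" by (simp add: algebra_simps)
    hence "z * (e - b * iv e z) = iv e u * p" using efield_iv(2)[OF L z] LD(3) z(1) bL b(1) by simp
    hence "z * ((e - b * iv e z) * w) = iv e u * (w * p)" by (simp add: mult_ac)
    hence z_eq: "z = iv e u * (w * p)"
      using efield_iv(2)[OF L eL] unit[OF b(2)] LD(3)[OF z(1)] by (simp add: w_def)
    have wp: "w * p \<in> polys_below M (iv e u) m1" by (rule polys_below_scale[OF Mr(1) wM(1) b(3)])
    show ?thesis
    proof (cases n1)
      case 0
      hence "z = 0" using z_eq wp m1 n1 that(5) by simp
      thus ?thesis using z by simp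
    next
      case (Suc n2)
      obtain r a where r: "r \<in> polys_below M u n1" "a \<in> M" "z = r + u ^ n1 * a"
        using polys_below_top[OF Mr(1)] n unfolding n1 by blast
      have aL: "a \<in> L" using r Mr by blast
      have wpL: "w * p \<in> L" using polys_subset[OF Mr(1) L' Mr(3) efield_iv(1)[OF L u]] polysI[OF Mr(1) wp] by blast
      have "u ^ n1 * a = u ^ n1 * a * (iv e z * z)" using efield_iv(3)[OF L z] LD(3)[OF aL] by (simp add: mult.assoc)
      also have "\<dots> = u ^ n1 * a * (iv e z * (iv e u * (w * p)))" using z_eq by simp
      also have "\<dots> = (a * iv e z) * (u ^ n2 * ((u * iv e u) * (w * p)))" by (simp add: Suc mult_ac)
      also have "\<dots> = (a * iv e z) * (u ^ n2 * (w * p))" using efield_iv(2)[OF L u] LD(2)[OF wpL] by simp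
      finally have "u ^ n1 * a = (a * iv e z) * (u ^ n2 * (w * p))" .
      moreover have "u ^ n2 * (w * p) \<in> polys_below M u (Suc n2)"
        by (rule polys_below_reverse[OF Mr(1,3) u wp]) (use that(5) n1 m1 Suc in simp)
      hence "r + (a * iv e z) * (u ^ n2 * (w * p)) \<in> polys_below M u n1"
        unfolding Suc[symmetric]
        by (intro polys_below_add[OF Mr(1) r(1)] polys_below_scale[OF Mr(1) MD(6)[OF r(2) ivz]])
      ultimately have "z \<in> polys_below M u n1" using r(3) by metis
      thus ?thesis using n1 by blast
    qed
  qed
  have "u \<in> M \<or> iv e u \<in> M" if u: "u \<in> L" "u \<noteq> 0" for u
  proof (rule ccontr)
    assume no: "\<not> ?thesis"
    note iu = efield_iv[OF L u]
    have "\<exists>n. z \<in> polys_below M u n" "\<exists>n. z \<in> polys_below M (iv e u) n"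
      using adjoin[of u] adjoin[of "iv e u"] no u iu by (auto simp: polys_def)
    hence "\<exists>n. z \<in> polys_below M u n \<and> (\<forall>k<n. z \<notin> polys_below M u k)"
      "\<exists>n. z \<in> polys_below M (iv e u) n \<and> (\<forall>k<n. z \<notin> polys_below M (iv e u) k)"
      by (simp_all only: exists_least_iff[symmetric])
    then obtain n m where n: "z \<in> polys_below M u n" "\<And>k. k < n \<Longrightarrow> z \<notin> polys_below M u k"
      and m: "z \<in> polys_below M (iv e u) m" "\<And>k. k < m \<Longrightarrow> z \<notin> polys_below M (iv e u) k"
      by blast
    show False
    proof (cases "m \<le> n")
      case True thus False using reduce[OF u n(1) m(1)] n(2) by blast
    next
      case False thus False using reduce[OF iu(1,4) m(1)] n(1) m(2) iv_iv[OF L u(1)] by force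
    qed
  qed
  hence "vring M" using Mr z R(2) by (auto simp: vring_def)
  thus ?thesis using Mr by blast
qed

text \<open>A function without poles lies in K[1/z], since otherwise this ring would extend to a
  valuation ring at which \<open>z\<close> has a pole. The resulting monic equation makes
  \<open>z\<close> a divisor of a nonzero constant, so it vanishes nowhere.\<close>

lemma regular_in_maxid:
  assumes z: "z \<in> L" "\<And>V. vring V \<Longrightarrow> z \<in> V" and V: "vring V" "z \<in> maxid V"
  shows "z = 0"
proof (rule ccontr)
  assume z0: "z \<noteq> 0"
  note iz = efield_iv[OF L z(1) z0]
  have "z \<in> polys K (iv e z)"
  proof (rule ccontr)
    assume "z \<notin> polys K (iv e z)"
    moreover have "esubring e (polys K (iv e z))" "K \<subseteq> polys K (iv e z)" "polys K (iv e z) \<subseteq> L" "iv e z \<in> polys K (iv e z)"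
      using polys_esubring[OF K'] polys_const[OF K'] polys_subset[OF K' L' KL iz(1)] polys_var[OF K'] LD(2)[OF iz(1)]
      by auto
    ultimately show False using pole_exists[OF z(1) z0] z(2) by blast
  qed
  then obtain m where m: "z \<in> polys_below K (iv e z) m" by (auto simp: polys_def)
  have "z ^ m * z \<in> polys_below K z (Suc m)"
    by (rule polys_below_reverse[OF K' KL z(1) z0 m]) simp
  hence "z ^ Suc m * e \<in> polys_below K z (Suc m)" using LD(3)[OF z(1)] by (simp add: power_Suc2 mult.assoc del: power_Suc)
  then obtain a p where a: "a \<in> K" "p \<in> polys K z" "a \<noteq> 0" "a = z * p"
    using monic_relation_constant[OF L K KL z(1) z0] by blast
  have "p \<in> V" using polys_subset[OF K' vringD(1,2)[OF V(1)] z(2)[OF V(1)]] a by blast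
  hence "a \<in> maxid V" using maxid_mult[OF V] a by simp
  thus False using K_maxid[OF V(1) a(1)] a by simp
qed

end

section \<open>Degrees of zero divisors by counting\<close>

context spanned_field
begin

lemma residues_ge_2: "vring V \<Longrightarrow> residues V \<ge> 2"
proof -
  assume V: "vring V"
  have "separated ((*) (unif V) ` V) {0, e}"
    using unit_notin_maxid[OF V] maxid_uminus[OF V, of "- e"] unif(3)[OF V] by (auto simp: separated_def)
  hence "card {0, e} \<le> residues V"
    using index_le[OF V unif(4,2)[OF V], of "{0, e}"] vring_ring[OF V] by (simp add: residues_def[OF V])
  thus ?thesis using efield_unit_nz[OF L] by simp
qed

text \<open>Chinese remaindering by counting. Weak approximation realises every tuple of digit
  expansions at the places of \<open>S\<close> by an element of the intersection \<open>R\<close> of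
  these rings, and different tuples are incongruent modulo \<open>x\<close>; then
  \<open>index_bound\<close> applies to \<open>R\<close>.\<close>

lemma residue_bound:
  assumes S: "finite S" "\<And>V. V \<in> S \<Longrightarrow> vring V" and x: "x \<in> polys_below K s (Suc d)" "x \<noteq> 0" "\<And>V. V \<in> S \<Longrightarrow> x \<in> V"
  shows "(\<Prod>V\<in>S. residues V ^ nat (val V x)) \<le> card K ^ (d * length ws)"
proof -
  define R where "R = L \<inter> \<Inter>S"
  have xL: "x \<in> L" using polys_L polysI[OF K' x(1)] by blast
  have R: "esubring e R" unfolding esubring_def
  proof (intro conjI ballI)
    show "e \<in> R" using LD(1) vring_ring(1)[OF S(2)] by (simp add: R_def)
    fix a assume a: "a \<in> R"
    show "e * a = a" "- a \<in> R" using a LD(2,4) vring_ring(4)[OF S(2)] by (simp_all add: R_def)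
    fix b assume "b \<in> R"
    thus "a + b \<in> R" "a * b \<in> R" using a LD(5,6) vring_ring(5,6)[OF S(2)] by (simp_all add: R_def)
  qed
  have RL: "R \<subseteq> L" by (auto simp: R_def)
  have xR: "x \<in> R" using xL x by (auto simp: R_def)
  define k where "k V = nat (val V x)" for V
  have kval: "int (k V) = val V x" if "V \<in> S" for V
    using val_nonneg[OF S(2)[OF that] xL x(2)] x(3)[OF that] by (simp add: k_def)
  have "\<forall>V\<in>S. \<exists>T. finite T \<and> T \<subseteq> V \<and> separated (maxid V) T \<and> card T = residues V"
  proof
    fix V assume "V \<in> S"
    from residue_transversal[OF S(2)[OF this]]
    show "\<exists>T. finite T \<and> T \<subseteq> V \<and> separated (maxid V) T \<and> card T = residues V" by (elim exE conjE, intro exI conjI)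
  qed
  then obtain T where T: "\<And>V. V \<in> S \<Longrightarrow> finite (T V) \<and> T V \<subseteq> V \<and> separated (maxid V) (T V) \<and> card (T V) = residues V"
    by metis
  define D where "D V = polys_below (T V) (unif V) (k V)" for V
  have D: "D V \<subseteq> V \<and> finite (D V) \<and> card (D V) = residues V ^ k V \<and> separated ((*) (unif V ^ k V) ` V) (D V)"
    if V: "V \<in> S" for V
    using digit_sums[OF L vringD(1,3)[OF S(2)[OF V]] unif(4,2)[OF S(2)[OF V]], of "T V"] T[OF V] unif(3)[OF S(2)[OF V]]
    unfolding D_def by metis
  have "\<exists>z\<in>L. \<forall>V\<in>S. z - f V \<in> (*) (unif V ^ k V) ` V" if "f \<in> PiE S D" for f
    by (rule weak_approximation[OF S]) (use that D in \<open>auto simp: PiE_iff\<close>)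
  then obtain z where z: "\<And>f. f \<in> PiE S D \<Longrightarrow> z f \<in> L" "\<And>f V. f \<in> PiE S D \<Longrightarrow> V \<in> S \<Longrightarrow> z f - f V \<in> (*) (unif V ^ k V) ` V"
    by metis
  have zR: "z f \<in> R" if f: "f \<in> PiE S D" for f
  proof -
    have "z f \<in> V" if V: "V \<in> S" for V
    proof -
      have "z f - f V \<in> V"
        using z(2)[OF f V] esubring_power_mult[OF vringD(1) unif(4), OF S(2)[OF V] S(2)[OF V]] by auto
      moreover have "f V \<in> V" using f V D by (auto simp: PiE_iff)
      ultimately have "z f - f V + f V \<in> V" using vring_ring(5)[OF S(2)[OF V]] by blast
      thus ?thesis by simp
    qed
    thus ?thesis using z(1)[OF f] by (simp add: R_def)
  qed
  have inj: "f = g" if f: "f \<in> PiE S D" and g: "g \<in> PiE S D" and d: "z f - z g \<in> (*) x ` R" for f g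
  proof (rule PiE_ext[OF f g])
    fix V assume V: "V \<in> S"
    note V' = S(2)[OF V]
    obtain y where y: "y \<in> R" "z f - z g = x * y" using d by blast
    have yV: "y \<in> V" using y V by (auto simp: R_def)
    have "x \<in> (*) (unif V ^ k V) ` V" using val_ge_iff[OF V' xL] kval[OF V] by simp
    from unif_power_ideal(3)[OF V' this this yV] have "z f - z g \<in> (*) (unif V ^ k V) ` V"
      using y by (simp add: mult.commute)
    from unif_power_ideal(2)[OF V' this z(2)[OF f V]] unif_power_ideal(1)[OF V' _ z(2)[OF g V]]
    have "(z f - z g) - (z f - f V) + (z g - g V) \<in> (*) (unif V ^ k V) ` V" by blast
    hence "f V - g V \<in> (*) (unif V ^ k V) ` V" by simp
    moreover have "f V \<in> D V" "g V \<in> D V" using f g V by (auto simp: PiE_iff)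
    ultimately show "f V = g V" using separatedD D[OF V] by metis
  qed
  have "inj_on z (PiE S D)"
  proof (rule inj_onI)
    fix f g assume "f \<in> PiE S D" "g \<in> PiE S D" "z f = z g"
    thus "f = g" using inj[of f g] esubringD(8)[OF R(1)] by force
  qed
  hence "(\<Prod>V\<in>S. residues V ^ k V) = card (z ` PiE S D)"
    using D S(1) by (simp add: card_image card_PiE)
  also have "\<dots> \<le> card K ^ (d * length ws)"
  proof (rule index_bound[OF R RL xR x(2,1)])
    show "finite (z ` PiE S D)" using S(1) D by (intro finite_imageI finite_PiE) auto
    show "z ` PiE S D \<subseteq> R" using zR by blast
    show "separated ((*) x ` R) (z ` PiE S D)" using inj by (auto simp: separated_def)
  qed
  finally show ?thesis by (simp add: k_def)
qed

end

section \<open>Riemann-Roch spaces\<close>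

lemma card_le_fibers:
  assumes T: "finite T" "f ` A \<subseteq> T" and fib: "\<And>a. a \<in> A \<Longrightarrow> finite {b \<in> A. f b = f a} \<and> card {b \<in> A. f b = f a} \<le> N"
  shows "finite A \<and> card A \<le> card T * N"
proof -
  have eq: "A = (\<Union>t\<in>f ` A. {b \<in> A. f b = t})" by auto
  have fin: "finite (f ` A)" using T finite_subset by blast
  have fib': "finite {b \<in> A. f b = t}" "card {b \<in> A. f b = t} \<le> N" if "t \<in> f ` A" for t
    using fib that by auto
  have "finite A" by (rule finite_subset[OF equalityD1[OF eq] finite_UN_I[OF fin fib'(1)]])
  moreover have "card A \<le> (\<Sum>t\<in>f ` A. card {b \<in> A. f b = t})"
    using card_UN_le[OF fin, of "\<lambda>t. {b \<in> A. f b = t}"] eq by simp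
  moreover have "(\<Sum>t\<in>f ` A. card {b \<in> A. f b = t}) \<le> of_nat (card (f ` A)) * N"
    by (rule sum_bounded_above) (rule fib'(2))
  ultimately have "finite A" "card A \<le> card (f ` A) * N" by auto
  moreover have "card (f ` A) \<le> card T" using card_mono T by blast
  ultimately show ?thesis by (meson mult_le_mono1 order_trans)
qed

lemma finite_if_card_bounded:
  assumes "\<And>S. finite S \<Longrightarrow> S \<subseteq> A \<Longrightarrow> card S \<le> N"
  shows "finite A"
proof (rule ccontr)
  assume "infinite A"
  then obtain S where "S \<subseteq> A" "finite S" "card S = Suc N" using infinite_arbitrarily_large by blast
  thus False using assms[of S] by simp
qed

context spanned_field
begin

definition RR :: "('a set \<Rightarrow> int) \<Rightarrow> 'a set" where
  "RR D = {z \<in> L. z = 0 \<or> (\<forall>V. vring V \<longrightarrow> val V z \<ge> - D V)}"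

lemma RR_zero: "0 \<in> RR D"
  using LD(8) by (simp add: RR_def)

lemma RR_add: "z \<in> RR D \<Longrightarrow> w \<in> RR D \<Longrightarrow> z + w \<in> RR D"
proof (cases "z = 0 \<or> w = 0 \<or> z + w = 0")
  case False
  assume zw: "z \<in> RR D" "w \<in> RR D"
  hence "val V (z + w) \<ge> - D V" if "vring V" for V
    using val_add[OF that, of z "- D V" w] False that by (simp add: RR_def)
  thus ?thesis using zw LD(5) by (simp add: RR_def)
qed (use RR_zero in auto)

lemma RR_uminus: "z \<in> RR D \<Longrightarrow> - z \<in> RR D"
  using val_uminus[of _ z] LD(4) by (auto simp: RR_def)

lemma RR_diff: "z \<in> RR D \<Longrightarrow> w \<in> RR D \<Longrightarrow> z - w \<in> RR D"
  using RR_add[of z D "- w"] RR_uminus by simp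

lemma RR_scale:
  assumes "c \<in> K" "z \<in> RR D"
  shows "c * z \<in> RR D"
proof (cases "c = 0 \<or> z = 0")
  case False
  hence "val V (c * z) = val V z" if "vring V" for V
    using val_mult[OF that, of c z] val_K[OF that] assms KL by (auto simp: RR_def)
  thus ?thesis using assms KL LD(6) by (auto simp: RR_def)
qed (use RR_zero in auto)

lemma RR_mono: "(\<And>V. vring V \<Longrightarrow> D V \<le> D' V) \<Longrightarrow> RR D \<subseteq> RR D'"
  unfolding RR_def by force

lemma RR_regular: "z \<in> RR (\<lambda>V. 0) \<longleftrightarrow> z \<in> L \<and> (\<forall>V. vring V \<longrightarrow> z \<in> V)"
  using val_nonneg vring_ring(8) by (auto simp: RR_def)

text \<open>Reduction modulo the maximal ideal is injective on functions without poles, by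
  \<open>regular_in_maxid\<close>.\<close>

lemma RR_regular_finite:
  assumes V: "vring V"
  shows "finite (RR (\<lambda>V. 0)) \<and> card (RR (\<lambda>V. 0)) \<le> residues V"
proof -
  obtain T where T: "finite T" "card T = residues V" "\<forall>v\<in>V. \<exists>a\<in>T. v - a \<in> maxid V"
    using residue_transversal[OF V] by blast
  then obtain f where f: "\<And>v. v \<in> V \<Longrightarrow> f v \<in> T \<and> v - f v \<in> maxid V" by metis
  have sub: "RR (\<lambda>V. 0) \<subseteq> V" using V RR_regular by blast
  have "inj_on f (RR (\<lambda>V. 0))"
  proof (rule inj_onI)
    fix x y assume x: "x \<in> RR (\<lambda>V. 0)" and y: "y \<in> RR (\<lambda>V. 0)" and eq: "f x = f y"
    have "(x - f x) - (y - f y) \<in> maxid V" using maxid_diff[OF V] f sub x y by blast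
    hence "x - y \<in> maxid V" using eq by simp
    moreover have "x - y \<in> RR (\<lambda>V. 0)" using RR_diff x y by blast
    ultimately show "x = y" using regular_in_maxid[of "x - y"] V RR_regular[of "x - y"] by auto
  qed
  moreover have "f ` RR (\<lambda>V. 0) \<subseteq> T" using f sub by blast
  ultimately show ?thesis using T card_inj_on_le inj_on_finite by metis
qed

text \<open>Allowing one more pole at \<open>V\<close> adds one leading coefficient, an element of
  the residue field; functions with equal leading coefficient differ by an element of
  \<open>RR D\<close>.\<close>

lemma RR_add_place:
  assumes V: "vring V" and fin: "finite (RR D)" and D': "\<And>V'. vring V' \<Longrightarrow> D' V' = (if V' = V then D V + 1 else D V')"
  shows "finite (RR D') \<and> card (RR D') \<le> residues V * card (RR D)"
proof -
  obtain T where T: "finite T" "card T = residues V" "\<forall>v\<in>V. \<exists>a\<in>T. v - a \<in> maxid V"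
    using residue_transversal[OF V] by blast
  then obtain f where f: "\<And>v. v \<in> V \<Longrightarrow> f v \<in> T \<and> v - f v \<in> maxid V" by metis
  let ?u = "upow V (D V + 1)"
  note u = upow_L[OF V, of "D V + 1"] upow_nz[OF V, of "D V + 1"] val_upow[OF V, of "D V + 1"]
  have inV: "z * ?u \<in> V" if "z \<in> RR D'" for z
  proof (cases "z = 0")
    case False
    have zL: "z \<in> L" and "val V z \<ge> - (D V + 1)" using that V D'[OF V] False by (auto simp: RR_def)
    hence "val V (z * ?u) \<ge> 0" using val_mult[OF V zL False u(1,2)] u(3) by simp
    thus ?thesis using val_nonneg[OF V LD(6)[OF zL u(1)] efield_mult_nz[OF L zL u(1) False u(2)]] by simp
  qed (use vring_ring(8)[OF V] in simp)
  have RL: "RR D' \<subseteq> L" "RR D \<subseteq> L" by (auto simp: RR_def)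
  have down: "w \<in> RR D" if w: "w \<in> RR D'" "w * ?u \<in> maxid V" for w
  proof (cases "w = 0")
    case False
    have wL: "w \<in> L" using w RL by blast
    have "val V (w * ?u) > 0"
      using val_pos[OF V LD(6)[OF wL u(1)] efield_mult_nz[OF L wL u(1) False u(2)]] w by simp
    hence "val V w > - (D V + 1)" using val_mult[OF V wL False u(1,2)] u(3) by simp
    thus ?thesis using w D' wL by (auto simp: RR_def split: if_splits)
  qed (use RR_zero in simp)
  have "finite (RR D') \<and> card (RR D') \<le> card T * card (RR D)"
  proof (rule card_le_fibers[OF T(1), of "\<lambda>z. f (z * ?u)"])
    show "(\<lambda>z. f (z * ?u)) ` RR D' \<subseteq> T" using f inV by blast
    fix a assume a: "a \<in> RR D'"
    let ?F = "{b \<in> RR D'. f (b * ?u) = f (a * ?u)}"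
    have "(\<lambda>b. b - a) ` ?F \<subseteq> RR D"
    proof (intro image_subsetI, rule down)
      fix b assume b: "b \<in> ?F"
      show "b - a \<in> RR D'" using RR_diff a b by blast
      have "(b * ?u - f (b * ?u)) - (a * ?u - f (a * ?u)) \<in> maxid V"
        using maxid_diff[OF V] f inV a b by blast
      thus "(b - a) * ?u \<in> maxid V" using b by (simp add: left_diff_distrib)
    qed
    moreover have "inj_on (\<lambda>b. b - a) ?F" by (simp add: inj_on_def)
    ultimately show "finite ?F \<and> card ?F \<le> card (RR D)"
      using fin by (meson card_inj_on_le inj_on_finite)
  qed
  thus ?thesis using T by simp
qed

lemma RR_add_places:
  assumes S: "finite S" "\<And>V. V \<in> S \<Longrightarrow> vring V" and fin: "finite (RR D)"
    and D': "\<And>V. vring V \<Longrightarrow> V \<in> S \<Longrightarrow> D V \<le> D' V" "\<And>V. vring V \<Longrightarrow> V \<notin> S \<Longrightarrow> D' V = D V"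
  shows "finite (RR D') \<and> card (RR D') \<le> (\<Prod>V\<in>S. residues V ^ nat (D' V - D V)) * card (RR D)"
  using S D'
proof (induction S arbitrary: D' rule: finite_induct)
  case empty
  hence "RR D' = RR D" by (intro equalityI RR_mono) auto
  thus ?case using fin by simp
next
  case (insert V0 S)
  have V0: "vring V0" using insert by blast
  have *: "finite (RR D'') \<and> card (RR D'') \<le> residues V0 ^ k * ((\<Prod>V\<in>S. residues V ^ nat (D' V - D V)) * card (RR D))"
    if "\<And>V. vring V \<Longrightarrow> D'' V = (if V = V0 then D V + int k else D' V)" for k D''
    using that
  proof (induction k arbitrary: D'')
    case 0
    have "finite (RR D'') \<and> card (RR D'') \<le> (\<Prod>V\<in>S. residues V ^ nat (D'' V - D V)) * card (RR D)"
      by (rule insert.IH) (use insert.prems insert.hyps 0 in auto)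
    moreover have "(\<Prod>V\<in>S. residues V ^ nat (D'' V - D V)) = (\<Prod>V\<in>S. residues V ^ nat (D' V - D V))"
      by (rule prod.cong) (use insert 0 in auto)
    ultimately show ?case by simp
  next
    case (Suc k)
    let ?D = "\<lambda>V. if V = V0 then D V + int k else D' V"
    have IH: "finite (RR ?D)" "card (RR ?D) \<le> residues V0 ^ k * ((\<Prod>V\<in>S. residues V ^ nat (D' V - D V)) * card (RR D))"
      using Suc.IH[of ?D] by auto
    have "finite (RR D'') \<and> card (RR D'') \<le> residues V0 * card (RR ?D)"
      by (rule RR_add_place[OF V0 IH(1)]) (use Suc.prems in auto)
    moreover have "residues V0 * card (RR ?D) \<le> residues V0 ^ Suc k * ((\<Prod>V\<in>S. residues V ^ nat (D' V - D V)) * card (RR D))"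
      using mult_le_mono2[OF IH(2), of "residues V0"] by (simp add: mult.assoc)
    ultimately show ?case by linarith
  qed
  have "finite (RR D') \<and> card (RR D') \<le> residues V0 ^ nat (D' V0 - D V0) * ((\<Prod>V\<in>S. residues V ^ nat (D' V - D V)) * card (RR D))"
    by (rule *) (use insert V0 in auto)
  thus ?case using insert by (simp add: mult.assoc)
qed

lemma RR_finite:
  assumes V0: "vring V0" and S: "finite {V. vring V \<and> D V > 0}"
  shows "finite (RR D)"
proof -
  have "finite (RR (\<lambda>V. max 0 (D V)))"
    using RR_add_places[OF S _ conjunct1[OF RR_regular_finite[OF V0]], of "\<lambda>V. max 0 (D V)"] by auto
  thus ?thesis by (rule finite_subset[OF RR_mono, rotated]) simp
qed

lemma divides_polynomial:
  assumes V: "vring V" "s \<in> V"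
  shows "\<exists>x\<in>polys K s. x \<noteq> 0 \<and> val V x \<ge> int k"
proof -
  have t: "unif V ^ k * e \<in> V" "unif V ^ k * e \<noteq> 0"
    using esubring_power_mult[OF vringD(1)[OF V(1)] unif(4)[OF V(1)] vring_ring(1)[OF V(1)]]
      efield_power_mult_nz[OF L unif(5,2)[OF V(1)] LD(1) efield_unit_nz[OF L]] by auto
  obtain x where x: "x \<in> polys K s" "x \<noteq> 0" "x \<in> (*) (unif V ^ k * e) ` V"
    using divides_polynomial_aux[OF vringD(1-3)[OF V(1)] V(2) t] by blast
  have "x \<in> (*) (unif V ^ k) ` V" using x(3) vring_ring(2)[OF V(1)] by (auto simp: mult.assoc)
  thus ?thesis using x val_ge_iff[OF V(1)] polys_L by blast
qed

lemma val_at_infinity: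
  assumes V: "vring V" "s \<notin> V"
  shows "g \<in> polys_below K s (Suc d) \<Longrightarrow> g \<notin> polys_below K s d \<Longrightarrow> val V g = int d * val V s"
proof (induction d arbitrary: g)
  case 0
  then obtain a p where "g = a + s * p" "a \<in> K" "p \<in> polys_below K s 0" by (blast elim: polys_below_SucE)
  thus ?case using 0 val_K[OF V(1), of a] by simp
next
  case (Suc d)
  from Suc.prems(1) obtain a p where p: "g = a + s * p" "a \<in> K" "p \<in> polys_below K s (Suc d)" by (rule polys_below_SucE)
  have s0: "s \<noteq> 0" using V vring_ring(8)[OF V(1)] by auto
  have pn: "p \<notin> polys_below K s d" using Suc.prems(2) p polys_below_SucI by blast
  hence p0: "p \<noteq> 0" using polys_below_zero[OF K'] by blast
  have pL: "p \<in> L" using polys_L polysI[OF K' p(3)] by blast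
  have vs: "val V s < 0" using val_nonneg[OF V(1) s s0] V by simp
  have v: "val V (s * p) = val V s + int d * val V s"
    using val_mult[OF V(1) s s0 pL p0] Suc.IH[OF p(3) pn] by simp
  have "val V (s * p) < 0" using v vs mult_nonneg_nonpos[of "int d" "val V s"] by simp
  hence "a = 0 \<or> val V (s * p) < val V a" using val_K[OF V(1) p(2)] by (cases "a = 0") auto
  hence "val V (s * p + a) = val V (s * p)"
    using val_add_eq[OF V(1) LD(6)[OF s pL] efield_mult_nz[OF L s pL s0 p0]] p(2) KL by blast
  thus ?case using v p(1) by (simp add: algebra_simps)
qed

end

text \<open>The degree is a parameter here. That residue fields have a power of
  \<open>card K\<close> elements is shown for the model, where degrees are dimensions.\<close>

locale graded_field = spanned_field e L K s ws for e :: "'a::comm_ring_1" and L K s ws +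
  fixes deg :: "'a set \<Rightarrow> nat"
  assumes deg: "vring V \<Longrightarrow> residues V = card K ^ deg V"
begin

lemma deg_pos: "vring V \<Longrightarrow> deg V > 0"
  using residues_ge_2[of V] deg[of V] by (cases "deg V") auto

lemma prod_residues:
  assumes "\<And>V. V \<in> S \<Longrightarrow> vring V" "\<And>V. V \<in> S \<Longrightarrow> k V \<ge> 0"
  shows "(\<Prod>V\<in>S. residues V ^ nat (k V)) = card K ^ nat (\<Sum>V\<in>S. k V * int (deg V))"
proof -
  have "(\<Prod>V\<in>S. residues V ^ nat (k V)) = (\<Prod>V\<in>S. card K ^ (nat (k V) * deg V))"
    using deg assms(1) by (intro prod.cong) (auto simp: power_mult[symmetric] mult.commute)
  also have "\<dots> = card K ^ (\<Sum>V\<in>S. nat (k V) * deg V)" by (rule power_sum[symmetric])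
  also have "int (\<Sum>V\<in>S. nat (k V) * deg V) = (\<Sum>V\<in>S. k V * int (deg V))"
    unfolding of_nat_sum using assms(2) by (intro sum.cong) auto
  hence "(\<Sum>V\<in>S. nat (k V) * deg V) = nat (\<Sum>V\<in>S. k V * int (deg V))" by linarith
  finally show ?thesis .
qed

lemma degree_bound:
  assumes S: "finite S" "\<And>V. V \<in> S \<Longrightarrow> vring V" and x: "x \<in> polys_below K s (Suc d)" "x \<noteq> 0" "\<And>V. V \<in> S \<Longrightarrow> x \<in> V"
  shows "(\<Sum>V\<in>S. val V x * int (deg V)) \<le> int (d * length ws)"
proof -
  have xL: "x \<in> L" using polys_L polysI[OF K' x(1)] by blast
  have nn: "val V x \<ge> 0" if "V \<in> S" for V using val_nonneg[OF S(2)[OF that] xL x(2)] x(3) that by simp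
  have "card K ^ nat (\<Sum>V\<in>S. val V x * int (deg V)) \<le> card K ^ (d * length ws)"
    using residue_bound[OF S x] prod_residues[OF S(2) nn] by simp
  hence "nat (\<Sum>V\<in>S. val V x * int (deg V)) \<le> d * length ws"
    using card_K by (subst (asm) power_increasing_iff) auto
  moreover have "(\<Sum>V\<in>S. val V x * int (deg V)) \<ge> 0" using nn by (intro sum_nonneg) auto
  ultimately show ?thesis by linarith
qed

lemma zeros_finite:
  assumes x: "x \<in> polys_below K s (Suc d)" "x \<noteq> 0"
  shows "finite {V. vring V \<and> x \<in> maxid V}"
proof (rule finite_if_card_bounded)
  fix S assume S: "finite S" "S \<subseteq> {V. vring V \<and> x \<in> maxid V}"
  have xL: "x \<in> L" using polys_L polysI[OF K' x(1)] by blast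
  have "(\<Sum>V\<in>S. 1) \<le> (\<Sum>V\<in>S. val V x * int (deg V))"
  proof (rule sum_mono)
    fix V assume "V \<in> S"
    hence V: "vring V" "x \<in> maxid V" using S by auto
    have "val V x \<ge> 1" "int (deg V) \<ge> 1" using val_pos[OF V(1) xL x(2)] V(2) deg_pos[OF V(1)] by auto
    thus "1 \<le> val V x * int (deg V)" using mult_mono[of 1 "val V x" 1 "int (deg V)"] by simp
  qed
  also have "\<dots> \<le> int (d * length ws)" by (rule degree_bound[OF S(1) _ x]) (use S maxid_sub in auto)
  finally have "int (card S) \<le> int (d * length ws)" by simp
  thus "card S \<le> d * length ws" by (simp only: of_nat_le_iff)
qed

lemma graded_field_flip: "s \<noteq> 0 \<Longrightarrow> graded_field e L K (iv e s) ws deg"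
proof -
  assume s0: "s \<noteq> 0"
  interpret F: spanned_field e L K "iv e s" ws by (rule spanned_field_flip[OF spanned_field_axioms s0])
  show ?thesis
  proof unfold_locales
    fix V assume V: "vring V"
    have "F.residues V = residues V"
      unfolding F.residues_def[OF V] residues_def[OF V] F.index_def index_def F.unif_def unif_def by simp
    thus "F.residues V = card K ^ deg V" using deg[OF V] by simp
  qed
qed

text \<open>This is \<open>degree_bound\<close> for 1/s, a polynomial of degree one in
  itself.\<close>

lemma infinity_degree:
  assumes S: "finite S" "\<And>V. V \<in> S \<Longrightarrow> vring V \<and> s \<notin> V"
  shows "(\<Sum>V\<in>S. - val V s * int (deg V)) \<le> int (length ws)"
proof (cases "S = {}")
  case False
  then obtain V where "vring V" "s \<notin> V" using S by blast
  hence s0: "s \<noteq> 0" using vring_ring(8) by auto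
  interpret F: graded_field e L K "iv e s" ws deg by (rule graded_field_flip[OF s0])
  note ivs = efield_iv[OF L s s0]
  have "iv e s * e \<in> polys_below K (iv e s) (Suc 1)"
    using polys_below_var_power[OF K' KD(1), of "iv e s" 1] by simp
  hence i: "iv e s \<in> polys_below K (iv e s) (Suc 1)" using LD(3) ivs by simp
  have "(\<Sum>V\<in>S. F.val V (iv e s) * int (deg V)) \<le> int (1 * length ws)"
    by (rule F.degree_bound[OF S(1) _ i]) (use S ivs vringD(5)[OF _ s] in auto)
  moreover have "F.val V (iv e s) = - val V s" if "V \<in> S" for V
  proof -
    have V: "vring V" using S that by blast
    have "F.val V (iv e s) = val V (iv e s)"
      unfolding F.val_def val_def F.upow_def upow_def F.unif_def unif_def by simp
    thus ?thesis using val_iv[OF V s s0] by simp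
  qed
  ultimately show ?thesis by simp
qed simp

lemma infinity_finite: "finite {V. vring V \<and> s \<notin> V}"
proof (rule finite_if_card_bounded)
  fix S assume S: "finite S" "S \<subseteq> {V. vring V \<and> s \<notin> V}"
  have "(\<Sum>V\<in>S. 1) \<le> (\<Sum>V\<in>S. - val V s * int (deg V))"
  proof (rule sum_mono)
    fix V assume "V \<in> S"
    hence V: "vring V" "s \<notin> V" using S by auto
    have "s \<noteq> 0" using V vring_ring(8) by auto
    hence "- val V s \<ge> 1" "int (deg V) \<ge> 1" using val_nonneg[OF V(1) s] V(2) deg_pos[OF V(1)] by auto
    thus "1 \<le> - val V s * int (deg V)" using mult_mono[of 1 "- val V s" 1 "int (deg V)"] by simp
  qed
  also have "\<dots> \<le> int (length ws)" by (rule infinity_degree) (use S in auto)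
  finally show "card S \<le> length ws" by simp
qed

text \<open>Every divisor is dominated by one linearly equivalent to a multiple of the pole divisor of
  \<open>s\<close>, and enlarging a divisor does not decrease the difference between degree and dimension.\<close>

theorem Riemann_inequality:
  assumes s0: "s \<noteq> 0" and H: "\<And>m. card K ^ (length ws * m) \<le> card (RR (\<lambda>V. int (m + 1) * max 0 (- val V s)))"
    and D: "finite {V. vring V \<and> D V \<noteq> 0}" and l: "card (RR D) = card K ^ l"
  shows "(\<Sum>V | vring V \<and> D V \<noteq> 0. D V * int (deg V)) - int (length ws) \<le> int l"
proof -
  define S0 where "S0 = {V. vring V \<and> D V \<noteq> 0}"
  have "\<exists>x. x \<in> polys K s \<and> x \<noteq> 0 \<and> val V x \<ge> D V" if "vring V" "s \<in> V" for V
    using divides_polynomial[OF that, of "nat (D V)"] int_nat_eq[of "D V"] by (smt (verit))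
  then obtain x where x: "\<And>V. vring V \<Longrightarrow> s \<in> V \<Longrightarrow> x V \<in> polys K s \<and> x V \<noteq> 0 \<and> val V (x V) \<ge> D V" by metis
  \<comment> \<open>One polynomial per place, multiplied together; polynomials are regular at these
    places, so a further factor never lowers a valuation.\<close>
  have ex_g: "\<exists>g\<in>polys K s. g \<noteq> 0 \<and> (\<forall>V\<in>S. s \<in> V \<longrightarrow> val V g \<ge> D V)" if "finite S" "S \<subseteq> {V. vring V}" for S
    using that
  proof (induction S)
    case empty
    thus ?case using esubringD(1)[OF polys_ring] efield_unit_nz[OF L] by auto
  next
    case (insert V S)
    then obtain g where g: "g \<in> polys K s" "g \<noteq> 0" "\<forall>V\<in>S. s \<in> V \<longrightarrow> val V g \<ge> D V" by auto
    show ?case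
    proof (cases "s \<in> V")
      case True
      have V: "vring V" using insert by simp
      note xV = x[OF V True]
      have gL: "g \<in> L" "x V \<in> L" using g xV polys_L by auto
      have nn: "val V' (g * x V) \<ge> val V' g \<and> val V' (g * x V) \<ge> val V' (x V)" if V': "vring V'" "s \<in> V'" for V'
      proof -
        have "polys K s \<subseteq> V'" by (rule polys_subset[OF K' vringD(1,2)[OF V'(1)] V'(2)])
        hence "val V' g \<ge> 0" "val V' (x V) \<ge> 0" using val_nonneg[OF V'(1)] gL g xV by auto
        thus ?thesis using val_mult[OF V'(1) gL(1) g(2) gL(2)] xV by simp
      qed
      have "val V' (g * x V) \<ge> D V'" if "V' \<in> insert V S" "s \<in> V'" for V'
        using nn[of V'] that insert.prems g(3) xV by fastforce
      thus ?thesis using g xV esubringD(6)[OF polys_ring] efield_mult_nz[OF L gL] by (metis (full_types))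
    next
      case False
      thus ?thesis using g by auto
    qed
  qed
  obtain g where g: "g \<in> polys K s" "g \<noteq> 0" "\<forall>V\<in>S0. s \<in> V \<longrightarrow> val V g \<ge> D V"
    using ex_g[of S0] D by (auto simp: S0_def)
  have gL: "g \<in> L" using g polys_L by blast
  note ig = efield_iv[OF L gL g(2)]
  have "\<exists>d. g \<in> polys_below K s d" using g by (auto simp: polys_def)
  hence "\<exists>d. g \<in> polys_below K s d \<and> (\<forall>k<d. g \<notin> polys_below K s k)"
    by (simp only: exists_least_iff[symmetric])
  then obtain d' where d': "g \<in> polys_below K s d'" "\<forall>k<d'. g \<notin> polys_below K s k" by blast
  obtain d where "d' = Suc d" using d'(1) g(2) by (cases d') auto
  hence d: "g \<in> polys_below K s (Suc d)" "g \<notin> polys_below K s d" using d' by auto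
  define N where "N = (\<Sum>V\<in>S0. nat \<bar>D V\<bar>)"
  have N: "D V \<le> int N" if "vring V" for V
  proof (cases "V \<in> S0")
    case True
    have "nat \<bar>D V\<bar> \<le> N" unfolding N_def by (rule member_le_sum) (use True D S0_def in auto)
    thus ?thesis by simp
  next
    case False
    thus ?thesis using that by (simp add: S0_def)
  qed
  \<comment> \<open>At a pole of \<open>s\<close>, \<open>d\<close> pays for the pole of
    \<open>g\<close>, while \<open>N\<close> dominates \<open>D\<close>; what remains of
    \<open>D2\<close> there is \<open>N + 1\<close> times the pole order of
    \<open>s\<close>.\<close>
  define m where "m = N + d"
  define D2 where "D2 V = int (m + 1) * max 0 (- val V s) + val V g" for V
  have g_inf: "val V g = int d * val V s" if "vring V" "s \<notin> V" for V
    using val_at_infinity[OF that d] .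
  have D2_inf: "D2 V = int (N + 1) * (- val V s)" "val V s < 0" if V: "vring V" "s \<notin> V" for V
  proof -
    show *: "val V s < 0" using val_nonneg[OF V(1) s s0] V by simp
    show "D2 V = int (N + 1) * (- val V s)" using * g_inf[OF V] by (simp add: D2_def m_def algebra_simps)
  qed
  have polysV: "polys K s \<subseteq> V" if "vring V" "s \<in> V" for V
    by (rule polys_subset[OF K' vringD(1,2)[OF that(1)] that(2)])
  have valg: "val V g \<ge> 0" if "vring V" "s \<in> V" for V
    using val_nonneg[OF that(1) gL g(2)] polysV[OF that] g(1) by blast
  define S where "S = S0 \<union> {V. vring V \<and> s \<notin> V} \<union> {V. vring V \<and> g \<in> maxid V}"
  have S: "finite S" "\<And>V. V \<in> S \<Longrightarrow> vring V"
    using D infinity_finite zeros_finite[OF d(1) g(2)] by (auto simp: S_def S0_def)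
  have D2_fin: "D2 V = val V g" if V: "vring V" "s \<in> V" for V
    using val_nonneg[OF V(1) s s0] V(2) by (simp add: D2_def)
  have le: "D V \<le> D2 V" if V: "vring V" for V
  proof (cases "s \<in> V")
    case True
    thus ?thesis using D2_fin[OF V True] g(3) valg[OF V True] V by (cases "V \<in> S0") (auto simp: S0_def)
  next
    case False
    note i = D2_inf[OF V False]
    have "int N * 1 \<le> int (N + 1) * (- val V s)" by (rule mult_mono) (use i in auto)
    thus ?thesis using N[OF V] i by simp
  qed
  have off: "D2 V = D V" if V: "vring V" "V \<notin> S" for V
  proof -
    have "s \<in> V" "g \<notin> maxid V" "D V = 0" using V by (auto simp: S_def S0_def)
    thus ?thesis using D2_fin[of V] valg[of V] val_pos[OF V(1) gL g(2)] V by force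
  qed
  have "card (RR D) > 0" using l card_K by simp
  hence finD: "finite (RR D)" using card_gt_0_iff by blast
  have fin2: "finite (RR D2)" "card (RR D2) \<le> (\<Prod>V\<in>S. residues V ^ nat (D2 V - D V)) * card (RR D)"
    using RR_add_places[OF S finD le off] by auto
  let ?A = "\<lambda>V. int (m + 1) * max 0 (- val V s)"
  \<comment> \<open>\<open>D2\<close> is the divisor of \<open>g\<close> plus m + 1 times the pole
    divisor of \<open>s\<close>, so division by \<open>g\<close> transports the many functions
    provided by \<open>H\<close>.\<close>
  have "(\<lambda>w. w * iv e g) ` RR ?A \<subseteq> RR D2"
  proof (intro image_subsetI)
    fix w assume w: "w \<in> RR ?A"
    show "w * iv e g \<in> RR D2"
    proof (cases "w = 0")
      case False
      have wL: "w \<in> L" using w by (auto simp: RR_def)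
      have "val V (w * iv e g) = val V w - val V g" if "vring V" for V
        using val_mult[OF that wL False ig(1,4)] val_iv[OF that gL g(2)] by simp
      thus ?thesis using w False LD(6)[OF wL ig(1)] by (fastforce simp: RR_def D2_def)
    qed (use RR_zero in simp)
  qed
  moreover have "inj_on (\<lambda>w. w * iv e g) (RR ?A)"
    using efield_cancel[OF L ig(1) _ _ ig(4)] by (intro inj_onI) (auto simp: RR_def mult.commute)
  ultimately have "card (RR ?A) \<le> card (RR D2)" using fin2(1) by (meson card_inj_on_le)
  hence "card K ^ (length ws * m) \<le> (\<Prod>V\<in>S. residues V ^ nat (D2 V - D V)) * card (RR D)"
    using H[of m] fin2(2) by linarith
  also have "\<dots> = card K ^ (nat (\<Sum>V\<in>S. (D2 V - D V) * int (deg V)) + l)"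
    using prod_residues[of S "\<lambda>V. D2 V - D V"] S(2) le l by (simp add: power_add)
  finally have "length ws * m \<le> nat (\<Sum>V\<in>S. (D2 V - D V) * int (deg V)) + l"
    using card_K by (subst (asm) power_increasing_iff) auto
  moreover have "(\<Sum>V\<in>S. (D2 V - D V) * int (deg V)) \<ge> 0" using le S by (intro sum_nonneg) auto
  ultimately have "int (length ws * m) \<le> (\<Sum>V\<in>S. (D2 V - D V) * int (deg V)) + int l" by linarith
  hence 1: "int (length ws * m) \<le> (\<Sum>V\<in>S. D2 V * int (deg V)) - (\<Sum>V\<in>S. D V * int (deg V)) + int l"
    by (simp only: left_diff_distrib sum_subtractf)
  have 2: "(\<Sum>V\<in>S. D V * int (deg V)) = (\<Sum>V\<in>S0. D V * int (deg V))"
  proof (rule sum.mono_neutral_right[OF S(1)])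
    show "S0 \<subseteq> S" by (auto simp: S_def)
    show "\<forall>V\<in>S - S0. D V * int (deg V) = 0" using S(2) by (simp add: S0_def)
  qed
  \<comment> \<open>The degree of \<open>D2\<close> is at most m + 1 times \<open>length ws\<close>:
    the zeros of \<open>g\<close> contribute at most \<open>d\<close> times and the poles of
    \<open>s\<close> at most \<open>N + 1\<close> times \<open>length ws\<close>.\<close>
  let ?F = "S \<inter> {V. s \<in> V}" and ?I = "S - {V. s \<in> V}"
  have "(\<Sum>V\<in>S. D2 V * int (deg V)) = (\<Sum>V\<in>?F. D2 V * int (deg V)) + (\<Sum>V\<in>?I. D2 V * int (deg V))"
    by (rule sum.Int_Diff[OF S(1)])
  also have "(\<Sum>V\<in>?F. D2 V * int (deg V)) = (\<Sum>V\<in>?F. val V g * int (deg V))"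
    using D2_fin S by (intro sum.cong) auto
  also have "\<dots> \<le> int (d * length ws)"
    by (rule degree_bound[OF _ _ d(1) g(2)]) (use S polysV g(1) in auto)
  also have "(\<Sum>V\<in>?I. D2 V * int (deg V)) = int (N + 1) * (\<Sum>V\<in>?I. - val V s * int (deg V))"
    unfolding sum_distrib_left using D2_inf S by (intro sum.cong) auto
  also have "\<dots> \<le> int (N + 1) * int (length ws)"
    by (rule mult_left_mono[OF infinity_degree]) (use S in auto)
  finally have "(\<Sum>V\<in>S. D2 V * int (deg V)) \<le> int (d * length ws) + int (N + 1) * int (length ws)" by simp
  hence "(\<Sum>V\<in>S. D2 V * int (deg V)) \<le> int (length ws * m) + int (length ws)"
    by (simp add: m_def algebra_simps)
  thus ?thesis using 1 2 by (simp add: S0_def)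
qed

end

section \<open>Counting rational places\<close>

context spanned_field
begin

lemma val_prod:
  assumes V: "vring V" and f: "\<And>i. i \<in> A \<Longrightarrow> f i \<in> L \<and> f i \<noteq> 0"
  shows "val V (prod f A * e) = (\<Sum>i\<in>A. val V (f i))"
  using f
proof (induction A rule: infinite_finite_induct)
  case (insert i A)
  have "prod f A * e \<in> L" "prod f A * e \<noteq> 0"
    using esubring_prod[OF L' _ LD(1), of A f] efield_prod_nz[OF L _ LD(1) efield_unit_nz[OF L], of A f] insert.prems
    by simp_all
  thus ?case using insert val_mult[OF V, of "f i" "prod f A * e"] by (simp add: mult.assoc)
qed (use val_unit[OF V] in auto)

text \<open>Functions without poles inject into the residue field, which has only
  \<open>card K\<close> elements at a rational place.\<close>

lemma regular_constants:
  assumes V: "vring V" "residues V = card K"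
  shows "RR (\<lambda>V. 0) = K"
proof -
  have "K \<subseteq> RR (\<lambda>V. 0)" using RR_regular vringD(2) KL by auto
  thus ?thesis using RR_regular_finite[OF V(1)] V(2) by (metis card_seteq)
qed

lemma algebraic_in_vring:
  assumes z: "z \<in> L" "z ^ i * e \<in> polys_below K z i" and V: "vring V"
  shows "z \<in> V"
proof (rule ccontr)
  assume nz: "z \<notin> V"
  hence z0: "z \<noteq> 0" using vring_ring(8)[OF V] by auto
  note iz = efield_iv[OF L z(1) z0]
  have izV: "iv e z \<in> V" using vringD(5)[OF V z(1) nz] .
  obtain n where n: "i = Suc n" using z(2) efield_unit_nz[OF L] by (cases i) auto
  have "iv e z ^ n * (z ^ i * e) \<in> polys_below K (iv e z) (Suc n)"
    using polys_below_reverse[OF K' KL iz(1,4), of "z ^ i * e" i n] z(2) n iv_iv[OF L z(1)] by simp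
  moreover have "iv e z ^ n * (z ^ i * e) = iv e z ^ n * (z ^ n * (z * e))" by (simp add: n mult_ac)
  hence "iv e z ^ n * (z ^ i * e) = z"
    using efield_power_iv[OF L iz(1,4) z(1), of n] iv_iv[OF L z(1)] LD(3)[OF z(1)] by simp
  ultimately have "z \<in> polys K (iv e z)" using polysI[OF K'] by metis
  thus False using polys_subset[OF K' vringD(1,2)[OF V] izV] nz by blast
qed

lemma residue_in_K:
  assumes V: "vring V" "residues V = card K" and z: "z \<in> V"
  shows "\<exists>c\<in>K. z - c \<in> maxid V"
proof -
  obtain T where T: "finite T" "card T = card K" "\<forall>v\<in>V. \<exists>a\<in>T. v - a \<in> maxid V"
    using residue_transversal[OF V(1)] V(2) by metis
  then obtain f where f: "\<And>v. v \<in> V \<Longrightarrow> f v \<in> T \<and> v - f v \<in> maxid V" by metis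
  have KV: "K \<subseteq> V" using vringD(2)[OF V(1)] .
  have "inj_on f K"
  proof (rule inj_onI)
    fix x y assume x: "x \<in> K" "y \<in> K" and eq: "f x = f y"
    have "(x - f x) - (y - f y) \<in> maxid V" using maxid_diff[OF V(1)] f KV x by blast
    hence "x - y \<in> maxid V" using eq by simp
    thus "x = y" using K_maxid[OF V(1) KD(7)[OF x]] by simp
  qed
  hence "f ` K = T" using f KV T finK by (intro card_subset_eq) (auto simp: card_image)
  then obtain c where c: "c \<in> K" "f c = f z" using f[OF z] by force
  have "(z - f z) - (c - f c) \<in> maxid V" using maxid_diff[OF V(1)] f z c KV by blast
  thus ?thesis using c by (intro bexI[of _ c]) simp_all
qed

end

context graded_field
begin

text \<open>A nonconstant function \<open>z\<close> whose only pole is \<open>V0\<close> takes values in \<open>K\<close> at all other rational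
  places, so the product of the \<open>z - c\<close>, \<open>c \<in> K\<close>, vanishes at all of them.\<close>

lemma rational_places_bound:
  assumes dim: "\<And>D. finite {V. vring V \<and> D V \<noteq> 0} \<Longrightarrow> card (RR D) = card K ^ l D"
    and genus: "\<And>D. finite {V. vring V \<and> D V \<noteq> 0} \<Longrightarrow>
      (\<Sum>V | vring V \<and> D V \<noteq> 0. D V * int (deg V)) - int (l D) + 1 \<le> int g"
    and S: "finite S" "\<And>V. V \<in> S \<Longrightarrow> vring V \<and> deg V = 1"
  shows "card S \<le> card K * (g + 1) + g + 1"
proof (cases "S = {}")
  case False
  then obtain V0 where V0: "V0 \<in> S" "vring V0" "deg V0 = 1" using S by blast
  have res: "residues V = card K" if "V \<in> S" for V using deg S that by simp
  define P where "P k = (\<lambda>V. if V = V0 then int k else 0)" for k :: nat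
  have suppP: "finite {V. vring V \<and> P k V \<noteq> 0}" for k by (rule finite_subset[of _ "{V0}"]) (auto simp: P_def)
  have degP: "(\<Sum>V | vring V \<and> P k V \<noteq> 0. P k V * int (deg V)) = int k" for k
  proof -
    have "(\<Sum>V | vring V \<and> P k V \<noteq> 0. P k V * int (deg V)) = (\<Sum>V\<in>{V0}. P k V * int (deg V))"
      by (rule sum.mono_neutral_left) (use V0 in \<open>auto simp: P_def\<close>)
    thus ?thesis using V0 by (simp add: P_def)
  qed
  have lP: "l (P k) \<le> k + 1" for k
  proof -
    have "card (RR (P k)) \<le> (\<Prod>V\<in>{V0}. residues V ^ nat (P k V - 0)) * card (RR (\<lambda>V. 0))"
      using RR_add_places[of "{V0}" "\<lambda>V. 0" "P k"] V0 RR_regular_finite[OF V0(2)] by (simp add: P_def)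
    also have "\<dots> = card K ^ (k + 1)"
      using res[OF V0(1)] regular_constants[OF V0(2)] by (simp add: P_def)
    finally have "card K ^ l (P k) \<le> card K ^ (k + 1)" using dim[OF suppP] by simp
    thus ?thesis using card_K by (subst (asm) power_increasing_iff) auto
  qed
  \<comment> \<open>Degree \<open>g + 1\<close> forces a second dimension, hence a function that is
    not constant.\<close>
  have "l (P (g + 1)) \<ge> 2" using genus[OF suppP, of "g + 1"] degP[of "g + 1"] by linarith
  hence "card K ^ 2 \<le> card (RR (P (g + 1)))" using dim[OF suppP] card_K by (simp add: power_increasing)
  moreover have "card K < card K ^ 2" using card_K by (simp add: power2_eq_square)
  ultimately have lt: "card K < card (RR (P (g + 1)))" by linarith
  have "\<not> RR (P (g + 1)) \<subseteq> K"
  proof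
    assume "RR (P (g + 1)) \<subseteq> K"
    from card_mono[OF finK this] lt show False by linarith
  qed
  then obtain z where z: "z \<in> RR (P (g + 1))" "z \<notin> K" by blast
  have zL: "z \<in> L" using z by (auto simp: RR_def)
  have z0: "z \<noteq> 0" using z KD by auto
  have zV: "z \<in> V" if "vring V" "V \<noteq> V0" for V
  proof -
    have "val V z \<ge> - P (g + 1) V" using z(1) z0 that(1) by (simp add: RR_def)
    thus ?thesis using that(2) val_nonneg[OF that(1) zL z0] by (simp add: P_def)
  qed
  have "\<not> (\<forall>V. vring V \<longrightarrow> z \<in> V)"
    using z(2) regular_constants[OF V0(2) res[OF V0(1)]] RR_regular zL by blast
  hence zV0: "z \<notin> V0" using zV by blast
  have zneg: "val V0 z < 0" using val_nonneg[OF V0(2) zL z0] zV0 by simp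
  have zc: "z - c \<in> L \<and> z - c \<noteq> 0" if "c \<in> K" for c using that z(2) LD(7)[OF zL] KL by auto
  define f where "f = (\<Prod>c\<in>K. z - c) * e"
  have f: "f \<in> L" "f \<noteq> 0"
    unfolding f_def using esubring_prod[OF L' _ LD(1), of K "\<lambda>c. z - c"]
      efield_prod_nz[OF L _ LD(1) efield_unit_nz[OF L], of K "\<lambda>c. z - c"] zc by simp_all
  have valf: "val V f = (\<Sum>c\<in>K. val V (z - c))" if "vring V" for V
    unfolding f_def by (rule val_prod[OF that zc])
  have val0: "val V0 f = int (card K) * val V0 z"
  proof -
    have "val V0 (z - c) = val V0 z" if c: "c \<in> K" for c
    proof -
      have "- c = 0 \<or> val V0 z < val V0 (- c)" using val_K[OF V0(2) KD(4)[OF c]] zneg by (cases "c = 0") auto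
      thus ?thesis using val_add_eq[OF V0(2) zL z0, of "- c"] LD(4) c KL by auto
    qed
    thus ?thesis using valf[OF V0(2)] by simp
  qed
  have valf_nn: "val V f \<ge> 0" if V: "vring V" "V \<noteq> V0" for V
  proof -
    have "z - c \<in> V" if "c \<in> K" for c using vring_ring(7)[OF V(1) zV[OF V]] vringD(2)[OF V(1)] that by blast
    hence "val V (z - c) \<ge> 0" if "c \<in> K" for c using val_nonneg[OF V(1)] zc[OF that] that by blast
    thus ?thesis unfolding valf[OF V(1)] by (rule sum_nonneg)
  qed
  have valf_pos: "val V f \<ge> 1" if VS: "V \<in> S" "V \<noteq> V0" for V
  proof -
    have V: "vring V" using S VS by blast
    obtain c where c: "c \<in> K" "z - c \<in> maxid V" using residue_in_K[OF V res[OF VS(1)] zV[OF V VS(2)]] by blast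
    have nn: "val V (z - c) \<ge> 0" if "c \<in> K" for c
      using val_nonneg[OF V] zc[OF that] vring_ring(7)[OF V zV[OF V VS(2)]] vringD(2)[OF V] that by blast
    have "1 \<le> val V (z - c)" using val_pos[OF V] zc[OF c(1)] c(2) by fastforce
    also have "\<dots> \<le> val V f" unfolding valf[OF V] by (rule member_le_sum) (use c nn finK in auto)
    finally show ?thesis .
  qed
  \<comment> \<open>The sum of the other places of \<open>S\<close>. Multiplication by
    \<open>f\<close> cancels these poles at the price of \<open>card K * (g + 1)\<close> poles at
    \<open>V0\<close>, which bounds \<open>l B\<close> above; the genus bounds it below in terms of
    \<open>card S\<close>.\<close>
  define B where "B = (\<lambda>V. if V \<in> S - {V0} then 1 else 0 :: int)"
  have supp_eq: "{V. vring V \<and> B V \<noteq> 0} = S - {V0}" using S by (auto simp: B_def)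
  have suppB: "finite {V. vring V \<and> B V \<noteq> 0}" using S(1) unfolding supp_eq by simp
  have degB: "(\<Sum>V | vring V \<and> B V \<noteq> 0. B V * int (deg V)) = int (card (S - {V0}))"
    unfolding supp_eq using S by (simp add: B_def)
  let ?k = "card K * (g + 1)"
  have "(\<lambda>u. u * f) ` RR B \<subseteq> RR (P ?k)"
  proof (intro image_subsetI)
    fix u assume u: "u \<in> RR B"
    show "u * f \<in> RR (P ?k)"
    proof (cases "u = 0")
      case False
      have uL: "u \<in> L" using u by (auto simp: RR_def)
      have "val V (u * f) \<ge> - P ?k V" if V: "vring V" for V
      proof -
        have m: "val V (u * f) = val V u + val V f" using val_mult[OF V uL False f] .
        have uB: "val V u \<ge> - B V" using u V False by (simp add: RR_def)
        show ?thesis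
        proof (cases "V = V0")
          case True
          have "val V0 z \<ge> - int (g + 1)" using z(1) z0 V0(2) by (auto simp: RR_def P_def)
          hence "int (card K) * val V0 z \<ge> int (card K) * (- int (g + 1))" by (rule mult_left_mono) simp
          hence "val V0 (u * f) \<ge> - int ?k" using True m uB val0 by (simp add: B_def) (simp add: algebra_simps)
          thus ?thesis using True by (simp add: P_def)
        next
          case False
          thus ?thesis using m uB valf_nn[OF V False] valf_pos[of V] by (cases "V \<in> S") (auto simp: B_def P_def)
        qed
      qed
      thus ?thesis using LD(6)[OF uL f(1)] by (simp add: RR_def)
    qed (use RR_zero in simp)
  qed
  moreover have "inj_on (\<lambda>u. u * f) (RR B)"
    using efield_cancel[OF L f(1) _ _ f(2)] by (intro inj_onI) (auto simp: RR_def mult.commute)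
  moreover have "finite (RR (P ?k))" using dim[OF suppP] card_K by (intro card_ge_0_finite) simp
  ultimately have "card (RR B) \<le> card (RR (P ?k))" by (metis card_inj_on_le)
  hence "card K ^ l B \<le> card K ^ l (P ?k)" using dim[OF suppP] dim[OF suppB] by simp
  hence "l B \<le> l (P ?k)" using card_K by (subst (asm) power_increasing_iff) auto
  hence "l B \<le> ?k + 1" using lP[of ?k] by linarith
  moreover have "int (card (S - {V0})) - int (l B) + 1 \<le> int g" using genus[OF suppB] degB by simp
  ultimately have "card (S - {V0}) \<le> ?k + g" by linarith
  moreover have "card S = Suc (card (S - {V0}))" by (rule card.remove[OF S(1) V0(1)])
  ultimately show ?thesis by linarith
qed simp

text \<open>If the elements of \<open>R\<close> are, to every order, polynomials in \<open>s - a\<close> at the places above the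
  points \<open>a \<in> A\<close>, then \<open>R\<close> has room for the many elements of \<open>W m\<close> only if all these points
  split completely.\<close>

lemma splitting_count:
  fixes R :: "'a set" and W :: "nat \<Rightarrow> 'a set"
  assumes A: "A \<subseteq> K" "0 \<notin> A"
    and loc: "\<And>V a j y. vring V \<Longrightarrow> a \<in> A \<Longrightarrow> s - a \<in> maxid V \<Longrightarrow> y \<in> R \<Longrightarrow>
      \<exists>p\<in>polys_below K (s - a) j. \<exists>v\<in>V. y - p = (s - a) ^ j * v"
    and W: "\<And>m. W m \<subseteq> R" "\<And>m. W m \<subseteq> L" "\<And>m. card K ^ (length ws * m) \<le> card (W m)"
      "\<And>m x y. x \<in> W m \<Longrightarrow> y \<in> W m \<Longrightarrow> x - y \<in> W m"
      "\<And>m x V. x \<in> W m \<Longrightarrow> vring V \<Longrightarrow> s \<in> V \<Longrightarrow> x * s \<in> V"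
      "\<And>m x V. x \<in> W m \<Longrightarrow> vring V \<Longrightarrow> s \<notin> V \<Longrightarrow> x = 0 \<or> val V x \<ge> int (m + 1) * val V s"
    and V1: "vring V1" "s \<notin> V1"
  shows "\<exists>S. finite S \<and> card S = length ws * card A \<and> (\<forall>V\<in>S. vring V \<and> deg V = 1)"
proof (cases "A = {}")
  case False
  have finA: "finite A" using A finK finite_subset by blast
  define d where "d = card A"
  have d: "d > 0" using finA False by (simp add: d_def card_gt_0_iff)
  have s0: "s \<noteq> 0" using V1 vring_ring(8) by auto
  have sa: "s - a \<in> L \<and> s - a \<noteq> 0" if "a \<in> A" for a
    using that A KL LD(7)[OF s] vringD(2)[OF V1(1)] V1(2) by auto
  define x where "x = (\<Prod>a\<in>A. s - a) * e"
  have x: "x \<in> L" "x \<noteq> 0"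
    unfolding x_def using esubring_prod[OF L' _ LD(1), of A "\<lambda>a. s - a"]
      efield_prod_nz[OF L _ LD(1) efield_unit_nz[OF L], of A "\<lambda>a. s - a"] sa by simp_all
  have valx: "val V x = (\<Sum>a\<in>A. val V (s - a))" if "vring V" for V
    unfolding x_def by (rule val_prod[OF that sa])
  have "(\<Prod>a\<in>B. s - a) * e \<in> polys_below K s (Suc (card B))" if "B \<subseteq> A" for B
    using finite_subset[OF that finA] that
  proof (induction B)
    case empty
    show ?case using polys_below_const[OF K' KD(1)] by simp
  next
    case (insert a B)
    have "e \<in> polys_below K s (Suc 0)" using polys_below_const[OF K' KD(1)] .
    hence "- a + s * e \<in> polys_below K s (Suc (Suc 0))"
      by (rule polys_below_SucI[rotated]) (use insert A KD in auto)
    hence "s - a \<in> polys_below K s (Suc 1)" using LD(3)[OF s] by simp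
    from polys_below_mult[OF K' insert.IH this] show ?case using insert by (simp add: mult_ac)
  qed
  hence xP: "x \<in> polys_below K s (Suc d)" by (simp add: x_def d_def)
  have val_inf: "val V x = int d * val V s" "val V s < 0" if V: "vring V" "s \<notin> V" for V
  proof -
    show vs: "val V s < 0" using val_nonneg[OF V(1) s s0] V by simp
    have "val V (s - a) = val V s" if a: "a \<in> A" for a
    proof -
      have "- a \<in> K" using a A KD(4) by blast
      hence "- a = 0 \<or> val V s < val V (- a)" using val_K[OF V(1), of "- a"] vs by (cases "- a = 0") auto
      thus ?thesis using val_add_eq[OF V(1) s s0, of "- a"] \<open>- a \<in> K\<close> KL by auto
    qed
    thus "val V x = int d * val V s" using valx[OF V(1)] by (simp add: d_def)
  qed
  have nn: "val V (s - a) \<ge> 0" if "vring V" "s \<in> V" "a \<in> A" for V a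
    using val_nonneg[OF that(1)] sa[OF that(3)] vring_ring(7)[OF that(1,2)] vringD(2)[OF that(1)] A that(3) by blast
  define S where "S = {V. vring V \<and> x \<in> maxid V}"
  have S: "finite S" using zeros_finite[OF xP x(2)] by (simp add: S_def)
  have xs: "val V x \<ge> 1 \<and> s \<in> V" if "V \<in> S" for V
  proof -
    have V: "vring V" and vx: "val V x \<ge> 1" using that val_pos[OF _ x] by (force simp: S_def)+
    moreover have "s \<in> V"
    proof (rule ccontr)
      assume "s \<notin> V"
      from val_inf[OF V this] vx show False using mult_nonneg_nonpos[of "int d" "val V s"] by simp
    qed
    ultimately show ?thesis by blast
  qed
  have "\<exists>a\<in>A. s - a \<in> maxid V \<and> val V x = val V (s - a)" if VS: "V \<in> S" for V
  proof -
    have V: "vring V" using VS by (simp add: S_def)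
    have "\<exists>a\<in>A. val V (s - a) \<noteq> 0"
    proof (rule ccontr)
      assume "\<not> ?thesis"
      thus False using xs[OF VS] valx[OF V] by simp
    qed
    then obtain a where a: "a \<in> A" "val V (s - a) > 0" using nn[OF V] xs[OF VS] by force
    have am: "s - a \<in> maxid V" using val_pos[OF V] sa[OF a(1)] a(2) by blast
    have "val V (s - b) = 0" if b: "b \<in> A - {a}" for b
    proof -
      have "a - b \<in> K" by (rule KD(7)) (use a b A in auto)
      hence "a - b \<in> units V" using K_units[OF V, of "a - b"] b by auto
      from units_add_maxid[OF V this am] have "s - b \<in> units V" by simp
      thus ?thesis by (rule val_units[OF V])
    qed
    hence "val V x = val V (s - a)" using valx[OF V] sum.remove[OF finA a(1), of "\<lambda>a. val V (s - a)"] by simp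
    thus ?thesis using a am by blast
  qed
  then obtain c where c: "\<And>V. V \<in> S \<Longrightarrow> c V \<in> A \<and> s - c V \<in> maxid V \<and> val V x = val V (s - c V)" by metis
  \<comment> \<open>An element of \<open>W m\<close> is determined by its first \<open>j\<close>
    coefficients at the places of \<open>S\<close>, as soon as \<open>j * d\<close> zeros outweigh
    the \<open>m + 2\<close> poles allowed at infinity by \<open>u * s\<close>.\<close>
  have count: "length ws * m \<le> j * card S" if m: "m + 2 < j * d" for m j
  proof -
    define p where "p y V = (SOME p. p \<in> polys_below K (s - c V) j \<and> (\<exists>v\<in>V. y - p = (s - c V) ^ j * v))" for y V
    have p: "p y V \<in> polys_below K (s - c V) j" "\<exists>v\<in>V. y - p y V = (s - c V) ^ j * v" if V: "V \<in> S" and y: "y \<in> W m" for V y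
    proof -
      have "\<exists>p\<in>polys_below K (s - c V) j. \<exists>v\<in>V. y - p = (s - c V) ^ j * v"
        by (rule loc) (use c[OF V] V y W(1) in \<open>auto simp: S_def\<close>)
      hence "\<exists>p. p \<in> polys_below K (s - c V) j \<and> (\<exists>v\<in>V. y - p = (s - c V) ^ j * v)" by blast
      from someI_ex[OF this] show "p y V \<in> polys_below K (s - c V) j" "\<exists>v\<in>V. y - p y V = (s - c V) ^ j * v"
        unfolding p_def by blast+
    qed
    define F where "F y = restrict (p y) S" for y
    let ?T = "PiE S (\<lambda>V. polys_below K (s - c V) j)"
    have "inj_on F (W m)"
    proof (rule inj_onI, rule ccontr)
      fix y z assume y: "y \<in> W m" and z: "z \<in> W m" and eq: "F y = F z" and "y \<noteq> z"
      define u where "u = y - z"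
      have u: "u \<in> W m" "u \<noteq> 0" using W(4)[OF y z] \<open>y \<noteq> z\<close> by (auto simp: u_def)
      have uL: "u \<in> L" using W(2) u by blast
      note u = u uL
      have us: "u * s \<in> L" "u * s \<noteq> 0" using LD(6)[OF u(3) s] efield_mult_nz[OF L u(3) s u(2) s0] by auto
      note ix = efield_iv[OF L x]
      \<comment> \<open>For a difference \<open>u\<close> whose expansions all vanish, this quotient
        has no poles and is zero at the poles of \<open>s\<close>, hence is zero.\<close>
      define Y where "Y = iv e x ^ j * (u * s)"
      have Y: "Y \<in> L" "Y \<noteq> 0"
        unfolding Y_def using esubring_power_mult[OF L' ix(1) us(1)] efield_power_mult_nz[OF L ix(1,4) us] by auto
      have valY: "val V Y = val V u + val V s - int j * val V x" if "vring V" for V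
        unfolding Y_def using val_power[OF that ix(1,4) us] val_iv[OF that x] val_mult[OF that u(3,2) s s0] by simp
      have inf: "val V Y > 0" if V: "vring V" "s \<notin> V" for V
      proof -
        have "val V u \<ge> int (m + 1) * val V s" using W(6)[OF u(1) V] u(2) by blast
        hence "val V Y \<ge> int (m + 1) * val V s + val V s - int j * (int d * val V s)"
          using valY[OF V(1)] val_inf[OF V] by simp
        also have "int (m + 1) * val V s + val V s - int j * (int d * val V s) = (int (j * d) - int (m + 2)) * (- val V s)"
          by (simp add: algebra_simps)
        finally show ?thesis using m val_inf(2)[OF V] mult_pos_pos[of "int (j * d) - int (m + 2)" "- val V s"] by linarith
      qed
      have "Y \<in> V" if V: "vring V" for V
      proof (cases "s \<in> V")
        case False
        thus ?thesis using inf[OF V] val_nonneg[OF V Y] by simp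
      next
        case True
        have "val V Y \<ge> 0"
        proof (cases "V \<in> S")
          case True
          obtain v w where v: "v \<in> V" "y - p y V = (s - c V) ^ j * v" "w \<in> V" "z - p z V = (s - c V) ^ j * w"
            using p(2)[OF True] y z by blast
          have "p y V = p z V" using eq True unfolding F_def by (metis restrict_apply')
          hence "u = (s - c V) ^ j * (v - w)" using v by (simp add: u_def right_diff_distrib[symmetric] algebra_simps)
          moreover from this have "v - w \<noteq> 0" using u by auto
          moreover have "v - w \<in> V" using vring_ring(7)[OF V v(1,3)] .
          ultimately have "val V u \<ge> int j * val V x"
            using val_power[OF V, of "s - c V" "v - w" j] sa c[OF True] val_nonneg[OF V, of "v - w"] vring_sub[OF V]
            by auto
          moreover have "val V s \<ge> 0" using val_nonneg[OF V s s0] \<open>s \<in> V\<close> by simp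
          ultimately show ?thesis using valY[OF V] by simp
        next
          case False
          hence "val V x \<le> 0" using val_pos[OF V x] V by (force simp: S_def)
          moreover have "val V x \<ge> 0" unfolding valx[OF V] by (rule sum_nonneg[OF nn[OF V True]])
          moreover have "val V (u * s) \<ge> 0" using val_nonneg[OF V us] W(5)[OF u(1) V True] by simp
          ultimately show ?thesis using valY[OF V] val_mult[OF V u(3,2) s s0] by simp
        qed
        thus ?thesis using val_nonneg[OF V Y] by simp
      qed
      moreover have "Y \<in> maxid V1" using inf[OF V1] val_pos[OF V1(1) Y] by simp
      ultimately show False using regular_in_maxid[OF Y(1) _ V1(1)] Y(2) by blast
    qed
    moreover have "F ` W m \<subseteq> ?T" using p(1) by (auto simp: F_def)
    moreover have "finite ?T" using S polys_below_finite[OF K' finK] by (intro finite_PiE) auto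
    ultimately have "card (W m) \<le> card ?T" by (metis card_inj_on_le)
    also have "\<dots> = (\<Prod>V\<in>S. card (polys_below K (s - c V) j))" using S by (rule card_PiE)
    also have "\<dots> \<le> (\<Prod>V\<in>S. card K ^ j)" using polys_below_finite[OF K' finK] by (intro prod_mono) auto
    finally have "card K ^ (length ws * m) \<le> card K ^ (j * card S)"
      using W(3)[of m] by (simp add: power_mult)
    thus ?thesis using card_K by (subst (asm) power_increasing_iff) auto
  qed
  have ge: "length ws * d \<le> card S"
  proof (rule ccontr)
    assume "\<not> ?thesis"
    hence n: "length ws * d \<ge> card S + 1" by simp
    define n where "n = length ws"
    \<comment> \<open>For m = j d - 3 the count loses 3 n; one missing place would cost
      \<open>j\<close>, so \<open>j\<close> is taken larger than 3 n.\<close>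
    define j where "j = 3 * n + 3"
    have jd: "j * d \<ge> 3" using d mult_le_mono[of 3 j 1 d] by (simp add: j_def)
    have "n * (j * d - 3) \<le> j * card S" unfolding n_def by (rule count) (use jd in simp)
    moreover have "n * (j * d - 3) = j * (n * d) - 3 * n" by (simp add: diff_mult_distrib2 mult_ac)
    moreover have "j * (n * d) \<ge> j * (card S + 1)" using n by (intro mult_le_mono2) (simp add: n_def)
    ultimately show False by (simp add: j_def)
  qed
  have deg_sum: "(\<Sum>V\<in>S. val V x * int (deg V)) \<le> int (d * length ws)"
    by (rule degree_bound[OF S _ xP x(2)]) (auto simp: S_def subsetD[OF maxid_sub])
  have ge1: "val V x * int (deg V) \<ge> 1" if "V \<in> S" for V
    using xs[OF that] deg_pos[of V] that mult_mono[of 1 "val V x" 1 "int (deg V)"] by (simp add: S_def)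
  have "int (card S) \<le> (\<Sum>V\<in>S. val V x * int (deg V))" using sum_mono[of S "\<lambda>V. 1", OF ge1] by simp
  \<comment> \<open>At least \<open>length ws * d\<close> places, each contributing at least one,
    share a total of at most \<open>d * length ws\<close>; so each contributes exactly one.\<close>
  hence cS: "card S = length ws * d" and z: "(\<Sum>V\<in>S. val V x * int (deg V) - 1) = 0"
  proof -
    have "int (length ws * d) \<le> int (card S)" using ge by (simp only: of_nat_le_iff)
    moreover have "int (d * length ws) = int (length ws * d)" by (simp add: mult.commute)
    moreover note deg_sum \<open>int (card S) \<le> (\<Sum>V\<in>S. val V x * int (deg V))\<close>
    ultimately have "int (card S) = int (length ws * d)" "(\<Sum>V\<in>S. val V x * int (deg V)) = int (card S)" by linarith+
    thus "card S = length ws * d" "(\<Sum>V\<in>S. val V x * int (deg V) - 1) = 0"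
      by (simp_all only: of_nat_eq_iff sum_subtractf) simp
  qed
  have "deg V = 1" if "V \<in> S" for V
  proof -
    have "0 \<le> val V x * int (deg V) - 1" if "V \<in> S" for V using ge1[OF that] by linarith
    hence "val V x * int (deg V) - 1 = 0"
      using z that sum_nonneg_eq_0_iff[OF S, of "\<lambda>V. val V x * int (deg V) - 1"] by simp
    thus ?thesis using pos_zmult_eq_1_iff[of "val V x" "int (deg V)"] xs[OF that] by simp
  qed
  thus ?thesis using cS S by (intro exI[of _ S]) (auto simp: S_def d_def)
qed auto

end

section \<open>Models of function fields\<close>

lemma (in ring) card_Span:
  assumes K: "subfield K R" "finite K"
  shows "independent K Us \<Longrightarrow> finite (Span K Us) \<and> card (Span K Us) = card K ^ length Us"
proof (induction Us)
  case (Cons u Us)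
  have u: "u \<in> carrier R" "u \<notin> Span K Us" "independent K Us" using independent_backwards[OF Cons.prems] by auto
  have KR: "K \<subseteq> carrier R" using subfieldE(3)[OF K(1)] .
  note dim = dimension_independent[OF u(3)]
  note W = space_subgroup_props[OF K(1) dim]
  let ?h = "\<lambda>(k, v). k \<otimes> u \<oplus> v"
  have eq: "Span K (u # Us) = ?h ` (K \<times> Span K Us)" by (force simp: line_extension_mem_iff)
  have "inj_on ?h (K \<times> Span K Us)"
  proof (rule inj_onI, clarify)
    fix k v k' v' assume k: "k \<in> K" "k' \<in> K" and v: "v \<in> Span K Us" "v' \<in> Span K Us"
      and eq: "k \<otimes> u \<oplus> v = k' \<otimes> u \<oplus> v'"
    have c: "k \<in> carrier R" "k' \<in> carrier R" "v \<in> carrier R" "v' \<in> carrier R" using k v KR W(1) by auto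
    have "(k \<ominus> k') \<otimes> u = (k \<otimes> u \<oplus> v) \<ominus> (k' \<otimes> u \<oplus> v)" using c u(1) by algebra
    also have "\<dots> = v' \<ominus> v" unfolding eq using c u(1) by algebra
    finally have kk: "(k \<ominus> k') \<otimes> u \<in> Span K Us" using W(3,4) v by (simp add: minus_eq)
    have "k \<ominus> k' \<in> K" using subringE(5,7)[OF subfieldE(1)[OF K(1)]] k by (simp add: minus_eq)
    hence "k \<ominus> k' = \<zero>" using W(6)[of "k \<ominus> k'" u] kk u by blast
    hence "k = k'" using c by simp
    moreover from this have "v = v'" using eq c u(1) by simp
    ultimately show "k = k' \<and> v = v'" by blast
  qed
  thus ?case unfolding eq using Cons.IH[OF u(3)] K(2) by (simp add: card_image card_cartesian_product)
qed simp

text \<open>Links dimensions with cardinalities. In a finite space the lengths of independent lists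
  are bounded, and a list of maximal length spans.\<close>

lemma (in ring) finite_space_dimension:
  assumes K: "subfield K R" "finite K" and E: "subalgebra K E R" "finite E"
  shows "finite_dimension K E \<and> card E = card K ^ dim K E"
proof -
  define P where "P n \<longleftrightarrow> (\<exists>Us. independent K Us \<and> set Us \<subseteq> E \<and> length Us = n)" for n
  have "n \<le> card E" if "P n" for n
    using that independent_distinct[OF K(1)] E(2) card_mono[of E] distinct_card unfolding P_def by metis
  moreover have "P 0" by (auto simp: P_def)
  ultimately obtain n where n: "P n" "\<And>m. P m \<Longrightarrow> m \<le> n"
    using GreatestI_nat[of P 0 "card E"] Greatest_le_nat[of P _ "card E"] by blast
  then obtain Us where Us: "independent K Us" "set Us \<subseteq> E" "length Us = n" by (auto simp: P_def)
  have "u \<in> Span K Us" if u: "u \<in> E" for u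
  proof (rule ccontr)
    assume "u \<notin> Span K Us"
    hence "independent K (u # Us)" using Us u subalgebra_in_carrier[OF E(1)] by (auto intro: li_Cons)
    hence "P (Suc n)" unfolding P_def using Us u by (intro exI[of _ "u # Us"]) simp
    thus False using n(2)[of "Suc n"] by simp
  qed
  hence E_eq: "Span K Us = E" using subalgebra_Span_incl[OF K(1) E(1) Us(2)] by auto
  have "dimension (length Us) K E" using dimension_independent[OF Us(1)] E_eq by simp
  moreover from dimI[OF K(1) this] have "dim K E = length Us" by (simp add: over_def)
  ultimately show ?thesis using card_Span[OF K Us(1)] E_eq finite_dimensionI by simp
qed

text \<open>The map \<open>f\<close> identifies the record \<open>R\<close>, for which places and
  genus are defined, with the concrete field \<open>L\<close>, where the arithmetic takes
  place.\<close>

locale field_model = spanned_field e L K s ws + R: field R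
  for e :: "'a::comm_ring_1" and L K s ws and R :: "('b, 'c) ring_scheme" (structure) +
  fixes f :: "'b \<Rightarrow> 'a"
  assumes bij: "bij_betw f (carrier R) L"
    and f_add: "x \<in> carrier R \<Longrightarrow> y \<in> carrier R \<Longrightarrow> f (x \<oplus> y) = f x + f y"
    and f_mult: "x \<in> carrier R \<Longrightarrow> y \<in> carrier R \<Longrightarrow> f (x \<otimes> y) = f x * f y"
    and f_one: "f \<one> = e"
begin

definition g :: "'a \<Rightarrow> 'b" where
  "g = inv_into (carrier R) f"

definition pull :: "'a set \<Rightarrow> 'b set" where
  "pull S = {x \<in> carrier R. f x \<in> S}"

lemma f_L: "x \<in> carrier R \<Longrightarrow> f x \<in> L"
  using bij by (auto simp: bij_betw_def)

lemma f_inj: "x \<in> carrier R \<Longrightarrow> y \<in> carrier R \<Longrightarrow> f x = f y \<longleftrightarrow> x = y"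
  using bij by (auto simp: bij_betw_def inj_on_def)

lemma g: "z \<in> L \<Longrightarrow> g z \<in> carrier R" "z \<in> L \<Longrightarrow> f (g z) = z"
  using bij inv_into_into[of z f "carrier R"] f_inv_into_f[of z f "carrier R"] by (auto simp: g_def bij_betw_def)

lemma g_f: "x \<in> carrier R \<Longrightarrow> g (f x) = x"
  using f_inj g f_L by blast

lemma f_zero: "f \<zero> = 0"
  using f_add[of \<zero> \<zero>] by simp

lemma f_eq_zero: "x \<in> carrier R \<Longrightarrow> f x = 0 \<longleftrightarrow> x = \<zero>"
  using f_inj[of x \<zero>] f_zero by simp

lemma f_uminus: "x \<in> carrier R \<Longrightarrow> f (\<ominus> x) = - f x"
  using f_add[of x "\<ominus> x"] f_zero R.r_neg[of x] by (simp add: eq_neg_iff_add_eq_0 add.commute)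

lemma f_minus: "x \<in> carrier R \<Longrightarrow> y \<in> carrier R \<Longrightarrow> f (x \<ominus> y) = f x - f y"
  by (simp add: R.minus_eq f_add f_uminus)

lemma f_inv:
  assumes "x \<in> carrier R" "x \<noteq> \<zero>"
  shows "f (inv x) = iv e (f x)" "inv x \<in> carrier R" "inv x \<noteq> \<zero>"
proof -
  have x: "x \<in> Units R" using assms R.field_Units by simp
  thus ic: "inv x \<in> carrier R" by simp
  show "inv x \<noteq> \<zero>" using R.Units_r_inv[OF x] assms by (auto simp: R.r_null)
  have "f x * f (inv x) = e" using f_mult[OF assms(1) ic] R.Units_r_inv[OF x] f_one by simp
  thus "f (inv x) = iv e (f x)"
    using iv_eqI[of "f x" "f (inv x)" e] LD(2) f_L[OF ic] f_eq_zero assms by simp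
qed

lemma f_nat_pow: "x \<in> carrier R \<Longrightarrow> f (x [^] (k::nat)) = f x ^ k * e"
  by (induction k) (simp_all add: f_one f_mult mult_ac)

lemma pull_mem: "x \<in> pull S \<longleftrightarrow> x \<in> carrier R \<and> f x \<in> S"
  by (simp add: pull_def)

lemma f_pull: "S \<subseteq> L \<Longrightarrow> f ` pull S = S"
  using g unfolding pull_def image_def by force

lemma pull_image: "T \<subseteq> carrier R \<Longrightarrow> pull (f ` T) = T"
  unfolding pull_def using f_inj by (auto dest: subsetD)

lemma pull_inj: "S \<subseteq> L \<Longrightarrow> S' \<subseteq> L \<Longrightarrow> pull S = pull S' \<longleftrightarrow> S = S'"
  using f_pull by metis

lemma card_pull: "S \<subseteq> L \<Longrightarrow> card (pull S) = card S"
  using f_pull[of S] card_image[of f "pull S"] bij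
  by (metis (no_types, lifting) bij_betw_def inj_on_subset mem_Collect_eq pull_def subsetI)

lemma finite_pull: "S \<subseteq> L \<Longrightarrow> finite (pull S) \<longleftrightarrow> finite S"
  using f_pull[of S] finite_image_iff[of f "pull S"] bij
  by (metis (no_types, lifting) bij_betw_def inj_on_subset mem_Collect_eq pull_def subsetI)

lemma pull_subring: "esubring e S \<Longrightarrow> subring (pull S) R"
  by (rule R.subringI) (auto simp: pull_mem f_one f_uminus f_add f_mult intro: esubringD)

lemma pull_subfield: "efield e S \<Longrightarrow> subfield (pull S) R"
  by (rule R.subfieldI'[OF pull_subring[OF efield_esubring]])
    (use f_inv efield_iv_closed[of e S] in \<open>auto simp: pull_mem\<close>)

lemma image_esubring:
  assumes "subring V R"
  shows "esubring e (f ` V)"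
proof -
  note V = subringE[OF assms]
  show ?thesis unfolding esubring_def
  proof (intro conjI ballI)
    show "e \<in> f ` V" using V f_one by (metis image_eqI)
    fix z assume "z \<in> f ` V"
    then obtain x where x: "x \<in> V" "z = f x" by blast
    show "e * z = z" using LD(2) f_L x V by blast
    show "- z \<in> f ` V" using f_uminus x V by (metis image_eqI subsetD)
    fix w assume "w \<in> f ` V"
    then obtain y where y: "y \<in> V" "w = f y" by blast
    show "z + w \<in> f ` V" using f_add[of x y] x y V by (metis image_eqI subsetD)
    show "z * w \<in> f ` V" using f_mult[of x y] x y V by (metis image_eqI subsetD)
  qed
qed

abbreviation "K0 \<equiv> pull K"

lemmas K0_subfield = pull_subfield[OF K]

lemma K0_finite: "finite K0" "card K0 = card K"
  using finite_pull[OF KL] card_pull[OF KL] finK by auto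

section \<open>Places\<close>

lemma valuation_ring_pull:
  assumes V: "vring V"
  shows "R.valuation_ring K0 (pull V)"
  unfolding R.valuation_ring_def
proof (intro conjI ballI)
  show "subring (pull V) R" by (rule pull_subring[OF vringD(1)[OF V]])
  show "pull V \<subset> carrier R"
    using vringD(3,4)[OF V] pull_inj[of V L] f_L by (auto simp: pull_def)
  have "K \<noteq> V"
  proof
    assume KV: "K = V"
    obtain z where z: "z \<in> L" "z \<notin> V" using vringD(3,4)[OF V] by blast
    hence "iv e (iv e z) \<in> K" using vringD(5)[OF V z] efield_iv_closed[OF K] KV by blast
    thus False using iv_iv[OF L z(1)] z KV by simp
  qed
  thus "K0 \<subset> pull V" using vringD(2,3)[OF V] KL pull_inj[of K V] by (auto simp: pull_def)
  fix z assume "z \<in> carrier R - {\<zero>}"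
  thus "z \<in> pull V \<or> inv z \<in> pull V" using vringD(5)[OF V, of "f z"] f_inv[of z] f_L[of z] by (auto simp: pull_mem)
qed

lemma vring_image:
  assumes V: "R.valuation_ring K0 V"
  shows "vring (f ` V)" "pull (f ` V) = V"
proof -
  have V': "subring V R" "K0 \<subset> V" "V \<subset> carrier R" "\<And>z. z \<in> carrier R \<Longrightarrow> z \<noteq> \<zero> \<Longrightarrow> z \<in> V \<or> inv z \<in> V"
    using V by (auto simp: R.valuation_ring_def)
  show p: "pull (f ` V) = V" by (rule pull_image) (use V' in auto)
  have "K \<subseteq> f ` V" using f_pull[OF KL] V'(2) by blast
  moreover have "f ` V \<subseteq> L" using V' f_L by blast
  moreover have "f ` V \<noteq> L" using p V'(3) f_L by (auto simp: pull_def)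
  moreover have "z \<in> f ` V \<or> iv e z \<in> f ` V" if "z \<in> L" "z \<noteq> 0" for z
  proof -
    have "g z \<in> carrier R" "g z \<noteq> \<zero>" using that g f_zero by (auto simp: f_eq_zero[symmetric])
    thus ?thesis using V'(4)[of "g z"] f_inv(1)[of "g z"] g(2)[OF that(1)] by (metis image_eqI)
  qed
  ultimately show "vring (f ` V)" using image_esubring[OF V'(1)] by (auto simp: vring_def)
qed

lemma sub_uminus: "subring V R \<Longrightarrow> x \<in> V \<Longrightarrow> \<ominus>\<^bsub>R\<lparr>carrier := V\<rparr>\<^esub> x = \<ominus> x"
  using abelian_group.minus_equality[OF ring.is_abelian_group[OF R.subring_is_ring], of V "\<ominus> x" x]
    subringE[of V R] R.l_neg[of x] by (auto dest: subsetD)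

lemma maxid_ideal:
  assumes V: "vring V"
  shows "ideal (pull (maxid V)) (R\<lparr>carrier := pull V\<rparr>)"
proof -
  let ?A = "R\<lparr>carrier := pull V\<rparr>"
  note sub = pull_subring[OF vringD(1)[OF V]]
  interpret A: ring ?A by (rule R.subring_is_ring[OF sub])
  show ?thesis
  proof (rule idealI[OF A.ring_axioms])
    show "subgroup (pull (maxid V)) (add_monoid ?A)"
    proof (rule A.add.subgroupI)
      show "pull (maxid V) \<subseteq> carrier ?A" using subsetD[OF maxid_sub] by (auto simp: pull_mem)
      have "\<zero> \<in> pull (maxid V)" using maxid_zero[OF V] f_zero by (simp add: pull_mem)
      thus "pull (maxid V) \<noteq> {}" by blast
      show "\<ominus>\<^bsub>?A\<^esub> a \<in> pull (maxid V)" if "a \<in> pull (maxid V)" for a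
        using that sub_uminus[OF sub, of a] maxid_uminus[OF V] f_uminus subsetD[OF maxid_sub] by (auto simp: pull_mem)
      show "a \<oplus>\<^bsub>?A\<^esub> b \<in> pull (maxid V)" if "a \<in> pull (maxid V)" "b \<in> pull (maxid V)" for a b
        using that maxid_add[OF V] f_add by (auto simp: pull_mem)
    qed
    fix a x assume "a \<in> pull (maxid V)" "x \<in> carrier ?A"
    thus "x \<otimes>\<^bsub>?A\<^esub> a \<in> pull (maxid V)" "a \<otimes>\<^bsub>?A\<^esub> x \<in> pull (maxid V)"
      using maxid_mult[OF V, of "f a" "f x"] f_mult by (auto simp: pull_mem mult.commute)
  qed
qed

lemma ideal_sub_maxid:
  assumes V: "vring V" and I: "ideal I (R\<lparr>carrier := pull V\<rparr>)" "I \<noteq> pull V"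
  shows "I \<subseteq> pull (maxid V)"
proof
  interpret I: ideal I "R\<lparr>carrier := pull V\<rparr>" by (rule I)
  fix x assume x: "x \<in> I"
  hence xV: "x \<in> carrier R" "f x \<in> V" using I.a_subset by (auto simp: pull_mem)
  show "x \<in> pull (maxid V)"
  proof (rule ccontr)
    assume "x \<notin> pull (maxid V)"
    hence u: "f x \<in> units V" using xV by (auto simp: pull_mem maxid_def)
    have x0: "x \<noteq> \<zero>" using unitsD(3)[OF V u] f_zero by auto
    have "inv x \<in> pull V" using f_inv[OF xV(1) x0] unitsD(4)[OF V u] by (simp add: pull_mem)
    hence "inv x \<otimes> x \<in> I" using I.I_l_closed[OF x] by simp
    hence "\<one> \<in> I" using xV x0 R.field_Units by (simp add: R.Units_l_inv)
    thus False using I.one_imp_carrier I(2) by simp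
  qed
qed

lemma maxid_maximal:
  assumes V: "vring V"
  shows "maximalideal (pull (maxid V)) (R\<lparr>carrier := pull V\<rparr>)"
proof (rule maximalidealI[OF maxid_ideal[OF V]])
  have "\<one> \<in> pull V" "\<one> \<notin> pull (maxid V)"
    using vring_ring(1)[OF V] unit_notin_maxid[OF V] f_one by (auto simp: pull_mem)
  thus "carrier (R\<lparr>carrier := pull V\<rparr>) \<noteq> pull (maxid V)" by auto
  fix J assume "ideal J (R\<lparr>carrier := pull V\<rparr>)" "pull (maxid V) \<subseteq> J"
  thus "J = pull (maxid V) \<or> J = carrier (R\<lparr>carrier := pull V\<rparr>)" using ideal_sub_maxid[OF V, of J] by auto
qed

lemma places_eq: "R.places K0 = (\<lambda>V. pull (maxid V)) ` {V. vring V}"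
proof (intro equalityI subsetI)
  fix P assume "P \<in> (\<lambda>V. pull (maxid V)) ` {V. vring V}"
  thus "P \<in> R.places K0" using valuation_ring_pull maxid_maximal by (auto simp: R.places_def)
next
  fix P assume "P \<in> R.places K0"
  then obtain V' where V': "R.valuation_ring K0 V'" "maximalideal P (R\<lparr>carrier := V'\<rparr>)" by (auto simp: R.places_def)
  define V where "V = f ` V'"
  have V: "vring V" "pull V = V'" using vring_image[OF V'(1)] by (auto simp: V_def)
  interpret P: maximalideal P "R\<lparr>carrier := V'\<rparr>" by (rule V')
  have "P \<subseteq> pull (maxid V)" using ideal_sub_maxid[OF V(1), of P] P.is_ideal P.I_notcarr V(2) by auto
  moreover have "pull (maxid V) \<subseteq> V'" using subsetD[OF maxid_sub] unfolding V(2)[symmetric] by (auto simp: pull_mem)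
  moreover have "\<one> \<in> V'" "\<one> \<notin> pull (maxid V)"
    using vring_ring(1)[OF V(1)] unit_notin_maxid[OF V(1)] f_one V(2) by (auto simp: pull_mem)
  ultimately have "pull (maxid V) = P"
    using P.I_maximal[of "pull (maxid V)"] maxid_ideal[OF V(1)] V(2) by auto
  thus "P \<in> (\<lambda>V. pull (maxid V)) ` {V. vring V}" using V(1) by blast
qed

lemma ring_of_place:
  assumes V: "vring V"
  shows "R.ring_of_place (pull (maxid V)) = R\<lparr>carrier := pull V\<rparr>"
proof -
  have "{z \<in> carrier R. z = \<zero> \<or> inv z \<notin> pull (maxid V)} = pull V"
  proof (intro equalityI subsetI)
    fix z assume z: "z \<in> {z \<in> carrier R. z = \<zero> \<or> inv z \<notin> pull (maxid V)}"
    show "z \<in> pull V"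
    proof (cases "z = \<zero>")
      case False
      thus ?thesis using z f_inv[of z] iv_in_maxid[OF V, of "f z"] f_L[of z] by (auto simp: pull_mem)
    qed (use f_zero vring_ring(8)[OF V] z in \<open>auto simp: pull_mem\<close>)
  next
    fix z assume z: "z \<in> pull V"
    have "inv z \<notin> pull (maxid V)" if "z \<noteq> \<zero>"
    proof
      assume "inv z \<in> pull (maxid V)"
      hence "iv e (f z) * f z \<in> maxid V" using f_inv[of z] that z maxid_mult[OF V] by (auto simp: pull_mem)
      moreover have "iv e (f z) * f z = e" using efield_iv(3)[OF L f_L, of z] f_eq_zero[of z] that z by (auto simp: pull_mem)
      ultimately show False using unit_notin_maxid[OF V] by simp
    qed
    thus "z \<in> {z \<in> carrier R. z = \<zero> \<or> inv z \<notin> pull (maxid V)}" using z by (auto simp: pull_mem)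
  qed
  thus ?thesis by (simp add: R.ring_of_place_def)
qed

lemma pull_maxid_inj:
  assumes "vring V" "vring V'" "pull (maxid V) = pull (maxid V')"
  shows "V = V'"
proof -
  have "R\<lparr>carrier := pull V\<rparr> = R\<lparr>carrier := pull V'\<rparr>"
    using ring_of_place[OF assms(1)] ring_of_place[OF assms(2)] assms(3) by simp
  hence "carrier (R\<lparr>carrier := pull V\<rparr>) = carrier (R\<lparr>carrier := pull V'\<rparr>)" by (rule arg_cong)
  hence "pull V = pull V'" by simp
  thus ?thesis using pull_inj vringD(3) assms by blast
qed

text \<open>A transversal of \<open>V\<close> corresponds bijectively to the residue class field, a
  finite vector space over the image of \<open>K\<close>.\<close>

lemma place_degree:
  assumes V: "vring V"
  shows "residues V = card K ^ R.place_degree K0 (pull (maxid V))"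
proof -
  let ?A = "R\<lparr>carrier := pull V\<rparr>" and ?P = "pull (maxid V)"
  let ?B = "?A Quot ?P" and ?h = "\<lambda>a. ?P +>\<^bsub>?A\<^esub> a"
  note sub = pull_subring[OF vringD(1)[OF V]]
  interpret A: domain ?A by (rule R.subring_is_domain[OF sub])
  interpret P: maximalideal ?P ?A by (rule maxid_maximal[OF V])
  interpret B: field ?B by (rule P.quotient_is_field[OF A.is_cring])
  interpret h: ring_hom_ring ?A ?B ?h by (rule P.rcos_ring_hom_ring)
  have KV: "K0 \<subseteq> pull V" using vringD(2)[OF V] by (auto simp: pull_mem)
  have "subfield K0 ?A"
    by (rule A.subfield_iff(1)) (use R.subfield_iff(2)[OF K0_subfield] KV in auto)
  note hK = h.img_is_subfield[OF this B.one_not_zero]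
  have cB: "carrier ?B = ?h ` pull V" by (auto simp: FactRing_def A_RCOSETS_def')
  obtain T where T: "finite T" "T \<subseteq> V" "separated (maxid V) T" "card T = residues V"
    "\<forall>v\<in>V. \<exists>a\<in>T. v - a \<in> maxid V"
    using residue_transversal[OF V] by blast
  have TL: "t \<in> L" if "t \<in> T" for t using T(2) vring_sub[OF V] that by blast
  have gT: "g t \<in> pull V" if "t \<in> T" for t using g[OF TL[OF that]] T(2) that by (auto simp: pull_mem)
  have eq_iff: "?h a = ?h b \<longleftrightarrow> f a - f b \<in> maxid V" if ab: "a \<in> pull V" "b \<in> pull V" for a b
  proof -
    have c: "a \<in> carrier R" "b \<in> carrier R" "f a \<in> V" "f b \<in> V" using ab by (auto simp: pull_mem)
    have "a \<ominus>\<^bsub>?A\<^esub> b = a \<ominus> b" using sub_uminus[OF sub ab(2)] by (simp add: a_minus_def)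
    hence "f (a \<ominus>\<^bsub>?A\<^esub> b) = f a - f b" "a \<ominus>\<^bsub>?A\<^esub> b \<in> carrier R" using f_minus c by auto
    thus ?thesis using A.quotient_eq_iff_same_a_r_cos[OF P.is_ideal, of a b] ab by (simp add: pull_mem)
  qed
  have "inj_on (\<lambda>t. ?h (g t)) T"
    using eq_iff[OF gT gT] g(2)[OF TL] separatedD[OF T(3)] by (intro inj_onI) simp
  moreover have "(\<lambda>t. ?h (g t)) ` T = carrier ?B"
  proof (intro equalityI subsetI)
    fix Y assume "Y \<in> carrier ?B"
    then obtain a where a: "a \<in> pull V" "Y = ?h a" using cB by blast
    then obtain t where t: "t \<in> T" "f a - t \<in> maxid V" using T(5) by (auto simp: pull_mem)
    hence "?h a = ?h (g t)" using eq_iff[OF a(1) gT[OF t(1)]] g(2)[OF TL[OF t(1)]] by simp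
    thus "Y \<in> (\<lambda>t. ?h (g t)) ` T" using a t by blast
  qed (use gT cB in auto)
  ultimately have card: "card (carrier ?B) = residues V" "finite (carrier ?B)"
    using T(1,4) card_image by (metis, metis finite_imageI)
  have "card (carrier ?B) = card (?h ` K0) ^ B.dim (?h ` K0) (carrier ?B)"
    using B.finite_space_dimension[OF hK(2) _ B.carrier_is_subalgebra card(2)] K0_finite subfieldE(3)[OF hK(2)] by simp
  moreover have "card (?h ` K0) = card K" using card_image[OF hK(1)] K0_finite by simp
  ultimately show ?thesis
    using card unfolding R.place_degree_def R.residue_field_def ring_of_place[OF V] by simp
qed

section \<open>Valuations and Riemann-Roch spaces of the model\<close>

lemma f_int_pow:
  assumes V: "vring V" and t: "t \<in> carrier R" "t \<noteq> \<zero>"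
  shows "t [^] (n::int) \<in> carrier R" "t [^] n \<noteq> \<zero>" "val V (f (t [^] n)) = n * val V (f t)"
proof -
  have ft: "f t \<in> L" "f t \<noteq> 0" using t f_L f_eq_zero by auto
  have nat: "t [^] k \<in> carrier R \<and> t [^] k \<noteq> \<zero> \<and> val V (f (t [^] k)) = int k * val V (f t)" for k :: nat
  proof -
    have "t [^] k \<in> carrier R" using t by simp
    moreover have "f (t [^] k) \<noteq> 0"
      unfolding f_nat_pow[OF t(1)] by (rule efield_power_mult_nz[OF L ft LD(1) efield_unit_nz[OF L]])
    moreover have "val V (f (t [^] k)) = int k * val V (f t)"
      unfolding f_nat_pow[OF t(1)] using val_power[OF V ft LD(1) efield_unit_nz[OF L]] val_unit[OF V] by simp
    ultimately show ?thesis using f_zero by auto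
  qed
  have "t [^] n \<in> carrier R \<and> t [^] n \<noteq> \<zero> \<and> val V (f (t [^] n)) = n * val V (f t)"
  proof (cases "n < 0")
    case True
    define y where "y = t [^] nat (- n)"
    have y: "y \<in> carrier R" "y \<noteq> \<zero>" "val V (f y) = int (nat (- n)) * val V (f t)" using nat by (auto simp: y_def)
    have "f y \<in> L" "f y \<noteq> 0" using y f_L f_eq_zero by auto
    hence "val V (iv e (f y)) = - val V (f y)" by (rule val_iv[OF V])
    moreover have tn: "t [^] n = inv y" unfolding y_def by (subst int_pow_def2) (simp add: True)
    ultimately have "val V (f (t [^] n)) = n * val V (f t)" using f_inv(1)[OF y(1,2)] y(3) True by simp
    thus ?thesis using f_inv(2,3)[OF y(1,2)] tn by simp
  next
    case False
    hence "t [^] n = t [^] nat n" by (subst int_pow_def2) simp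
    thus ?thesis using nat[of "nat n"] False by simp
  qed
  thus "t [^] n \<in> carrier R" "t [^] n \<noteq> \<zero>" "val V (f (t [^] n)) = n * val V (f t)" by auto
qed

lemma Units_place:
  assumes V: "vring V"
  shows "u \<in> Units (R\<lparr>carrier := pull V\<rparr>) \<longleftrightarrow> u \<in> carrier R \<and> f u \<in> units V"
proof
  assume "u \<in> Units (R\<lparr>carrier := pull V\<rparr>)"
  then obtain y where y: "u \<in> pull V" "y \<in> pull V" "y \<otimes> u = \<one>" by (auto simp: Units_def)
  have c: "u \<in> carrier R" "y \<in> carrier R" "f u \<in> V" "f y \<in> V" using y by (auto simp: pull_mem)
  have "f u * f y = e" using f_mult[OF c(2,1)] y f_one by (simp add: mult.commute)
  moreover have u0: "f u \<noteq> 0" using calculation efield_unit_nz[OF L] by auto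
  ultimately have "iv e (f u) = f y" using iv_eqI[OF _ LD(2)[OF f_L[OF c(2)]]] by blast
  thus "u \<in> carrier R \<and> f u \<in> units V" using c u0 by (simp add: units_def)
next
  assume u: "u \<in> carrier R \<and> f u \<in> units V"
  hence u0: "u \<noteq> \<zero>" using unitsD(3)[OF V] f_zero by auto
  hence "inv u \<in> pull V" using u f_inv[of u] unitsD(4)[OF V, of "f u"] by (simp add: pull_mem)
  moreover have "u \<in> pull V" using u unitsD(1)[OF V] by (simp add: pull_mem)
  moreover have "inv u \<otimes> u = \<one>" "u \<otimes> inv u = \<one>" using u u0 R.field_Units by (simp_all add: R.Units_l_inv R.Units_r_inv)
  ultimately show "u \<in> Units (R\<lparr>carrier := pull V\<rparr>)" by (auto simp: Units_def)
qed

text \<open>The exponent does not depend on the generator chosen: a generator of the ideal divides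
  the uniformizer without being a unit, so its valuation is exactly 1.\<close>

lemma place_valuation:
  assumes V: "vring V" and z: "z \<in> carrier R" "z \<noteq> \<zero>"
  shows "R.place_valuation (pull (maxid V)) z = val V (f z)"
  unfolding R.place_valuation_def ring_of_place[OF V]
proof (rule the_equality)
  have fz: "f z \<in> L" "f z \<noteq> 0" using z f_L f_eq_zero by auto
  note u = unif[OF V]
  have val1: "val V (unif V) = 1"
    using val_upow[OF V, of 1] upow_nat[OF V, of 1] LD(3)[OF u(5)] by simp
  define t where "t = g (unif V)"
  have t: "t \<in> carrier R" "f t = unif V" "t \<noteq> \<zero>" using g[OF u(5)] u(2) f_zero by (auto simp: t_def)
  have "pull (maxid V) = PIdl\<^bsub>R\<lparr>carrier := pull V\<rparr>\<^esub> t"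
  proof (intro equalityI subsetI)
    fix x assume x: "x \<in> pull (maxid V)"
    then obtain v where v: "v \<in> V" "f x = unif V * v" using u(3) by (auto simp: pull_mem)
    have vL: "v \<in> L" using v vring_sub[OF V] by blast
    have "f (g v \<otimes> t) = f x" using f_mult[OF g(1)[OF vL] t(1)] g(2)[OF vL] t(2) v(2) by (simp add: mult.commute)
    hence "x = g v \<otimes> t" using f_inj[of "g v \<otimes> t" x] g(1)[OF vL] t(1) x by (simp add: pull_mem)
    moreover have "g v \<in> pull V" using g[OF vL] v by (simp add: pull_mem)
    ultimately show "x \<in> PIdl\<^bsub>R\<lparr>carrier := pull V\<rparr>\<^esub> t" by (auto simp: cgenideal_def)
  next
    fix x assume "x \<in> PIdl\<^bsub>R\<lparr>carrier := pull V\<rparr>\<^esub> t"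
    then obtain y where y: "y \<in> pull V" "x = y \<otimes> t" by (auto simp: cgenideal_def)
    thus "x \<in> pull (maxid V)"
      using f_mult[of y t] t maxid_mult[OF V u(1), of "f y"] by (simp add: pull_mem mult.commute)
  qed
  moreover have "t \<in> pull (maxid V)" using t u by (simp add: pull_mem)
  moreover have "\<exists>w\<in>Units (R\<lparr>carrier := pull V\<rparr>). z = t [^] val V (f z) \<otimes> w"
  proof
    let ?p = "t [^] val V (f z)"
    note p = f_int_pow[OF V t(1,3), of "val V (f z)"]
    have fp: "f ?p \<in> L" "f ?p \<noteq> 0" using p f_L f_eq_zero by auto
    note ip = f_inv[OF p(1,2)]
    have "val V (f (inv ?p \<otimes> z)) = 0"
      using f_mult[OF ip(2) z(1)] val_mult[OF V efield_iv(1,4)[OF L fp] fz] val_iv[OF V fp] p(3) t(2) val1 ip(1) by simp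
    moreover have w: "f (inv ?p \<otimes> z) \<in> L" "f (inv ?p \<otimes> z) \<noteq> 0"
      using f_L[of "inv ?p \<otimes> z"] f_mult[OF ip(2) z(1)] ip z
        efield_mult_nz[OF L efield_iv(1)[OF L fp] fz(1) efield_iv(4)[OF L fp] fz(2)] by auto
    ultimately have "f (inv ?p \<otimes> z) \<in> units V"
      using val_nonneg[OF V w] val_nonneg[OF V efield_iv(1,4)[OF L w]] val_iv[OF V w] by (simp add: units_def)
    thus "inv ?p \<otimes> z \<in> Units (R\<lparr>carrier := pull V\<rparr>)" using Units_place[OF V] ip z by simp
    have "?p \<in> Units R" using p R.field_Units by simp
    thus "z = ?p \<otimes> (inv ?p \<otimes> z)" using z p ip by (simp add: R.m_assoc[symmetric] R.Units_r_inv)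
  qed
  ultimately show "\<exists>t\<in>pull (maxid V). \<exists>w\<in>Units (R\<lparr>carrier := pull V\<rparr>).
      pull (maxid V) = PIdl\<^bsub>R\<lparr>carrier := pull V\<rparr>\<^esub> t \<and> z = t [^] val V (f z) \<otimes> w" by blast
  fix n :: int assume "\<exists>t\<in>pull (maxid V). \<exists>w\<in>Units (R\<lparr>carrier := pull V\<rparr>).
      pull (maxid V) = PIdl\<^bsub>R\<lparr>carrier := pull V\<rparr>\<^esub> t \<and> z = t [^] n \<otimes> w"
  then obtain t' w where t': "t' \<in> pull (maxid V)" "w \<in> Units (R\<lparr>carrier := pull V\<rparr>)"
    "pull (maxid V) = PIdl\<^bsub>R\<lparr>carrier := pull V\<rparr>\<^esub> t'" "z = t' [^] n \<otimes> w" by blast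
  have w: "w \<in> carrier R" "f w \<in> units V" using t'(2) Units_place[OF V] by auto
  have "t \<in> pull (maxid V)" using t(1,2) u(1) by (simp add: pull_mem)
  hence "t \<in> PIdl\<^bsub>R\<lparr>carrier := pull V\<rparr>\<^esub> t'" using t'(3) by blast
  then obtain y where y: "y \<in> pull V" "t = y \<otimes> t'" by (auto simp: cgenideal_def)
  have yc: "y \<in> carrier R" "f y \<in> V" "t' \<in> carrier R" "f t' \<in> maxid V" using y t'(1) by (auto simp: pull_mem)
  have nz: "y \<noteq> \<zero>" "t' \<noteq> \<zero>" using y t(3) yc by auto
  have fy: "f y \<in> L" "f y \<noteq> 0" "f t' \<in> L" "f t' \<noteq> 0" using yc nz f_L f_eq_zero by auto
  have "1 = val V (f y) + val V (f t')"
    using val_mult[OF V fy] f_mult[OF yc(1,3)] y(2) t(2) val1 by simp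
  moreover have "val V (f y) \<ge> 0" using val_nonneg[OF V fy(1,2)] yc by simp
  moreover have "val V (f t') > 0" using val_pos[OF V fy(3,4)] yc by simp
  ultimately have vt': "val V (f t') = 1" by linarith
  note p = f_int_pow[OF V yc(3) nz(2), of n]
  have fp: "f (t' [^] n) \<in> L" "f (t' [^] n) \<noteq> 0" using p f_L f_eq_zero by auto
  have "val V (f z) = val V (f (t' [^] n)) + val V (f w)"
    using t'(4) f_mult[OF p(1) w(1)] val_mult[OF V fp unitsD(2,3)[OF V w(2)]] by simp
  thus "n = val V (f z)" using p(3) vt' val_units[OF V w(2)] by simp
qed

lemma RR_space:
  "R.Riemann_Roch_space K0 D = pull (RR (\<lambda>V. D (pull (maxid V))))"
proof -
  have "(\<forall>P\<in>R.places K0. R.place_valuation P z \<ge> - D P) \<longleftrightarrow> (\<forall>V. vring V \<longrightarrow> val V (f z) \<ge> - D (pull (maxid V)))"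
    if "z \<in> carrier R" "z \<noteq> \<zero>" for z
    using place_valuation[OF _ that] by (auto simp: places_eq)
  thus ?thesis using f_L f_eq_zero f_zero by (auto simp: R.Riemann_Roch_space_def RR_def pull_def)
qed

end

section \<open>Invariants of the model\<close>

text \<open>Transcendence in Horner form: if a polynomial vanishes at \<open>s\<close>, so do its
  constant term and the value of the remaining quotient; by repetition all coefficients
  vanish.\<close>

definition transc :: "'a::comm_ring_1 set \<Rightarrow> 'a \<Rightarrow> bool" where
  "transc K s \<longleftrightarrow> (\<forall>a\<in>K. \<forall>p\<in>polys K s. a + s * p = 0 \<longrightarrow> a = 0 \<and> p = 0)"

lemma transc_leading_coefficient:
  assumes K: "esubring e K" and s: "transc K s"
  shows "r \<in> polys_below K s n \<Longrightarrow> a \<in> K \<Longrightarrow> r + s ^ n * a = 0 \<Longrightarrow> a = 0"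
proof (induction n arbitrary: r)
  case (Suc n)
  from Suc.prems(1) obtain b r' where r: "r = b + s * r'" "b \<in> K" "r' \<in> polys_below K s n" by (rule polys_below_SucE)
  have "r' + s ^ n * a \<in> polys_below K s (Suc n)"
    using polys_below_add[OF K polys_below_Suc[OF K r(3)] polys_below_var_power[OF K Suc.prems(2)]] .
  hence "r' + s ^ n * a \<in> polys K s" by (rule polysI[OF K])
  moreover have "b + s * (r' + s ^ n * a) = 0" using r Suc.prems(3) by (simp add: algebra_simps)
  ultimately have "r' + s ^ n * a = 0" using s r(2) unfolding transc_def by blast
  thus ?case using Suc.IH[OF r(3) Suc.prems(2)] by blast
qed simp

lemma transc_nz:
  assumes "esubring e K" "e \<noteq> 0" "transc K s"
  shows "s \<noteq> 0"
proof
  assume "s = 0"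
  hence "0 + s * e = 0" by simp
  hence "e = 0" using assms(3) esubringD(1,8)[OF assms(1)] polys_const[OF assms(1), of e s] unfolding transc_def by blast
  thus False using assms(2) by simp
qed

lemma card_polys_below:
  assumes K: "esubring e K" "finite K" and s: "transc K s"
  shows "card (polys_below K s d) = card K ^ d"
proof (induction d)
  case (Suc d)
  have eq: "polys_below K s (Suc d) = (\<lambda>(a, p). a + s * p) ` (K \<times> polys_below K s d)"
    by (auto simp: polys_below.simps(2))
  have "inj_on (\<lambda>(a, p). a + s * p) (K \<times> polys_below K s d)"
  proof (rule inj_onI, clarify)
    fix a p b r assume *: "a \<in> K" "b \<in> K" "p \<in> polys_below K s d" "r \<in> polys_below K s d" "a + s * p = b + s * r"
    have "(a - b) + s * (p - r) = 0" using *(5) by (simp add: algebra_simps)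
    moreover have "a - b \<in> K" "p - r \<in> polys K s"
      using * esubringD(7)[OF K(1)] polys_below_diff[OF K(1)] polysI[OF K(1)] by blast+
    ultimately have "a - b = 0 \<and> p - r = 0" using s unfolding transc_def by blast
    thus "a = b \<and> p = r" by simp
  qed
  thus ?case unfolding eq using Suc by (simp add: card_image card_cartesian_product)
qed simp

section \<open>Constant field, genus and rational places of the model\<close>

context field_model
begin

lemma f_monomial:
  assumes "a \<in> carrier R" "x \<in> carrier R"
  shows "f (a \<otimes> x [^] (n::nat)) = f x ^ n * f a"
proof -
  have "f (a \<otimes> x [^] n) = f x ^ n * (e * f a)" using f_mult assms f_nat_pow by (simp add: mult_ac)
  thus ?thesis using LD(2)[OF f_L[OF assms(1)]] by simp
qed

lemma f_eval:
  assumes "x \<in> carrier R"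
  shows "set p \<subseteq> K0 \<Longrightarrow> f (R.eval p x) \<in> polys_below K (f x) (length p)"
proof (induction p)
  case (Cons a p)
  have a: "a \<in> carrier R" "f a \<in> K" using Cons.prems by (auto simp: pull_mem)
  have p: "set p \<subseteq> carrier R" using Cons.prems by (auto simp: pull_mem)
  have "f (a \<otimes> x [^] length p) = f x ^ length p * f a" by (rule f_monomial[OF a(1) assms])
  hence "f (R.eval (a # p) x) = f x ^ length p * f a + f (R.eval p x)"
    using f_add[of "a \<otimes> x [^] length p" "R.eval p x"] a assms R.eval_in_carrier[OF p assms] by simp
  thus ?case using polys_below_add[OF K' polys_below_var_power[OF K' a(2)] polys_below_Suc[OF K' Cons.IH]] Cons.prems
    by simp
qed (simp add: f_zero)

lemma eval_Cons_zero:
  assumes x: "x \<in> carrier R" and p: "p \<in> carrier (K0[X])" "p \<noteq> []" "R.eval p x = \<zero>"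
  shows "\<exists>n. \<exists>a\<in>K. \<exists>r\<in>polys_below K (f x) n. a \<noteq> 0 \<and> r + f x ^ n * a = 0"
proof -
  obtain a p' where ap: "p = a # p'" using p(2) by (cases p) auto
  have pol: "polynomial K0 p" using p(1) univ_poly_carrier by blast
  hence a: "a \<in> K0" "a \<noteq> \<zero>" using R.lead_coeff_not_zero[of K0 a p'] ap by auto
  have p': "set p' \<subseteq> K0" using R.polynomial_incl[OF pol] ap by auto
  have ac: "a \<in> carrier R" "f a \<in> K" "f a \<noteq> 0" using a f_eq_zero by (auto simp: pull_mem)
  have p'c: "set p' \<subseteq> carrier R" using p' by (auto simp: pull_mem)
  have "f (a \<otimes> x [^] length p') = f x ^ length p' * f a" by (rule f_monomial[OF ac(1) x])
  hence "f (R.eval p' x) + f x ^ length p' * f a = f (R.eval p x)"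
    using f_add[of "a \<otimes> x [^] length p'" "R.eval p' x"] ac x R.eval_in_carrier[OF p'c x] ap by simp
  thus ?thesis using f_eval[OF x p'] ac p(3) f_zero by (intro exI[of _ "length p'"] bexI[of _ "f a"] bexI[of _ "f (R.eval p' x)"]) auto
qed

lemma lspan_subset_Span:
  assumes F: "subfield F R" "E \<subseteq> f ` F"
  shows "set us \<subseteq> L \<Longrightarrow> z \<in> lspan E us \<Longrightarrow> g z \<in> R.Span F (map g us)"
proof (induction us arbitrary: z)
  case Nil
  thus ?case using g_f[of \<zero>] f_zero by simp
next
  case (Cons u us)
  from Cons.prems(2) obtain a y where z: "z = a * u + y" "a \<in> E" "y \<in> lspan E us" by (rule lspan_ConsE)
  obtain k where k: "k \<in> F" "a = f k" using F(2) z(2) by blast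
  have kc: "k \<in> carrier R" using k subfieldE(3)[OF F(1)] by auto
  have uL: "u \<in> L" "set us \<subseteq> L" using Cons.prems(1) by auto
  have yL: "y \<in> L" using lspan_subset[OF L' E_L uL(2)] z(3) by blast
  have "f (k \<otimes> g u \<oplus> g y) = z" using z k kc g uL yL by (simp add: f_add f_mult)
  hence "g z = k \<otimes> g u \<oplus> g y" using g_f[of "k \<otimes> g u \<oplus> g y"] kc g uL yL by simp
  thus ?case using Cons.IH[OF uL(2) z(3)] k R.line_extension_mem_iff by auto
qed

lemma function_field_model:
  assumes tr: "transc K s"
  shows "function_field R K0"
  unfolding function_field_def
proof (intro conjI)
  show "field R" by (rule R.field_axioms)
  show "subfield K0 R" by (rule K0_subfield)
  define x where "x = g s"
  have x: "x \<in> carrier R" "f x = s" using g s by (auto simp: x_def)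
  have "a_kernel (K0[X]) R (\<lambda>p. R.eval p x) \<subseteq> {[]}"
  proof
    fix p assume "p \<in> a_kernel (K0[X]) R (\<lambda>p. R.eval p x)"
    hence p: "p \<in> carrier (K0[X])" "R.eval p x = \<zero>" by (auto simp: a_kernel_def')
    have "p = []"
    proof (rule ccontr)
      assume "p \<noteq> []"
      then obtain n a r where "a \<in> K" "r \<in> polys_below K s n" "a \<noteq> 0" "r + s ^ n * a = 0"
        using eval_Cons_zero[OF x(1) p(1) _ p(2)] x(2) by blast
      thus False using transc_leading_coefficient[OF K' tr] by blast
    qed
    thus "p \<in> {[]}" by simp
  qed
  moreover have "[] \<in> a_kernel (K0[X]) R (\<lambda>p. R.eval p x)" by (simp add: a_kernel_def' univ_poly_def R.zero_is_polynomial)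
  ultimately have "a_kernel (K0[X]) R (\<lambda>p. R.eval p x) = {[]}" by auto
  from R.trivial_ker_imp_transcendental[OF subfieldE(1)[OF K0_subfield] x(1) this]
  have 1: "R.transcendental K0 x" by (simp add: over_def)
  define F where "F = generate_field R (insert x K0)"
  have H: "insert x K0 \<subseteq> carrier R" using x(1) by (auto simp: pull_mem)
  have F: "subfield F R" unfolding F_def by (rule R.generate_field_is_subfield[OF H])
  have Fc: "F \<subseteq> carrier R" by (rule subfieldE(3)[OF F])
  have Fe: "efield e (f ` F)" unfolding efield_def
  proof (intro conjI ballI impI)
    show "e \<noteq> 0" by (rule efield_unit_nz[OF L])
    show "esubring e (f ` F)" by (rule image_esubring[OF subfieldE(1)[OF F]])
    fix z assume "z \<in> f ` F" "z \<noteq> 0"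
    then obtain y where y: "y \<in> F" "z = f y" "y \<noteq> \<zero>" using f_zero by auto
    have "inv y \<in> F" using R.subfield_m_inv(1)[OF F, of y] y by simp
    moreover have "z * f (inv y) = e"
      using f_inv[of y] y Fc efield_iv(2)[OF L f_L, of y] f_eq_zero[of y] by auto
    ultimately show "\<exists>w\<in>f ` F. z * w = e" by blast
  qed
  have "x \<in> F" "K0 \<subseteq> F" unfolding F_def by (auto intro: generate_field.incl)
  hence "s \<in> f ` F" "K \<subseteq> f ` F" using x(2) f_pull[OF KL] by blast+
  hence "polys K s \<subseteq> f ` F" using polys_subset[OF K' efield_esubring[OF Fe]] by blast
  hence E: "E \<subseteq> f ` F" using fractions_subset[OF L polys_ring polys_L _ Fe] f_L Fc by blast
  have gws: "set (map g ws) \<subseteq> carrier R" using g(1) ws by auto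
  have "R.Span F (map g ws) = carrier R"
  proof
    show "R.Span F (map g ws) \<subseteq> carrier R" by (rule R.Span_in_carrier[OF Fc gws])
    show "carrier R \<subseteq> R.Span F (map g ws)"
    proof
      fix y assume y: "y \<in> carrier R"
      have "f y \<in> lspan E ws" using f_L[OF y] span by blast
      thus "y \<in> R.Span F (map g ws)" using lspan_subset_Span[OF F E ws] g_f[OF y] by metis
    qed
  qed
  hence "R.finite_dimension F (carrier R)" using R.Span_finite_dimension[OF F gws] by simp
  thus "\<exists>x\<in>carrier R. R.transcendental K0 x \<and>
      R.finite_dimension (generate_field R (insert x K0)) (carrier R)" using 1 x(1) unfolding F_def by blast
qed

text \<open>An algebraic element satisfies a monic equation and has no poles, and a rational place
  forces such functions to be constants.\<close>

lemma full_constant_field_model: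
  assumes V: "vring V" "residues V = card K"
  shows "full_constant_field R K0"
  unfolding full_constant_field_def
proof (intro equalityI subsetI)
  fix z assume "z \<in> K0"
  thus "z \<in> {z \<in> carrier R. R.algebraic K0 z}"
    using R.algebraic_self[OF subfieldE(1)[OF K0_subfield]] by (simp add: over_def pull_mem)
next
  fix z assume "z \<in> {z \<in> carrier R. R.algebraic K0 z}"
  hence z: "z \<in> carrier R" "(R.algebraic over K0) z" by (auto simp: over_def)
  obtain p where p: "p \<in> carrier (K0[X])" "p \<noteq> []" "R.eval p z = \<zero>"
    by (rule R.algebraicE[OF subfieldE(1)[OF K0_subfield] z])
  then obtain n a r where a: "a \<in> K" "r \<in> polys_below K (f z) n" "a \<noteq> 0" "r + f z ^ n * a = 0"
    using eval_Cons_zero[OF z(1)] by blast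
  note ia = efield_iv[OF K a(1,3)]
  have "iv e a * (r + f z ^ n * a) = 0" using a(4) by simp
  hence "f z ^ n * (a * iv e a) = - (iv e a * r)" by (simp add: algebra_simps eq_neg_iff_add_eq_0)
  hence "f z ^ n * e = - (iv e a * r)" using ia by simp
  hence monic: "f z ^ n * e \<in> polys_below K (f z) n"
    using polys_below_uminus[OF K' polys_below_scale[OF K' ia(1) a(2)]] by simp
  have "f z \<in> RR (\<lambda>V. 0)" using RR_regular f_L[OF z(1)] algebraic_in_vring[OF f_L[OF z(1)] monic] by blast
  thus "z \<in> K0" using regular_constants[OF V] z by (simp add: pull_mem)
qed

lemma RR_dim:
  assumes fin: "finite (RR D)"
  shows "card (RR D) = card K ^ R.dim K0 (pull (RR D))"
proof -
  have RL: "RR D \<subseteq> L" by (auto simp: RR_def)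
  have "subalgebra K0 (pull (RR D)) R"
  proof (intro subalgebra.intro subalgebra_axioms.intro)
    have "\<zero> \<in> pull (RR D)" using RR_zero f_zero by (simp add: pull_mem)
    hence "pull (RR D) \<noteq> {}" by blast
    thus "subgroup (pull (RR D)) (add_monoid R)"
      by (intro R.add.subgroupI) (auto simp: pull_mem f_add f_uminus intro: RR_add RR_uminus)
    show "k \<otimes> v \<in> pull (RR D)" if "k \<in> K0" "v \<in> pull (RR D)" for k v
      using that RR_scale f_mult by (auto simp: pull_mem)
  qed
  moreover have "finite (pull (RR D))" using finite_pull[OF RL] fin by simp
  ultimately show ?thesis
    using R.finite_space_dimension[OF K0_subfield K0_finite(1)] K0_finite(2) card_pull[OF RL] by simp
qed

definition deg :: "'a set \<Rightarrow> nat" where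
  "deg V = R.place_degree K0 (pull (maxid V))"

sublocale G: graded_field e L K s ws deg
  by unfold_locales (simp add: deg_def place_degree)

lemma divisor_support:
  assumes "D \<in> R.divisors K0"
  shows "{P. D P \<noteq> 0} = (\<lambda>V. pull (maxid V)) ` {V. vring V \<and> D (pull (maxid V)) \<noteq> 0}"
  using assms unfolding R.divisors_def places_eq by auto

lemma maxid_inj_on: "inj_on (\<lambda>V. pull (maxid V)) {V. vring V \<and> Q V}"
  using pull_maxid_inj by (auto simp: inj_on_def)

lemma divisor_degree_model:
  assumes "D \<in> R.divisors K0"
  shows "R.divisor_degree K0 D = (\<Sum>V | vring V \<and> D (pull (maxid V)) \<noteq> 0. D (pull (maxid V)) * int (deg V))"
  unfolding R.divisor_degree_def divisor_support[OF assms]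
  by (subst sum.reindex[OF maxid_inj_on]) (simp add: deg_def)

lemma divisor_support_finite:
  assumes "D \<in> R.divisors K0"
  shows "finite {V. vring V \<and> D (pull (maxid V)) \<noteq> 0}"
  using assms finite_image_iff[OF maxid_inj_on] divisor_support[OF assms] unfolding R.divisors_def by simp

lemma divisor_exists:
  assumes "finite {V. vring V \<and> D V \<noteq> 0}"
  shows "\<exists>D'\<in>R.divisors K0. \<forall>V. vring V \<longrightarrow> D' (pull (maxid V)) = D V"
proof -
  \<comment> \<open>A place determines its ring, and the image of that ring under \<open>f\<close>
    is the valuation ring at which \<open>D\<close> is to be evaluated.\<close>
  define D' where "D' P = (if P \<in> R.places K0 then D (f ` carrier (R.ring_of_place P)) else 0)" for P
  have eq: "D' (pull (maxid V)) = D V" if "vring V" for V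
    using that ring_of_place[OF that] f_pull[OF vringD(3)[OF that]] by (auto simp: D'_def places_eq)
  have "{P. D' P \<noteq> 0} \<subseteq> (\<lambda>V. pull (maxid V)) ` {V. vring V \<and> D V \<noteq> 0}"
  proof
    fix P assume P: "P \<in> {P. D' P \<noteq> 0}"
    hence "P \<in> R.places K0" by (auto simp: D'_def split: if_splits)
    then obtain V where "vring V" "P = pull (maxid V)" by (auto simp: places_eq)
    thus "P \<in> (\<lambda>V. pull (maxid V)) ` {V. vring V \<and> D V \<noteq> 0}" using P eq by auto
  qed
  moreover have "{P. D' P \<noteq> 0} \<subseteq> R.places K0" by (auto simp: D'_def split: if_splits)
  ultimately have "D' \<in> R.divisors K0" using finite_subset[OF _ finite_imageI[OF assms]] by (simp add: R.divisors_def)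
  thus ?thesis using eq by blast
qed

lemma num_rational_places: "R.num_places K0 1 = card {V. vring V \<and> deg V = 1}"
proof -
  have "{P \<in> R.places K0. R.place_degree K0 P = 1} = (\<lambda>V. pull (maxid V)) ` {V. vring V \<and> deg V = 1}"
    by (auto simp: places_eq deg_def)
  thus ?thesis unfolding R.num_places_def by (simp add: card_image[OF maxid_inj_on])
qed

text \<open>By Riemann's inequality the values whose maximum is the genus are bounded by
  \<open>length ws + 1\<close>, and the zero divisor contributes 0. So the maximum is attained and
  is a natural number.\<close>

theorem model_invariants:
  assumes s: "transc K s"
    and H: "\<And>m. card K ^ (length ws * m) \<le> card (RR (\<lambda>V. int (m + 1) * max 0 (- val V s)))"
    and S: "finite S" "S \<noteq> {}" "\<And>V. V \<in> S \<Longrightarrow> vring V \<and> deg V = 1"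
  shows "\<exists>n. global_function_field R K0 \<and> R.genus K0 = int n \<and> n \<le> length ws + 1 \<and>
    card S \<le> R.num_places K0 1 \<and> card S \<le> card K * (n + 1) + n + 1"
proof -
  obtain V0 where V0: "vring V0" "deg V0 = 1" using S by blast
  have res: "residues V0 = card K" using G.deg[OF V0(1)] V0(2) by simp
  have s0: "s \<noteq> 0" by (rule transc_nz[OF K' efield_unit_nz[OF L] s])
  have gff: "global_function_field R K0"
    unfolding global_function_field_def
    using function_field_model[OF s] full_constant_field_model[OF V0(1) res] K0_finite by simp
  define l where "l D = R.dim K0 (pull (RR D))" for D
  have l: "card (RR D) = card K ^ l D" if "finite {V. vring V \<and> D V \<noteq> 0}" for D
    unfolding l_def
  proof (rule RR_dim[OF RR_finite[OF V0(1)]])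
    show "finite {V. vring V \<and> D V > 0}" by (rule finite_subset[OF _ that]) auto
  qed
  define w where "w D = (\<Sum>V | vring V \<and> D V \<noteq> 0. D V * int (deg V)) - int (l D) + 1" for D
  define I where "I = {w D |D. finite {V. vring V \<and> D V \<noteq> 0}}"
  have w_le: "w D \<le> int (length ws + 1)" if "finite {V. vring V \<and> D V \<noteq> 0}" for D
    using G.Riemann_inequality[OF s0 H that l[OF that]] by (simp add: w_def)
  have w_cong: "w D = w D'" if "\<And>V. vring V \<Longrightarrow> D V = D' V" for D D'
  proof -
    have "RR D = RR D'" using that by (auto simp: RR_def)
    moreover have "{V. vring V \<and> D V \<noteq> 0} = {V. vring V \<and> D' V \<noteq> 0}" using that by auto
    ultimately show ?thesis using that by (auto simp: w_def l_def intro!: sum.cong)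
  qed
  have I_eq: "I = {R.divisor_degree K0 D - int (R.dim K0 (R.Riemann_Roch_space K0 D)) + 1 |D. D \<in> R.divisors K0}"
  proof (intro equalityI subsetI)
    fix x assume "x \<in> I"
    then obtain D where D: "x = w D" "finite {V. vring V \<and> D V \<noteq> 0}" by (auto simp: I_def)
    obtain D' where D': "D' \<in> R.divisors K0" "\<forall>V. vring V \<longrightarrow> D' (pull (maxid V)) = D V"
      using divisor_exists[OF D(2)] by blast
    have "x = w (\<lambda>V. D' (pull (maxid V)))" unfolding D(1) by (rule w_cong) (use D'(2) in simp)
    thus "x \<in> {R.divisor_degree K0 D - int (R.dim K0 (R.Riemann_Roch_space K0 D)) + 1 |D. D \<in> R.divisors K0}"
      using D'(1) divisor_degree_model[OF D'(1)] by (intro CollectI exI[of _ D']) (simp add: w_def l_def RR_space)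
  next
    fix x assume "x \<in> {R.divisor_degree K0 D - int (R.dim K0 (R.Riemann_Roch_space K0 D)) + 1 |D. D \<in> R.divisors K0}"
    then obtain D where D: "D \<in> R.divisors K0"
      "x = R.divisor_degree K0 D - int (R.dim K0 (R.Riemann_Roch_space K0 D)) + 1" by blast
    hence "x = w (\<lambda>V. D (pull (maxid V)))"
      using divisor_degree_model[OF D(1)] by (simp add: w_def l_def RR_space)
    thus "x \<in> I" using divisor_support_finite[OF D(1)] by (auto simp: I_def)
  qed
  have "card (RR (\<lambda>V. 0)) = card K ^ 1" using regular_constants[OF V0(1) res] by simp
  hence "card K ^ l (\<lambda>V. 0) = card K ^ 1" using l[of "\<lambda>V. 0"] by simp
  hence "l (\<lambda>V. 0) = 1" using card_K by (subst (asm) power_inject_exp) auto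
  hence zero: "0 \<in> I" unfolding I_def by (intro CollectI exI[of _ "\<lambda>V. 0"]) (simp add: w_def)
  have bdd: "x \<le> int (length ws + 1)" if "x \<in> I" for x using that w_le by (auto simp: I_def)
  \<comment> \<open>The maximum of a nonempty set of integers bounded above, found by minimising the
    distance to the bound.\<close>
  obtain m where m: "m \<in> I" "\<And>x. x \<in> I \<Longrightarrow> x \<le> m"
  proof -
    obtain m where "m \<in> I" "\<forall>x. x \<in> I \<longrightarrow> nat (int (length ws + 1) - m) \<le> nat (int (length ws + 1) - x)"
      using ex_has_least_nat[of "\<lambda>x. x \<in> I" 0 "\<lambda>x. nat (int (length ws + 1) - x)"] zero by blast
    thus thesis using that[of m] bdd by (smt (verit, best) nat_le_eq_zle)
  qed
  define n where "n = nat m"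
  have mn: "m = int n" using m(2)[OF zero] by (simp add: n_def)
  have "R.genus K0 = m"
    unfolding R.genus_def
  proof (rule Greatest_equality)
    show "\<exists>D\<in>R.divisors K0. m = R.divisor_degree K0 D - int (R.dim K0 (R.Riemann_Roch_space K0 D)) + 1"
      using m(1) unfolding I_eq by auto
    fix y assume "\<exists>D\<in>R.divisors K0. y = R.divisor_degree K0 D - int (R.dim K0 (R.Riemann_Roch_space K0 D)) + 1"
    hence "y \<in> I" unfolding I_eq by auto
    thus "y \<le> m" by (rule m(2))
  qed
  hence genus: "R.genus K0 = int n" using mn by simp
  have bound: "card S' \<le> card K * (n + 1) + n + 1" if "finite S'" "S' \<subseteq> {V. vring V \<and> deg V = 1}" for S'
  proof (rule G.rational_places_bound[of l])
    fix D :: "'a set \<Rightarrow> int" assume D: "finite {V. vring V \<and> D V \<noteq> 0}"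
    show "card (RR D) = card K ^ l D" by (rule l[OF D])
    have "w D \<le> int n" using m(2)[of "w D"] D mn by (auto simp: I_def)
    thus "(\<Sum>V | vring V \<and> D V \<noteq> 0. D V * int (deg V)) - int (l D) + 1 \<le> int n" by (simp add: w_def)
  qed (use that in auto)
  have "finite {V. vring V \<and> deg V = 1}" by (rule finite_if_card_bounded) (rule bound)
  hence "card S \<le> R.num_places K0 1" unfolding num_rational_places using S by (intro card_mono) auto
  moreover have "card S \<le> card K * (n + 1) + n + 1" by (rule bound) (use S in auto)
  moreover have "n \<le> length ws + 1" using bdd[OF m(1)] mn by simp
  ultimately show ?thesis using gff genus by blast
qed

end

section \<open>Monomial bases and lattices\<close>

primrec ringgen :: "'a::comm_ring_1 set \<Rightarrow> 'a list \<Rightarrow> 'a set" where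
  "ringgen E [] = E"
| "ringgen E (u # us) = polys (ringgen E us) u"

text \<open>Higher powers come first, so that terms of lower degree stand later in the list; the
  triangular comparison of two monomial lists depends on this order.\<close>

primrec powers_mult :: "'a::comm_ring_1 \<Rightarrow> nat \<Rightarrow> 'a list \<Rightarrow> 'a list" where
  "powers_mult u 0 ms = []"
| "powers_mult u (Suc t) ms = map ((*) (u ^ t)) ms @ powers_mult u t ms"

primrec monomials :: "'a::comm_ring_1 \<Rightarrow> nat \<Rightarrow> 'a list \<Rightarrow> 'a list" where
  "monomials e q [] = [e]"
| "monomials e q (u # us) = powers_mult u q (monomials e q us)"

lemma lspan_append_left: "x \<in> lspan E us \<Longrightarrow> 0 \<in> E \<Longrightarrow> x \<in> lspan E (us @ vs)"
proof (induction us arbitrary: x)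
  case (Cons u us)
  from Cons.prems(1) obtain a z where "x = a * u + z" "a \<in> E" "z \<in> lspan E us" by (rule lspan_ConsE)
  thus ?case using Cons.IH Cons.prems(2) lspan_ConsI by fastforce
qed (simp add: lspan_zero)

lemma lspan_append_right: "x \<in> lspan E vs \<Longrightarrow> 0 \<in> E \<Longrightarrow> x \<in> lspan E (us @ vs)"
  by (induction us) (use lspan_subset_Cons in fastforce)+

lemma set_powers_mult: "x \<in> set (powers_mult u t ms) \<longleftrightarrow> (\<exists>k<t. \<exists>m\<in>set ms. x = u ^ k * m)"
  by (induction t) (auto simp: less_Suc_eq)

context
  fixes e :: "'a::comm_ring_1" and E :: "'a set"
  assumes E: "esubring e E"
begin

lemma ringgen_esubring: "\<forall>u\<in>set us. e * u = u \<Longrightarrow> esubring e (ringgen E us)"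
  by (induction us) (use E polys_esubring in auto)

lemma ringgen_tail: "\<forall>u\<in>set us. e * u = u \<Longrightarrow> ringgen E us \<subseteq> ringgen E (u # us)"
  using polys_const[OF ringgen_esubring, of us _ u] by auto

lemma ringgen_base: "\<forall>u\<in>set us. e * u = u \<Longrightarrow> E \<subseteq> ringgen E us"
proof (induction us)
  case (Cons u us)
  thus ?case using ringgen_tail[of us u] by auto
qed simp

lemma ringgen_mem: "\<forall>u\<in>set us. e * u = u \<Longrightarrow> u \<in> set us \<Longrightarrow> u \<in> ringgen E us"
proof (induction us)
  case (Cons v us)
  show ?case
  proof (cases "u = v")
    case True
    thus ?thesis using polys_var[OF ringgen_esubring, of us v] Cons.prems by simp
  next
    case False
    thus ?thesis using Cons ringgen_tail[of us v] by auto
  qed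
qed simp

lemma ringgen_subset:
  assumes "esubring e R" "E \<subseteq> R" "set us \<subseteq> R"
  shows "ringgen E us \<subseteq> R"
  using assms(3)
proof (induction us)
  case (Cons u us)
  have "esubring e (ringgen E us)" using ringgen_esubring Cons.prems esubringD(2)[OF assms(1)] by auto
  thus ?case using polys_subset[OF _ assms(1)] Cons by simp
qed (use assms(2) in simp)

lemma polys_below_lspan:
  assumes ms: "S \<subseteq> lspan E ms"
  shows "p \<in> polys_below S u t \<Longrightarrow> esubring e S \<Longrightarrow> p \<in> lspan E (powers_mult u t ms)"
proof (induction t arbitrary: p)
  case (Suc t)
  obtain r a where r: "r \<in> polys_below S u t" "a \<in> S" "p = r + u ^ t * a"
    using polys_below_top[OF Suc.prems(2,1)] by blast
  have "u ^ t * a \<in> lspan E (map ((*) (u ^ t)) ms)" using lspan_map_mult r(2) ms by blast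
  hence "u ^ t * a \<in> lspan E (powers_mult u (Suc t) ms)"
    using lspan_append_left esubringD(8)[OF E] by simp
  moreover have "r \<in> lspan E (powers_mult u (Suc t) ms)"
    using lspan_append_right[OF Suc.IH[OF r(1) Suc.prems(2)]] esubringD(8)[OF E] by simp
  ultimately show ?case using lspan_esubring_add[OF E] r(3) by simp
qed (simp add: lspan_esubring_zero[OF E])

lemma polys_reduce:
  assumes S: "esubring e S" and u: "e * u = u" and q: "q \<ge> 2" and as: "u ^ q - u \<in> S"
  shows "polys S u = polys_below S u q"
proof
  show "polys_below S u q \<subseteq> polys S u" using polysI[OF S] by blast
  show "polys S u \<subseteq> polys_below S u q"
  proof
    fix p assume "p \<in> polys S u"
    thus "p \<in> polys_below S u q"
    proof (induction rule: polys_induct[OF S, consumes 1, case_names zero step])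
      case zero show ?case by (rule polys_below_zero[OF S])
    next
      case (step a p)
      obtain k where k: "q = Suc (Suc k)" using q by (metis add_2_eq_Suc le_Suc_ex)
      obtain r b where r: "r \<in> polys_below S u (Suc k)" "b \<in> S" "p = r + u ^ Suc k * b"
        using polys_below_top[OF S] step.IH unfolding k by blast
      have 1: "a + u * r \<in> polys_below S u q" unfolding k by (rule polys_below_SucI[OF step.hyps(1) r(1)])
      have 2: "(u ^ q - u) * b \<in> polys_below S u q"
        unfolding k using polys_below_const[OF S] esubringD(6)[OF S as r(2)] k by blast
      have "u ^ 1 * b \<in> polys_below S u (Suc 1)" by (rule polys_below_var_power[OF S r(2)])
      hence 3: "u * b \<in> polys_below S u q" using polys_below_mono[OF S, of "Suc 1" q] q by auto
      have eq: "a + u * p = (a + u * r) + ((u ^ q - u) * b + u * b)"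
        unfolding r(3) k by (simp add: algebra_simps)
      show ?case unfolding eq by (rule polys_below_add[OF S 1 polys_below_add[OF S 2 3]])
    qed
  qed
qed

definition AS_tower :: "nat \<Rightarrow> 'a list \<Rightarrow> bool" where
  "AS_tower q us \<longleftrightarrow> (\<forall>vs u ts. us = vs @ u # ts \<longrightarrow> e * u = u \<and> u ^ q - u \<in> ringgen E ts)"

lemma AS_tower_Cons: "AS_tower q (u # us) \<longleftrightarrow> e * u = u \<and> u ^ q - u \<in> ringgen E us \<and> AS_tower q us"
  unfolding AS_tower_def by (auto simp: Cons_eq_append_conv)

lemma AS_tower_unit: "AS_tower q us \<Longrightarrow> \<forall>u\<in>set us. e * u = u"
  by (induction us) (auto simp: AS_tower_Cons)

lemma ringgen_span:
  assumes q: "q \<ge> 2"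
  shows "AS_tower q us \<Longrightarrow> ringgen E us \<subseteq> lspan E (monomials e q us)"
proof (induction us)
  case Nil
  show ?case using lspan_ConsI[of _ E 0 "[]" e] esubringD(3)[OF E] by auto
next
  case (Cons u us)
  note S = ringgen_esubring[OF AS_tower_unit]
  have "AS_tower q us" "e * u = u" "u ^ q - u \<in> ringgen E us" using Cons.prems by (auto simp: AS_tower_Cons)
  thus ?case using polys_reduce[OF S, of q us u q] q polys_below_lspan[OF Cons.IH _ S] by auto
qed

lemma monomials_ringgen:
  assumes "AS_tower q us"
  shows "set (monomials e q us) \<subseteq> ringgen E us"
  using assms
proof (induction us)
  case (Cons u us)
  have u: "AS_tower q us" "e * u = u" using Cons.prems by (auto simp: AS_tower_Cons)
  note S = ringgen_esubring[OF AS_tower_unit[OF u(1)]]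
  have "u ^ k * m \<in> ringgen E (u # us)" if "m \<in> set (monomials e q us)" for k m
    using polysI[OF S polys_below_var_power[OF S]] that Cons.IH[OF u(1)] by auto
  thus ?case by (auto simp: set_powers_mult)
qed (use esubringD(1)[OF E] in simp)

lemma lspan_monomials:
  assumes "q \<ge> 2" "AS_tower q us"
  shows "lspan E (monomials e q us) = ringgen E us"
  using ringgen_span[OF assms] lspan_subset[OF ringgen_esubring[OF AS_tower_unit[OF assms(2)]]
    ringgen_base[OF AS_tower_unit[OF assms(2)]] monomials_ringgen[OF assms(2)]] by auto

text \<open>The lists are read from the tail: each \<open>w0\<close> agrees with its partner \<open>w\<close> up to the span of the
  later entries.\<close>

primrec triangular :: "('a \<times> 'a) list \<Rightarrow> bool" where
  "triangular [] = True"
| "triangular (z # zs) = (snd z - fst z \<in> lspan E (map fst zs) \<and> triangular zs)"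

lemma power_diff_polys:
  assumes S: "esubring e S" and d: "d \<in> S" "u0 = u + d" and w: "w \<in> S"
  shows "(u0 ^ t - u ^ t) * w \<in> polys_below S u t"
proof (induction t)
  case (Suc t)
  let ?p = "(u0 ^ t - u ^ t) * w"
  have "(u0 ^ Suc t - u ^ Suc t) * w = u * ?p + (d * ?p + u ^ t * (d * w))"
    using d(2) by (simp add: algebra_simps)
  moreover have "u * ?p \<in> polys_below S u (Suc t)" by (rule polys_below_shift[OF S Suc])
  moreover have "d * ?p \<in> polys_below S u (Suc t)" by (rule polys_below_Suc[OF S polys_below_scale[OF S d(1) Suc]])
  moreover have "u ^ t * (d * w) \<in> polys_below S u (Suc t)" by (rule polys_below_var_power[OF S esubringD(6)[OF S d(1) w]])
  ultimately show ?case using polys_below_add[OF S] by simp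
qed simp

lemma triangular_powers:
  assumes S: "esubring e S" "S \<subseteq> lspan E (map fst zs)" and d: "u0 - u \<in> S"
    and zs: "triangular zs" "set (map snd zs) \<subseteq> S"
  shows "triangular (zip (powers_mult u t (map fst zs)) (powers_mult u0 t (map snd zs)))"
proof (induction t)
  case (Suc t)
  let ?B = "zip (powers_mult u t (map fst zs)) (powers_mult u0 t (map snd zs))"
  have len: "length (powers_mult v t ms) = t * length ms" for v t and ms :: "'a list" by (induction t) auto
  have fstB: "map fst ?B = powers_mult u t (map fst zs)" by (simp add: len)
  have zip_map: "zip (map ((*) a \<circ> fst) ys) (map ((*) b \<circ> snd) ys) = map (\<lambda>z. (a * fst z, b * snd z)) ys" for a b ys
    by (induction ys) auto
  have "triangular (map (\<lambda>z. (u ^ t * fst z, u0 ^ t * snd z)) ys @ ?B)"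
    if "triangular ys" "set (map snd ys) \<subseteq> S" for ys
    using that
  proof (induction ys)
    case Nil show ?case using Suc by simp
  next
    case (Cons z ys)
    let ?A = "map (\<lambda>z. (u ^ t * fst z, u0 ^ t * snd z)) ys"
    have "u ^ t * (snd z - fst z) \<in> lspan E (map ((*) (u ^ t)) (map fst ys))"
      by (rule lspan_map_mult) (use Cons.prems(1) in simp)
    hence 1: "u ^ t * (snd z - fst z) \<in> lspan E (map fst (?A @ ?B))"
      using lspan_append_left esubringD(8)[OF E] by (simp add: comp_def)
    have "(u0 ^ t - u ^ t) * snd z \<in> polys_below S u t"
      by (rule power_diff_polys[OF S(1) d]) (use Cons.prems(2) in auto)
    hence "(u0 ^ t - u ^ t) * snd z \<in> lspan E (map fst ?B)"
      unfolding fstB using polys_below_lspan[OF S(2) _ S(1)] by blast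
    hence 2: "(u0 ^ t - u ^ t) * snd z \<in> lspan E (map fst (?A @ ?B))"
      using lspan_append_right esubringD(8)[OF E] by simp
    have "u0 ^ t * snd z - u ^ t * fst z = u ^ t * (snd z - fst z) + (u0 ^ t - u ^ t) * snd z"
      by (simp add: algebra_simps)
    thus ?case using lspan_esubring_add[OF E 1 2] Cons by simp
  qed
  from this[OF zs] show ?case by (simp add: zip_append len zip_map)
qed simp

text \<open>If each generator is changed by an element of the ring of the later ones, then u0^t w0 -
  u^t w splits into u^t (w0 - w) and (u0^t - u^t) w0. The first involves later monomials of the same
  block, the second only lower powers of \<open>u\<close>.\<close>

lemma triangular_monomials:
  assumes q: "q \<ge> 2"
  shows "AS_tower q us \<Longrightarrow> length us0 = length us \<Longrightarrow> \<forall>u\<in>set us0. e * u = u \<Longrightarrow>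
    (\<forall>k<length us. us0 ! k - us ! k \<in> ringgen E (drop (Suc k) us)) \<Longrightarrow>
    triangular (zip (monomials e q us) (monomials e q us0)) \<and> set (monomials e q us0) \<subseteq> ringgen E us \<and>
    length (monomials e q us0) = length (monomials e q us)"
proof (induction us arbitrary: us0)
  case Nil
  thus ?case using lspan_esubring_zero[OF E, of "[]"] esubringD(1)[OF E] by simp
next
  case (Cons u us)
  then obtain u0 vs where us0: "us0 = u0 # vs" by (cases us0) auto
  have u: "AS_tower q us" "e * u = u" using Cons.prems(1) by (auto simp: AS_tower_Cons)
  have d: "u0 - u \<in> ringgen E us" using Cons.prems(4)[rule_format, of 0] us0 by simp
  have IH: "triangular (zip (monomials e q us) (monomials e q vs))" "set (monomials e q vs) \<subseteq> ringgen E us"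
    "length (monomials e q vs) = length (monomials e q us)"
    using Cons.IH[OF u(1), of vs] Cons.prems us0 by fastforce+
  note S = ringgen_esubring[OF AS_tower_unit[OF u(1)]]
  let ?z = "zip (monomials e q us) (monomials e q vs)"
  have z: "map fst ?z = monomials e q us" "map snd ?z = monomials e q vs" using IH(3) by auto
  have "triangular (zip (powers_mult u q (map fst ?z)) (powers_mult u0 q (map snd ?z)))"
    by (rule triangular_powers[OF S _ d IH(1)]) (use z IH(2) lspan_monomials[OF q u(1)] in auto)
  moreover have len: "length (powers_mult v t ms) = t * length ms" for v t and ms :: "'a list" by (induction t) auto
  have S': "esubring e (ringgen E (u # us))" using polys_esubring[OF S u(2)] by simp
  have u0: "u0 \<in> ringgen E (u # us)"
  proof -
    have "u0 - u \<in> ringgen E (u # us)" "u \<in> ringgen E (u # us)"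
      using d polys_const[OF S] polys_var[OF S u(2)] by auto
    from esubringD(5)[OF S' this] show ?thesis by simp
  qed
  have "u0 ^ k * m \<in> ringgen E (u # us)" if "m \<in> set (monomials e q vs)" for k m
    using esubring_power_mult[OF S' u0, of m k] that polys_const[OF S] IH(2) by auto
  hence "set (monomials e q (u0 # vs)) \<subseteq> ringgen E (u # us)"
    by (auto simp: set_powers_mult)
  ultimately show ?case using us0 z IH(3) len by simp
qed

text \<open>The monomials may be dependent, because the degree of the tower is not known. A pair is
  dropped when its first component depends on later ones; this changes no span, so the remaining
  pairs stay triangular.\<close>

lemma prune:
  "triangular zs \<Longrightarrow> \<exists>ys. set ys \<subseteq> set zs \<and> triangular ys \<and> indep E (map fst ys) \<and>
    lspan E (map fst ys) = lspan E (map fst zs)"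
proof (induction zs)
  case (Cons z zs)
  then obtain ys where ys: "set ys \<subseteq> set zs" "triangular ys" "indep E (map fst ys)"
    "lspan E (map fst ys) = lspan E (map fst zs)" by auto
  show ?case
  proof (cases "fst z \<in> lspan E (map fst zs)")
    case True
    have "lspan E (fst z # map fst zs) = lspan E (map fst zs)"
      using True lspan_subset_Cons[OF esubringD(8)[OF E]] lspan_esubring_add[OF E] lspan_esubring_scale[OF E]
      by (force elim!: lspan_ConsE)
    thus ?thesis using ys by (intro exI[of _ ys]) auto
  next
    case False
    have "lspan E (fst z # map fst ys) = lspan E (fst z # map fst zs)" using ys(4) by (simp add: lspan.simps)
    thus ?thesis using ys Cons.prems False by (intro exI[of _ "z # ys"]) auto
  qed
qed auto

text \<open>An additive splitting of the coefficients passes to combinations: the part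
  \<open>c\<close> of a coefficient moves from \<open>fst p\<close> to \<open>snd p\<close>, and the
  error is absorbed by the later entries.\<close>

lemma lspan_split:
  assumes A: "\<And>x y. x \<in> A \<Longrightarrow> y \<in> A \<Longrightarrow> x + y \<in> A" and C: "C \<subseteq> E"
    and dec: "\<And>x. x \<in> E \<Longrightarrow> \<exists>a\<in>A. \<exists>c\<in>C. x = a + c"
  shows "triangular zs \<Longrightarrow> z \<in> lspan E (map fst zs) \<Longrightarrow>
    \<exists>a\<in>lspan A (map fst zs). \<exists>c\<in>lspan C (map snd zs). z = a + c"
proof (induction zs arbitrary: z)
  case (Cons p zs)
  have "z \<in> lspan E (fst p # map fst zs)" using Cons.prems(2) by simp
  then obtain b z' where z: "z = b * fst p + z'" "b \<in> E" "z' \<in> lspan E (map fst zs)" by (rule lspan_ConsE)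
  obtain a c where ac: "a \<in> A" "c \<in> C" "b = a + c" using dec[OF z(2)] by blast
  have "c * (snd p - fst p) \<in> lspan E (map fst zs)"
    using lspan_esubring_scale[OF E] Cons.prems(1) ac(2) C by auto
  hence "z' - c * (snd p - fst p) \<in> lspan E (map fst zs)" by (rule lspan_esubring_diff[OF E z(3)])
  then obtain a' c' where ac': "a' \<in> lspan A (map fst zs)" "c' \<in> lspan C (map snd zs)" "z' - c * (snd p - fst p) = a' + c'"
    using Cons.IH Cons.prems(1) by (meson triangular.simps(2))
  have "z = (a * fst p + a') + (c * snd p + c')"
    using z(1) ac(3) ac'(3) by (simp add: algebra_simps)
  thus ?case using lspan_ConsI[OF ac(1) ac'(1)] lspan_ConsI[OF ac(2) ac'(2)] by (metis list.simps(9))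
qed auto

text \<open>A lattice over the projective line glued from \<open>A\<close>-combinations of the \<open>w\<close> and
  \<open>C\<close>-combinations of the \<open>w0\<close> by a unipotent matrix has as many sections as the trivial one.\<close>

lemma lattice_sections:
  assumes fE: "efield e E"
    and A: "A \<subseteq> E" "0 \<in> A" "\<And>x y. x \<in> A \<Longrightarrow> y \<in> A \<Longrightarrow> x + y \<in> A"
    and C: "C \<subseteq> E" "0 \<in> C" "\<And>x y. x \<in> C \<Longrightarrow> y \<in> C \<Longrightarrow> x + y \<in> C" "\<And>x. x \<in> C \<Longrightarrow> - x \<in> C"
    and dec: "\<And>x. x \<in> E \<Longrightarrow> \<exists>a\<in>A. \<exists>c\<in>C. x = a + c" and F: "finite F" "F \<subseteq> A" "F \<subseteq> C"
  shows "triangular zs \<Longrightarrow> indep E (map fst zs) \<Longrightarrow> \<forall>z\<in>set zs. e * fst z = fst z \<Longrightarrow> \<exists>Y. finite Y \<and>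
    Y \<subseteq> lspan A (map fst zs) \<inter> lspan C (map snd zs) \<and> card Y = card F ^ length zs"
proof (induction zs)
  case Nil
  show ?case by (intro exI[of _ "{0}"]) simp
next
  case (Cons z zs)
  then obtain Y where Y: "finite Y" "Y \<subseteq> lspan A (map fst zs) \<inter> lspan C (map snd zs)" "card Y = card F ^ length zs"
    by auto
  let ?I = "lspan A (map fst (z # zs)) \<inter> lspan C (map snd (z # zs))"
  have neg: "- x \<in> lspan C ws" if "x \<in> lspan C ws" for x ws using lspan_scale[of C "- 1" C x ws] C(4) that by simp
  \<comment> \<open>A section with leading coefficient \<open>a\<close>: the difference of
    \<open>a * snd z\<close> and \<open>a * fst z\<close> splits into an \<open>A\<close> part and a
    \<open>C\<close> part, and moving each to its own side gives two descriptions of one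
    element.\<close>
  have "\<exists>\<alpha>\<in>lspan A (map fst zs). a * fst z + \<alpha> \<in> ?I" if a: "a \<in> F" for a
  proof -
    have "a * (snd z - fst z) \<in> lspan E (map fst zs)"
      using lspan_esubring_scale[OF E, of a] a F A(1) Cons.prems(1) by auto
    then obtain \<alpha> \<gamma> where *: "\<alpha> \<in> lspan A (map fst zs)" "\<gamma> \<in> lspan C (map snd zs)" "a * (snd z - fst z) = \<alpha> + \<gamma>"
      using lspan_split[OF A(3) C(1) dec] Cons.prems(1) by (meson triangular.simps(2))
    have "a * fst z + \<alpha> = a * snd z + - \<gamma>" using *(3) by (simp add: algebra_simps)
    moreover have "a * snd z + - \<gamma> \<in> lspan C (map snd (z # zs))" using lspan_ConsI[OF _ neg[OF *(2)], of a "snd z"] a F(3) by auto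
    moreover have "a * fst z + \<alpha> \<in> lspan A (map fst (z # zs))" using lspan_ConsI[OF _ *(1), of a "fst z"] a F(2) by auto
    ultimately have "a * fst z + \<alpha> \<in> ?I" by (metis IntI)
    thus ?thesis using *(1) by blast
  qed
  then obtain \<alpha> where \<alpha>: "\<And>a. a \<in> F \<Longrightarrow> \<alpha> a \<in> lspan A (map fst zs)" "\<And>a. a \<in> F \<Longrightarrow> a * fst z + \<alpha> a \<in> ?I" by metis
  let ?h = "\<lambda>(a, y). (a * fst z + \<alpha> a) + y"
  have AE: "lspan A ws \<subseteq> lspan E ws" for ws by (rule lspan_mono[OF A(1)])
  have "inj_on ?h (F \<times> Y)"
  proof (rule inj_onI, clarify)
    fix a y b y' assume a: "a \<in> F" "b \<in> F" and y: "y \<in> Y" "y' \<in> Y"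
      and eq: "a * fst z + \<alpha> a + y = b * fst z + \<alpha> b + y'"
    have "(a - b) * fst z = (\<alpha> b - \<alpha> a) + (y' - y)" using eq by (simp add: algebra_simps)
    moreover have "(\<alpha> b - \<alpha> a) + (y' - y) \<in> lspan E (map fst zs)"
      using \<alpha>(1) a y Y(2) AE by (intro lspan_esubring_add[OF E] lspan_esubring_diff[OF E]) blast+
    ultimately have m: "(a - b) * fst z \<in> lspan E (map fst zs)" by simp
    have ab: "a - b \<in> E" using esubringD(7)[OF E] a F A(1) by blast
    have "a - b = 0"
    proof (rule ccontr)
      assume "a - b \<noteq> 0"
      note i = efield_iv[OF fE ab this]
      have "iv e (a - b) * ((a - b) * fst z) \<in> lspan E (map fst zs)" by (rule lspan_esubring_scale[OF E i(1) m])
      moreover have "iv e (a - b) * ((a - b) * fst z) = fst z" using i(3) Cons.prems(3) by (simp add: mult.assoc[symmetric])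
      ultimately show False using Cons.prems(2) by simp
    qed
    thus "a = b \<and> y = y'" using eq by simp
  qed
  hence "card (?h ` (F \<times> Y)) = card F ^ length (z # zs)" using Y by (simp add: card_image card_cartesian_product)
  moreover have "?h ` (F \<times> Y) \<subseteq> ?I"
  proof (intro image_subsetI, clarify)
    fix a y assume a: "a \<in> F" and y: "y \<in> Y"
    have "y \<in> lspan A (map fst (z # zs))" "y \<in> lspan C (map snd (z # zs))"
      using y Y(2) lspan_subset_Cons[OF A(2)] lspan_subset_Cons[OF C(2)] by fastforce+
    thus "a * fst z + \<alpha> a + y \<in> ?I" using \<alpha>(2)[OF a] lspan_add[OF A(3)] lspan_add[OF C(3)] by blast
  qed
  ultimately show ?case using F(1) Y(1) by (intro exI[of _ "?h ` (F \<times> Y)"]) simp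
qed

end

section \<open>Artin-Schreier generators above infinity\<close>

text \<open>Read from the tail, the order of adjunction is u_1, y_1, u_2, y_2 and so on; each y
  comes after the u of its index.\<close>

primrec gens :: "(nat \<Rightarrow> 'a) \<Rightarrow> (nat \<Rightarrow> 'a) \<Rightarrow> nat \<Rightarrow> 'a list" where
  "gens y u 0 = []"
| "gens y u (Suc i) = y (Suc i) # u (Suc i) # gens y u i"

definition prev :: "(nat \<Rightarrow> 'a) \<Rightarrow> nat \<Rightarrow> 'a list" where
  "prev T i = map T (rev [1..<Suc i])"

lemma gens_cong: "(\<And>j. 1 \<le> j \<Longrightarrow> j \<le> i \<Longrightarrow> u j = u' j) \<Longrightarrow> gens y u i = gens y u' i"
  by (induction i) auto

lemma prev_Suc: "prev T (Suc i) = T (Suc i) # prev T i"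
  by (simp add: prev_def)

locale AS_base = base_field e L K for e :: "'a::comm_ring_1" and L K +
  fixes s :: 'a and q :: nat
  assumes s: "s \<in> L" "s \<noteq> 0" and q: "q \<ge> 2"
    and frobenius: "\<And>x y. x \<in> L \<Longrightarrow> y \<in> L \<Longrightarrow> (x + y) ^ q = x ^ q + y ^ q"
begin

text \<open>Only the poles of \<open>s\<close> count, that is the places above infinity. With 1/s in
  place of \<open>s\<close> the same set describes the places above zero.\<close>

definition regular :: "'a set" where
  "regular = {z \<in> L. \<forall>V. vring V \<longrightarrow> s \<notin> V \<longrightarrow> z \<in> V}"

text \<open>The elements \<open>z\<close> with \<open>q v(z) \<ge> v(s)\<close> at all poles of \<open>s\<close>.\<close>

definition small :: "'a set" where
  "small = {z \<in> L. z ^ q * iv e s \<in> regular}"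

lemmas ivs = efield_iv[OF L s]

lemma regular_L: "regular \<subseteq> L"
  by (auto simp: regular_def)

lemma regular_ring: "esubring e regular"
  unfolding esubring_def
proof (intro conjI ballI)
  show "e \<in> regular" using LD(1) vring_ring(1) by (simp add: regular_def)
  fix x assume x: "x \<in> regular"
  show "e * x = x" "- x \<in> regular" using x LD(2,4) vring_ring(4) by (simp_all add: regular_def)
  fix y assume "y \<in> regular"
  thus "x + y \<in> regular" "x * y \<in> regular" using x LD(5,6) vring_ring(5,6) by (simp_all add: regular_def)
qed

lemmas regularD = esubringD[OF regular_ring]

lemma K_regular: "K \<subseteq> regular"
  using KL vringD(2) by (auto simp: regular_def)

lemma ivs_regular: "iv e s \<in> regular"
  using ivs(1) vringD(5)[OF _ s(1)] by (simp add: regular_def)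

lemma power_L: "z \<in> L \<Longrightarrow> z ^ q \<in> L"
  using esubring_power[OF L', of z q] q by simp

lemma regular_power: "z \<in> regular \<Longrightarrow> z ^ q \<in> regular"
  using esubring_power[OF regular_ring, of z q] q by simp

lemma frobenius_zero: "(0::'a) ^ q = 0"
  using q by (simp add: power_0_left)

lemma frobenius_uminus: "x \<in> L \<Longrightarrow> (- x) ^ q = - (x ^ q)"
  using frobenius[of x "- x"] LD(4)[of x] frobenius_zero by (simp add: eq_neg_iff_add_eq_0 add.commute)

lemma frobenius_diff: "x \<in> L \<Longrightarrow> y \<in> L \<Longrightarrow> (x - y) ^ q = x ^ q - y ^ q"
  using frobenius[of x "- y"] frobenius_uminus[of y] LD(4)[of y] by simp

lemma K_perfect:
  assumes "a \<in> K"
  shows "\<exists>b\<in>K. b ^ q = a"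
proof -
  have "inj_on (\<lambda>x. x ^ q) K"
  proof (rule inj_onI)
    fix x y assume x: "x \<in> K" "y \<in> K" "x ^ q = y ^ q"
    have "x \<in> L" "y \<in> L" using x KL by auto
    hence "(x - y) ^ q = 0" using frobenius_diff[of x y] x(3) by simp
    thus "x = y" using efield_power_nz[OF K KD(7)[OF x(1,2)]] by auto
  qed
  moreover have "(\<lambda>x. x ^ q) ` K \<subseteq> K" using esubring_power[OF K'] q by auto
  ultimately have "(\<lambda>x. x ^ q) ` K = K" using finK by (simp add: endo_inj_surj)
  thus ?thesis using assms by (metis imageE)
qed

lemma regular_root:
  assumes "z \<in> L" "z ^ q \<in> regular"
  shows "z \<in> regular"
  using assms vring_power[of _ z q] q by (auto simp: regular_def)

lemma small_L: "small \<subseteq> L"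
  by (auto simp: small_def)

lemma regular_small: "z \<in> regular \<Longrightarrow> z \<in> small"
  using regularD(6)[OF regular_power ivs_regular] regular_L by (auto simp: small_def)

lemma small_add:
  assumes "z \<in> small" "w \<in> small"
  shows "z + w \<in> small"
proof -
  have z: "z \<in> L" "w \<in> L" "z ^ q * iv e s \<in> regular" "w ^ q * iv e s \<in> regular" using assms by (auto simp: small_def)
  have "(z + w) ^ q * iv e s = z ^ q * iv e s + w ^ q * iv e s" using frobenius[OF z(1,2)] by (simp only: distrib_right)
  hence "(z + w) ^ q * iv e s \<in> regular" using regularD(5)[OF z(3,4)] by (simp only:)
  thus ?thesis using LD(5)[OF z(1,2)] by (simp add: small_def)
qed

lemma small_scale: "a \<in> K \<Longrightarrow> z \<in> small \<Longrightarrow> a * z \<in> small"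
  using regularD(6)[OF regular_power, of a "z ^ q * iv e s"] K_regular LD(6) KL
  by (auto simp: small_def power_mult_distrib mult.assoc)

text \<open>Two poles of relative order at most 1/q add up to at most that of \<open>s\<close>, as q
  is at least 2. On q-th powers: the product of the two regular elements z^q / s and w^q / s only
  misses a power of 1/s.\<close>

lemma small_mult:
  assumes "z \<in> small" "w \<in> small"
  shows "z * w * iv e s \<in> regular"
proof (rule regular_root)
  have zL: "z \<in> L" "w \<in> L" using assms small_L by auto
  show "z * w * iv e s \<in> L" using LD(6)[OF LD(6)[OF zL] ivs(1)] .
  obtain k where k: "q = Suc (Suc k)" using q by (metis add_2_eq_Suc le_Suc_ex)
  have "(z * w * iv e s) ^ q = (iv e s ^ k) * ((z ^ q * iv e s) * (w ^ q * iv e s))"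
    by (simp add: power_mult_distrib k mult_ac)
  also have "\<dots> \<in> regular"
    by (rule esubring_power_mult[OF regular_ring ivs_regular regularD(6)]) (use assms in \<open>auto simp: small_def\<close>)
  finally show "(z * w * iv e s) ^ q \<in> regular" .
qed

lemma small_ivs: "z \<in> small \<Longrightarrow> z * iv e s \<in> regular"
  using small_mult[OF _ regular_small[OF regularD(1)], of z] LD(3) small_L by auto

lemma regular_AS:
  assumes "z \<in> L" "z ^ q - z \<in> regular"
  shows "z \<in> regular"
  using assms vring_artin_schreier[OF _ assms(1) q] by (auto simp: regular_def)

text \<open>At a pole, z^q - z is z^q times a unit, because the correction 1/z^(q-1) vanishes
  there.\<close>

lemma AS_pole:
  assumes V: "vring V" and z: "z \<in> L" "z \<notin> V"
  shows "e - iv e z ^ (q - 1) \<in> units V" "z ^ q * (e - iv e z ^ (q - 1)) = z ^ q - z"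
proof -
  have z0: "z \<noteq> 0" using z vring_ring(8)[OF V] by auto
  note iz = efield_iv[OF L z(1) z0]
  obtain k where k: "q - 1 = Suc k" using q by (cases "q - 1") auto
  have "iv e z * iv e z ^ k \<in> maxid V"
  proof (cases k)
    case 0
    thus ?thesis using iv_in_maxid[OF V z] by simp
  next
    case (Suc j)
    have "iv e z ^ k \<in> V" using esubring_power[OF vringD(1)[OF V], of "iv e z" k] iv_in_maxid[OF V z] maxid_sub Suc by blast
    thus ?thesis by (rule maxid_mult[OF V iv_in_maxid[OF V z]])
  qed
  hence "- (iv e z ^ (q - 1)) \<in> maxid V" using maxid_uminus[OF V] k by simp
  from units_add_maxid[OF V unit_in_units[OF V] this] show "e - iv e z ^ (q - 1) \<in> units V" by simp
  have "z ^ q = z ^ (q - 1) * z" using q by (metis power_minus_mult zero_less_numeral order_less_le_trans)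
  hence "z ^ q * iv e z ^ (q - 1) = iv e z ^ (q - 1) * (z ^ (q - 1) * z)" by (simp add: mult.commute)
  also have "\<dots> = z" using efield_power_iv[OF L iz(1,4) z(1), of "q - 1"] iv_iv[OF L z(1)] by simp
  finally show "z ^ q * (e - iv e z ^ (q - 1)) = z ^ q - z"
    using LD(3)[OF power_L[OF z(1)]] by (simp add: right_diff_distrib)
qed

lemma AS_quotient:
  assumes V: "vring V" and z: "z \<in> L" "z \<notin> V" and w: "(z ^ q - z) * w \<in> V"
  shows "z ^ q * w \<in> V"
proof -
  note p = AS_pole[OF V z]
  note u = unitsD[OF V p(1)]
  have "iv e (e - iv e z ^ (q - 1)) * ((z ^ q - z) * w) \<in> V" using vring_ring(6)[OF V u(4) w] .
  moreover have "iv e (e - iv e z ^ (q - 1)) * ((z ^ q - z) * w) =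
      (iv e (e - iv e z ^ (q - 1)) * (e - iv e z ^ (q - 1))) * (z ^ q * w)"
    unfolding p(2)[symmetric] by (simp add: mult_ac)
  moreover have "e * (z ^ q * w) = z ^ q * w" using LD(2)[OF power_L[OF z(1)]] by (simp add: mult.assoc[symmetric])
  ultimately show ?thesis using efield_iv(3)[OF L u(2,3)] by simp
qed

lemma small_AS:
  assumes z: "z \<in> L" and eq: "(z ^ q - z) * iv e s \<in> regular"
  shows "z \<in> small"
proof -
  have "z ^ q * iv e s \<in> V" if V: "vring V" "s \<notin> V" for V
  proof (cases "z \<in> V")
    case True
    have "z ^ q \<in> V" using esubring_power[OF vringD(1)[OF V(1)] True, of q] q by simp
    thus ?thesis using vring_ring(6)[OF V(1)] vringD(5)[OF V(1) s(1) V(2)] by blast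
  next
    case False
    thus ?thesis using AS_quotient[OF V(1) z False] eq V by (auto simp: regular_def)
  qed
  thus ?thesis using z LD(6)[OF power_L[OF z] ivs(1)] by (auto simp: small_def regular_def)
qed

text \<open>The right hand side of an Artin-Schreier equation matters only modulo regular elements,
  and what remains is to be a K-linear combination of known poles.\<close>

definition mod_regular :: "'a list \<Rightarrow> 'a set" where
  "mod_regular ws = {x + y |x y. x \<in> lspan K ws \<and> y \<in> regular}"

lemma mod_regularI: "x \<in> lspan K ws \<Longrightarrow> y \<in> regular \<Longrightarrow> x + y \<in> mod_regular ws"
  by (auto simp: mod_regular_def)

lemma mod_regular_lspan: "x \<in> lspan K ws \<Longrightarrow> x \<in> mod_regular ws"
  using mod_regularI[OF _ regularD(8), of x ws] by simp

lemma mod_regular_regular: "y \<in> regular \<Longrightarrow> y \<in> mod_regular ws"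
  using mod_regularI[OF lspan_esubring_zero[OF K'], of y ws] by simp

lemma mod_regular_add:
  assumes "x \<in> mod_regular ws" "y \<in> mod_regular ws"
  shows "x + y \<in> mod_regular ws"
proof -
  obtain a b c d where "x = a + b" "a \<in> lspan K ws" "b \<in> regular" "y = c + d" "c \<in> lspan K ws" "d \<in> regular"
    using assms by (auto simp: mod_regular_def)
  moreover from this have "x + y = (a + c) + (b + d)" by (simp add: algebra_simps)
  ultimately show ?thesis using mod_regularI lspan_esubring_add[OF K'] regularD(5) by metis
qed

lemma mod_regular_scale:
  assumes "k \<in> K" "x \<in> mod_regular ws"
  shows "k * x \<in> mod_regular ws"
proof -
  obtain a b where "x = a + b" "a \<in> lspan K ws" "b \<in> regular" using assms by (auto simp: mod_regular_def)
  moreover from this have "k * x = k * a + k * b" by (simp add: algebra_simps)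
  ultimately show ?thesis
    using mod_regularI lspan_esubring_scale[OF K' assms(1)] regularD(6) K_regular assms(1) by (metis subsetD)
qed

lemma mod_regular_subset: "mod_regular ws \<subseteq> mod_regular (w # ws)"
  using lspan_subset_Cons[OF KD(8)] unfolding mod_regular_def by blast

subsection \<open>Chains\<close>

text \<open>In a chain above \<open>s\<close> the poles of the entries have order \<open>1/q\<close>, \<open>1/q\<^sup>2\<close>, \<dots> of that of \<open>s\<close>.\<close>

primrec chain :: "'a list \<Rightarrow> bool" where
  "chain [] = True"
| "chain (c # cs) = (chain cs \<and> c \<in> L \<and>
    (\<exists>\<gamma>\<in>K. \<gamma> \<noteq> 0 \<and> c ^ q - c - \<gamma> * hd (cs @ [s]) \<in> regular))"

lemma chain_L: "chain cs \<Longrightarrow> set cs \<subseteq> L"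
  by (induction cs) auto

lemma chain_hd_L: "chain cs \<Longrightarrow> hd (cs @ [s]) \<in> L"
  using chain_L[of cs] s by (cases cs) auto

lemma chain_pole:
  assumes V: "vring V" "s \<notin> V"
  shows "chain cs \<Longrightarrow> hd (cs @ [s]) \<notin> V"
proof (induction cs)
  case (Cons c cs)
  obtain \<gamma> where g: "\<gamma> \<in> K" "\<gamma> \<noteq> 0" "c ^ q - c - \<gamma> * hd (cs @ [s]) \<in> regular" using Cons.prems by auto
  have hL: "hd (cs @ [s]) \<in> L" using chain_hd_L Cons.prems by auto
  show ?case
  proof
    assume "hd ((c # cs) @ [s]) \<in> V"
    hence c: "c \<in> V" by simp
    have "c ^ q \<in> V" using esubring_power[OF vringD(1)[OF V(1)] c, of q] q by simp
    moreover have "c ^ q - c - \<gamma> * hd (cs @ [s]) \<in> V" using g(3) V unfolding regular_def by blast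
    ultimately have "(c ^ q - c) - (c ^ q - c - \<gamma> * hd (cs @ [s])) \<in> V"
      using vring_ring(7)[OF V(1) vring_ring(7)[OF V(1) _ c]] by blast
    moreover have "(c ^ q - c) - (c ^ q - c - \<gamma> * hd (cs @ [s])) = \<gamma> * hd (cs @ [s])" by simp
    ultimately have "\<gamma> * hd (cs @ [s]) \<in> V" by (simp only:)
    hence "iv e \<gamma> * (\<gamma> * hd (cs @ [s])) \<in> V"
      using vring_ring(6)[OF V(1)] efield_iv(1)[OF K g(1,2)] vringD(2)[OF V(1)] by blast
    moreover have "iv e \<gamma> * (\<gamma> * hd (cs @ [s])) = hd (cs @ [s])"
      using efield_iv(3)[OF K g(1,2)] LD(2)[OF hL] by (simp add: mult.assoc[symmetric])
    ultimately show False using Cons by auto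
  qed
qed (use V in auto)

text \<open>Let c^q - c be congruent to \<gamma> t, and let b^q = a / \<gamma>, a root that exists
  in the finite field \<open>K\<close>. Then a t is congruent to (b c)^q - b c plus a multiple of c.
  So, up to h^q - h, each entry of the chain can be traded for the one added after it until only the
  head is left.\<close>

lemma chain_reduce:
  "chain cs \<Longrightarrow> p \<in> lspan K (cs @ [s]) \<Longrightarrow>
    \<exists>h\<in>lspan K cs. \<exists>a\<in>K. p - (h ^ q - h) - a * hd (cs @ [s]) \<in> regular"
proof (induction cs arbitrary: p)
  case Nil
  hence "p \<in> lspan K [s]" by simp
  then obtain a where "a \<in> K" "p = a * s" by (auto elim!: lspan_ConsE)
  thus ?case using regularD(8) frobenius_zero by (intro bexI[of _ 0] bexI[of _ a]) auto
next
  case (Cons c cs)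
  obtain \<gamma> where g: "\<gamma> \<in> K" "\<gamma> \<noteq> 0" "c ^ q - c - \<gamma> * hd (cs @ [s]) \<in> regular" using Cons.prems(1) by auto
  have cL: "c \<in> L" "chain cs" using Cons.prems(1) by auto
  have "p \<in> lspan K (c # (cs @ [s]))" using Cons.prems(2) by simp
  then obtain a p' where p: "p = a * c + p'" "a \<in> K" "p' \<in> lspan K (cs @ [s])" by (rule lspan_ConsE)
  obtain h a' where h: "h \<in> lspan K cs" "a' \<in> K" "p' - (h ^ q - h) - a' * hd (cs @ [s]) \<in> regular"
    using Cons.IH[OF cL(2) p(3)] by blast
  note ig = efield_iv[OF K g(1,2)]
  obtain b where b: "b \<in> K" "b ^ q = a' * iv e \<gamma>" using K_perfect[OF KD(6)[OF h(2) ig(1)]] by blast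
  have bg: "b ^ q * \<gamma> = a'" using b(2) ig(3) KD(3)[OF h(2)] by (simp add: mult.assoc)
  have hL: "h \<in> L" using lspan_subset[OF L' KL chain_L[OF cL(2)]] h(1) by blast
  have bcL: "b * c \<in> L" using LD(6) b KL cL by blast
  have bq: "b ^ q \<in> K" using esubring_power[OF K' b(1), of q] q by simp
  let ?h = "b * c + h" and ?t = "hd (cs @ [s])"
  have "?h ^ q = b ^ q * c ^ q + h ^ q" using frobenius[OF bcL hL] by (simp add: power_mult_distrib)
  hence "p - (?h ^ q - ?h) - (a - b ^ q + b) * c = (p' - (h ^ q - h) - a' * ?t) - b ^ q * (c ^ q - c - \<gamma> * ?t) + (a' - b ^ q * \<gamma>) * ?t"
    unfolding p(1) by (simp add: algebra_simps)
  hence "p - (?h ^ q - ?h) - (a - b ^ q + b) * c = (p' - (h ^ q - h) - a' * ?t) - b ^ q * (c ^ q - c - \<gamma> * ?t)"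
    unfolding bg by simp
  also have "\<dots> \<in> regular" using regularD(7)[OF h(3) regularD(6)[OF _ g(3)]] bq K_regular by blast
  finally have "p - (?h ^ q - ?h) - (a - b ^ q + b) * hd ((c # cs) @ [s]) \<in> regular" by simp
  moreover have "a - b ^ q + b \<in> K" using KD(5)[OF KD(7)[OF p(2) bq] b(1)] .
  moreover have "?h \<in> lspan K (c # cs)" by (rule lspan_ConsI[OF b(1) h(1)])
  ultimately show ?case by blast
qed

text \<open>The poles of the monomials are at most those of \<open>s\<close> divided by the head of
  the chain; this leaves room for the powers of the next generator.\<close>

definition bounded_monomials :: "'a list \<Rightarrow> 'a list \<Rightarrow> bool" where
  "bounded_monomials us cs \<longleftrightarrow> (\<forall>V. vring V \<longrightarrow> s \<notin> V \<longrightarrow>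
    (\<forall>w\<in>set (monomials e q us). w * (hd (cs @ [s]) * iv e s) \<in> V))"

lemma bounded_monomials_regular:
  assumes "bounded_monomials us cs" "u \<in> regular"
  shows "bounded_monomials (u # us) cs"
  unfolding bounded_monomials_def
proof (intro allI impI ballI)
  fix V w assume V: "vring V" "s \<notin> V" and "w \<in> set (monomials e q (u # us))"
  then obtain k m where w: "w = u ^ k * m" "m \<in> set (monomials e q us)" by (auto simp: set_powers_mult)
  have "u \<in> V" using assms(2) V by (auto simp: regular_def)
  thus "w * (hd (cs @ [s]) * iv e s) \<in> V"
    using esubring_power_mult[OF vringD(1)[OF V(1)]] assms(1) V w unfolding bounded_monomials_def
    by (metis mult.assoc)
qed

text \<open>The pole order of \<open>c\<close> is 1/q of that of the old head \<open>t\<close>. For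
  k < q the poles of c^k * c are at most those of \<open>t\<close>, exactly the room that was
  left.\<close>

lemma bounded_monomials_chain:
  assumes b: "bounded_monomials us cs" and c: "chain (c # cs)"
  shows "bounded_monomials (c # us) (c # cs)"
  unfolding bounded_monomials_def
proof (intro allI impI ballI)
  fix V w assume V: "vring V" "s \<notin> V" and "w \<in> set (monomials e q (c # us))"
  then obtain k m where w: "k < q" "w = c ^ k * m" "m \<in> set (monomials e q us)" by (auto simp: set_powers_mult)
  let ?t = "hd (cs @ [s])"
  have cL: "c \<in> L" "chain cs" using c by auto
  have tV: "?t \<notin> V" using chain_pole[OF V cL(2)] .
  have tL: "?t \<in> L" "?t \<noteq> 0" using chain_hd_L[OF cL(2)] tV vring_ring(8)[OF V(1)] by auto
  note it = efield_iv[OF L tL]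
  have itV: "iv e ?t \<in> V" using vringD(5)[OF V(1) tL(1) tV] .
  have cV: "c \<notin> V" using chain_pole[OF V c] by simp
  have c0: "c \<noteq> 0" using cV vring_ring(8)[OF V(1)] by auto
  obtain \<gamma> where g: "\<gamma> \<in> K" "c ^ q - c - \<gamma> * ?t \<in> regular" using c by auto
  have "(c ^ q - c - \<gamma> * ?t) * iv e ?t + \<gamma> \<in> V"
    using vring_ring(5,6)[OF V(1)] g V itV vringD(2)[OF V(1)] by (auto simp: regular_def)
  moreover have "(c ^ q - c - \<gamma> * ?t) * iv e ?t + \<gamma> = (c ^ q - c) * iv e ?t - \<gamma> * (?t * iv e ?t) + \<gamma>"
    by (simp add: algebra_simps)
  ultimately have "(c ^ q - c) * iv e ?t \<in> V" using it(2) KD(3)[OF g(1)] by simp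
  hence cq: "c ^ q * iv e ?t \<in> V" by (rule AS_quotient[OF V(1) cL(1) cV])
  have icV: "iv e c \<in> V" using vringD(5)[OF V(1) cL(1) cV] .
  note ic = efield_iv[OF L cL(1) c0]
  have ctL: "c ^ Suc k * iv e ?t \<in> L" by (rule esubring_power_mult[OF L' cL(1) it(1)])
  have "iv e c ^ (q - Suc k) * (c ^ q * iv e ?t) = iv e c ^ (q - Suc k) * (c ^ (q - Suc k) * (c ^ Suc k * iv e ?t))"
    using w(1) by (simp add: mult.assoc[symmetric] power_add[symmetric] del: power_Suc)
  also have "\<dots> = c ^ Suc k * iv e ?t"
    using efield_power_iv[OF L ic(1,4) ctL, of "q - Suc k"] iv_iv[OF L cL(1)] by simp
  finally have "c ^ Suc k * iv e ?t \<in> V"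
    using esubring_power_mult[OF vringD(1)[OF V(1)] icV cq, of "q - Suc k"] by simp
  moreover have mV: "m * (?t * iv e s) \<in> V" using b V w(3) unfolding bounded_monomials_def by blast
  ultimately have "(c ^ Suc k * iv e ?t) * (m * (?t * iv e s)) \<in> V" by (rule vring_ring(6)[OF V(1)])
  moreover have "(c ^ Suc k * iv e ?t) * (m * (?t * iv e s)) = (c ^ k * m * (c * iv e s)) * (?t * iv e ?t)"
    by (simp add: mult_ac)
  moreover have "\<dots> = c ^ k * m * (c * iv e s)" using it(2) LD(3)[OF ivs(1)] by (simp add: mult.assoc)
  ultimately show "w * (hd ((c # cs) @ [s]) * iv e s) \<in> V" using w(2) by simp
qed

text \<open>The sequence \<open>T\<close> of Artin-Schreier elements is replaced by one in which every element is
  either regular or the next member of a chain.\<close>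

lemma infinity_generators:
  assumes y: "\<And>j. 1 \<le> j \<Longrightarrow> j \<le> m \<Longrightarrow> y j \<in> regular"
    and T: "\<And>j. j < m \<Longrightarrow> T (Suc j) \<in> L \<and> T (Suc j) ^ q - T (Suc j) \<in> mod_regular (prev T j @ [s])"
  shows "\<exists>u. (\<forall>j<m. u (Suc j) - T (Suc j) \<in> lspan K (prev T j)) \<and>
    (\<forall>V. vring V \<longrightarrow> s \<notin> V \<longrightarrow> (\<forall>w\<in>set (monomials e q (gens y u m)). w * iv e s \<in> V))"
proof -
  have main: "\<exists>u cs. (\<forall>j<i. u (Suc j) - T (Suc j) \<in> lspan K (prev T j)) \<and> chain cs \<and>
      lspan K cs \<subseteq> lspan K (prev T i) \<and> mod_regular (prev T i @ [s]) \<subseteq> mod_regular (cs @ [s]) \<and>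
      bounded_monomials (gens y u i) cs" if "i \<le> m" for i
    using that
  proof (induction i)
    case 0
    have "bounded_monomials (gens y (\<lambda>_. 0) 0) []"
      using ivs(2) LD(2)[OF LD(1)] vring_ring(1) by (simp add: bounded_monomials_def)
    thus ?case by (intro exI[of _ "\<lambda>_. 0"] exI[of _ "[]"]) (simp add: prev_def)
  next
    case (Suc i)
    then obtain u cs where u: "\<forall>j<i. u (Suc j) - T (Suc j) \<in> lspan K (prev T j)" and cs: "chain cs"
      "lspan K cs \<subseteq> lspan K (prev T i)" "mod_regular (prev T i @ [s]) \<subseteq> mod_regular (cs @ [s])"
      "bounded_monomials (gens y u i) cs" by auto
    have yr: "y (Suc i) \<in> regular" using y Suc.prems by simp
    have TL: "T (Suc i) \<in> L" "T (Suc i) ^ q - T (Suc i) \<in> mod_regular (cs @ [s])" using T[of i] Suc.prems cs(3) by auto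
    then obtain p r where p: "p \<in> lspan K (cs @ [s])" "r \<in> regular" "T (Suc i) ^ q - T (Suc i) = p + r"
      by (auto simp: mod_regular_def)
    obtain h a where h: "h \<in> lspan K cs" "a \<in> K" "p - (h ^ q - h) - a * hd (cs @ [s]) \<in> regular"
      using chain_reduce[OF cs(1) p(1)] by blast
    have hL: "h \<in> L" using lspan_subset[OF L' KL chain_L[OF cs(1)]] h(1) by blast
    \<comment> \<open>Subtracting \<open>h\<close> changes the equation by h^q - h and leaves a
      multiple \<open>a\<close> of the head of the chain. For \<open>a = 0\<close> the new element
      is regular; otherwise it extends the chain.\<close>
    define c where "c = T (Suc i) - h"
    have cL: "c \<in> L" using LD(7)[OF TL(1) hL] by (simp add: c_def)
    have "c ^ q - c - a * hd (cs @ [s]) = (p - (h ^ q - h) - a * hd (cs @ [s])) + r"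
      using p(3) frobenius_diff[OF TL(1) hL] by (simp add: c_def algebra_simps)
    hence creg: "c ^ q - c - a * hd (cs @ [s]) \<in> regular" using regularD(5)[OF h(3) p(2)] by (simp only:)
    define u' where "u' = u(Suc i := c)"
    have g: "gens y u' i = gens y u i" by (rule gens_cong) (simp add: u'_def)
    have hprev: "h \<in> lspan K (prev T i)" using h(1) cs(2) by blast
    have u': "\<forall>j<Suc i. u' (Suc j) - T (Suc j) \<in> lspan K (prev T j)"
    proof (intro allI impI)
      fix j assume "j < Suc i"
      show "u' (Suc j) - T (Suc j) \<in> lspan K (prev T j)"
      proof (cases "j = i")
        case True
        thus ?thesis using lspan_esubring_uminus[OF K' hprev] by (simp add: u'_def c_def)
      next
        case False
        thus ?thesis using u \<open>j < Suc i\<close> by (simp add: u'_def)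
      qed
    qed
    have sub: "lspan K (prev T i) \<subseteq> lspan K (prev T (Suc i))" unfolding prev_Suc by (rule lspan_subset_Cons[OF KD(8)])
    have c_in: "c \<in> lspan K (prev T (Suc i))"
    proof -
      have "e * T (Suc i) + - h \<in> lspan K (prev T (Suc i))"
        unfolding prev_Suc by (rule lspan_ConsI[OF KD(1) lspan_esubring_uminus[OF K' hprev]])
      thus ?thesis using LD(2)[OF TL(1)] by (simp add: c_def)
    qed
    have T_eq: "T (Suc i) = c + h" by (simp add: c_def)
    show ?case
    proof (cases "a = 0")
      case True
      hence cr: "c \<in> regular" using creg regular_AS[OF cL] by simp
      have "mod_regular (prev T (Suc i) @ [s]) \<subseteq> mod_regular (cs @ [s])"
      proof
        fix x assume "x \<in> mod_regular (prev T (Suc i) @ [s])"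
        then obtain x1 x2 where x: "x = x1 + x2" "x1 \<in> lspan K (T (Suc i) # (prev T i @ [s]))" "x2 \<in> regular"
          by (auto simp: mod_regular_def prev_Suc)
        from x(2) obtain k z where k: "x1 = k * T (Suc i) + z" "k \<in> K" "z \<in> lspan K (prev T i @ [s])" by (rule lspan_ConsE)
        have "k * c + x2 \<in> regular" using regularD(5,6) cr x(3) k(2) K_regular by blast
        moreover have "k * h \<in> lspan K (cs @ [s])"
          using lspan_append_left[OF lspan_esubring_scale[OF K' k(2) h(1)] KD(8)] .
        moreover have "z \<in> mod_regular (cs @ [s])" using mod_regular_lspan[OF k(3)] cs(3) by blast
        moreover have "x = (k * h + (k * c + x2)) + z" using x(1) k(1) T_eq by (simp add: algebra_simps)
        ultimately show "x \<in> mod_regular (cs @ [s])" using mod_regular_add[OF mod_regularI] by metis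
      qed
      moreover have "bounded_monomials (gens y u' (Suc i)) cs"
        using bounded_monomials_regular[OF bounded_monomials_regular[OF cs(4) cr] yr] g by (simp add: u'_def)
      ultimately show ?thesis using u' cs(1,2) sub by (intro exI[of _ u'] exI[of _ cs]) blast
    next
      case False
      have ch: "chain (c # cs)" using cs(1) cL h(2) False creg by auto
      have "mod_regular (prev T (Suc i) @ [s]) \<subseteq> mod_regular ((c # cs) @ [s])"
      proof
        fix x assume "x \<in> mod_regular (prev T (Suc i) @ [s])"
        then obtain x1 x2 where x: "x = x1 + x2" "x1 \<in> lspan K (T (Suc i) # (prev T i @ [s]))" "x2 \<in> regular"
          by (auto simp: mod_regular_def prev_Suc)
        from x(2) obtain k z where k: "x1 = k * T (Suc i) + z" "k \<in> K" "z \<in> lspan K (prev T i @ [s])" by (rule lspan_ConsE)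
        have "k * h \<in> lspan K (cs @ [s])"
          using lspan_append_left[OF lspan_esubring_scale[OF K' k(2) h(1)] KD(8)] .
        hence "k * c + k * h \<in> lspan K (c # (cs @ [s]))" by (rule lspan_ConsI[OF k(2)])
        hence "(k * c + k * h) + x2 \<in> mod_regular (c # (cs @ [s]))" using mod_regularI x(3) by blast
        moreover have "z \<in> mod_regular (c # (cs @ [s]))"
          using mod_regular_lspan[OF k(3)] cs(3) mod_regular_subset by blast
        moreover have "x = ((k * c + k * h) + x2) + z" using x(1) k(1) T_eq by (simp add: algebra_simps)
        ultimately show "x \<in> mod_regular ((c # cs) @ [s])" using mod_regular_add by (metis append_Cons)
      qed
      moreover have "bounded_monomials (gens y u' (Suc i)) (c # cs)"
        using bounded_monomials_regular[OF bounded_monomials_chain[OF cs(4) ch] yr] g by (simp add: u'_def)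
      moreover have "lspan K (c # cs) \<subseteq> lspan K (prev T (Suc i))"
      proof
        fix x assume "x \<in> lspan K (c # cs)"
        then obtain k z where "x = k * c + z" "k \<in> K" "z \<in> lspan K cs" by (rule lspan_ConsE)
        thus "x \<in> lspan K (prev T (Suc i))"
          using lspan_esubring_add[OF K' lspan_esubring_scale[OF K' _ c_in]] cs(2) sub by blast
      qed
      ultimately show ?thesis using u' ch by (intro exI[of _ u'] exI[of _ "c # cs"]) blast
    qed
  qed
  obtain u cs where u: "\<forall>j<m. u (Suc j) - T (Suc j) \<in> lspan K (prev T j)" "chain cs"
    "bounded_monomials (gens y u m) cs" using main[of m] by auto
  have "w * iv e s \<in> V" if V: "vring V" "s \<notin> V" and w: "w \<in> set (monomials e q (gens y u m))" for V w
  proof -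
    let ?t = "hd (cs @ [s])"
    have tV: "?t \<notin> V" using chain_pole[OF V u(2)] .
    have tL: "?t \<in> L" "?t \<noteq> 0" using chain_hd_L[OF u(2)] tV vring_ring(8)[OF V(1)] by auto
    have "iv e ?t * (w * (?t * iv e s)) \<in> V"
      using vring_ring(6)[OF V(1) vringD(5)[OF V(1) tL(1) tV]] u(3) V w unfolding bounded_monomials_def by blast
    moreover have "iv e ?t * (w * (?t * iv e s)) = w * ((?t * iv e ?t) * iv e s)" by (simp add: mult_ac)
    ultimately show ?thesis using efield_iv(2)[OF L tL] LD(2)[OF ivs(1)] by simp
  qed
  thus ?thesis using u(1) by blast
qed

end

section \<open>The tower\<close>

text \<open>The coefficients of the quotient of the generating series of \<open>x\<close> and
  \<open>y\<close>, when \<open>y 0\<close> is the unit.\<close>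

fun quotient_seq :: "(nat \<Rightarrow> 'a::comm_ring_1) \<Rightarrow> (nat \<Rightarrow> 'a) \<Rightarrow> nat \<Rightarrow> 'a" where
  "quotient_seq x y n = x n - (\<Sum>j<n. quotient_seq x y j * y (n - j))"

declare quotient_seq.simps [simp del]

section \<open>Generating series of the two sequences and their quotient\<close>

locale two_seq =
  fixes e :: "'a::comm_ring_1" and \<Omega> :: "'a set" and s c :: 'a and q :: nat and x y :: "nat \<Rightarrow> 'a"
  assumes \<Omega>: "efield e \<Omega>" and s: "s \<in> \<Omega>" "s \<noteq> 0" and c: "c \<in> \<Omega>" and q: "q \<ge> 2"
    and frobenius: "\<And>x y. x \<in> \<Omega> \<Longrightarrow> y \<in> \<Omega> \<Longrightarrow> (x + y) ^ q = x ^ q + y ^ q"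
    and init: "x 0 = e" "y 0 = e" and seq_in: "\<And>i. x i \<in> \<Omega>" "\<And>i. y i \<in> \<Omega>"
    and x_rec: "\<And>i. x (Suc i) ^ q - x (Suc i) = c * (x i - s * y i)"
    and y_rec: "\<And>i. y (Suc i) ^ q - y (Suc i) = c * (iv e s * x i - y i)"
begin

lemmas \<Omega>' = efield_esubring[OF \<Omega>]
lemmas \<Omega>D = esubringD[OF \<Omega>']
lemmas ivs = efield_iv[OF \<Omega> s]

text \<open>The symmetry that turns infinity into zero: \<open>x\<close> and \<open>y\<close>,
  \<open>s\<close> and its inverse, \<open>c\<close> and its negative are exchanged.\<close>

lemma swap: "two_seq e \<Omega> (iv e s) (- c) q y x"
proof
  show "efield e \<Omega>" "iv e s \<in> \<Omega>" "iv e s \<noteq> 0" "- c \<in> \<Omega>" "2 \<le> q" "y 0 = e" "x 0 = e" "\<And>i. y i \<in> \<Omega>" "\<And>i. x i \<in> \<Omega>"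
    using \<Omega> ivs \<Omega>D(4)[OF c] q init seq_in by auto
  show "(a + b) ^ q = a ^ q + b ^ q" if "a \<in> \<Omega>" "b \<in> \<Omega>" for a b by (rule frobenius[OF that])
  show "y (Suc i) ^ q - y (Suc i) = - c * (y i - iv e s * x i)" for i unfolding y_rec by (simp add: algebra_simps)
  show "x (Suc i) ^ q - x (Suc i) = - c * (iv e (iv e s) * y i - x i)" for i
    unfolding x_rec using iv_iv[OF \<Omega> s(1)] by (simp add: algebra_simps)
qed

abbreviation "ratio \<equiv> quotient_seq x y"

lemma ratio_in: "ratio n \<in> \<Omega>"
proof (induction n rule: less_induct)
  case (less n)
  have "(\<Sum>j<n. ratio j * y (n - j)) \<in> \<Omega>"
    by (rule esubring_sum[OF \<Omega>']) (use less seq_in \<Omega>D(6) in auto)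
  thus ?case using \<Omega>D(7)[OF seq_in(1)] by (subst quotient_seq.simps)
qed

lemma ratio_0: "ratio 0 = e"
  by (subst quotient_seq.simps) (simp add: init)

lemma ratio_sum: "(\<Sum>j\<le>n. ratio j * y (n - j)) = x n"
proof -
  have "(\<Sum>j\<le>n. ratio j * y (n - j)) = (\<Sum>j<n. ratio j * y (n - j)) + ratio n * e"
    unfolding lessThan_Suc_atMost[symmetric] by (simp add: init)
  also have "ratio n * e = x n - (\<Sum>j<n. ratio j * y (n - j))"
    using \<Omega>D(3)[OF ratio_in] quotient_seq.simps[of x y n] by metis
  finally show ?thesis by simp
qed

lemma frobenius_sum: "finite A \<Longrightarrow> (\<And>i. i \<in> A \<Longrightarrow> f i \<in> \<Omega>) \<Longrightarrow> sum f A ^ q = (\<Sum>i\<in>A. f i ^ q)"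
proof (induction A rule: finite_induct)
  case (insert i A)
  thus ?case using frobenius[of "f i" "sum f A"] esubring_sum[OF \<Omega>', of A f] by simp
qed (use q in \<open>simp add: power_0_left\<close>)

text \<open>Frobenius on the coefficients only; the variable of the series is kept, so this is not
  the q-th power of the series.\<close>

definition frob :: "'a fps \<Rightarrow> 'a fps" where
  "frob A = Abs_fps (\<lambda>n. fps_nth A n ^ q)"

lemma frob_mult:
  assumes "\<And>n. fps_nth A n \<in> \<Omega>" "\<And>n. fps_nth B n \<in> \<Omega>"
  shows "frob (A * B) = frob A * frob B"
proof (rule fps_ext)
  fix n
  have "fps_nth (A * B) n ^ q = (\<Sum>i=0..n. (fps_nth A i * fps_nth B (n - i)) ^ q)"
    unfolding fps_mult_nth by (rule frobenius_sum) (use assms \<Omega>D(6) in auto)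
  thus "fps_nth (frob (A * B)) n = fps_nth (frob A * frob B) n"
    by (simp add: frob_def fps_mult_nth power_mult_distrib)
qed

lemma fps_mult_eq_0:
  assumes "\<And>n. fps_nth D n \<in> \<Omega>" "fps_nth Y 0 = e" "D * Y = 0"
  shows "D = 0"
proof -
  have "fps_nth D n = 0" for n
  proof (induction n rule: less_induct)
    case (less n)
    have "0 = (\<Sum>i=0..n. fps_nth D i * fps_nth Y (n - i))" using assms(3) fps_mult_nth[of D Y n] by simp
    also have "\<dots> = (\<Sum>i\<in>{n}. fps_nth D i * fps_nth Y (n - i))" using less by (intro sum.mono_neutral_right) auto
    also have "\<dots> = fps_nth D n" using assms(1,2) \<Omega>D(3) by simp
    finally show ?case by simp
  qed
  thus ?thesis by (simp add: fps_eq_iff)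
qed

text \<open>With X = R Y and T the variable, the recursions read frob X = X + cT(X - sY) and frob Y
  = Y + cT(X/s - Y). Multiplicativity of \<open>frob\<close> and cancellation of Y leave the Riccati
  equation frob R (1 + cT(R/s - 1)) = R + cT(R - s), of which this is a coefficient.\<close>

lemma ratio_rec:
  "ratio (Suc n) ^ q - ratio (Suc n) =
    c * ratio n ^ q + c * ratio n - c * iv e s * (\<Sum>j\<le>n. ratio j ^ q * ratio (n - j)) - (if n = 0 then c * s else 0)"
proof -
  define Xf where "Xf = Abs_fps x"
  define Y where "Y = Abs_fps y"
  define R where "R = Abs_fps ratio"
  define C where "C = fps_const c * fps_X"
  define S where "S = fps_const s"
  define I where "I = fps_const (iv e s)"
  have nth_C: "fps_nth (C * A) n = (case n of 0 \<Rightarrow> 0 | Suc k \<Rightarrow> c * fps_nth A k)" for A n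
    unfolding C_def by (simp add: mult.assoc split: nat.split)
  have C0: "fps_nth C 0 = 0" by (simp add: C_def)
  have eq: "e ^ q = e" using unit_power_mult[OF \<Omega>' \<Omega>D(1), of "q - 1"] q by (metis power_minus_mult zero_less_numeral order_less_le_trans)
  have XRY: "Xf = R * Y"
    using ratio_sum by (simp add: fps_eq_iff Xf_def R_def Y_def fps_mult_nth atLeast0AtMost)
  have RIn: "fps_nth R n \<in> \<Omega>" "fps_nth Y n \<in> \<Omega>" for n using ratio_in seq_in by (auto simp: R_def Y_def)
  have fX: "frob Xf = Xf + C * (Xf - S * Y)"
  proof (rule fps_ext)
    fix n show "fps_nth (frob Xf) n = fps_nth (Xf + C * (Xf - S * Y)) n"
    proof (cases n)
      case (Suc k)
      thus ?thesis using x_rec[of k] by (simp add: nth_C) (simp add: frob_def Xf_def S_def Y_def algebra_simps)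
    qed (simp add: frob_def Xf_def C0 init eq)
  qed
  have fY: "frob Y = Y + C * (I * Xf - Y)"
  proof (rule fps_ext)
    fix n show "fps_nth (frob Y) n = fps_nth (Y + C * (I * Xf - Y)) n"
    proof (cases n)
      case (Suc k)
      thus ?thesis using y_rec[of k] by (simp add: nth_C) (simp add: frob_def Xf_def I_def Y_def algebra_simps)
    qed (simp add: frob_def Y_def C0 init eq)
  qed
  define D where "D = frob R + C * (I * (frob R * R)) - C * frob R - R - C * R + C * S"
  have "D * Y = frob R * (Y + C * (I * Xf - Y)) - (Xf + C * (Xf - S * Y))"
    unfolding D_def XRY by (simp add: algebra_simps)
  also have "\<dots> = 0" using frob_mult[of R Y] RIn fX fY XRY by simp
  finally have DY: "D * Y = 0" .
  have nth_P: "fps_nth (frob R * R) n = (\<Sum>j\<le>n. ratio j ^ q * ratio (n - j))" for n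
    by (simp add: frob_def R_def fps_mult_nth atLeast0AtMost)
  have nth_S: "fps_nth S n = (if n = 0 then s else 0)" for n by (simp add: S_def)
  have nth_I: "fps_nth (I * A) n = iv e s * fps_nth A n" for A n by (simp add: I_def)
  have nth_D: "fps_nth D (Suc n) = ratio (Suc n) ^ q + c * (iv e s * (\<Sum>j\<le>n. ratio j ^ q * ratio (n - j))) - c * ratio n ^ q
    - ratio (Suc n) - c * ratio n + (if n = 0 then c * s else 0)" for n
    unfolding D_def by (simp add: nth_C nth_I nth_P nth_S) (simp add: frob_def R_def)
  have rq: "ratio n ^ q \<in> \<Omega>" for n using esubring_power[OF \<Omega>' ratio_in, of q] q by simp
  have sumO: "(\<Sum>j\<le>n. ratio j ^ q * ratio (n - j)) \<in> \<Omega>" for n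
    by (rule esubring_sum[OF \<Omega>']) (use rq ratio_in \<Omega>D(6) in auto)
  have "fps_nth D n \<in> \<Omega>" for n
  proof (cases n)
    case 0
    have "fps_nth D 0 = ratio 0 ^ q - ratio 0" unfolding D_def by (simp add: C0) (simp add: frob_def R_def)
    thus ?thesis using 0 rq ratio_in \<Omega>D(7) by simp
  next
    case (Suc k)
    have "(if k = 0 then c * s else 0) \<in> \<Omega>" using \<Omega>D(6)[OF c s(1)] \<Omega>D(8) by simp
    thus ?thesis unfolding Suc nth_D
      by (intro \<Omega>D(5) \<Omega>D(7) rq ratio_in \<Omega>D(6)[OF c] \<Omega>D(6)[OF ivs(1)] sumO)
  qed
  hence "D = 0" by (rule fps_mult_eq_0[OF _ _ DY]) (simp add: Y_def init)
  hence "fps_nth D (Suc n) = 0" by simp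
  thus ?thesis unfolding nth_D by (simp add: algebra_simps)
qed

text \<open>The quotients X/Y and Y/X are inverse series, so the higher coefficients of their
  product vanish.\<close>

lemma ratio_swap_sum: "(\<Sum>j\<le>Suc n. ratio j * quotient_seq y x (Suc n - j)) = 0"
proof -
  interpret W: two_seq e \<Omega> "iv e s" "- c" q y x by (rule swap)
  define R where "R = Abs_fps ratio"
  define Z where "Z = Abs_fps W.ratio"
  define Xf where "Xf = Abs_fps x"
  define Y where "Y = Abs_fps y"
  have "Xf = R * Y" using ratio_sum by (simp add: fps_eq_iff Xf_def R_def Y_def fps_mult_nth atLeast0AtMost)
  moreover have "Y = Z * Xf" using W.ratio_sum by (simp add: fps_eq_iff Xf_def Z_def Y_def fps_mult_nth atLeast0AtMost)
  moreover have "fps_const e * Xf = Xf" using \<Omega>D(2) seq_in by (simp add: fps_eq_iff Xf_def)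
  moreover have "(R * Z - fps_const e) * Xf = R * (Z * Xf) - fps_const e * Xf" by (simp add: algebra_simps)
  ultimately have zero: "(R * Z - fps_const e) * Xf = 0" by simp
  have inO: "fps_nth (R * Z - fps_const e) k \<in> \<Omega>" for k
  proof -
    have "fps_nth (R * Z) k \<in> \<Omega>" unfolding fps_mult_nth
      by (rule esubring_sum[OF \<Omega>']) (use ratio_in W.ratio_in \<Omega>D(6) in \<open>auto simp: R_def Z_def\<close>)
    thus ?thesis using \<Omega>D(1,7,8) by simp
  qed
  have "R * Z - fps_const e = 0" by (rule fps_mult_eq_0[OF inO _ zero]) (simp add: Xf_def init)
  hence "fps_nth (R * Z) (Suc n) = fps_nth (fps_const e) (Suc n)" by simp
  thus ?thesis by (simp add: fps_mult_nth R_def Z_def atLeast0AtMost)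
qed

end

text \<open>The recursion is that of \<open>quotient_seq\<close>, see \<open>ratio_rec\<close>.\<close>

locale seq_at_infinity = AS_base e L K s q for e :: "'a::comm_ring_1" and L K s q +
  fixes c :: 'a and R :: "nat \<Rightarrow> 'a" and m :: nat
  assumes c: "c \<in> K" and R_0: "R 0 = e" and R_L: "\<And>j. j \<le> m \<Longrightarrow> R j \<in> L"
    and R_rec: "\<And>n. n < m \<Longrightarrow> R (Suc n) ^ q - R (Suc n) =
      c * R n ^ q + c * R n - c * iv e s * (\<Sum>j\<le>n. R j ^ q * R (n - j)) - (if n = 0 then c * s else 0)"
begin

lemma mod_regular_prev: "i \<le> j \<Longrightarrow> mod_regular (prev R i @ [s]) \<subseteq> mod_regular (prev R j @ [s])"
proof (induction j rule: dec_induct)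
  case (step j)
  thus ?case using mod_regular_subset[of "prev R j @ [s]" "R (Suc j)"] by (simp add: prev_Suc)
qed simp

lemma R_in_mod_regular: "j \<le> m \<Longrightarrow> R j \<in> mod_regular (prev R j @ [s])"
proof (cases j)
  case 0
  thus ?thesis using mod_regular_regular[OF regularD(1)] R_0 by simp
next
  case (Suc i)
  assume "j \<le> m"
  hence "R j \<in> lspan K (prev R j @ [s])"
    unfolding Suc prev_Suc using lspan_member[OF K'] LD(2)[OF R_L] Suc by simp
  thus ?thesis by (rule mod_regular_lspan)
qed

lemma lspan_prev_small:
  "(\<And>k. 1 \<le> k \<Longrightarrow> k \<le> j \<Longrightarrow> R k \<in> small) \<Longrightarrow> z \<in> lspan K (prev R j @ [s]) \<Longrightarrow> \<exists>a\<in>K. z - a * s \<in> small"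
proof (induction j arbitrary: z)
  case 0
  then obtain a where "a \<in> K" "z = a * s" by (auto simp: prev_def elim!: lspan_ConsE)
  thus ?case using regular_small[OF regularD(8)] by (intro bexI[of _ a]) auto
next
  case (Suc j)
  have "z \<in> lspan K (R (Suc j) # (prev R j @ [s]))" using Suc.prems(2) by (simp add: prev_Suc)
  then obtain b w where w: "z = b * R (Suc j) + w" "b \<in> K" "w \<in> lspan K (prev R j @ [s])" by (rule lspan_ConsE)
  obtain a where a: "a \<in> K" "w - a * s \<in> small" using Suc.IH[OF _ w(3)] Suc.prems(1) by auto
  have "b * R (Suc j) \<in> small" using small_scale[OF w(2)] Suc.prems(1)[of "Suc j"] by simp
  hence "b * R (Suc j) + (w - a * s) \<in> small" using small_add a(2) by blast
  thus ?case using a(1) w(1) by (auto simp: algebra_simps)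
qed

lemma mod_regular_small:
  assumes "\<And>k. 1 \<le> k \<Longrightarrow> k \<le> j \<Longrightarrow> R k \<in> small" "z \<in> mod_regular (prev R j @ [s])"
  shows "\<exists>a\<in>K. z - a * s \<in> small"
proof -
  obtain p r where z: "z = p + r" "p \<in> lspan K (prev R j @ [s])" "r \<in> regular" using assms(2) by (auto simp: mod_regular_def)
  obtain a where a: "a \<in> K" "p - a * s \<in> small" using lspan_prev_small[OF assms(1) z(2)] by blast
  have "(p - a * s) + r \<in> small" using small_add a(2) regular_small[OF z(3)] by blast
  thus ?thesis using a(1) z(1) by (auto simp: algebra_simps)
qed

text \<open>Both claims need each other: smallness makes the quadratic terms linear modulo regular
  elements, and linearity of the right hand side bounds its pole by that of \<open>s\<close>, so
  that the next term is small.\<close>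

lemma R_AS_small:
  "i \<le> m \<Longrightarrow> (\<forall>j<i. R (Suc j) ^ q - R (Suc j) \<in> mod_regular (prev R j @ [s])) \<and> (\<forall>j\<le>i. R j \<in> small)"
proof (induction i)
  case 0
  show ?case using R_0 regular_small[OF regularD(1)] by simp
next
  case (Suc n)
  hence IH: "\<And>j. j < n \<Longrightarrow> R (Suc j) ^ q - R (Suc j) \<in> mod_regular (prev R j @ [s])" "\<And>j. j \<le> n \<Longrightarrow> R j \<in> small" by auto
  have n: "n < m" using Suc.prems by simp
  let ?M = "mod_regular (prev R n @ [s])"
  have Rin: "R j \<in> ?M" if "j \<le> n" for j using R_in_mod_regular[of j] mod_regular_prev[OF that] that n by auto
  have Rq: "R j ^ q \<in> ?M" if j: "j \<le> n" for j
  proof (cases j)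
    case 0
    have "e ^ q \<in> regular" using regular_power[OF regularD(1)] .
    thus ?thesis using mod_regular_regular 0 R_0 by simp
  next
    case (Suc i)
    have "R (Suc i) ^ q - R (Suc i) \<in> ?M" using IH(1)[of i] mod_regular_prev[of i n] Suc j by auto
    from mod_regular_add[OF this Rin[of "Suc i"]] show ?thesis using Suc j by simp
  qed
  \<comment> \<open>Modulo small elements, \<open>R j ^ q\<close> is a multiple a s of
    \<open>s\<close>. Hence the product divided by \<open>s\<close> is \<open>a * R k\<close> plus a
    product of two small elements over \<open>s\<close>, which is regular.\<close>
  have prod_in: "iv e s * (R j ^ q * R k) \<in> ?M" if j: "j \<le> n" "k \<le> n" for j k
  proof -
    obtain a where a: "a \<in> K" "R j ^ q - a * s \<in> small" using mod_regular_small[OF IH(2) Rq[OF j(1)]] by blast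
    have "iv e s * (R j ^ q * R k) = a * ((s * iv e s) * R k) + (R j ^ q - a * s) * R k * iv e s"
      by (simp add: algebra_simps)
    moreover have "(s * iv e s) * R k = R k" using ivs(2) LD(2)[OF R_L] j n by simp
    moreover have "(R j ^ q - a * s) * R k * iv e s \<in> regular" using small_mult[OF a(2) IH(2)[OF j(2)]] .
    ultimately show ?thesis using mod_regular_add[OF mod_regular_scale[OF a(1) Rin[OF j(2)]] mod_regular_regular] by simp
  qed
  have sum: "(\<Sum>j\<le>n. iv e s * (R j ^ q * R (n - j))) \<in> ?M"
  proof -
    have "(\<Sum>j\<in>A. iv e s * (R j ^ q * R (n - j))) \<in> ?M" if "finite A" "A \<subseteq> {..n}" for A
      using that by (induction A rule: finite_induct) (use mod_regular_regular[OF regularD(8)] mod_regular_add prod_in in auto)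
    thus ?thesis by blast
  qed
  have s_in: "s \<in> ?M"
    using mod_regular_lspan[OF lspan_member[OF K', of s "prev R n @ [s]"]] LD(2)[OF s(1)] by simp
  have neg: "- c \<in> K" using KD(4)[OF c] .
  have "c * R n ^ q + c * R n + (- c) * (\<Sum>j\<le>n. iv e s * (R j ^ q * R (n - j))) + (if n = 0 then (- c) * s else 0) \<in> ?M"
    using mod_regular_scale[OF c Rq] mod_regular_scale[OF c Rin] mod_regular_scale[OF neg sum] mod_regular_scale[OF neg s_in]
      mod_regular_regular[OF regularD(8)] by (intro mod_regular_add) auto
  moreover have "(\<Sum>j\<le>n. iv e s * (R j ^ q * R (n - j))) = iv e s * (\<Sum>j\<le>n. R j ^ q * R (n - j))"
    by (simp add: sum_distrib_left)
  hence "R (Suc n) ^ q - R (Suc n) =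
      c * R n ^ q + c * R n + (- c) * (\<Sum>j\<le>n. iv e s * (R j ^ q * R (n - j))) + (if n = 0 then (- c) * s else 0)"
    unfolding R_rec[OF n] by (cases "n = 0") (simp_all add: mult.assoc)
  ultimately have AS: "R (Suc n) ^ q - R (Suc n) \<in> ?M" by (simp only:)
  then obtain a where a: "a \<in> K" "(R (Suc n) ^ q - R (Suc n)) - a * s \<in> small" using mod_regular_small[OF IH(2)] by blast
  have "((R (Suc n) ^ q - R (Suc n)) - a * s) * iv e s + a \<in> regular"
    using regularD(5)[OF small_ivs[OF a(2)]] a(1) K_regular by blast
  moreover have "((R (Suc n) ^ q - R (Suc n)) - a * s) * iv e s + a = (R (Suc n) ^ q - R (Suc n)) * iv e s - a * (s * iv e s) + a"
    by (simp add: algebra_simps)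
  ultimately have "(R (Suc n) ^ q - R (Suc n)) * iv e s \<in> regular" using ivs(2) KD(3)[OF a(1)] by simp
  hence "R (Suc n) \<in> small" using small_AS R_L Suc.prems by blast
  thus ?case using IH AS by (auto simp: less_Suc_eq le_Suc_eq)
qed

end

text \<open>If \<open>x i\<close> is small then x_i / s is regular; so the equation of the next
  \<open>y\<close> has a regular right hand side and that of the next \<open>x\<close> has at most
  the poles of \<open>s\<close>.\<close>

lemma (in AS_base) seq_regular:
  assumes c: "c \<in> K" and xy: "x 0 = e" "y 0 = e" "\<And>i. i \<le> m \<Longrightarrow> x i \<in> L" "\<And>i. i \<le> m \<Longrightarrow> y i \<in> L"
    and x_rec: "\<And>i. i < m \<Longrightarrow> x (Suc i) ^ q - x (Suc i) = c * (x i - s * y i)"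
    and y_rec: "\<And>i. i < m \<Longrightarrow> y (Suc i) ^ q - y (Suc i) = c * (iv e s * x i - y i)"
  shows "i \<le> m \<Longrightarrow> y i \<in> regular \<and> x i \<in> small"
proof (induction i)
  case 0
  show ?case using xy regularD(1) regular_small by simp
next
  case (Suc i)
  hence IH: "y i \<in> regular" "x i \<in> small" and i: "i < m" by auto
  have cr: "c \<in> regular" using c K_regular by blast
  have xs: "x i * iv e s \<in> regular" by (rule small_ivs[OF IH(2)])
  hence "iv e s * x i - y i \<in> regular" using regularD(7)[OF _ IH(1)] by (simp add: mult.commute)
  hence "c * (iv e s * x i - y i) \<in> regular" using regularD(6)[OF cr] by blast
  hence "y (Suc i) ^ q - y (Suc i) \<in> regular" using y_rec[OF i] by simp
  hence y: "y (Suc i) \<in> regular" using regular_AS xy(4)[OF Suc.prems] by blast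
  have "c * (x i * iv e s - y i) \<in> regular" using regularD(6)[OF cr regularD(7)[OF xs IH(1)]] .
  moreover have "c * (x i - s * y i) * iv e s = c * (x i * iv e s - (s * iv e s) * y i)" by (simp add: algebra_simps)
  hence "(x (Suc i) ^ q - x (Suc i)) * iv e s = c * (x i * iv e s - y i)"
    using x_rec[OF i] ivs(2) LD(2)[OF xy(4)] i by simp
  ultimately have "(x (Suc i) ^ q - x (Suc i)) * iv e s \<in> regular" by simp
  hence "x (Suc i) \<in> small" using small_AS xy(3)[OF Suc.prems] by blast
  thus ?case using y by blast
qed

lemma polys_translate:
  assumes S: "esubring e S" and u: "e * u = u" "e * v = v" "u - v \<in> S"
  shows "polys S u = polys S v"
proof -
  have *: "polys S u \<subseteq> polys S v" if "e * v = v" "u - v \<in> S" for u v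
  proof (rule polys_subset[OF S polys_esubring[OF S that(1)]])
    show "S \<subseteq> polys S v" using polys_const[OF S] by blast
    have "(u - v) + v \<in> polys S v"
      using esubringD(5)[OF polys_esubring[OF S that(1)]] polys_const[OF S that(2)] polys_var[OF S that(1)] by blast
    thus "u \<in> polys S v" by simp
  qed
  have "v - u \<in> S" using esubringD(4)[OF S u(3)] by simp
  thus ?thesis using *[OF u(2,3)] *[OF u(1)] by blast
qed

lemma mem_ringgen_gens:
  assumes E: "esubring e E" and u: "\<And>j. e * u j = u j" "\<And>j. e * y j = y j"
  shows "1 \<le> j \<Longrightarrow> j \<le> i \<Longrightarrow> u j \<in> ringgen E (gens y u i) \<and> y j \<in> ringgen E (gens y u i)"
proof -
  assume j: "1 \<le> j" "j \<le> i"
  have "u j \<in> set (gens y u i) \<and> y j \<in> set (gens y u i)"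
    using j by (induction i) (auto simp: le_Suc_eq)
  moreover have "\<forall>v\<in>set (gens y u i). e * v = v" by (induction i) (use u in auto)
  ultimately show ?thesis using ringgen_mem[OF E] by blast
qed

section \<open>The levels of the tower as fields over K(s)\<close>

locale tower = base_field e \<Omega> K + two_seq e \<Omega> s c q x y
  for e :: "'a::comm_ring_1" and \<Omega> K s c q x y +
  assumes c_K: "c \<in> K" and transc: "transc K s"
begin

abbreviation "E \<equiv> fractions e (polys K s)"

lemma polys_\<Omega>: "polys K s \<subseteq> \<Omega>"
  by (rule polys_subset[OF K' \<Omega>' KL s(1)])

lemma polys_ring: "esubring e (polys K s)"
  by (rule polys_esubring[OF K' \<Omega>D(2)[OF s(1)]])

lemma E: "efield e E"
  by (rule fractions_efield[OF \<Omega> polys_ring polys_\<Omega>])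

lemmas E' = efield_esubring[OF E]

lemma E_\<Omega>: "E \<subseteq> \<Omega>"
  by (rule fractions_subset[OF \<Omega> polys_ring polys_\<Omega> _ \<Omega> polys_\<Omega>]) simp

lemma K_E: "K \<subseteq> E"
  using fractions_incl[OF \<Omega> polys_ring polys_\<Omega>] polys_const[OF K'] by blast

lemma s_E: "s \<in> E" "iv e s \<in> E"
proof -
  show "s \<in> E" using fractions_incl[OF \<Omega> polys_ring polys_\<Omega>] polys_var[OF K' \<Omega>D(2)[OF s(1)]] by blast
  thus "iv e s \<in> E" by (rule efield_iv_closed[OF E])
qed

text \<open>The level is generated by the ratios and the \<open>y\<close>. The \<open>x\<close> are
  recovered as convolutions, and the ratios have the simpler equations above infinity.\<close>

abbreviation "B m \<equiv> ringgen E (gens y ratio m)"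

lemma unit_ratio: "e * ratio j = ratio j" "e * y j = y j" "e * x j = x j"
  using \<Omega>D(2) ratio_in seq_in by auto

lemma gens_unit: "\<forall>v\<in>set (gens y ratio m). e * v = v"
  by (induction m) (use unit_ratio in auto)

lemma B_ring: "esubring e (B m)"
  by (rule ringgen_esubring[OF E' gens_unit])

lemmas BD = esubringD[OF B_ring]

lemma E_B: "E \<subseteq> B m"
  by (rule ringgen_base[OF E' gens_unit])

lemma B_\<Omega>: "B m \<subseteq> \<Omega>"
proof (rule ringgen_subset[OF E' \<Omega>' E_\<Omega>])
  show "set (gens y ratio m) \<subseteq> \<Omega>" by (induction m) (use ratio_in seq_in in auto)
qed

lemma seq_B: "j \<le> m \<Longrightarrow> ratio j \<in> B m \<and> y j \<in> B m"
proof (cases j)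
  case 0
  thus ?thesis using BD(1) ratio_0 init by simp
next
  case (Suc i)
  assume "j \<le> m"
  thus ?thesis using mem_ringgen_gens[of e E ratio y j m] E' unit_ratio(1,2) Suc by simp
qed

lemma x_B: "j \<le> m \<Longrightarrow> x j \<in> B m"
proof -
  assume j: "j \<le> m"
  have "(\<Sum>i\<le>j. ratio i * y (j - i)) \<in> B m"
    by (rule esubring_sum[OF B_ring]) (use j seq_B BD(6) in auto)
  thus ?thesis by (simp only: ratio_sum)
qed

lemma gens_AS: "AS_tower e E q (gens y ratio m)"
proof (induction m)
  case 0
  show ?case by (simp add: AS_tower_def[OF E'])
next
  case (Suc m)
  have cB: "c \<in> B m" using c_K K_E E_B by blast
  have sB: "s \<in> B m" "iv e s \<in> B m" using s_E E_B by blast+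
  have Rq: "ratio j ^ q \<in> B m" if "j \<le> m" for j using esubring_power[OF B_ring, of "ratio j" m q] seq_B[OF that] q by simp
  have "(\<Sum>j\<le>m. ratio j ^ q * ratio (m - j)) \<in> B m"
    by (rule esubring_sum[OF B_ring]) (use Rq seq_B BD(6) in auto)
  moreover have "(if m = 0 then c * s else 0) \<in> B m" using BD(6)[OF cB sB(1)] BD(8)[of m]
    by (auto simp del: gens.simps ringgen.simps)
  ultimately have 1: "ratio (Suc m) ^ q - ratio (Suc m) \<in> B m"
    unfolding ratio_rec using cB sB Rq[of m] seq_B[of m m] by (intro BD(7) BD(5) BD(6)) auto
  have "c * (iv e s * x m - y m) \<in> B m" using cB sB x_B[of m m] seq_B[of m m] by (intro BD(6) BD(7)) auto
  hence "y (Suc m) ^ q - y (Suc m) \<in> ringgen E (ratio (Suc m) # gens y ratio m)"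
    unfolding y_rec using ringgen_tail[OF E' gens_unit] by blast
  thus ?case using Suc 1 unit_ratio by (simp add: AS_tower_Cons[OF E'])
qed

lemma B_span: "B m = lspan E (monomials e q (gens y ratio m))"
  by (rule lspan_monomials[OF E' q gens_AS, symmetric])

text \<open>A ring without zero divisors that is finitely spanned over the field \<open>E\<close>:
  every nonzero \<open>z\<close> divides a nonzero element of \<open>E\<close>.\<close>

lemma B_field: "efield e (B m)"
  unfolding efield_def
proof (intro conjI ballI impI)
  show "e \<noteq> 0" by (rule efield_unit_nz[OF \<Omega>])
  show "esubring e (B m)" by (rule B_ring)
  fix z assume z: "z \<in> B m" "z \<noteq> 0"
  have ws: "set (monomials e q (gens y ratio m)) \<subseteq> \<Omega>"
    using monomials_ringgen[OF E' gens_AS] B_\<Omega> by blast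
  have "z ^ k * e \<in> lspan E (monomials e q (gens y ratio m))" for k
    using esubring_power_mult[OF B_ring z(1) BD(1)] B_span by blast
  then obtain a p where a: "a \<in> E" "p \<in> polys E z" "a \<noteq> 0" "a = z * p"
    using nonzero_constant_relation[OF \<Omega> E E_\<Omega> _ z(2) ws] z(1) B_\<Omega> by blast
  note ia = efield_iv[OF E a(1,3)]
  have "p \<in> B m" using polys_subset[OF E' B_ring E_B z(1)] a(2) by blast
  hence "iv e a * p \<in> B m" using ia(1) E_B BD(6) by blast
  moreover have "z * (iv e a * p) = iv e a * a" using a(4) by (simp add: mult_ac)
  ultimately show "\<exists>w\<in>B m. z * w = e" using ia(3) by auto
qed

lemma swap_tower: "tower e \<Omega> K (iv e s) (- c) q y x"
proof -
  interpret W: two_seq e \<Omega> "iv e s" "- c" q y x by (rule swap)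
  show ?thesis
  proof
    show "- c \<in> K" using KD(4)[OF c_K] .
    show "transc K (iv e s)" unfolding transc_def
    proof (intro ballI impI)
      fix a p assume a: "a \<in> K" "p \<in> polys K (iv e s)" "a + iv e s * p = 0"
      obtain d where d: "p \<in> polys_below K (iv e s) d" using a by (auto simp: polys_def)
      have pL: "p \<in> \<Omega>" using a(2) polys_subset[OF K' \<Omega>' KL ivs(1)] by blast
      have "s ^ d * p \<in> polys_below K s (Suc d)" by (rule polys_below_reverse[OF K' KL s d]) simp
      \<comment> \<open>A polynomial in 1/s of degree less than \<open>d\<close>, multiplied by
        \<open>s ^ d\<close>, has no constant term; so \<open>a\<close> becomes a leading
        coefficient that no other term can cancel.\<close>
      have r: "\<exists>r\<in>polys_below K s d. s ^ d * p = s * r" using d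
      proof (induction d arbitrary: p)
        case 0 thus ?case by simp
      next
        case (Suc d)
        from Suc.prems obtain b p' where p: "p = b + iv e s * p'" "b \<in> K" "p' \<in> polys_below K (iv e s) d" by (rule polys_below_SucE)
        obtain r where r: "r \<in> polys_below K s d" "s ^ d * p' = s * r" using Suc.IH[OF p(3)] by blast
        have p'L: "p' \<in> \<Omega>" using polysI[OF K' p(3)] polys_subset[OF K' \<Omega>' KL ivs(1)] by blast
        have "s ^ Suc d * p = s * (s ^ d * b) + s ^ d * ((s * iv e s) * p')" unfolding p(1) by (simp add: algebra_simps)
        hence "s ^ Suc d * p = s * (s ^ d * b + r)" using ivs(2) \<Omega>D(2)[OF p'L] r(2) by (simp add: algebra_simps)
        moreover have "s ^ d * b + r \<in> polys_below K s (Suc d)"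
          using polys_below_add[OF K' polys_below_var_power[OF K' p(2)] polys_below_Suc[OF K' r(1)]] .
        ultimately show ?case by blast
      qed
      then obtain r where r: "r \<in> polys_below K s d" "s ^ d * p = s * r" by blast
      have rL: "r \<in> \<Omega>" using polysI[OF K' r(1)] polys_\<Omega> by blast
      have aL: "a \<in> \<Omega>" using a KL by blast
      have "0 = s ^ d * (a + iv e s * p)" using a(3) by simp
      also have "\<dots> = s ^ d * a + iv e s * (s ^ d * p)" by (simp add: algebra_simps)
      also have "\<dots> = s ^ d * a + (s * iv e s) * r" unfolding r(2) by (simp add: mult_ac)
      also have "\<dots> = r + s ^ d * a" using ivs(2) \<Omega>D(2)[OF rL] by simp
      finally have r0: "r + s ^ d * a = 0" by simp
      hence "a = 0" by (rule transc_leading_coefficient[OF K' transc r(1) a(1)])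
      moreover from this have "iv e s * p = 0" using a(3) by simp
      hence "p = 0" using efield_no_zero_div[OF \<Omega> ivs(1) pL] ivs(4) by blast
      ultimately show "a = 0 \<and> p = 0" by blast
    qed
  qed
qed

end

section \<open>Comparison of the generators at zero and at infinity\<close>

context tower
begin

lemma inverse_ratio_B: "j \<le> m \<Longrightarrow> quotient_seq y x j \<in> B m"
proof (induction j rule: less_induct)
  case (less j)
  interpret W: tower e \<Omega> K "iv e s" "- c" q y x by (rule swap_tower)
  show ?case
  proof (cases j)
    case 0
    thus ?thesis using W.ratio_0 BD(1) by simp
  next
    case (Suc n)
    have "(\<Sum>i\<le>Suc n. ratio i * W.ratio (Suc n - i)) = ratio 0 * W.ratio (Suc n) + (\<Sum>i\<le>n. ratio (Suc i) * W.ratio (n - i))"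
      by (subst sum.atMost_Suc_shift) simp
    hence "W.ratio (Suc n) = - (\<Sum>i\<le>n. ratio (Suc i) * W.ratio (n - i))"
      using ratio_swap_sum[of n] ratio_0 \<Omega>D(2)[OF W.ratio_in] by (simp add: eq_neg_iff_add_eq_0)
    moreover have "(\<Sum>i\<le>n. ratio (Suc i) * W.ratio (n - i)) \<in> B m"
      by (rule esubring_sum[OF B_ring]) (use less Suc seq_B BD(6) in auto)
    ultimately show ?thesis using BD(4) Suc by simp
  qed
qed

text \<open>In the coefficient of index n + 1 of the product of the two inverse series only the two
  outer terms lie outside level \<open>n\<close>. So the ratios at zero and at infinity are
  negatives of each other modulo the previous level.\<close>

lemma ratio_plus_inverse: "ratio (Suc n) + quotient_seq y x (Suc n) \<in> B n"
proof -
  interpret W: tower e \<Omega> K "iv e s" "- c" q y x by (rule swap_tower)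
  have "(\<Sum>i\<le>Suc n. ratio i * W.ratio (Suc n - i)) =
      (ratio 0 * W.ratio (Suc n) + (\<Sum>i<n. ratio (Suc i) * W.ratio (n - i))) + ratio (Suc n) * W.ratio 0"
    by (subst sum.atMost_Suc_shift) (simp add: lessThan_Suc_atMost[symmetric])
  hence "ratio (Suc n) + W.ratio (Suc n) = - (\<Sum>i<n. ratio (Suc i) * W.ratio (n - i))"
    using ratio_swap_sum[of n] ratio_0 W.ratio_0 \<Omega>D(2)[OF W.ratio_in] \<Omega>D(3)[OF ratio_in]
    by (simp add: eq_neg_iff_add_eq_0 algebra_simps)
  moreover have "(\<Sum>i<n. ratio (Suc i) * W.ratio (n - i)) \<in> B n"
    by (rule esubring_sum[OF B_ring]) (use seq_B inverse_ratio_B BD(6) in auto)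
  ultimately show ?thesis using BD(4) by simp
qed

text \<open>Again the outer terms of a convolution. It permits \<open>x\<close> to replace
  \<open>y\<close> as a generator above zero once the ratio of the same index has been
  adjoined.\<close>

lemma x_minus_y: "x (Suc n) - y (Suc n) - ratio (Suc n) \<in> B n"
proof -
  define S where "S = (\<Sum>i<n. ratio (Suc i) * y (n - i))"
  have "(\<Sum>i\<le>Suc n. ratio i * y (Suc n - i)) = (ratio 0 * y (Suc n) + S) + ratio (Suc n) * y 0"
    unfolding S_def by (subst sum.atMost_Suc_shift) (simp add: lessThan_Suc_atMost[symmetric])
  hence "x (Suc n) = (ratio 0 * y (Suc n) + S) + ratio (Suc n) * y 0" by (simp only: ratio_sum)
  hence "x (Suc n) = (y (Suc n) + S) + ratio (Suc n)"
    using ratio_0 init(2) unit_ratio(2)[of "Suc n"] \<Omega>D(3)[OF ratio_in[of "Suc n"]] by simp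
  hence "x (Suc n) - y (Suc n) - ratio (Suc n) = S" by simp
  moreover have "S \<in> B n" unfolding S_def
    by (rule esubring_sum[OF B_ring]) (use seq_B BD(6) in auto)
  ultimately show ?thesis by simp
qed

lemma AS_base_level: "AS_base e (B m) K s q"
proof -
  have b: "base_field e (B m) K" by (rule base_field.intro[OF B_field K order_trans[OF K_E E_B] finK])
  have sB: "s \<in> B m" using s_E(1) E_B by blast
  have frob: "(a + b) ^ q = a ^ q + b ^ q" if "a \<in> B m" "b \<in> B m" for a b using frobenius that B_\<Omega> by blast
  show ?thesis by (rule AS_base.intro[OF b AS_base_axioms.intro[OF sB s(2) q frob]])
qed

text \<open>At the poles of \<open>s\<close> and at its zeros, the monomials in suitable generators have poles
  dominated by \<open>s\<close> and \<open>1/s\<close>, respectively; the two monomial bases are related by a unipotent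
  matrix.\<close>

lemma level_at_infinity:
  "\<exists>u. (\<forall>j<m. u (Suc j) - ratio (Suc j) \<in> lspan K (prev ratio j)) \<and>
    (\<forall>V. base_field.vring e (B m) K V \<longrightarrow> s \<notin> V \<longrightarrow> (\<forall>w\<in>set (monomials e q (gens y u m)). w * iv e s \<in> V))"
proof -
  interpret A: AS_base e "B m" K s q by (rule AS_base_level)
  interpret S: seq_at_infinity e "B m" K s q c ratio m
    by unfold_locales (use c_K ratio_0 seq_B ratio_rec in auto)
  have "y j \<in> A.regular" if "j \<le> m" for j
    by (rule conjunct1[OF A.seq_regular[of c x y m]]) (use c_K init x_B seq_B x_rec y_rec that in auto)
  thus ?thesis using S.R_AS_small[of m] seq_B by (intro A.infinity_generators) auto
qed

text \<open>The argument above infinity for the exchanged system: the \<open>x\<close> are regular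
  above zero, and the inverse ratios take the place of the ratios.\<close>

lemma level_at_zero:
  "\<exists>u. (\<forall>j<m. u (Suc j) + quotient_seq y x (Suc j) \<in> lspan K (prev (quotient_seq y x) j)) \<and>
    (\<forall>V. base_field.vring e (B m) K V \<longrightarrow> iv e s \<notin> V \<longrightarrow> (\<forall>w\<in>set (monomials e q (gens x u m)). w * s \<in> V))"
proof -
  interpret W: tower e \<Omega> K "iv e s" "- c" q y x by (rule swap_tower)
  interpret A0: AS_base e "B m" K s q by (rule AS_base_level)
  interpret A: AS_base e "B m" K "iv e s" q
    by unfold_locales (use A0.ivs q A0.frobenius in auto)
  interpret S: seq_at_infinity e "B m" K "iv e s" q "- c" W.ratio m
    by unfold_locales (use KD(4)[OF c_K] W.ratio_0 inverse_ratio_B W.ratio_rec in auto)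
  \<comment> \<open>The sign makes the generators above zero agree with \<open>ratio\<close>, rather
    than its negative, modulo the previous level.\<close>
  let ?T = "\<lambda>j. - W.ratio j"
  have reg: "x j \<in> A.regular" if "j \<le> m" for j
    by (rule conjunct1[OF A.seq_regular[of "- c" y x m]])
      (use KD(4)[OF c_K] init x_B seq_B W.x_rec W.y_rec that in auto)
  have sub: "lspan K (prev W.ratio j @ ws) \<subseteq> lspan K (prev ?T j @ ws)" if "\<forall>w\<in>set ws. e * w = w" for j ws
  proof (rule lspan_trans[OF K'], rule subsetI)
    fix z assume "z \<in> set (prev W.ratio j @ ws)"
    then consider i where "i \<in> set (rev [1..<Suc j])" "z = W.ratio i" | "z \<in> set ws" by (auto simp: prev_def)
    thus "z \<in> lspan K (prev ?T j @ ws)"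
    proof cases
      case 1
      have "- W.ratio i \<in> set (prev ?T j @ ws)" using 1 by (auto simp: prev_def)
      moreover have "e * (- W.ratio i) = - W.ratio i" using \<Omega>D(2)[OF W.ratio_in] by simp
      ultimately have "- (- W.ratio i) \<in> lspan K (prev ?T j @ ws)"
        using lspan_esubring_uminus[OF K'] lspan_member[OF K'] by blast
      thus ?thesis using 1 by simp
    next
      case 2
      thus ?thesis using lspan_member[OF K'] that by simp
    qed
  qed
  have sub': "lspan K (prev ?T j) \<subseteq> lspan K (prev W.ratio j)" for j
  proof (rule lspan_trans[OF K'], rule subsetI)
    fix z assume "z \<in> set (prev ?T j)"
    then obtain i where i: "W.ratio i \<in> set (prev W.ratio j)" "z = - W.ratio i" by (auto simp: prev_def)
    show "z \<in> lspan K (prev W.ratio j)"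
      unfolding i(2) using lspan_esubring_uminus[OF K' lspan_member[OF K' i(1)]] \<Omega>D(2)[OF W.ratio_in] by simp
  qed
  have AS: "?T (Suc j) \<in> B m \<and> ?T (Suc j) ^ q - ?T (Suc j) \<in> A.mod_regular (prev ?T j @ [iv e s])" if j: "j < m" for j
  proof
    have Z: "W.ratio (Suc j) \<in> B m" using inverse_ratio_B j by simp
    thus "?T (Suc j) \<in> B m" by (rule BD(4))
    have "W.ratio (Suc j) ^ q - W.ratio (Suc j) \<in> A.mod_regular (prev W.ratio j @ [iv e s])"
      using S.R_AS_small[of m] j by blast
    hence "W.ratio (Suc j) ^ q - W.ratio (Suc j) \<in> A.mod_regular (prev ?T j @ [iv e s])"
      using sub[of "[iv e s]" j] \<Omega>D(2)[OF ivs(1)] unfolding A.mod_regular_def by auto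
    hence "- e * (W.ratio (Suc j) ^ q - W.ratio (Suc j)) \<in> A.mod_regular (prev ?T j @ [iv e s])"
      by (rule A.mod_regular_scale[OF KD(4)[OF KD(1)]])
    moreover have "- e * (W.ratio (Suc j) ^ q - W.ratio (Suc j)) = ?T (Suc j) ^ q - ?T (Suc j)"
    proof -
      have "W.ratio (Suc j) ^ q - W.ratio (Suc j) \<in> B m"
        using BD(7)[OF A.power_L[OF Z] Z] .
      thus ?thesis using BD(2) A.frobenius_uminus[OF Z] by simp
    qed
    ultimately show "?T (Suc j) ^ q - ?T (Suc j) \<in> A.mod_regular (prev ?T j @ [iv e s])" by simp
  qed
  have "\<exists>u. (\<forall>j<m. u (Suc j) - ?T (Suc j) \<in> lspan K (prev ?T j)) \<and>
    (\<forall>V. A0.vring V \<longrightarrow> iv e s \<notin> V \<longrightarrow> (\<forall>w\<in>set (monomials e q (gens x u m)). w * iv e (iv e s) \<in> V))"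
    by (rule A.infinity_generators) (use reg AS in auto)
  then obtain u where u: "\<forall>j<m. u (Suc j) - ?T (Suc j) \<in> lspan K (prev ?T j)"
    "\<forall>V. A0.vring V \<longrightarrow> iv e s \<notin> V \<longrightarrow> (\<forall>w\<in>set (monomials e q (gens x u m)). w * iv e (iv e s) \<in> V)"
    by blast
  have "\<forall>j<m. u (Suc j) + W.ratio (Suc j) \<in> lspan K (prev W.ratio j)" using u(1) sub' by auto
  thus ?thesis using u(2) iv_iv[OF \<Omega> s(1)] by auto
qed

end

lemma monomials_subset:
  assumes "esubring e T"
  shows "set us \<subseteq> T \<Longrightarrow> set (monomials e q us) \<subseteq> T"
proof (induction us)
  case (Cons u us)
  hence "set (monomials e q us) \<subseteq> T" "u \<in> T" by auto
  thus ?case using esubring_power_mult[OF assms] by (fastforce simp: set_powers_mult)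
qed (use esubringD(1)[OF assms] in simp)

context tower
begin

lemma lspan_prev_B:
  assumes "\<And>i. i \<le> j \<Longrightarrow> T i \<in> B j"
  shows "lspan K (prev T j) \<subseteq> B j"
  by (rule lspan_subset[OF B_ring order_trans[OF K_E E_B]]) (use assms in \<open>auto simp: prev_def\<close>)

text \<open>First components are bounded above infinity, second components above zero, and
  triangularity allows gluing. The last clause transfers to the basis any property of the sequences
  that defines a ring containing \<open>K\<close>, such as regularity away from zero and
  infinity.\<close>

lemma level_basis:
  obtains zs where "triangular E zs" "indep E (map fst zs)" "B m = lspan E (map fst zs)"
    "set (map fst zs) \<subseteq> B m"
    "\<And>V w. base_field.vring e (B m) K V \<Longrightarrow> s \<notin> V \<Longrightarrow> w \<in> set (map fst zs) \<Longrightarrow> w * iv e s \<in> V"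
    "\<And>V w. base_field.vring e (B m) K V \<Longrightarrow> iv e s \<notin> V \<Longrightarrow> w \<in> set (map snd zs) \<Longrightarrow> w * s \<in> V"
    "\<And>T. esubring e T \<Longrightarrow> K \<subseteq> T \<Longrightarrow> (\<And>i. i \<le> m \<Longrightarrow> x i \<in> T \<and> y i \<in> T) \<Longrightarrow> set (map fst zs) \<subseteq> T"
proof -
  interpret W: tower e \<Omega> K "iv e s" "- c" q y x by (rule swap_tower)
  obtain u where u: "\<And>j. j < m \<Longrightarrow> u (Suc j) - ratio (Suc j) \<in> lspan K (prev ratio j)"
    "\<And>V w. base_field.vring e (B m) K V \<Longrightarrow> s \<notin> V \<Longrightarrow> w \<in> set (monomials e q (gens y u m)) \<Longrightarrow> w * iv e s \<in> V"
    using level_at_infinity[of m] by blast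
  obtain v where v: "\<And>j. j < m \<Longrightarrow> v (Suc j) + W.ratio (Suc j) \<in> lspan K (prev W.ratio j)"
    "\<And>V w. base_field.vring e (B m) K V \<Longrightarrow> iv e s \<notin> V \<Longrightarrow> w \<in> set (monomials e q (gens x v m)) \<Longrightarrow> w * s \<in> V"
    using level_at_zero[of m] by blast
  have du: "u (Suc j) - ratio (Suc j) \<in> B j" if "j < m" for j
    using u(1)[OF that] lspan_prev_B[of j ratio] seq_B by blast
  have dv: "v (Suc j) + W.ratio (Suc j) \<in> B j" if "j < m" for j
    using v(1)[OF that] lspan_prev_B[of j W.ratio] inverse_ratio_B by blast
  have B_unit: "e * z = z" if "z \<in> B j" for z j using BD(2)[OF that] .
  have eu: "e * u (Suc j) = u (Suc j)" if "j < m" for j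
  proof -
    have "e * (u (Suc j) - ratio (Suc j)) = u (Suc j) - ratio (Suc j)" by (rule B_unit[OF du[OF that]])
    thus ?thesis using unit_ratio(1)[of "Suc j"] by (simp add: right_diff_distrib)
  qed
  have ev: "e * v (Suc j) = v (Suc j)" if "j < m" for j
  proof -
    have "e * (v (Suc j) + W.ratio (Suc j)) = v (Suc j) + W.ratio (Suc j)" by (rule B_unit[OF dv[OF that]])
    thus ?thesis using \<Omega>D(2)[OF W.ratio_in[of "Suc j"]] by (simp add: distrib_left)
  qed
  \<comment> \<open>The generators for infinity still generate each level and satisfy Artin-Schreier
    equations; each generator for zero differs from its partner by an element of the ring of those
    adjoined before.\<close>
  have main: "ringgen E (gens y u i) = B i \<and> AS_tower e E q (gens y u i) \<and> length (gens x v i) = length (gens y u i) \<and>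
      (\<forall>w\<in>set (gens x v i). e * w = w) \<and>
      (\<forall>k<length (gens y u i). gens x v i ! k - gens y u i ! k \<in> ringgen E (drop (Suc k) (gens y u i)))" if "i \<le> m" for i
    using that
  proof (induction i)
    case 0
    show ?case by (simp add: AS_tower_def[OF E'])
  next
    case (Suc i)
    hence i: "i < m" and IH: "ringgen E (gens y u i) = B i" "AS_tower e E q (gens y u i)"
      "length (gens x v i) = length (gens y u i)" "\<forall>w\<in>set (gens x v i). e * w = w"
      "\<forall>k<length (gens y u i). gens x v i ! k - gens y u i ! k \<in> ringgen E (drop (Suc k) (gens y u i))" by auto
    have tr: "polys (B i) (u (Suc i)) = polys (B i) (ratio (Suc i))"
      by (rule polys_translate[OF B_ring eu[OF i] unit_ratio(1) du[OF i]])
    have S: "esubring e (polys (B i) (ratio (Suc i)))" by (rule polys_esubring[OF B_ring unit_ratio(1)])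
    have AS: "ratio (Suc i) ^ q - ratio (Suc i) \<in> B i" "y (Suc i) ^ q - y (Suc i) \<in> polys (B i) (ratio (Suc i))"
      using gens_AS[of "Suc i"] by (auto simp: AS_tower_Cons[OF E'])
    have 1: "ringgen E (gens y u (Suc i)) = B (Suc i)" using IH(1) tr by simp
    define d where "d = u (Suc i) - ratio (Suc i)"
    have d: "d \<in> B i" using du[OF i] by (simp add: d_def)
    have dq: "d ^ q \<in> B i" using esubring_power[OF B_ring d, of q] q by simp
    have "u (Suc i) ^ q = (ratio (Suc i) + d) ^ q" by (simp add: d_def)
    also have "\<dots> = ratio (Suc i) ^ q + d ^ q" by (rule frobenius[OF ratio_in subsetD[OF B_\<Omega> d]])
    finally have "u (Suc i) ^ q - u (Suc i) = (ratio (Suc i) ^ q - ratio (Suc i)) + (d ^ q - d)" by (simp add: d_def)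
    hence uAS: "u (Suc i) ^ q - u (Suc i) \<in> B i" using BD(5)[OF AS(1) BD(7)[OF dq d]] by simp
    have 2: "AS_tower e E q (gens y u (Suc i))"
      using IH(1,2) uAS AS(2) tr eu[OF i] unit_ratio(2) by (simp add: AS_tower_Cons[OF E'])
    \<comment> \<open>Both are compared with the ratios, whose sum with the inverse ratio lies in
      the previous level.\<close>
    have "v (Suc i) - u (Suc i) = (v (Suc i) + W.ratio (Suc i)) - (ratio (Suc i) + W.ratio (Suc i)) - d" by (simp add: d_def)
    hence 3: "v (Suc i) - u (Suc i) \<in> B i" using BD(7)[OF BD(7)[OF dv[OF i] ratio_plus_inverse] d] by metis
    \<comment> \<open>The difference of \<open>x\<close> and \<open>y\<close> involves the ratio of
      the same index, which is why the ratio is adjoined before \<open>y\<close>.\<close>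
    have "x (Suc i) - y (Suc i) - ratio (Suc i) \<in> polys (B i) (ratio (Suc i))"
      using x_minus_y polys_const[OF B_ring] by blast
    from esubringD(5)[OF S this polys_var[OF B_ring unit_ratio(1)]]
    have 4: "x (Suc i) - y (Suc i) \<in> polys (B i) (ratio (Suc i))" by simp
    show ?case using 1 2 IH 3 4 tr ev[OF i] unit_ratio(3) by (simp add: All_less_Suc2)
  qed
  let ?us = "gens y u m" and ?vs = "gens x v m"
  have T: "triangular E (zip (monomials e q ?us) (monomials e q ?vs))"
    "length (monomials e q ?vs) = length (monomials e q ?us)"
    using triangular_monomials[OF E' q, where us = ?us and us0 = ?vs] main[of m] by auto
  define ps where "ps = zip (monomials e q ?us) (monomials e q ?vs)"
  have ps: "map fst ps = monomials e q ?us" "map snd ps = monomials e q ?vs" using T(2) by (auto simp: ps_def)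
  obtain zs where zs: "set zs \<subseteq> set ps" "triangular E zs" "indep E (map fst zs)" "lspan E (map fst zs) = lspan E (map fst ps)"
    using prune[OF E' T(1)[folded ps_def]] by blast
  have sub: "set (map fst zs) \<subseteq> set (monomials e q ?us)" "set (map snd zs) \<subseteq> set (monomials e q ?vs)"
    unfolding ps[symmetric] using zs(1) by auto
  have BE: "B m = lspan E (map fst zs)" using zs(4) ps(1) lspan_monomials[OF E' q, of ?us] main[of m] by simp
  have uB: "set (monomials e q ?us) \<subseteq> B m" using monomials_ringgen[OF E', of q ?us] main[of m] by simp
  have gen: "set (map fst zs) \<subseteq> T" if T: "esubring e T" "K \<subseteq> T" "\<And>i. i \<le> m \<Longrightarrow> x i \<in> T \<and> y i \<in> T" for T
  proof -
    have rT: "i \<le> m \<Longrightarrow> ratio i \<in> T" for i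
    proof (induction i rule: less_induct)
      case (less i)
      have "(\<Sum>j<i. ratio j * y (i - j)) \<in> T"
        by (rule esubring_sum[OF T(1)]) (use less T(3) esubringD(6)[OF T(1)] in auto)
      thus ?case using esubringD(7)[OF T(1)] T(3)[OF less.prems] by (subst quotient_seq.simps) auto
    qed
    have "u (Suc j) \<in> T" if j: "j < m" for j
    proof -
      have "lspan K (prev ratio j) \<subseteq> T"
        by (rule lspan_subset[OF T(1,2)]) (use rT j in \<open>auto simp: prev_def\<close>)
      hence "u (Suc j) - ratio (Suc j) \<in> T" using u(1)[OF j] by blast
      from esubringD(5)[OF T(1) this rT[of "Suc j"]]
      have "(u (Suc j) - ratio (Suc j)) + ratio (Suc j) \<in> T" using j by simp
      thus ?thesis by simp
    qed
    hence "i \<le> m \<Longrightarrow> set (gens y u i) \<subseteq> T" for i by (induction i) (use T(3) in auto)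
    thus ?thesis using monomials_subset[OF T(1), of ?us q] sub(1) by blast
  qed
  show thesis
    by (rule that[OF zs(2,3) BE order_trans[OF sub(1) uB] u(2)[OF _ _ subsetD[OF sub(1)]]
      v(2)[OF _ _ subsetD[OF sub(2)]] gen])
qed

end

section \<open>Counting on a level of the tower\<close>

text \<open>Collects what the counting needs from one level, without the surrounding algebraically
  closed field. \<open>F\<close> plays the part of the field with \<open>q\<close> elements, through
  the factorisation of z^q - z.\<close>

locale tower_level = graded_field e L K s "map fst zs" deg
  for e :: "'a::comm_ring_1" and L K s and zs :: "('a \<times> 'a) list" and deg +
  fixes c b :: 'a and q m :: nat and x y :: "nat \<Rightarrow> 'a" and F :: "'a set"
  assumes transc: "transc K s" and q: "q \<ge> 2"
    and frobenius: "\<And>x y. x \<in> L \<Longrightarrow> y \<in> L \<Longrightarrow> (x + y) ^ q = x ^ q + y ^ q"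
    and c: "c = b ^ q - b" "b \<in> K" "c \<noteq> 0"
    and init: "x 0 = e" "y 0 = e" and seq_in: "\<And>i. i \<le> m \<Longrightarrow> x i \<in> L \<and> y i \<in> L"
    and x_rec: "\<And>i. i < m \<Longrightarrow> x (Suc i) ^ q - x (Suc i) = c * (x i - s * y i)"
    and y_rec: "\<And>i. i < m \<Longrightarrow> y (Suc i) ^ q - y (Suc i) = c * (iv e s * x i - y i)"
    and triangular: "triangular E zs" and indep: "indep E (map fst zs)"
    and at_infinity: "\<And>V w. vring V \<Longrightarrow> s \<notin> V \<Longrightarrow> w \<in> set (map fst zs) \<Longrightarrow> w * iv e s \<in> V"
    and at_zero: "\<And>V w. vring V \<Longrightarrow> iv e s \<notin> V \<Longrightarrow> w \<in> set (map snd zs) \<Longrightarrow> w * s \<in> V"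
    and generated: "\<And>T. esubring e T \<Longrightarrow> K \<subseteq> T \<Longrightarrow> (\<And>i. i \<le> m \<Longrightarrow> x i \<in> T \<and> y i \<in> T) \<Longrightarrow> set (map fst zs) \<subseteq> T"
    and F: "F \<subseteq> K" "\<And>a. a \<in> F \<Longrightarrow> a ^ q = a" "\<And>z. z \<in> L \<Longrightarrow> z ^ q - z = (\<Prod>a\<in>F. z - a) * e"
begin

lemma s0: "s \<noteq> 0"
  by (rule transc_nz[OF K' efield_unit_nz[OF L] transc])

lemmas ivs = efield_iv[OF L s s0]

lemma c_K: "c \<in> K"
  unfolding c(1) using esubring_power[OF K' c(2), of q] q KD(7)[OF _ c(2)] by simp

lemma AS_base: "AS_base e L K s q"
  using s s0 q frobenius by unfold_locales auto

lemma pole_vring: "\<exists>V. vring V \<and> s \<notin> V"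
proof -
  have e: "e * iv e s = iv e s" by (rule LD(2)[OF ivs(1)])
  have "s \<notin> polys K (iv e s)"
  proof
    assume "s \<in> polys K (iv e s)"
    then obtain d where d: "s \<in> polys_below K (iv e s) d" by (auto simp: polys_def)
    have 1: "s ^ d * s \<in> polys_below K s (Suc d)" by (rule polys_below_reverse[OF K' KL s s0 d]) simp
    have "- (s ^ d * s) + s ^ Suc d * e = 0" using LD(3)[OF esubring_power_mult[OF L' s s, of d]] by (simp add: mult_ac)
    hence "e = 0" by (rule transc_leading_coefficient[OF K' transc polys_below_uminus[OF K' 1] KD(1)])
    thus False using efield_unit_nz[OF L] by simp
  qed
  thus ?thesis using pole_exists[OF s s0 polys_esubring[OF K' e] _ polys_subset[OF K' L' KL ivs(1)] polys_var[OF K' e]]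
      polys_const[OF K'] by blast
qed

text \<open>Where \<open>s\<close> is a unit the right hand sides of the equations are regular, and
  valuation rings are integrally closed.\<close>

lemma transition_at_finite_points:
  assumes V: "vring V" "s \<in> V" "iv e s \<in> V"
  shows "i \<le> m \<Longrightarrow> x i \<in> V \<and> y i \<in> V"
proof (induction i)
  case 0
  show ?case using vring_ring(1)[OF V(1)] init by simp
next
  case (Suc i)
  hence IH: "x i \<in> V" "y i \<in> V" and i: "i < m" by auto
  have cV: "c \<in> V" using c_K vringD(2)[OF V(1)] by blast
  have "c * (x i - s * y i) \<in> V" "c * (iv e s * x i - y i) \<in> V"
    using vring_ring(6)[OF V(1) cV] vring_ring(6,7)[OF V(1)] V(2,3) IH by simp_all
  thus ?case using vring_artin_schreier[OF V(1) _ q] seq_in[OF Suc.prems] x_rec[OF i] y_rec[OF i] by auto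
qed

subsection \<open>Sections\<close>

text \<open>The rational functions of \<open>s\<close> with poles only at zero and infinity, at
  infinity of order at most \<open>M\<close>.\<close>

definition near_infinity :: "nat \<Rightarrow> 'a set" where
  "near_infinity M = (*) (s ^ M) ` polys K (iv e s)"

text \<open>The local ring of K(s) at zero. The polynomials of degree at most \<open>M\<close> lie
  both here and in \<open>near_infinity M\<close>.\<close>

definition near_zero :: "'a set" where
  "near_zero = {f * iv e g |f g. f \<in> polys K s \<and> (\<exists>a\<in>K. \<exists>p\<in>polys K s. a \<noteq> 0 \<and> g = a + s * p)}"

lemma poly0_nz: "a \<in> K \<Longrightarrow> a \<noteq> 0 \<Longrightarrow> p \<in> polys K s \<Longrightarrow> a + s * p \<noteq> 0"
  using transc unfolding transc_def by blast

lemma near_zeroI: "f \<in> polys K s \<Longrightarrow> a \<in> K \<Longrightarrow> a \<noteq> 0 \<Longrightarrow> p \<in> polys K s \<Longrightarrow> f * iv e (a + s * p) \<in> near_zero"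
  unfolding near_zero_def by blast

lemma near_zero_E: "near_zero \<subseteq> E"
proof
  fix z assume "z \<in> near_zero"
  then obtain f a p where z: "z = f * iv e (a + s * p)" "f \<in> polys K s" "a \<in> K" "a \<noteq> 0" "p \<in> polys K s"
    by (auto simp: near_zero_def)
  have "a + s * p \<in> polys K s" by (rule polys_step[OF K' z(3,5)])
  thus "z \<in> E" unfolding z(1) using fractionsI[OF z(2) _ poly0_nz[OF z(3-5)]] by blast
qed

lemma near_zero_add:
  assumes "z \<in> near_zero" "w \<in> near_zero"
  shows "z + w \<in> near_zero"
proof -
  note P = esubringD[OF polys_ring]
  obtain f a p where z: "z = f * iv e (a + s * p)" "f \<in> polys K s" "a \<in> K" "a \<noteq> 0" "p \<in> polys K s"
    using assms(1) by (auto simp: near_zero_def)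
  obtain f' a' p' where w: "w = f' * iv e (a' + s * p')" "f' \<in> polys K s" "a' \<in> K" "a' \<noteq> 0" "p' \<in> polys K s"
    using assms(2) by (auto simp: near_zero_def)
  define g where "g = a + s * p"
  define g' where "g' = a' + s * p'"
  have g: "g \<in> polys K s" "g' \<in> polys K s" "g \<noteq> 0" "g' \<noteq> 0"
    using polys_step[OF K'] poly0_nz z w by (auto simp: g_def g'_def)
  have gL: "g \<in> L" "g' \<in> L" "f \<in> L" "f' \<in> L" using g z w polys_L by auto
  have "(f * g' + f' * g) * (iv e g * iv e g') = f * iv e g * (g' * iv e g') + f' * iv e g' * (g * iv e g)"
    by (simp add: algebra_simps)
  hence "z + w = (f * g' + f' * g) * iv e (g * g')"
    using z(1) w(1) efield_iv[OF L gL(1) g(3)] efield_iv[OF L gL(2) g(4)] iv_mult[OF L gL(1,2)] LD(3) LD(6) gL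
    by (simp add: g_def[symmetric] g'_def[symmetric])
  moreover have "g * g' = a * a' + s * (a * p' + p * a' + s * (p * p'))" by (simp add: g_def g'_def algebra_simps)
  moreover have "a * p' + p * a' + s * (p * p') \<in> polys K s"
    using P polys_const[OF K'] z w polys_var[OF K' LD(2)[OF s]] by (intro P(5) P(6)) auto
  moreover have "f * g' + f' * g \<in> polys K s" using P(5,6) z w g by blast
  moreover have "a * a' \<in> K" "a * a' \<noteq> 0" using KD(6) efield_mult_nz[OF K] z w by auto
  ultimately show ?thesis using near_zeroI by metis
qed

lemma near_zero_uminus: "z \<in> near_zero \<Longrightarrow> - z \<in> near_zero"
  unfolding near_zero_def using esubringD(4)[OF polys_ring] by (force simp flip: mult_minus_left)

lemma near_zero_polys: "f \<in> polys K s \<Longrightarrow> f \<in> near_zero"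
  using near_zeroI[of f e 0] KD(1) efield_unit_nz[OF L] esubringD(8)[OF polys_ring] iv_unit[OF L] LD(3) polys_L
  by auto

lemma polys_inf_ring: "esubring e (polys K (iv e s))"
  by (rule polys_esubring[OF K' LD(2)[OF ivs(1)]])

lemma polys_inf_E: "polys K (iv e s) \<subseteq> E"
  by (rule polys_subset[OF K' efield_esubring[OF E] K_E efield_iv(1)[OF E s_E s0]])

lemma near_infinity_polys: "p \<in> polys K (iv e s) \<Longrightarrow> p \<in> near_infinity M"
proof -
  assume p: "p \<in> polys K (iv e s)"
  have "iv e s ^ M * p \<in> polys K (iv e s)"
    by (rule esubring_power_mult[OF polys_inf_ring polys_var[OF K' LD(2)[OF ivs(1)]] p])
  moreover have "s ^ M * (iv e s ^ M * p) = p"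
    by (rule efield_power_iv[OF L s s0]) (use p polys_inf_E E_L in blast)
  ultimately show ?thesis unfolding near_infinity_def by (metis image_eqI)
qed

lemma near_infinity_E: "near_infinity M \<subseteq> E"
  unfolding near_infinity_def using esubring_power_mult[OF efield_esubring[OF E] s_E] polys_inf_E by blast

lemma near_infinity_add: "z \<in> near_infinity M \<Longrightarrow> w \<in> near_infinity M \<Longrightarrow> z + w \<in> near_infinity M"
  unfolding near_infinity_def using esubringD(5)[OF polys_inf_ring] by (auto simp flip: distrib_left)

lemma near_infinity_uminus: "z \<in> near_infinity M \<Longrightarrow> - z \<in> near_infinity M"
  unfolding near_infinity_def using esubringD(4)[OF polys_inf_ring] by (auto simp flip: mult_minus_right)

lemma zero_in_parts: "0 \<in> near_infinity M" "0 \<in> near_zero"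
  using near_infinity_polys[OF esubringD(8)[OF polys_inf_ring]] near_zero_polys[OF esubringD(8)[OF polys_ring]] by auto

text \<open>A pole at zero is removed by splitting off its principal part, a polynomial in
  1/s.\<close>

lemma partial_fractions:
  assumes z: "z \<in> E"
  shows "\<exists>a\<in>near_infinity M. \<exists>c\<in>near_zero. z = a + c"
proof -
  note P = esubringD[OF polys_ring]
  obtain f g where fg: "z = f * iv e g" "f \<in> polys K s" "g \<in> polys K s" "g \<noteq> 0" using z by (auto simp: fractions_def)
  have "g \<in> polys K s \<Longrightarrow> g \<noteq> 0 \<Longrightarrow> \<exists>k. \<exists>a\<in>K. \<exists>p\<in>polys K s. a \<noteq> 0 \<and> g = s ^ k * (a + s * p)" for g
  proof (induction rule: polys_induct[OF K', consumes 1, case_names zero step])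
    case (step a p)
    show ?case
    proof (cases "a = 0")
      case True
      hence "p \<noteq> 0" using step.prems by auto
      then obtain k a' p' where "a' \<in> K" "p' \<in> polys K s" "a' \<noteq> 0" "p = s ^ k * (a' + s * p')" using step.IH by blast
      thus ?thesis using True by (intro exI[of _ "Suc k"] bexI[of _ a'] bexI[of _ p']) (auto simp: mult.assoc)
    next
      case False
      thus ?thesis using step by (intro exI[of _ 0] bexI[of _ a] bexI[of _ p]) auto
    qed
  qed simp
  then obtain k a p where g: "a \<in> K" "p \<in> polys K s" "a \<noteq> 0" "g = s ^ k * (a + s * p)" using fg by blast
  define h where "h = a + s * p"
  have h: "h \<in> L" "h \<noteq> 0" using polys_step[OF K' g(1,2)] polys_L poly0_nz[OF g(1,3,2)] by (auto simp: h_def)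
  note ih = efield_iv[OF L h] and ia = efield_iv[OF K g(1,3)]
  have "f \<in> polys K s \<Longrightarrow> \<exists>u\<in>polys K (iv e s). \<exists>v\<in>near_zero. iv e s ^ k * (f * iv e h) = u + v" for f k
  proof (induction k arbitrary: f)
    case 0
    have "f * iv e h \<in> near_zero" unfolding h_def by (rule near_zeroI[OF 0 g(1,3,2)])
    thus ?case using esubringD(8)[OF polys_inf_ring] by force
  next
    case (Suc k)
    obtain d where "f \<in> polys_below K s d" using Suc.prems by (auto simp: polys_def)
    hence "f \<in> polys_below K s (Suc d)" by (rule polys_below_Suc[OF K'])
    then obtain f0 f1 where f: "f = f0 + s * f1" "f0 \<in> K" "f1 \<in> polys_below K s d" by (rule polys_below_SucE)
    have f1: "f1 \<in> polys K s" using polysI[OF K' f(3)] .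
    \<comment> \<open>The value at zero of the quotient of \<open>f\<close> by \<open>h\<close>;
      after subtracting it, the numerator is divisible by \<open>s\<close> and the order of the pole
      drops.\<close>
    define c0 where "c0 = f0 * iv e a"
    have c0: "c0 \<in> K" using KD(6)[OF f(2) ia(1)] by (simp add: c0_def)
    have c0a: "c0 * a = f0" using ia(3) KD(3)[OF f(2)] by (simp add: c0_def mult.assoc)
    let ?f = "f1 - c0 * p"
    have "?f \<in> polys K s" using P(6,7) f1 polys_const[OF K' c0] g(2) by blast
    then obtain u v where uv: "u \<in> polys K (iv e s)" "v \<in> near_zero" "iv e s ^ k * (?f * iv e h) = u + v" using Suc.IH by blast
    have fL: "?f * iv e h \<in> L" using LD(6)[OF _ ih(1)] \<open>?f \<in> polys K s\<close> polys_L by blast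
    have c0L: "c0 \<in> L" using c0 KL by blast
    have "f = c0 * h + s * ?f" using c0a by (simp add: f(1) h_def algebra_simps)
    hence "f * iv e h = (c0 * h + s * ?f) * iv e h" by (rule arg_cong)
    hence "f * iv e h = c0 * (h * iv e h) + s * (?f * iv e h)" by (simp add: distrib_right mult.assoc)
    hence "f * iv e h = c0 + s * (?f * iv e h)" using ih(2) LD(3)[OF c0L] by simp
    hence "iv e s ^ Suc k * (f * iv e h) = iv e s ^ Suc k * (c0 + s * (?f * iv e h))" by simp
    hence "iv e s ^ Suc k * (f * iv e h) = iv e s ^ Suc k * c0 + iv e s ^ k * ((s * iv e s) * (?f * iv e h))"
      by (simp only: power_Suc distrib_left mult_ac)
    hence "iv e s ^ Suc k * (f * iv e h) = (iv e s ^ Suc k * c0 + u) + v"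
      using ivs(2) LD(2)[OF fL] uv(3) by (simp add: add.assoc)
    moreover have "iv e s ^ Suc k * c0 + u \<in> polys K (iv e s)"
      using esubringD(5)[OF polys_inf_ring polysI[OF K' polys_below_var_power[OF K' c0]] uv(1)] .
    ultimately show ?case using uv(2) by blast
  qed
  then obtain u v where uv: "u \<in> polys K (iv e s)" "v \<in> near_zero" "iv e s ^ k * (f * iv e h) = u + v" using fg(2) by blast
  have "z = iv e s ^ k * (f * iv e h)"
  proof (cases k)
    case 0
    thus ?thesis using fg(1) g(4) by (simp add: h_def)
  next
    case (Suc j)
    have "s ^ k \<in> L" using esubring_power[OF L' s] Suc by blast
    hence "iv e g = iv e (s ^ k) * iv e h" unfolding g(4) h_def[symmetric] by (rule iv_mult[OF L _ h(1)])
    thus ?thesis using fg(1) iv_power[OF L s, of k] Suc by (simp add: mult_ac)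
  qed
  thus ?thesis using uv near_infinity_polys by blast
qed

text \<open>Global sections of a vector bundle on the projective line, given by the two bases and
  twisted by \<open>M\<close> at infinity.\<close>

definition sections :: "nat \<Rightarrow> 'a set" where
  "sections M = lspan (near_infinity M) (map fst zs) \<inter> lspan near_zero (map snd zs)"

lemma sections_many: "\<exists>Y. finite Y \<and> Y \<subseteq> sections M \<and> card Y = card K ^ (length zs * (M + 1))"
proof -
  let ?F = "polys_below K s (Suc M)"
  have "?F \<subseteq> near_infinity M"
  proof
    fix p assume p: "p \<in> ?F"
    hence "iv e s ^ M * p \<in> polys_below K (iv e s) (Suc M)"
      using polys_below_reverse[OF K' KL ivs(1,4), of p "Suc M" M] iv_iv[OF L s] by simp
    hence "iv e s ^ M * p \<in> polys K (iv e s)" by (rule polysI[OF K'])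
    moreover have "s ^ M * (iv e s ^ M * p) = p"
      by (rule efield_power_iv[OF L s s0]) (use polysI[OF K' p] polys_L in blast)
    ultimately show "p \<in> near_infinity M" unfolding near_infinity_def by (metis image_eqI)
  qed
  moreover have "?F \<subseteq> near_zero" using near_zero_polys polysI[OF K'] by blast
  moreover have "\<forall>z\<in>set zs. e * fst z = fst z" using ws LD(2) by auto
  ultimately have "\<exists>Y. finite Y \<and> Y \<subseteq> lspan (near_infinity M) (map fst zs) \<inter> lspan near_zero (map snd zs) \<and>
      card Y = card ?F ^ length zs"
    by (intro lattice_sections[OF efield_esubring[OF E] E near_infinity_E zero_in_parts(1) near_infinity_add near_zero_E
      zero_in_parts(2) near_zero_add near_zero_uminus partial_fractions conjunct1[OF polys_below_finite[OF K' finK]] _ _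
      triangular indep]) auto
  moreover have "card ?F ^ length zs = card K ^ (length zs * (M + 1))"
    unfolding card_polys_below[OF K' finK transc] power_mult[symmetric] by (simp add: mult.commute)
  ultimately show ?thesis by (simp add: sections_def)
qed

lemma sections_L: "sections M \<subseteq> L"
proof -
  have "lspan (near_infinity M) (map fst zs) \<subseteq> L"
    by (rule lspan_subset[OF L' order_trans[OF near_infinity_E E_L] ws])
  thus ?thesis by (auto simp: sections_def)
qed

lemma sections_diff:
  assumes "z \<in> sections M" "w \<in> sections M"
  shows "z - w \<in> sections M"
proof -
  have *: "z - w \<in> lspan A us" if "z \<in> lspan A us" "w \<in> lspan A us" "\<And>x y. x \<in> A \<Longrightarrow> y \<in> A \<Longrightarrow> x + y \<in> A"
    "\<And>x. x \<in> A \<Longrightarrow> - x \<in> A" for A us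
  proof -
    have "- w \<in> lspan A us" using lspan_scale[of A "- 1" A w us] that by simp
    thus ?thesis using lspan_add[OF that(3) that(1), of "- w"] by simp
  qed
  show ?thesis using assms *[OF _ _ near_infinity_add near_infinity_uminus] *[OF _ _ near_zero_add near_zero_uminus]
    by (auto simp: sections_def)
qed

lemma lspan_into_ring:
  assumes V: "esubring e V" and A: "\<And>a w. a \<in> A \<Longrightarrow> w \<in> set us \<Longrightarrow> a * w * t \<in> V"
  shows "z \<in> lspan A us \<Longrightarrow> z * t \<in> V"
  using A
proof (induction us arbitrary: z)
  case (Cons u us)
  from Cons.prems(1) obtain a w where z: "z = a * u + w" "a \<in> A" "w \<in> lspan A us" by (rule lspan_ConsE)
  have "w * t \<in> V" using Cons.IH[OF z(3)] Cons.prems(2) by simp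
  moreover have "a * u * t \<in> V" using Cons.prems(2)[OF z(2)] by simp
  ultimately show ?case using esubringD(5)[OF V] z(1) by (simp add: distrib_right)
qed (use esubringD(8)[OF V] in simp)

text \<open>The coefficients contribute \<open>M\<close> times the pole of \<open>s\<close>, the
  basis once more.\<close>

lemma sections_at_infinity:
  assumes V: "vring V" "s \<notin> V" and z: "z \<in> sections M"
  shows "z = 0 \<or> val V z \<ge> int (M + 1) * val V s"
proof (cases "z = 0")
  case False
  have isV: "iv e s \<in> V" using vringD(5)[OF V(1) s V(2)] .
  have "z * iv e s ^ (M + 1) \<in> V"
  proof (rule lspan_into_ring[OF vringD(1)[OF V(1)]])
    show "z \<in> lspan (near_infinity M) (map fst zs)" using z by (simp add: sections_def)
    fix a w assume "a \<in> near_infinity M" and w: "w \<in> set (map fst zs)"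
    then obtain p where p: "a = s ^ M * p" "p \<in> polys K (iv e s)" by (auto simp: near_infinity_def)
    have pV: "p \<in> V" using polys_subset[OF K' vringD(1,2)[OF V(1)] isV] p(2) by blast
    have wV: "w * iv e s \<in> V" by (rule at_infinity[OF V w])
    have "a * w * iv e s ^ (M + 1) = s ^ M * (iv e s ^ M * (p * (w * iv e s)))" by (simp add: p(1) mult_ac)
    also have "\<dots> = p * (w * iv e s)"
      by (rule efield_power_iv[OF L s s0 vring_sub[OF V(1) vring_ring(6)[OF V(1) pV wV]]])
    finally show "a * w * iv e s ^ (M + 1) \<in> V" using vring_ring(6)[OF V(1) pV wV] by simp
  qed
  hence iz: "iv e s ^ (M + 1) * z \<in> V" by (simp add: mult.commute)
  have zL: "z \<in> L" using z sections_L by blast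
  have "val V (iv e s ^ (M + 1) * z) \<ge> 0"
    using val_nonneg[OF V(1) vring_sub[OF V(1) iz] efield_power_mult_nz[OF L ivs(1,4) zL False]] iz by simp
  hence "val V z + int (M + 1) * val V (iv e s) \<ge> 0" using val_power[OF V(1) ivs(1,4) zL False, of "M + 1"] by simp
  thus ?thesis unfolding val_iv[OF V(1) s s0] by simp
qed simp

text \<open>Where \<open>s\<close> is a unit, the description by the first basis shows that sections
  are regular. At its zeros the second basis has poles at most those of 1/s, which the factor
  \<open>s\<close> cancels.\<close>

lemma sections_finite:
  assumes V: "vring V" "s \<in> V" and z: "z \<in> sections M"
  shows "z * s \<in> V"
proof (cases "iv e s \<in> V")
  case True
  have "set (map fst zs) \<subseteq> V"
    using generated[OF vringD(1,2)[OF V(1)]] transition_at_finite_points[OF V True] by blast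
  moreover have "near_infinity M \<subseteq> V"
    using polys_subset[OF K' vringD(1,2)[OF V(1)] True] esubring_power_mult[OF vringD(1)[OF V(1)] V(2)]
    by (auto simp: near_infinity_def)
  ultimately have "lspan (near_infinity M) (map fst zs) \<subseteq> V" by (intro lspan_subset[OF vringD(1)[OF V(1)]])
  thus ?thesis using z vring_ring(6)[OF V(1) _ V(2)] by (auto simp: sections_def)
next
  case False
  have sm: "s \<in> maxid V" using maxid_iff[OF V(1) s] False by blast
  show ?thesis
  proof (rule lspan_into_ring[OF vringD(1)[OF V(1)]])
    show "z \<in> lspan near_zero (map snd zs)" using z by (simp add: sections_def)
    fix a w assume "a \<in> near_zero" and w: "w \<in> set (map snd zs)"
    then obtain f k p where a: "a = f * iv e (k + s * p)" "f \<in> polys K s" "k \<in> K" "k \<noteq> 0" "p \<in> polys K s"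
      by (auto simp: near_zero_def)
    have polysV: "polys K s \<subseteq> V" by (rule polys_subset[OF K' vringD(1,2)[OF V(1)] V(2)])
    have "k + s * p \<in> units V"
      using units_add_maxid[OF V(1) K_units[OF V(1) a(3,4)] maxid_mult[OF V(1) sm]] a(5) polysV by blast
    hence "a \<in> V" using a(1,2) polysV vring_ring(6)[OF V(1)] unitsD(4)[OF V(1)] by blast
    hence "a * (w * s) \<in> V" using vring_ring(6)[OF V(1)] at_zero[OF V(1) False w] by blast
    thus "a * w * s \<in> V" by (simp add: mult.assoc)
  qed
qed

end

section \<open>Lower bounds for Riemann-Roch spaces from sections\<close>

context tower_level
begin

lemma RR_infinity_finite: "finite (RR (\<lambda>V. int k * max 0 (- val V s)))"
proof -
  obtain V0 where V0: "vring V0" using pole_vring by blast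
  show ?thesis
    by (rule RR_finite[OF V0 finite_subset[OF _ infinity_finite]])
      (use val_nonneg[OF _ s s0] in \<open>auto simp: zero_less_mult_iff\<close>)
qed

text \<open>Multiplication by \<open>s\<close> removes the poles above zero and costs one more above
  infinity, whence \<open>M + 2\<close>.\<close>

lemma sections_RR:
  assumes z: "z \<in> sections M"
  shows "z * s \<in> RR (\<lambda>V. int (M + 2) * max 0 (- val V s))" (is "_ \<in> RR ?D")
proof (cases "z = 0")
  case False
  have zL: "z \<in> L" using z sections_L by blast
  have zs: "z * s \<in> L" "z * s \<noteq> 0" using LD(6)[OF zL s] efield_mult_nz[OF L zL s False s0] by auto
  have "val V (z * s) \<ge> - ?D V" if V: "vring V" for V
  proof (cases "s \<in> V")
    case True
    hence "val V (z * s) \<ge> 0" using val_nonneg[OF V zs] sections_finite[OF V True z] by simp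
    moreover have "?D V \<ge> 0" by simp
    ultimately show ?thesis by linarith
  next
    case sV: False
    have "val V z \<ge> int (M + 1) * val V s" using sections_at_infinity[OF V sV z] False by simp
    moreover have "val V s < 0" using val_nonneg[OF V s s0] sV by simp
    ultimately show ?thesis using val_mult[OF V zL False s s0] by (simp add: algebra_simps)
  qed
  thus ?thesis using zs by (simp add: RR_def)
qed (use RR_zero in simp)

lemma sections_inj: "inj_on (\<lambda>z. z * s) (sections M)"
proof (rule inj_onI)
  fix z w assume "z \<in> sections M" "w \<in> sections M" "z * s = w * s"
  thus "z = w" using efield_cancel[OF L s, of z w] s0 sections_L by (auto simp: mult.commute)
qed

lemma sections_card: "finite (sections M)" "card K ^ (length zs * (M + 1)) \<le> card (sections M)"
  "card (sections M) \<le> card (RR (\<lambda>V. int (M + 2) * max 0 (- val V s)))"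
proof -
  have sub: "(\<lambda>z. z * s) ` sections M \<subseteq> RR (\<lambda>V. int (M + 2) * max 0 (- val V s))" using sections_RR by blast
  show fin: "finite (sections M)"
    using finite_subset[OF sub RR_infinity_finite] sections_inj by (rule finite_imageD)
  show "card K ^ (length zs * (M + 1)) \<le> card (sections M)"
    using sections_many[of M] card_mono[OF fin] by metis
  show "card (sections M) \<le> card (RR (\<lambda>V. int (M + 2) * max 0 (- val V s)))"
    using card_mono[OF RR_infinity_finite sub] card_image[OF sections_inj] by metis
qed

text \<open>Sections of twist M - 1 are used: they have dimension at least \<open>M\<close> times
  the degree, and after multiplication by \<open>s\<close> their poles are bounded by
  \<open>M + 1\<close> times those of \<open>s\<close>.\<close>

lemma Riemann_Roch_lower:
  "card K ^ (length (map fst zs) * M) \<le> card (RR (\<lambda>V. int (M + 1) * max 0 (- val V s)))"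
proof (cases M)
  case 0
  have "card (RR (\<lambda>V. int (M + 1) * max 0 (- val V s))) \<noteq> 0"
    using RR_zero card_0_eq[OF RR_infinity_finite] by blast
  thus ?thesis using 0 by simp
next
  case (Suc M')
  thus ?thesis using sections_card(2,3)[of M'] by simp
qed

subsection \<open>Splitting points\<close>

context
  fixes V a
  assumes V: "vring V" and a: "a \<in> F" "a \<noteq> 0" and sa: "s - a \<in> maxid V"
begin

abbreviation "\<pi> \<equiv> s - a"

text \<open>The elements with a Taylor expansion up to order \<open>j\<close> in s - a with
  coefficients in \<open>K\<close>. That s - a is a uniformizer is not presupposed.\<close>

definition local_polys :: "nat \<Rightarrow> 'a set" where
  "local_polys j = {p + \<pi> ^ j * v |p v. p \<in> polys K \<pi> \<and> v \<in> V}"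

lemma aK: "a \<in> K"
  using a F by blast

lemma pi: "\<pi> \<in> V" "e * \<pi> = \<pi>"
  using sa maxid_sub vring_ring(2)[OF V] by blast+

lemma polys_V: "polys K \<pi> \<subseteq> V"
  by (rule polys_subset[OF K' vringD(1,2)[OF V] pi(1)])

lemma local_polysI: "p \<in> polys K \<pi> \<Longrightarrow> v \<in> V \<Longrightarrow> p + \<pi> ^ j * v \<in> local_polys j"
  by (auto simp: local_polys_def)

lemma local_polysE:
  assumes "z \<in> local_polys j"
  obtains p v where "z = p + \<pi> ^ j * v" "p \<in> polys K \<pi>" "v \<in> V"
  using assms by (auto simp: local_polys_def)

lemma local_polys_polys: "p \<in> polys K \<pi> \<Longrightarrow> p \<in> local_polys j"
  using local_polysI[of p 0] vring_ring(8)[OF V] by simp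

lemma local_polys_V: "local_polys j \<subseteq> V"
  unfolding local_polys_def
  using polys_V esubring_power_mult[OF vringD(1)[OF V] pi(1)] vring_ring(5)[OF V] by blast

lemma local_polys_ring: "esubring e (local_polys j)"
  unfolding esubring_def
proof (intro conjI ballI)
  note P = esubringD[OF polys_esubring[OF K' pi(2)]]
  show "e \<in> local_polys j" by (rule local_polys_polys[OF P(1)])
  fix z assume z': "z \<in> local_polys j"
  then obtain p v where z: "z = p + \<pi> ^ j * v" "p \<in> polys K \<pi>" "v \<in> V" by (rule local_polysE)
  show "e * z = z" using z' local_polys_V vring_ring(2)[OF V] by blast
  have "- z = - p + \<pi> ^ j * - v" by (simp add: z)
  thus "- z \<in> local_polys j" using local_polysI[OF P(4)[OF z(2)] vring_ring(4)[OF V z(3)]] by metis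
  fix z' assume "z' \<in> local_polys j"
  then obtain p' v' where z': "z' = p' + \<pi> ^ j * v'" "p' \<in> polys K \<pi>" "v' \<in> V" by (rule local_polysE)
  have "z + z' = (p + p') + \<pi> ^ j * (v + v')" by (simp add: z z' algebra_simps)
  thus "z + z' \<in> local_polys j" using local_polysI[OF P(5)[OF z(2) z'(2)] vring_ring(5)[OF V z(3) z'(3)]] by metis
  have "p * v' + v * p' + \<pi> ^ j * (v * v') \<in> V"
    by (intro vring_ring(5,6)[OF V] esubring_power_mult[OF vringD(1)[OF V] pi(1)])
      (use subsetD[OF polys_V] z z' in auto)
  moreover have "z * z' = p * p' + \<pi> ^ j * (p * v' + v * p' + \<pi> ^ j * (v * v'))" by (simp add: z z' algebra_simps)
  ultimately show "z * z' \<in> local_polys j" using local_polysI[OF P(6)[OF z(2) z'(2)]] by metis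
qed

lemma K_local_polys: "K \<subseteq> local_polys j"
  using local_polys_polys polys_const[OF K'] by blast

lemma s_local_polys: "s \<in> local_polys j"
  using esubringD(5)[OF local_polys_ring local_polys_polys[OF polys_var[OF K' pi(2)]] subsetD[OF K_local_polys aK]]
  by simp

lemma local_polys_antimono: "j \<le> k \<Longrightarrow> local_polys k \<subseteq> local_polys j"
proof
  fix z assume "z \<in> local_polys k" and jk: "j \<le> k"
  then obtain p v where z: "z = p + \<pi> ^ k * v" "p \<in> polys K \<pi>" "v \<in> V" by (auto elim: local_polysE)
  have "z = p + \<pi> ^ j * (\<pi> ^ (k - j) * v)" using jk z by (simp add: mult.assoc[symmetric] power_add[symmetric])
  thus "z \<in> local_polys j"
    using local_polysI[OF z(2) esubring_power_mult[OF vringD(1)[OF V] pi(1) z(3)]] by metis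
qed

lemma s_units: "s \<in> units V"
  using units_add_maxid[OF V K_units[OF V aK a(2)] sa] by simp

text \<open>The geometric series: 1/s = 1/a - (s - a)/a * 1/s, so each substitution gains one
  order.\<close>

lemma ivs_local_polys: "iv e s \<in> local_polys j"
proof (induction j)
  case 0
  show ?case using local_polysI[OF esubringD(8)[OF polys_esubring[OF K' pi(2)]] unitsD(4)[OF V s_units], of 0] by simp
next
  case (Suc j)
  then obtain p v where z: "iv e s = p + \<pi> ^ j * v" "p \<in> polys K \<pi>" "v \<in> V" by (rule local_polysE)
  note P = esubringD[OF polys_esubring[OF K' pi(2)]]
  note ia = efield_iv[OF K aK a(2)]
  have ia_L: "iv e a \<in> L" using ia(1) KL by blast
  have "iv e a * \<pi> * iv e s = iv e a * (s * iv e s) - (iv e a * a) * iv e s" by (simp add: algebra_simps)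
  hence "iv e s = iv e a - iv e a * \<pi> * iv e s" using ia(3) ivs LD(3)[OF ia_L] LD(2)[OF ivs(1)] by simp
  also have "\<dots> = iv e a - \<pi> * (iv e a * p) + \<pi> ^ Suc j * - (iv e a * v)"
    by (simp add: z(1) algebra_simps)
  finally have eq: "iv e s = iv e a - \<pi> * (iv e a * p) + \<pi> ^ Suc j * - (iv e a * v)" .
  have "iv e a - \<pi> * (iv e a * p) \<in> polys K \<pi>"
    by (intro P(6,7) polys_const[OF K' ia(1)] polys_var[OF K' pi(2)] z(2))
  moreover have "- (iv e a * v) \<in> V" using vring_ring(4,6)[OF V] ia(1) vringD(2)[OF V] z(3) by blast
  ultimately show ?case using local_polysI eq by metis
qed

text \<open>Hensel lifting for an Artin-Schreier equation. Once the residue of \<open>z\<close> lies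
  in \<open>K\<close>, z = z^q - (z^q - z) improves any approximation, because raising to the q-th
  power multiplies the order of the error.\<close>

lemma local_AS:
  assumes z: "z \<in> V" "k \<in> K" "z - k \<in> maxid V" and eq: "z ^ q - z \<in> local_polys j"
  shows "z \<in> local_polys j"
proof (cases "j = 0")
  case True
  thus ?thesis using local_polysI[OF esubringD(8)[OF polys_esubring[OF K' pi(2)]] z(1), of 0] by simp
next
  case False
  interpret A: AS_base e L K s q by (rule AS_base)
  obtain n where n: "q = Suc (Suc n)" using q by (metis add_2_eq_Suc le_Suc_ex)
  have KV: "K \<subseteq> V" by (rule vringD(2)[OF V])
  have piV: "\<pi> * v \<in> maxid V" if "v \<in> V" for v by (rule maxid_mult[OF V sa that])
  define t where "t = z - k"
  have t: "t \<in> maxid V" "t \<in> V" using z(3) maxid_sub by (auto simp: t_def)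
  have zkL: "z \<in> L" "k \<in> L" "t \<in> L" using z KL t vring_sub[OF V] by auto
  have "z ^ q - z \<in> local_polys 1" using eq local_polys_antimono[of 1 j] False by auto
  then obtain p v where pv: "z ^ q - z = p + \<pi> * v" "p \<in> polys K \<pi>" "v \<in> V" by (auto elim: local_polysE)
  obtain p0 p1 where p: "p = p0 + \<pi> * p1" "p0 \<in> K" "p1 \<in> V"
  proof -
    obtain d where "p \<in> polys_below K \<pi> d" using pv(2) by (auto simp: polys_def)
    from polys_below_Suc[OF K' this] obtain p0 p1 where "p = p0 + \<pi> * p1" "p0 \<in> K" "p1 \<in> polys_below K \<pi> d"
      by (rule polys_below_SucE)
    thus thesis using that polys_V polysI[OF K'] by blast
  qed
  \<comment> \<open>The value of t^q - t at \<open>V\<close>. It is zero because \<open>t\<close>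
    vanishes there; then t times the unit t^(q-1) - 1 is a multiple of s - a, and so is
    \<open>t\<close>.\<close>
  define \<kappa> where "\<kappa> = p0 - (k ^ q - k)"
  have kq: "k ^ q \<in> K" using esubring_power[OF K' z(2), of q] q by simp
  have \<kappa>: "\<kappa> \<in> K" using KD(7)[OF p(2) KD(7)[OF kq z(2)]] by (simp add: \<kappa>_def)
  have w: "p1 + v \<in> V" using vring_ring(5)[OF V p(3) pv(3)] .
  have "t ^ q - t = \<kappa> + \<pi> * (p1 + v)"
    using pv(1) p(1) A.frobenius_diff[OF zkL(1,2)] by (simp add: t_def \<kappa>_def algebra_simps)
  moreover have tq: "t ^ q - t = t * (t ^ Suc n - e)" using LD(3)[OF zkL(3)] by (simp add: n algebra_simps)
  moreover have tn: "t ^ Suc n \<in> maxid V"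
    using maxid_mult[OF V t(1) esubring_power_mult[OF vringD(1)[OF V] t(2) vring_ring(1)[OF V], of n]]
      esubring_power[OF L' zkL(3), of "Suc n"] LD(3) by (simp flip: mult.assoc)
  have un: "t ^ Suc n - e \<in> units V"
  proof -
    have "- e \<in> units V" using K_units[OF V KD(4)[OF KD(1)]] efield_unit_nz[OF L] by simp
    from units_add_maxid[OF V this tn] show ?thesis by simp
  qed
  have "t ^ q - t \<in> maxid V" unfolding tq by (rule maxid_mult[OF V t(1) unitsD(1)[OF V un]])
  ultimately have "\<kappa> \<in> maxid V" using maxid_diff[OF V _ piV[OF w], of "t ^ q - t"] by simp
  hence "\<kappa> = 0" by (rule K_maxid[OF V \<kappa>])
  hence eq1: "t * (t ^ Suc n - e) = \<pi> * (p1 + v)" using tq \<open>t ^ q - t = \<kappa> + \<pi> * (p1 + v)\<close> by simp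
  let ?u = "t ^ Suc n - e"
  have "t * (?u * iv e ?u) = \<pi> * ((p1 + v) * iv e ?u)" using eq1 by (simp add: mult.assoc[symmetric])
  hence "t = \<pi> * ((p1 + v) * iv e ?u)" using efield_iv(2)[OF L unitsD(2,3)[OF V un]] LD(3)[OF zkL(3)] by simp
  hence "z = k + \<pi> ^ 1 * ((p1 + v) * iv e ?u)" by (simp add: t_def algebra_simps)
  moreover have "(p1 + v) * iv e ?u \<in> V" by (rule vring_ring(6)[OF V w unitsD(4)[OF V un]])
  ultimately have z1: "z \<in> local_polys 1" using local_polysI[OF polys_const[OF K' z(2)]] by metis
  \<comment> \<open>An error of order i + 1 becomes one of order (i + 1) q, which is at least i +
    2.\<close>
  have "Suc i \<le> j \<Longrightarrow> z \<in> local_polys (Suc i)" for i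
  proof (induction i)
    case (Suc i)
    hence "z \<in> local_polys (Suc i)" by simp
    then obtain p v where pv: "z = p + \<pi> ^ Suc i * v" "p \<in> polys K \<pi>" "v \<in> V" by (rule local_polysE)
    have L2: "p \<in> L" "\<pi> ^ Suc i * v \<in> L"
      using pv polys_V vring_sub[OF V] esubring_power_mult[OF vringD(1)[OF V] pi(1) pv(3)] by blast+
    have "z ^ q = p ^ q + (\<pi> ^ Suc i * v) ^ q" unfolding pv(1) by (rule A.frobenius[OF L2])
    also have "(\<pi> ^ Suc i * v) ^ q = \<pi> ^ Suc (Suc i) * (\<pi> ^ (Suc i * q - Suc (Suc i)) * v ^ q)"
    proof -
      have "Suc i * q = Suc (Suc i) + (Suc i * q - Suc (Suc i))" using mult_le_mono2[OF q, of "Suc i"] by simp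
      thus ?thesis unfolding power_mult_distrib power_mult[symmetric] mult.assoc[symmetric] power_add[symmetric] by metis
    qed
    finally have "z ^ q = p ^ q + \<pi> ^ Suc (Suc i) * (\<pi> ^ (Suc i * q - Suc (Suc i)) * v ^ q)" .
    moreover have "p ^ q \<in> polys K \<pi>" using esubring_power[OF polys_esubring[OF K' pi(2)] pv(2), of q] q by simp
    moreover have "v ^ q \<in> V" using esubring_power[OF vringD(1)[OF V] pv(3), of q] q by simp
    ultimately have "z ^ q \<in> local_polys (Suc (Suc i))"
      using local_polysI esubring_power_mult[OF vringD(1)[OF V] pi(1)] by metis
    from esubringD(7)[OF local_polys_ring this subsetD[OF local_polys_antimono eq]] Suc.prems
    show ?case by simp
  qed (use z1 in simp)
  thus ?thesis using False by (cases j) auto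
qed

text \<open>The product of the \<open>z - k\<close> over \<open>F\<close> is in the maximal ideal,
  hence so is one of its factors.\<close>

lemma residue_in_F:
  assumes z: "z \<in> V" "z ^ q - z \<in> maxid V"
  shows "\<exists>k\<in>F. z - k \<in> maxid V"
proof (rule ccontr)
  assume no: "\<not> ?thesis"
  have "(\<Prod>k\<in>A. z - k) * e \<in> units V" if "finite A" "A \<subseteq> F" for A using that
  proof (induction rule: finite_induct)
    case (insert k A)
    have "z - k \<in> V" using insert.prems F(1) vringD(2)[OF V] vring_ring(7)[OF V z(1)] by blast
    hence "z - k \<in> units V" using no insert.prems by (auto simp: maxid_def)
    thus ?case using units_mult[OF V] insert by (simp add: mult.assoc)
  qed (use unit_in_units[OF V] in simp)
  hence "z ^ q - z \<in> units V" using F(3)[OF vring_sub[OF V z(1)]] finite_subset[OF F(1) finK] by simp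
  thus False using z(2) by (auto simp: maxid_def)
qed

text \<open>For w = x - a y at the next index, a^q = a gives that w^q - w is (s - a)/s times c (x_i
  - s y_i). It vanishes at \<open>V\<close>, so the residue of w is in \<open>F\<close>. This in
  turn fixes the residue of the next right hand side for \<open>x\<close>.\<close>

lemma seq_residues:
  "i \<le> m \<Longrightarrow> \<exists>\<omega>\<in>F. \<exists>\<xi>\<in>K. x i - a * y i - \<omega> \<in> maxid V \<and> x i - \<xi> \<in> maxid V"
proof (induction i)
  case 0
  interpret A: AS_base e L K s q by (rule AS_base)
  have aL: "a \<in> L" using aK KL by blast
  have eq: "e ^ q = e" using unit_power_mult[OF K' KD(1), of "q - 1"] q by (cases q) (auto simp: mult.commute)
  have ea: "e - a * e = e - a" using LD(3)[OF aL] by simp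
  have "(e - a) ^ q - (e - a) = 0" using A.frobenius_diff[OF LD(1) aL] F(2)[OF a(1)] eq by simp
  hence "\<exists>k\<in>F. (e - a) - k \<in> maxid V"
    using residue_in_F[OF subsetD[OF vringD(2)[OF V] KD(7)[OF KD(1) aK]]] maxid_zero[OF V] by simp
  thus ?case using KD(1) maxid_zero[OF V] ea by (auto simp: init intro!: bexI[of _ e])
next
  case (Suc i)
  interpret A: AS_base e L K s q by (rule AS_base)
  from Suc obtain \<omega> \<xi> where IH: "\<omega> \<in> F" "\<xi> \<in> K" "x i - a * y i - \<omega> \<in> maxid V" "x i - \<xi> \<in> maxid V" by auto
  have i: "i < m" "i \<le> m" using Suc by auto
  note sV = unitsD(1,4)[OF V s_units]
  have xy: "x i \<in> V" "y i \<in> V" "x (Suc i) \<in> V" "y (Suc i) \<in> V"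
    using transition_at_finite_points[OF V sV] i Suc.prems by auto
  have aV: "a \<in> V" "c \<in> V" "\<omega> \<in> V" "b \<in> V" using aK c_K IH(1) F(1) c(2) vringD(2)[OF V] by auto
  note sub = vring_sub[OF V]
  note V5 = vring_ring(5)[OF V] and V6 = vring_ring(6)[OF V] and V7 = vring_ring(7)[OF V]
  define w where "w = x (Suc i) - a * y (Suc i)"
  have wV: "w \<in> V" unfolding w_def by (rule V7[OF xy(3) V6[OF aV(1) xy(4)]])
  have d: "x i - s * y i \<in> V" by (rule V7[OF xy(1) V6[OF sV(1) xy(2)]])
  have "w ^ q = x (Suc i) ^ q - a ^ q * y (Suc i) ^ q"
    unfolding w_def using A.frobenius_diff[OF sub[OF xy(3)] sub[OF V6[OF aV(1) xy(4)]]] by (simp add: power_mult_distrib)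
  hence "w ^ q - w = (x (Suc i) ^ q - x (Suc i)) - a * (y (Suc i) ^ q - y (Suc i))"
    using F(2)[OF a(1)] by (simp add: w_def algebra_simps)
  also have "\<dots> = c * (x i - s * y i) - a * (c * (iv e s * x i - y i))" by (simp only: x_rec[OF i(1)] y_rec[OF i(1)])
  also have "iv e s * x i - y i = iv e s * (x i - s * y i)"
    using LD(2)[OF sub[OF xy(2)]] ivs(3) by (simp add: right_diff_distrib mult.assoc[symmetric])
  also have "c * (x i - s * y i) = (s * iv e s) * (c * (x i - s * y i))"
    using ivs(2) LD(2)[OF sub[OF V6[OF aV(2) d]]] by simp
  also have "(s * iv e s) * (c * (x i - s * y i)) - a * (c * (iv e s * (x i - s * y i))) = \<pi> * (iv e s * (c * (x i - s * y i)))"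
    by (simp add: algebra_simps)
  finally have "w ^ q - w \<in> maxid V" using maxid_mult[OF V sa V6[OF sV(2) V6[OF aV(2) d]]] by simp
  then obtain \<omega>' where \<omega>': "\<omega>' \<in> F" "w - \<omega>' \<in> maxid V" using residue_in_F[OF wV] by blast
  \<comment> \<open>Since \<omega> is fixed by the q-th power and c = b^q - b, the element b
    \<omega> solves the Artin-Schreier equation with right hand side c \<omega>, the value of that
    for \<open>x\<close> at \<open>V\<close>. The difference therefore has its residue in
    \<open>F\<close>.\<close>
  define z where "z = x (Suc i) - b * \<omega>"
  have zV: "z \<in> V" unfolding z_def by (rule V7[OF xy(3) V6[OF aV(4,3)]])
  have "z ^ q = x (Suc i) ^ q - b ^ q * \<omega>"
    unfolding z_def using A.frobenius_diff[OF sub[OF xy(3)] sub[OF V6[OF aV(4,3)]]] F(2)[OF IH(1)]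
    by (simp add: power_mult_distrib)
  hence "z ^ q - z = (x (Suc i) ^ q - x (Suc i)) - c * \<omega>" by (simp add: z_def c(1) algebra_simps)
  also have "\<dots> = (x i - a * y i - \<omega>) * c - \<pi> * (c * y i)" by (simp add: x_rec[OF i(1)] algebra_simps)
  finally have "z ^ q - z \<in> maxid V"
    using maxid_diff[OF V maxid_mult[OF V IH(3) aV(2)] maxid_mult[OF V sa V6[OF aV(2) xy(2)]]] by simp
  then obtain k where k: "k \<in> F" "z - k \<in> maxid V" using residue_in_F[OF zV] by blast
  have "b * \<omega> + k \<in> K" using KD(5) KD(6) c(2) IH(1) k(1) F(1) by blast
  moreover have "x (Suc i) - (b * \<omega> + k) \<in> maxid V" using k(2) by (simp add: z_def algebra_simps)
  ultimately show ?case using \<omega>' by (auto simp: w_def)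
qed

lemma seq_local_polys: "i \<le> m \<Longrightarrow> x i \<in> local_polys j \<and> y i \<in> local_polys j"
proof (induction i)
  case 0
  show ?case using esubringD(1)[OF local_polys_ring] by (simp add: init)
next
  case (Suc i)
  note T = esubringD[OF local_polys_ring[of j]]
  have i: "i < m" and IH: "x i \<in> local_polys j" "y i \<in> local_polys j" using Suc by auto
  have cT: "c \<in> local_polys j" using c_K K_local_polys by blast
  have xy: "x (Suc i) \<in> V" "y (Suc i) \<in> V"
    using transition_at_finite_points[OF V unitsD(1,4)[OF V s_units] Suc.prems] by auto
  obtain \<omega> \<xi> where r: "\<omega> \<in> F" "\<xi> \<in> K" "x (Suc i) - a * y (Suc i) - \<omega> \<in> maxid V" "x (Suc i) - \<xi> \<in> maxid V"
    using seq_residues[OF Suc.prems] by blast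
  have "x (Suc i) ^ q - x (Suc i) \<in> local_polys j"
    unfolding x_rec[OF i] by (rule T(6)[OF cT T(7)[OF IH(1) T(6)[OF s_local_polys IH(2)]]])
  from local_AS[OF xy(1) r(2,4) this] have 1: "x (Suc i) \<in> local_polys j" .
  note ia = efield_iv[OF K aK a(2)]
  \<comment> \<open>The residue of \<open>y\<close>, from those of \<open>x\<close> and x - a y;
    here \<open>a\<close> has to be nonzero.\<close>
  define k where "k = (\<xi> - \<omega>) * iv e a"
  have k: "k \<in> K" unfolding k_def using KD(6)[OF KD(7)[OF r(2)] ia(1)] r(1) F(1) by blast
  have "((x (Suc i) - \<xi>) - (x (Suc i) - a * y (Suc i) - \<omega>)) * iv e a = (a * iv e a) * y (Suc i) - k"
    by (simp add: k_def algebra_simps)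
  hence "y (Suc i) - k = ((x (Suc i) - \<xi>) - (x (Suc i) - a * y (Suc i) - \<omega>)) * iv e a"
    using ia(2) vring_ring(2)[OF V xy(2)] by simp
  hence "y (Suc i) - k \<in> maxid V"
    using maxid_mult[OF V maxid_diff[OF V r(4,3)]] ia(1) vringD(2)[OF V] by auto
  moreover have "y (Suc i) ^ q - y (Suc i) \<in> local_polys j"
    unfolding y_rec[OF i] by (rule T(6)[OF cT T(7)[OF T(6)[OF ivs_local_polys IH(1)] IH(2)]])
  ultimately have "y (Suc i) \<in> local_polys j" using local_AS[OF xy(2) k] by blast
  thus ?case using 1 by blast
qed

lemma sections_local_polys: "sections M \<subseteq> local_polys j"
proof -
  have "near_infinity M \<subseteq> local_polys j"
    using polys_subset[OF K' local_polys_ring K_local_polys ivs_local_polys, of j]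
      esubring_power_mult[OF local_polys_ring s_local_polys] by (auto simp: near_infinity_def)
  moreover have "set (map fst zs) \<subseteq> local_polys j"
    by (rule generated[OF local_polys_ring K_local_polys seq_local_polys])
  ultimately have "lspan (near_infinity M) (map fst zs) \<subseteq> local_polys j" by (rule lspan_subset[OF local_polys_ring])
  thus ?thesis by (auto simp: sections_def)
qed

lemma sections_approximation:
  assumes "z \<in> sections M"
  shows "\<exists>p\<in>polys_below K \<pi> j. \<exists>v\<in>V. z - p = \<pi> ^ j * v"
proof -
  have red: "\<exists>p'\<in>polys_below K \<pi> j. \<exists>r\<in>polys K \<pi>. p = p' + \<pi> ^ j * r" if "p \<in> polys K \<pi>" for p j
    using that
  proof (induction j arbitrary: p)
    case (Suc j)
    obtain d where "p \<in> polys_below K \<pi> d" using Suc.prems by (auto simp: polys_def)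
    from polys_below_Suc[OF K' this] obtain p0 p1 where p: "p = p0 + \<pi> * p1" "p0 \<in> K" "p1 \<in> polys_below K \<pi> d"
      by (rule polys_below_SucE)
    then obtain p' r where "p' \<in> polys_below K \<pi> j" "r \<in> polys K \<pi>" "p1 = p' + \<pi> ^ j * r"
      using Suc.IH polysI[OF K'] by blast
    thus ?case using p polys_below_SucI[of p0 K p' \<pi> j]
      by (intro bexI[of _ "p0 + \<pi> * p'"] bexI[of _ r]) (auto simp: algebra_simps)
  qed auto
  obtain p v where z: "z = p + \<pi> ^ j * v" "p \<in> polys K \<pi>" "v \<in> V"
    using local_polysE[OF subsetD[OF sections_local_polys assms]] .
  obtain p' r where "p' \<in> polys_below K \<pi> j" "r \<in> polys K \<pi>" "p = p' + \<pi> ^ j * r" using red[OF z(2)] by blast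
  thus ?thesis using z(1,3) polys_V vring_ring(5)[OF V, of r v]
    by (intro bexI[of _ p'] bexI[of _ "r + v"]) (auto simp: algebra_simps)
qed

end

lemma splitting_places: "\<exists>S. finite S \<and> card S = length zs * card (F - {0}) \<and> (\<forall>V\<in>S. vring V \<and> deg V = 1)"
proof -
  obtain V0 where V0: "vring V0" "s \<notin> V0" using pole_vring by blast
  have W: "card K ^ (length (map fst zs) * M) \<le> card (sections M)" for M
    using order_trans[OF _ sections_card(2)[of M], of "card K ^ (length zs * M)"] card_K by (simp add: power_increasing)
  have "\<exists>S. finite S \<and> card S = length (map fst zs) * card (F - {0}) \<and> (\<forall>V\<in>S. vring V \<and> deg V = 1)"
  proof (rule splitting_count[where W = sections and R = "\<Union>M. sections M"])
    show "\<exists>p\<in>polys_below K (s - a) j. \<exists>v\<in>V. y - p = (s - a) ^ j * v"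
      if "vring V" "a \<in> F - {0}" "s - a \<in> maxid V" "y \<in> (\<Union>M. sections M)" for V a j y
      using that sections_approximation[of V a y _ j] by blast
  qed (use V0 W F(1) sections_L sections_diff sections_finite sections_at_infinity in auto)
  thus ?thesis by simp
qed

text \<open>At a pole of \<open>s\<close>, x_i / s vanishes, and modulo the maximal ideal y_(i+1)^q
  - y_(i+1) = -c y_i. So each residue determines its predecessor, 0 has only 0 as predecessor, and e
  has 0. Hence the m + 1 residues starting from e are distinct, in a field of degree at most
  \<open>length zs\<close> over \<open>K\<close>.\<close>

lemma level_degree: "m + 1 \<le> card K ^ length zs"
proof -
  interpret A: AS_base e L K s q by (rule AS_base)
  obtain V where V: "vring V" "s \<notin> V" using pole_vring by blast
  have reg: "y i \<in> A.regular" "x i \<in> A.small" if "i \<le> m" for i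
    using A.seq_regular[OF c_K init _ _ x_rec y_rec that] seq_in by auto
  have yV: "y i \<in> V" if "i \<le> m" for i using reg(1)[OF that] V by (auto simp: A.regular_def)
  \<comment> \<open>The q-th power of x_i / s is the regular element x_i^q / s times a positive
    power of 1/s.\<close>
  have xP: "iv e s * x i \<in> maxid V" if i: "i \<le> m" for i
  proof -
    have xL: "x i \<in> L" using seq_in[OF i] by blast
    have isP: "iv e s \<in> maxid V" by (rule iv_in_maxid[OF V(1) s V(2)])
    have "x i ^ q * iv e s \<in> V" using reg(2)[OF i] V by (auto simp: A.small_def A.regular_def)
    from maxid_mult[OF V(1) maxid_mult[OF V(1) isP this], of "iv e s ^ (q - 2) * e"]
    have "iv e s * (x i ^ q * iv e s) * (iv e s ^ (q - 2) * e) \<in> maxid V"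
      using esubring_power_mult[OF vringD(1)[OF V(1)] subsetD[OF maxid_sub isP] vring_ring(1)[OF V(1)]] by blast
    moreover have "iv e s * (x i ^ q * iv e s) * (iv e s ^ (q - 2) * e) = (iv e s ^ Suc (Suc (q - 2)) * x i ^ q) * e"
      by (simp add: mult_ac)
    moreover have "Suc (Suc (q - 2)) = q" using q by simp
    moreover have xi: "iv e s * x i \<in> L" by (rule LD(6)[OF ivs(1) xL])
    hence "(iv e s ^ q * x i ^ q) * e = (iv e s * x i) ^ q"
      using LD(3)[OF esubring_power[OF L' xi, of q]] q by (simp add: power_mult_distrib)
    ultimately have P: "(iv e s * x i) ^ q \<in> maxid V" by simp
    hence "iv e s * x i \<in> V" using vring_power[OF V(1) xi, of q] q subsetD[OF maxid_sub P] by simp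
    thus ?thesis using maxid_power[OF V(1) P] q by simp
  qed
  have rec: "y (Suc i) ^ q - y (Suc i) + c * y i \<in> maxid V" if i: "i < m" for i
    using maxid_mult[OF V(1) xP[of i], of c] c_K vringD(2)[OF V(1)] i unfolding y_rec[OF i]
    by (auto simp: algebra_simps)
  have cancel: "z \<in> maxid V" if "c * z \<in> maxid V" "z \<in> V" for z
  proof -
    have "iv e c * (c * z) \<in> maxid V"
      using maxid_mult[OF V(1) that(1), of "iv e c"] efield_iv(1)[OF K c_K c(3)] vringD(2)[OF V(1)]
      by (auto simp: mult.commute)
    moreover have "iv e c * (c * z) = z"
      using efield_iv(3)[OF K c_K c(3)] vring_ring(2)[OF V(1) that(2)] by (simp flip: mult.assoc)
    ultimately show ?thesis by simp
  qed
  have pow: "z ^ q \<in> maxid V" if "z \<in> maxid V" for z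
  proof -
    have zV: "z \<in> V" using that maxid_sub by blast
    have "z * (z ^ (q - 2) * z) = z ^ Suc (Suc (q - 2))" by (simp add: mult_ac)
    moreover have "Suc (Suc (q - 2)) = q" using q by simp
    ultimately show ?thesis
      using maxid_mult[OF V(1) that esubring_power_mult[OF vringD(1)[OF V(1)] zV zV, of "q - 2"]] by simp
  qed
  have L: "y i \<in> L" if "i \<le> m" for i using seq_in[OF that] by blast
  have nz: "y i \<notin> maxid V" if "i \<le> m" for i using that
  proof (induction i)
    case (Suc i)
    show ?case
    proof
      assume P: "y (Suc i) \<in> maxid V"
      have "c * y i = (y (Suc i) ^ q - y (Suc i) + c * y i) - (y (Suc i) ^ q - y (Suc i))" by simp
      hence "c * y i \<in> maxid V"
        using maxid_diff[OF V(1) rec[of i] maxid_diff[OF V(1) pow[OF P] P]] Suc.prems by (metis Suc_le_eq)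
      thus False using cancel[OF _ yV[of i]] Suc by simp
    qed
  qed (use init unit_notin_maxid[OF V(1)] in simp)
  have diff: "c * (y i - y j) \<in> maxid V" if "y (Suc i) - y (Suc j) \<in> maxid V" "i < m" "j < m" for i j
  proof -
    let ?d = "y (Suc i) - y (Suc j)"
    have "?d ^ q = y (Suc i) ^ q - y (Suc j) ^ q" using A.frobenius_diff[OF L L] that by simp
    hence "c * (y i - y j) = ((y (Suc i) ^ q - y (Suc i) + c * y i) - (y (Suc j) ^ q - y (Suc j) + c * y j)) - (?d ^ q - ?d)"
      by (simp add: algebra_simps)
    thus ?thesis
      using maxid_diff[OF V(1) maxid_diff[OF V(1) rec[OF that(2)] rec[OF that(3)]] maxid_diff[OF V(1) pow[OF that(1)] that(1)]]
      by simp
  qed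
  \<comment> \<open>A coincidence is pushed back index by index until one of the two terms is y_0 =
    e; then the predecessor of the other has residue 0, excluded by \<open>nz\<close>.\<close>
  have neq: "y i - y (i + Suc k) \<notin> maxid V" if "i + Suc k \<le> m" for i k using that
  proof (induction i)
    case 0
    show ?case
    proof
      assume "y 0 - y (0 + Suc k) \<in> maxid V"
      hence P: "e - y (Suc k) \<in> maxid V" by (simp add: init)
      have k: "k < m" using 0 by simp
      have eq: "e ^ q = e" using unit_power_mult[OF K' KD(1), of "q - 1"] q by (cases q) (auto simp: mult.commute)
      have "(e - y (Suc k)) ^ q = e - y (Suc k) ^ q" using A.frobenius_diff[OF LD(1) L[of "Suc k"]] k eq by simp
      hence eq2: "c * y k = (y (Suc k) ^ q - y (Suc k) + c * y k) + ((e - y (Suc k)) ^ q - (e - y (Suc k)))" by simp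
      hence "c * y k \<in> maxid V"
        by (subst eq2) (rule maxid_add[OF V(1) rec[OF k] maxid_diff[OF V(1) pow[OF P] P]])
      thus False using cancel[OF _ yV[of k]] nz[of k] k by simp
    qed
  next
    case (Suc i)
    have "c * (y i - y (i + Suc k)) \<in> maxid V" if "y (Suc i) - y (Suc i + Suc k) \<in> maxid V"
      using diff[of i "i + Suc k"] that Suc.prems by simp
    moreover have "y i - y (i + Suc k) \<in> V" using vring_ring(7)[OF V(1) yV yV] Suc.prems by simp
    ultimately show ?case using cancel Suc by fastforce
  qed
  have lt: "y i - y j \<notin> maxid V" if "i < j" "j \<le> m" for i j
    using neq[of i "j - Suc i"] that by simp
  have sym: "y j - y i \<notin> maxid V" if "i < j" "j \<le> m" for i j
    using lt[OF that] maxid_uminus[OF V(1), of "y j - y i"] by auto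
  have inj: "y i - y j \<in> maxid V \<Longrightarrow> i = j" if "i \<le> m" "j \<le> m" for i j
    using lt[of i j] sym[of j i] that by (meson linorder_neqE_nat)
  have "card (y ` {..m}) \<le> index V (unif V)"
  proof (rule index_le[OF V(1) unif(4,2)[OF V(1)]])
    show "separated ((*) (unif V) ` V) (y ` {..m})"
      unfolding unif(3)[OF V(1), symmetric] separated_def using inj by fastforce
  qed (use yV in auto)
  moreover have "inj_on y {..m}" using inj maxid_zero[OF V(1)] by (auto intro!: inj_onI)
  ultimately have "m + 1 \<le> residues V" by (simp add: card_image residues_def[OF V(1)])
  also have "\<dots> = card K ^ deg V" by (rule deg[OF V(1)])
  also have "\<dots> \<le> card K ^ length zs"
  proof (rule power_increasing)
    have "- val V s \<ge> 1" using val_nonneg[OF V(1) s s0] V(2) by simp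
    hence "int (deg V) \<le> - val V s * int (deg V)" using mult_right_mono[of 1 "- val V s" "int (deg V)"] by simp
    thus "deg V \<le> length zs" using infinity_degree[of "{V}"] V by simp
  qed (use card_K in simp)
  finally show ?thesis .
qed

end

section \<open>Algebraically closed fields of positive characteristic\<close>

text \<open>Monic polynomials of degree \<open>n\<close>, represented by their functions in Horner
  form with leading coefficient \<open>e\<close>.\<close>

fun monics :: "'a::comm_ring_1 \<Rightarrow> 'a set \<Rightarrow> nat \<Rightarrow> ('a \<Rightarrow> 'a) set" where
  "monics e A 0 = {\<lambda>z. e}"
| "monics e A (Suc n) = {\<lambda>z. z * g z + c |g c. g \<in> monics e A n \<and> c \<in> A}"

lemma monicsI: "g \<in> monics e A n \<Longrightarrow> c \<in> A \<Longrightarrow> (\<lambda>z. z * g z + c) \<in> monics e A (Suc n)"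
  by auto

lemma monics_divide:
  assumes A: "esubring e A" and a: "a \<in> A"
  shows "g \<in> monics e A (Suc n) \<Longrightarrow> g a \<in> A \<and> (\<exists>h\<in>monics e A n. \<forall>z. g z = (z - a) * h z + g a)"
proof (induction n arbitrary: g)
  case 0
  then obtain c where g: "g = (\<lambda>z. z * e + c)" "c \<in> A" by auto
  thus ?case using a esubringD(3,5)[OF A] by (simp add: algebra_simps)
next
  case (Suc n)
  from Suc.prems obtain g1 c where g: "g = (\<lambda>z. z * g1 z + c)" "g1 \<in> monics e A (Suc n)" "c \<in> A"
    unfolding monics.simps(2)[of e A "Suc n"] by blast
  obtain h where h: "g1 a \<in> A" "h \<in> monics e A n" "\<And>z. g1 z = (z - a) * h z + g1 a" using Suc.IH[OF g(2)] by blast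
  have "g z = (z - a) * (z * h z + g1 a) + g a" for z
  proof -
    have "g z = z * ((z - a) * h z + g1 a) + c" unfolding g(1) using h(3)[of z] by metis
    thus ?thesis by (simp add: g(1) algebra_simps)
  qed
  moreover have "(\<lambda>z. z * h z + g1 a) \<in> monics e A (Suc n)" using h(1,2) by auto
  moreover have "g a \<in> A" unfolding g(1) by (rule esubringD(5)[OF A esubringD(6)[OF A a h(1)] g(3)])
  ultimately show ?case by (intro conjI bexI[of _ "\<lambda>z. z * h z + g1 a"] allI)
qed

text \<open>A relation for \<open>u\<close> over the finite field \<open>K\<close> makes 1/u
  integral, so K[1/u] is finite, hence a field. It then contains \<open>u\<close>, and K[u] would be
  finite.\<close>

lemma transc_if_infinite:
  assumes \<Omega>: "efield e \<Omega>" and K0: "efield e K" "K \<subseteq> \<Omega>" "finite K" and u: "u \<in> \<Omega>" and inf: "infinite (polys K u)"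
  shows "transc K u"
proof (rule ccontr)
  interpret base_field e \<Omega> K by unfold_locales (use \<Omega> K0 in auto)
  assume "\<not> ?thesis"
  then obtain a p where ap: "a \<in> K" "p \<in> polys K u" "a + u * p = 0" "a \<noteq> 0 \<or> p \<noteq> 0" by (auto simp: transc_def)
  have eu: "e * u = u" by (rule LD(2)[OF u])
  have pL: "p \<in> \<Omega>" using polys_subset[OF K' L' K0(2) u] ap(2) by blast
  have u0: "u \<noteq> 0"
  proof
    assume "u = 0"
    hence "polys K u \<subseteq> K" using polys_subset[OF K' K' order_refl KD(8)] by simp
    thus False using inf K0(3) finite_subset by blast
  qed
  hence a0: "a \<noteq> 0" using ap(3,4) efield_mult_nz[OF L u pL] by fastforce
  note ia = efield_iv[OF K0(1) ap(1) a0] and iu = efield_iv[OF L u u0]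
  obtain d where d: "- (iv e a * p) \<in> polys_below K u d"
    using polys_below_uminus[OF K' polys_below_scale[OF K' ia(1)]] ap(2) by (auto simp: polys_def)
  have "u * p = - a" using ap(3) by (simp add: add_eq_0_iff2)
  hence "(iv e a * p) * u = - e" using ia(3) by (simp add: mult.assoc mult.commute[of p])
  hence "- (iv e a * p) * u * iv e u = e * iv e u" by simp
  hence t: "- (iv e a * p) = iv e u"
    using iu(2) LD(3)[OF LD(6)[OF subsetD[OF K0(2) ia(1)] pL]] LD(2)[OF iu(1)] by (simp add: mult.assoc)
  define t where "t = iv e u"
  have tL: "t \<in> \<Omega>" "t \<noteq> 0" "iv e t = u" using iu(1,4) iv_iv[OF L u] by (auto simp: t_def)
  have et: "e * t = t" by (rule LD(2)[OF tL(1)])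
  let ?R = "polys_below K t (Suc d)"
  have m: "t ^ d * t \<in> ?R"
    using polys_below_reverse[OF K' K0(2) tL(1,2), of "- (iv e a * p)" d d] d t tL(3) by (simp add: t_def)
  have "polys K t \<subseteq> ?R"
  proof
    fix z assume "z \<in> polys K t"
    thus "z \<in> ?R"
    proof (induction rule: polys_induct[OF K', consumes 1, case_names zero step])
      case zero show ?case by (rule polys_below_zero[OF K'])
    next
      case (step c z)
      obtain r b where r: "r \<in> polys_below K t d" "b \<in> K" "z = r + t ^ d * b" using polys_below_top[OF K' step.IH] by blast
      have eq: "c + t * z = (c + t * r) + b * (t ^ d * t)" unfolding r(3) by (simp add: algebra_simps)
      show ?case
        unfolding eq by (rule polys_below_add[OF K' polys_below_SucI[OF step(1) r(1)] polys_below_scale[OF K' r(2) m]])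
    qed
  qed
  hence fin: "finite (polys K t)" using polys_below_finite[OF K' K0(3)] finite_subset by blast
  have "efield e (polys K t)" by (rule efield_finite[OF polys_esubring[OF K' et] fin polys_subset[OF K' L' K0(2) tL(1)] L])
  from efield_iv(1)[OF this polys_var[OF K' et] tL(2)]
  have "polys K u \<subseteq> polys K t"
    unfolding tL(3) using polys_subset[OF K' polys_esubring[OF K' et], of u] polys_const[OF K'] by blast
  thus False using inf fin finite_subset by blast
qed

text \<open>Of \<open>s\<close> only distinct powers are required. By
  \<open>transc_if_infinite\<close> this makes \<open>s\<close> transcendental over each of the
  finite subfields used below.\<close>

locale closed_field =
  fixes e :: "'a::comm_ring_1" and \<Omega> :: "'a set" and p :: nat and s :: 'a
  assumes \<Omega>: "efield e \<Omega>" and p: "normalization_semidom_class.prime p" "of_nat p * e = 0"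
    and root: "\<And>g n. g \<in> monics e \<Omega> (Suc n) \<Longrightarrow> \<exists>a\<in>\<Omega>. g a = 0"
    and s: "s \<in> \<Omega>" "\<And>i j. s ^ i * e = s ^ j * e \<Longrightarrow> i = j"
begin

lemmas \<Omega>' = efield_esubring[OF \<Omega>]
lemmas \<Omega>D = esubringD[OF \<Omega>']

lemma freshman:
  assumes "x \<in> \<Omega>" "y \<in> \<Omega>"
  shows "(x + y) ^ p = x ^ p + y ^ p"
proof -
  have p0: "p > 0" using p(1) prime_gt_0_nat by blast
  have "of_nat (p choose k) * x ^ k * y ^ (p - k) = 0" if k: "k \<in> {1..<p}" for k
  proof -
    have "p dvd (p choose k)" using k by (intro dvd_choose_prime[OF _ _ _ p(1)]) auto
    then obtain n where n: "p choose k = p * n" by blast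
    have "x ^ k \<in> \<Omega>" using esubring_power[OF \<Omega>' assms(1)] k by simp
    hence "of_nat (p choose k) * x ^ k = of_nat (p choose k) * (e * x ^ k)" using \<Omega>D(2) by simp
    also have "\<dots> = of_nat n * ((of_nat p * e) * x ^ k)" unfolding n by (simp add: mult_ac)
    finally show ?thesis using p(2) by simp
  qed
  hence "(\<Sum>k\<in>{1..<p}. of_nat (p choose k) * x ^ k * y ^ (p - k)) = 0" by (intro sum.neutral) auto
  moreover have "{..p} = insert 0 (insert p {1..<p})" using p0 by auto
  ultimately show ?thesis using p0 by (simp add: binomial_ring add.commute)
qed

lemma frobenius:
  assumes "x \<in> \<Omega>" "y \<in> \<Omega>"
  shows "(x + y) ^ (p ^ k) = x ^ (p ^ k) + y ^ (p ^ k)"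
proof (induction k)
  case (Suc k)
  have "z ^ (p ^ k) \<in> \<Omega>" if "z \<in> \<Omega>" for z
    using esubring_power[OF \<Omega>' that] prime_gt_0_nat[OF p(1)] by simp
  hence "(x ^ (p ^ k) + y ^ (p ^ k)) ^ p = (x ^ (p ^ k)) ^ p + (y ^ (p ^ k)) ^ p" using freshman assms by blast
  thus ?case unfolding power_Suc mult.commute[of p] power_mult Suc.IH .
qed simp

section \<open>Finite subfields as fixed points of powers of Frobenius\<close>

definition fixed :: "nat \<Rightarrow> 'a set" where
  "fixed Q = {z \<in> \<Omega>. z ^ Q = z}"

context
  fixes Q k :: nat
  assumes Q: "Q = p ^ k" "k > 0"
begin

lemma Q2: "Q \<ge> 2"
  using Q prime_ge_2_nat[OF p(1)] self_le_power[of p k] by auto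

lemma frobenius_Q: "x \<in> \<Omega> \<Longrightarrow> y \<in> \<Omega> \<Longrightarrow> (x + y) ^ Q = x ^ Q + y ^ Q"
  unfolding Q by (rule frobenius)

lemma AS_monic: "v \<in> A \<Longrightarrow> esubring e A \<Longrightarrow> \<exists>g\<in>monics e A Q. \<forall>z\<in>\<Omega>. g z = z ^ Q - z - v"
proof -
  assume v: "v \<in> A" and A: "esubring e A"
  obtain n where n: "Q = Suc (Suc n)" using Q2 by (metis add_2_eq_Suc le_Suc_ex)
  have pow: "(\<lambda>z. z ^ k * e) \<in> monics e A k" for k
  proof (induction k)
    case (Suc k)
    have "(\<lambda>z. z ^ Suc k * e) = (\<lambda>z. z * (z ^ k * e) + 0)" by (simp add: mult.assoc)
    thus ?case unfolding monics.simps using Suc esubringD(8)[OF A] by (intro CollectI exI conjI)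
  qed simp
  hence "(\<lambda>z. z * (z * (z ^ n * e) + - e) + - v) \<in> monics e A Q"
    unfolding n by (intro monicsI pow esubringD(4)[OF A] esubringD(1)[OF A] v)
  moreover have "z * (z * (z ^ n * e) + - e) + - v = z ^ Q - z - v" if z: "z \<in> \<Omega>" for z
  proof -
    have "z ^ Q * e = z ^ Q" using \<Omega>D(3)[OF esubring_power[OF \<Omega>' z, of Q]] n by simp
    thus ?thesis using \<Omega>D(3)[OF z] by (simp add: n algebra_simps)
  qed
  ultimately show ?thesis by (intro bexI[of _ "\<lambda>z. z * (z * (z ^ n * e) + - e) + - v"] ballI)
qed

lemma AS_root: "v \<in> \<Omega> \<Longrightarrow> \<exists>z\<in>\<Omega>. z ^ Q - z = v"
proof -
  assume "v \<in> \<Omega>"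
  then obtain g where g: "g \<in> monics e \<Omega> Q" "\<And>z. z \<in> \<Omega> \<Longrightarrow> g z = z ^ Q - z - v" using AS_monic[OF _ \<Omega>'] by blast
  obtain n where "Q = Suc n" using Q2 by (cases Q) auto
  then obtain a where "a \<in> \<Omega>" "g a = 0" using root g(1) by blast
  thus ?thesis using g(2) by force
qed

lemma monics_split: "g \<in> monics e \<Omega> n \<Longrightarrow> \<exists>as. length as = n \<and> set as \<subseteq> \<Omega> \<and> (\<forall>z. g z = (\<Prod>a\<leftarrow>as. z - a) * e)"
proof (induction n arbitrary: g)
  case (Suc n)
  obtain a where a: "a \<in> \<Omega>" "g a = 0" using root[OF Suc.prems] by blast
  obtain h where h: "h \<in> monics e \<Omega> n" "\<And>z. g z = (z - a) * h z" using monics_divide[OF \<Omega>' a(1) Suc.prems] a(2) by auto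
  obtain as where "length as = n" "set as \<subseteq> \<Omega>" "\<forall>z. h z = (\<Prod>a\<leftarrow>as. z - a) * e" using Suc.IH[OF h(1)] by blast
  thus ?case using a h(2) by (intro exI[of _ "a # as"]) (simp add: mult.assoc)
qed simp

lemma fixed_subset: "fixed Q \<subseteq> \<Omega>"
  by (auto simp: fixed_def)

lemma fixed_ring: "esubring e (fixed Q)"
  unfolding esubring_def
proof (intro conjI ballI)
  have "e ^ Q = e" using unit_power_mult[OF \<Omega>' \<Omega>D(1), of "Q - 1"] Q2 by (cases Q) (auto simp: mult.commute)
  thus "e \<in> fixed Q" using \<Omega>D(1) by (simp add: fixed_def)
  fix x assume x: "x \<in> fixed Q"
  show "e * x = x" using x \<Omega>D(2) by (auto simp: fixed_def)
  have xL: "x \<in> \<Omega>" "- x \<in> \<Omega>" using x \<Omega>D(4) by (auto simp: fixed_def)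
  have "(x + - x) ^ Q = x ^ Q + (- x) ^ Q" by (rule frobenius_Q[OF xL])
  hence "(- x) ^ Q = - x" using x Q2 by (simp add: fixed_def power_0_left eq_neg_iff_add_eq_0 add.commute)
  thus "- x \<in> fixed Q" using xL by (simp add: fixed_def)
  fix y assume "y \<in> fixed Q"
  thus "x + y \<in> fixed Q" "x * y \<in> fixed Q"
    using x frobenius_Q \<Omega>D(5,6) by (auto simp: fixed_def power_mult_distrib)
qed

text \<open>The list records roots with multiplicity, so its length is \<open>Q\<close>; that there
  are no repetitions is a separate matter.\<close>

lemma fixed_roots:
  obtains as where "length as = Q" "set as = fixed Q" "\<And>z. z \<in> \<Omega> \<Longrightarrow> z ^ Q - z = (\<Prod>a\<leftarrow>as. z - a) * e"
proof -
  obtain g where g: "g \<in> monics e \<Omega> Q" "\<And>z. z \<in> \<Omega> \<Longrightarrow> g z = z ^ Q - z" using AS_monic[OF \<Omega>D(8) \<Omega>'] by auto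
  obtain as where as: "length as = Q" "set as \<subseteq> \<Omega>" "\<And>z. g z = (\<Prod>a\<leftarrow>as. z - a) * e" using monics_split[OF g(1)] by blast
  have nz: "(\<Prod>a\<leftarrow>bs. z - a) * e \<in> \<Omega> \<and> ((\<Prod>a\<leftarrow>bs. z - a) * e = 0 \<longleftrightarrow> z \<in> set bs)" if z: "z \<in> \<Omega>" and "set bs \<subseteq> \<Omega>" for z bs
    using that(2)
  proof (induction bs)
    case (Cons b bs)
    hence "z - b \<in> \<Omega>" using \<Omega>D(7)[OF z] by auto
    moreover from this have "(z - b) * v = 0 \<longleftrightarrow> z = b \<or> v = 0" if "v \<in> \<Omega>" for v
      using efield_no_zero_div[OF \<Omega>] that by fastforce
    ultimately show ?case using Cons \<Omega>D(6) by (auto simp: mult.assoc)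
  qed (use efield_unit_nz[OF \<Omega>] \<Omega>D(1) in simp)
  have "z \<in> set as \<longleftrightarrow> z ^ Q = z" if z: "z \<in> \<Omega>" for z
    using nz[OF z as(2)] g(2)[OF z] as(3)[of z] by simp
  hence "set as = fixed Q" using as(2) by (auto simp: fixed_def)
  thus thesis using that as(1,3) g(2) by metis
qed

lemma fixed_field: "efield e (fixed Q)" "finite (fixed Q)"
proof -
  show fin: "finite (fixed Q)" using fixed_roots finite_set by metis
  show "efield e (fixed Q)" by (rule efield_finite[OF fixed_ring fin fixed_subset \<Omega>])
qed

lemma fixed_infinite: "infinite (polys (fixed Q) s)"
proof -
  have "s ^ i * e \<in> polys (fixed Q) s" for i
    using polysI[OF fixed_ring polys_below_var_power[OF fixed_ring esubringD(1)[OF fixed_ring]]] .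
  moreover have "inj (\<lambda>i. s ^ i * e)" using s(2) by (auto intro: injI)
  ultimately show ?thesis using infinite_iff_countable_subset by blast
qed

lemma fixed_transc: "transc (fixed Q) s"
  by (rule transc_if_infinite[OF \<Omega> fixed_field(1) fixed_subset fixed_field(2) s(1) fixed_infinite])

text \<open>A multiple root \<open>a\<close> of \<open>z\<^sup>Q - z\<close> would give \<open>t\<^sup>2 | t\<^sup>Q - t\<close> for \<open>t = s - a\<close>.\<close>

lemma fixed_distinct:
  assumes as: "length as = Q" "set as = fixed Q" "\<And>z. z \<in> \<Omega> \<Longrightarrow> z ^ Q - z = (\<Prod>a\<leftarrow>as. z - a) * e"
  shows "distinct as"
proof (rule ccontr)
  assume "\<not> ?thesis"
  then obtain xs ys zs a where split: "as = xs @ [a] @ ys @ [a] @ zs" using not_distinct_decomp by blast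
  hence a: "a \<in> fixed Q" using as(2) by auto
  have aL: "a \<in> \<Omega>" using a fixed_subset by blast
  define t where "t = s - a"
  define r where "r = (\<Prod>b\<leftarrow>xs @ ys @ zs. s - b) * e"
  have tL: "t \<in> \<Omega>" "e * t = t" using \<Omega>D(2,7)[OF \<Omega>D(7)[OF s(1) aL]] \<Omega>D(7)[OF s(1) aL] by (auto simp: t_def)
  note P = esubringD[OF polys_esubring[OF fixed_ring tL(2)]]
  have eq: "polys (fixed Q) t = polys (fixed Q) s"
    by (rule polys_translate[OF fixed_ring tL(2) \<Omega>D(2)[OF s(1)]]) (use esubringD(4)[OF fixed_ring a] in \<open>simp add: t_def\<close>)
  have tt: "transc (fixed Q) t"
    by (rule transc_if_infinite[OF \<Omega> fixed_field(1) fixed_subset fixed_field(2) tL(1)]) (use fixed_infinite eq in simp)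
  have t0: "t \<noteq> 0" by (rule transc_nz[OF fixed_ring efield_unit_nz[OF \<Omega>] tt])
  have sP: "s \<in> polys (fixed Q) t" using polys_var[OF fixed_ring \<Omega>D(2)[OF s(1)]] eq by simp
  have "(\<Prod>b\<leftarrow>bs. s - b) * e \<in> polys (fixed Q) t" if "set bs \<subseteq> fixed Q" for bs using that
  proof (induction bs)
    case (Cons b bs)
    have "s - b \<in> polys (fixed Q) t" using P(7)[OF sP polys_const[OF fixed_ring]] Cons.prems by auto
    thus ?case using Cons P(6) by (simp add: mult.assoc)
  qed (use P(1) in simp)
  moreover have "set (xs @ ys @ zs) \<subseteq> fixed Q" using split as(2) by auto
  ultimately have r: "r \<in> polys (fixed Q) t" unfolding r_def by blast
  have rL: "r \<in> \<Omega>" using polys_subset[OF fixed_ring \<Omega>' fixed_subset tL(1)] r by blast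
  obtain n where n: "Q = Suc (Suc n)" using Q2 by (metis add_2_eq_Suc le_Suc_ex)
  have "s ^ Q = t ^ Q + a ^ Q" using frobenius_Q[OF tL(1) aL] by (simp add: t_def)
  hence "t ^ Q - t = s ^ Q - s" using a by (simp add: fixed_def t_def)
  also have "\<dots> = t * (t * r)" using as(3)[OF s(1)] by (simp add: split r_def t_def mult_ac)
  finally have "t * (t ^ Suc n - e) = t * (t * r)" using \<Omega>D(3)[OF tL(1)] by (simp add: n algebra_simps)
  hence "t ^ Suc n - e = t * r"
    using efield_cancel[OF \<Omega> tL(1) _ _ t0] \<Omega>D(6)[OF tL(1) rL] \<Omega>D(7)[OF esubring_power[OF \<Omega>' tL(1)] \<Omega>D(1)] by blast
  moreover have "t ^ Suc n = t * (t ^ n * e)"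
    using \<Omega>D(3)[OF esubring_power[OF \<Omega>' tL(1), of "Suc n"]] by (simp add: mult.assoc)
  ultimately have "t * (t ^ n * e) - e = t * r" by metis
  hence "e + t * (r - t ^ n * e) = 0" by (simp add: right_diff_distrib flip: \<open>t * (t ^ n * e) - e = t * r\<close>)
  moreover have "r - t ^ n * e \<in> polys (fixed Q) t"
    using P(7)[OF r esubring_power_mult[OF polys_esubring[OF fixed_ring tL(2)] polys_var[OF fixed_ring tL(2)] P(1)]] .
  ultimately have "e = 0" using tt esubringD(1)[OF fixed_ring] unfolding transc_def by blast
  thus False using efield_unit_nz[OF \<Omega>] by blast
qed

lemma fixed_card: "card (fixed Q) = Q"
  and fixed_prod: "z \<in> \<Omega> \<Longrightarrow> z ^ Q - z = (\<Prod>a\<in>fixed Q. z - a) * e"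
proof -
  obtain as where as: "length as = Q" "set as = fixed Q" "\<And>z. z \<in> \<Omega> \<Longrightarrow> z ^ Q - z = (\<Prod>a\<leftarrow>as. z - a) * e"
    using fixed_roots by blast
  have d: "distinct as" by (rule fixed_distinct[OF as])
  show "card (fixed Q) = Q" using as distinct_card[OF d] by simp
  assume "z \<in> \<Omega>"
  thus "z ^ Q - z = (\<Prod>a\<in>fixed Q. z - a) * e" using as prod.distinct_set_conv_list[OF d, of "\<lambda>a. z - a"] by simp
qed

end

end

section \<open>A universe for commutative rings\<close>

text \<open>Each commutative ring on a subset of \<open>'a\<close> is an ideal of the product of all of them; the
  second component only serves to make the product nontrivial.\<close>

typedef 'a univ = "{f :: 'a ring \<Rightarrow> 'a. \<forall>R. if cring R then f R \<in> carrier R else f R = undefined} \<times> (UNIV :: int set)"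
proof
  show "(\<lambda>R. if cring R then \<zero>\<^bsub>R\<^esub> else undefined, 0) \<in>
      {f :: 'a ring \<Rightarrow> 'a. \<forall>R. if cring R then f R \<in> carrier R else f R = undefined} \<times> (UNIV :: int set)"
    by (simp add: cring.cring_simprules)
qed

setup_lifting type_definition_univ

instantiation univ :: (type) comm_ring_1
begin

lift_definition zero_univ :: "'a univ" is "(\<lambda>R. if cring R then \<zero>\<^bsub>R\<^esub> else undefined, 0)"
  by (simp add: cring.cring_simprules)

lift_definition one_univ :: "'a univ" is "(\<lambda>R. if cring R then \<one>\<^bsub>R\<^esub> else undefined, 1)"
  by (simp add: cring.cring_simprules)

lift_definition plus_univ :: "'a univ \<Rightarrow> 'a univ \<Rightarrow> 'a univ"
  is "\<lambda>f g. (\<lambda>R. if cring R then fst f R \<oplus>\<^bsub>R\<^esub> fst g R else undefined, snd f + snd g)"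
  by (simp add: mem_Times_iff cring.cring_simprules)

lift_definition uminus_univ :: "'a univ \<Rightarrow> 'a univ"
  is "\<lambda>f. (\<lambda>R. if cring R then \<ominus>\<^bsub>R\<^esub> fst f R else undefined, - snd f)"
  by (simp add: mem_Times_iff cring.cring_simprules)

definition minus_univ :: "'a univ \<Rightarrow> 'a univ \<Rightarrow> 'a univ" where
  "minus_univ f g = f + - g"

lift_definition times_univ :: "'a univ \<Rightarrow> 'a univ \<Rightarrow> 'a univ"
  is "\<lambda>f g. (\<lambda>R. if cring R then fst f R \<otimes>\<^bsub>R\<^esub> fst g R else undefined, snd f * snd g)"
  by (simp add: mem_Times_iff cring.cring_simprules)

instance
proof
  fix a b c :: "'a univ"
  note eqs = Rep_univ_inject[symmetric] plus_univ.rep_eq times_univ.rep_eq uminus_univ.rep_eq zero_univ.rep_eq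
    one_univ.rep_eq fun_eq_iff prod_eq_iff
  have C: "fst (Rep_univ x) S \<in> carrier S" if "cring S" for x :: "'a univ" and S using Rep_univ[of x] that by auto
  have U: "fst (Rep_univ x) S = undefined" if "\<not> cring S" for x :: "'a univ" and S using Rep_univ[of x] that by auto
  show "a * b * c = a * (b * c)" "a * b = b * a"
    by (simp_all add: eqs C monoid.m_assoc[OF ring.axioms(2)[OF cring.axioms(1)]] comm_monoid.m_comm[OF cring.axioms(2)])
  show "1 * a = a" "a + b + c = a + (b + c)" "a + b = b + a" "0 + a = a" "- a + a = 0" "(a + b) * c = a * c + b * c"
    by (simp_all add: eqs C U cring.cring_simprules distrib_right)
  show "a - b = a + - b" by (simp add: minus_univ_def)
  show "(0 :: 'a univ) \<noteq> 1" by (simp add: eqs)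
qed

end

text \<open>The element is supported at the coordinate \<open>R\<close>, with integer component 0,
  so the unit of the image is an idempotent different from 1.\<close>

lift_definition embed :: "'a ring \<Rightarrow> 'a \<Rightarrow> 'a univ"
  is "\<lambda>R x. (\<lambda>S. if cring S then if S = R \<and> x \<in> carrier R then x else \<zero>\<^bsub>S\<^esub> else undefined, 0)"
  by (simp add: cring.cring_simprules)

context
  fixes R :: "'a ring" (structure)
  assumes R: "cring R"
begin

interpretation cring R by (rule R)

lemma embed_add: "x \<in> carrier R \<Longrightarrow> y \<in> carrier R \<Longrightarrow> embed R (x \<oplus> y) = embed R x + embed R y"
  by (auto simp: Rep_univ_inject[symmetric] embed.rep_eq plus_univ.rep_eq cring.cring_simprules)

lemma zero_mult_zero: "cring S \<Longrightarrow> \<zero>\<^bsub>S\<^esub> \<otimes>\<^bsub>S\<^esub> \<zero>\<^bsub>S\<^esub> = \<zero>\<^bsub>S\<^esub>"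
proof -
  assume "cring S"
  then interpret S: cring S .
  show ?thesis by simp
qed

lemma embed_mult: "x \<in> carrier R \<Longrightarrow> y \<in> carrier R \<Longrightarrow> embed R (x \<otimes> y) = embed R x * embed R y"
  by (auto simp: Rep_univ_inject[symmetric] embed.rep_eq times_univ.rep_eq zero_mult_zero)

lemma embed_zero: "embed R \<zero> = 0"
  by (auto simp: Rep_univ_inject[symmetric] embed.rep_eq zero_univ.rep_eq)

lemma embed_uminus: "x \<in> carrier R \<Longrightarrow> embed R (\<ominus> x) = - embed R x"
  using embed_add[of "\<ominus> x" x] embed_zero by (simp add: l_neg eq_neg_iff_add_eq_0)

lemma embed_inj: "inj_on (embed R) (carrier R)"
proof (rule inj_onI)
  fix x y assume "x \<in> carrier R" "y \<in> carrier R" "embed R x = embed R y"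
  thus "x = y" using R by (auto simp: Rep_univ_inject[symmetric] embed.rep_eq dest!: fun_cong[where x = R])
qed

lemma embed_ring: "esubring (embed R \<one>) (embed R ` carrier R)"
  unfolding esubring_def by (auto simp flip: embed_mult embed_uminus embed_add)

lemma embed_power: "x \<in> carrier R \<Longrightarrow> embed R x ^ k * embed R \<one> = embed R (x [^] k)"
proof (induction k)
  case (Suc k)
  have "embed R x ^ Suc k * embed R \<one> = embed R (x [^] k) * embed R x" using Suc by (simp add: mult_ac)
  thus ?case using Suc.prems by (simp add: embed_mult)
qed simp

end

lemma embed_field:
  fixes R :: "'a ring" (structure)
  assumes "field R"
  shows "efield (embed R \<one>) (embed R ` carrier R)"
proof -
  interpret field R by (rule assms)
  have "embed R \<one> \<noteq> 0"
    using inj_on_contraD[OF embed_inj[OF is_cring] one_not_zero] embed_zero[OF is_cring] by simp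
  moreover have "\<exists>y\<in>carrier R. embed R x * embed R y = embed R \<one>" if "x \<in> carrier R" "embed R x \<noteq> 0" for x
  proof -
    have "x \<noteq> \<zero>" using that embed_zero[OF is_cring] by auto
    hence "x \<in> Units R" using that field_Units by blast
    hence "inv x \<in> carrier R" "x \<otimes> inv x = \<one>" by auto
    thus ?thesis using embed_mult[OF is_cring that(1), of "inv x"] by metis
  qed
  ultimately show ?thesis unfolding efield_def using embed_ring[OF is_cring] by blast
qed

text \<open>Translation by \<open>e\<close> permutes \<open>K\<close>, so summing over
  \<open>K\<close> gives \<open>card K\<close> times \<open>e\<close> equal to zero; without zero
  divisors one factor \<open>p\<close> suffices.\<close>

lemma characteristic:
  assumes \<Omega>: "efield e \<Omega>" and K: "esubring e K" "K \<subseteq> \<Omega>" "card K = p ^ k" "finite K"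
  shows "of_nat p * e = 0"
proof (rule ccontr)
  assume nz: "of_nat p * e \<noteq> 0"
  have "bij_betw (\<lambda>z. z + e) K K"
    by (rule bij_betw_byWitness[of _ "\<lambda>z. z - e"]) (use esubringD(5,7)[OF K(1) _ esubringD(1)[OF K(1)]] in auto)
  hence "(\<Sum>z\<in>K. z + e) = (\<Sum>z\<in>K. z)" by (rule sum.reindex_bij_betw)
  hence 0: "of_nat (p ^ k) * e = 0" using K(3) by (simp add: sum.distrib)
  have "of_nat n * e \<in> \<Omega>" for n
    by (induction n) (use esubringD(1,5,8)[OF efield_esubring[OF \<Omega>]] in \<open>auto simp: distrib_right\<close>)
  hence "of_nat p ^ k * e \<noteq> 0"
  proof (induction k)
    case (Suc k)
    have "of_nat p * (of_nat p ^ k * e) = (of_nat p * e) * (of_nat p ^ k * e)"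
      using esubringD(3)[OF efield_esubring[OF \<Omega>] Suc.prems[of "p ^ Suc k"]] by (simp add: mult_ac)
    moreover have "of_nat p ^ k * e \<in> \<Omega>" using Suc.prems[of "p ^ k"] by simp
    ultimately show ?case using efield_mult_nz[OF \<Omega> Suc.prems _ nz] Suc by (simp add: mult.assoc)
  qed (use efield_unit_nz[OF \<Omega>] in simp)
  thus False using 0 by simp
qed

text \<open>The algebraic closure of \<open>F\<close>, embedded in the universal ring. The image of
  \<open>K\<close> determines the characteristic, and the powers of the image of \<open>x\<close>
  are distinct because \<open>x\<close> is transcendental.\<close>

lemma closed_field_closure:
  fixes F :: "'a ring"
  assumes F: "field F" and K: "subfield K F" "card K = p ^ k" "normalization_semidom_class.prime p"
    and x: "x \<in> carrier F" "ring.transcendental F K x"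
  shows "\<exists>(e :: (('a list \<times> nat) multiset \<Rightarrow> 'a) univ) \<Omega> s. closed_field e \<Omega> p s"
proof -
  interpret F: field F by (rule F)
  define A where "A = F.alg_closure"
  interpret A: algebraic_closure A "F.indexed_const ` carrier F" unfolding A_def by (rule F.alg_closureE)
  define h :: "'a \<Rightarrow> ('a list \<times> nat) multiset \<Rightarrow> 'a" where "h = F.indexed_const"
  have h: "h \<in> ring_hom F A" unfolding h_def A_def by (rule F.alg_closureE)
  interpret h: ring_hom_ring F A h by (rule ring_hom_ringI2[OF F.ring_axioms A.ring_axioms h])
  let ?i = "embed A"
  define e where "e = ?i \<one>\<^bsub>A\<^esub>"
  define \<Omega> where "\<Omega> = ?i ` carrier A"
  define s where "s = ?i (h x)"
  note R = A.is_cring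
  note add = embed_add[OF R] and mult = embed_mult[OF R]
  have \<Omega>: "efield e \<Omega>" unfolding e_def \<Omega>_def by (rule embed_field[OF A.field_axioms])
  note KF = subfieldE(3)[OF K(1)] and Ks = subringE[OF subfieldE(1)[OF K(1)]]
  have finK: "finite K" using K(2) prime_gt_0_nat[OF K(3)] by (intro card_ge_0_finite) simp
  have inj: "inj_on (\<lambda>z. ?i (h z)) K"
  proof (rule inj_onI)
    fix z w assume zw: "z \<in> K" "w \<in> K" "?i (h z) = ?i (h w)"
    have "z \<in> carrier F" "w \<in> carrier F" using zw KF by auto
    thus "z = w" using zw(3) inj_onD[OF embed_inj[OF R], of "h z" "h w"] inj_onD[OF F.indexed_const_inj_on, of z w] h.hom_closed
      by (simp add: h_def)
  qed
  have "closed_field e \<Omega> p s"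
  proof
    show "efield e \<Omega>" "normalization_semidom_class.prime p" by (fact \<Omega> K(3))+
    show "of_nat p * e = 0"
    proof (rule characteristic[OF \<Omega>])
      show "card ((\<lambda>z. ?i (h z)) ` K) = p ^ k" "finite ((\<lambda>z. ?i (h z)) ` K)"
        using card_image[OF inj] K(2) finK by auto
      show "(\<lambda>z. ?i (h z)) ` K \<subseteq> \<Omega>" using KF by (auto simp: \<Omega>_def)
      show "esubring e ((\<lambda>z. ?i (h z)) ` K)"
        unfolding esubring_def
      proof (intro conjI ballI)
        have "e = ?i (h \<one>\<^bsub>F\<^esub>)" by (simp add: e_def)
        thus "e \<in> (\<lambda>z. ?i (h z)) ` K" using Ks(3) by (rule image_eqI)
        fix a assume "a \<in> (\<lambda>z. ?i (h z)) ` K"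
        then obtain z where z: "a = ?i (h z)" "z \<in> K" "z \<in> carrier F" using KF by auto
        show "e * a = a" using z by (simp add: e_def flip: mult)
        have "- a = ?i (h (\<ominus>\<^bsub>F\<^esub> z))" using z by (simp add: embed_uminus[OF R])
        thus "- a \<in> (\<lambda>z. ?i (h z)) ` K" using Ks(5)[OF z(2)] by (rule image_eqI)
        fix b assume "b \<in> (\<lambda>z. ?i (h z)) ` K"
        then obtain w where w: "b = ?i (h w)" "w \<in> K" "w \<in> carrier F" using KF by auto
        have "a + b = ?i (h (z \<oplus>\<^bsub>F\<^esub> w))" "a * b = ?i (h (z \<otimes>\<^bsub>F\<^esub> w))" using z w by (simp_all add: add mult)
        thus "a + b \<in> (\<lambda>z. ?i (h z)) ` K" "a * b \<in> (\<lambda>z. ?i (h z)) ` K"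
          using Ks(6,7)[OF z(2) w(2)] by (blast intro: image_eqI)+
      qed
    qed
    show "s \<in> \<Omega>" using x(1) by (simp add: s_def \<Omega>_def)
    show "i = j" if "s ^ i * e = s ^ j * e" for i j
    proof -
      have "?i (h (x [^]\<^bsub>F\<^esub> i)) = ?i (h (x [^]\<^bsub>F\<^esub> j))"
        using that x(1) by (simp add: s_def e_def embed_power[OF R] h.hom_nat_pow)
      hence "h (x [^]\<^bsub>F\<^esub> i) = h (x [^]\<^bsub>F\<^esub> j)" by (rule inj_onD[OF embed_inj[OF R]]) (use x(1) in auto)
      hence "x [^]\<^bsub>F\<^esub> i = x [^]\<^bsub>F\<^esub> j" unfolding h_def by (rule inj_onD[OF F.indexed_const_inj_on]) (use x(1) in auto)
      moreover have "F.monom \<one>\<^bsub>F\<^esub> i \<in> carrier (K[X]\<^bsub>F\<^esub>)" for i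
        using F.monom_is_polynomial[OF subfieldE(1)[OF K(1)], of "\<one>\<^bsub>F\<^esub>" i] Ks(3) by (simp add: univ_poly_carrier)
      ultimately have "F.monom \<one>\<^bsub>F\<^esub> i = F.monom \<one>\<^bsub>F\<^esub> j"
        using x inj_onD[OF x(2)[unfolded F.transcendental_def]] by (simp add: F.eval_monom)
      hence "length (F.monom \<one>\<^bsub>F\<^esub> i) = length (F.monom \<one>\<^bsub>F\<^esub> j)" by simp
      thus ?thesis by (simp add: F.monom_def)
    qed
    fix g n assume "g \<in> monics e \<Omega> (Suc n)"
    \<comment> \<open>Monic functions are turned into coefficient lists, leading coefficient first,
      to which the splitting of polynomials over the closure applies.\<close>
    moreover have "g \<in> monics e \<Omega> n \<Longrightarrow> \<exists>cs. set cs \<subseteq> carrier A \<and> length cs = Suc n \<and> hd cs = \<one>\<^bsub>A\<^esub> \<and>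
        (\<forall>z\<in>carrier A. g (?i z) = ?i (A.eval cs z))" for g n
    proof (induction n arbitrary: g)
      case 0
      thus ?case by (intro exI[of _ "[\<one>\<^bsub>A\<^esub>]"]) (auto simp: e_def)
    next
      case (Suc n)
      then obtain g' c where g: "g = (\<lambda>z. z * g' z + ?i c)" "g' \<in> monics e \<Omega> n" "c \<in> carrier A" by (auto simp: \<Omega>_def)
      obtain cs where cs: "set cs \<subseteq> carrier A" "length cs = Suc n" "hd cs = \<one>\<^bsub>A\<^esub>"
        "\<And>z. z \<in> carrier A \<Longrightarrow> g' (?i z) = ?i (A.eval cs z)" using Suc.IH[OF g(2)] by blast
      have "g (?i z) = ?i (A.eval (cs @ [c]) z)" if "z \<in> carrier A" for z
        using cs(4)[OF that] A.eval_in_carrier[OF cs(1) that] that g(3)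
        by (simp add: g(1) A.eval_append_aux[OF cs(1) g(3) that] add mult mult.commute)
      thus ?case using cs g(3) by (intro exI[of _ "cs @ [c]"]) (auto simp: hd_append)
    qed
    ultimately obtain cs where cs: "set cs \<subseteq> carrier A" "length cs = Suc (Suc n)" "hd cs = \<one>\<^bsub>A\<^esub>"
      "\<And>z. z \<in> carrier A \<Longrightarrow> g (?i z) = ?i (A.eval cs z)" by blast
    have P: "cs \<in> carrier (poly_ring A)" using cs(1,3) by (simp add: univ_poly_carrier[symmetric] polynomial_def)
    have "size (A.roots cs) = Suc n" using A.roots_over_carrier[OF P] cs(2) by (simp add: A.splitted_def)
    then obtain a where "a \<in># A.roots cs" by (cases "A.roots cs") auto
    hence "a \<in> carrier A" "A.eval cs a = \<zero>\<^bsub>A\<^esub>" using A.roots_mem_iff_is_root[OF P] by (auto simp: A.is_root_def)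
    hence "?i a \<in> \<Omega>" "g (?i a) = 0" using cs(4) embed_zero[OF R] by (auto simp: \<Omega>_def)
    thus "\<exists>a\<in>\<Omega>. g a = 0" by blast
  qed
  thus ?thesis by blast
qed

section \<open>Function fields on the natural numbers\<close>

lemma countable_lspan: "countable E \<Longrightarrow> countable (lspan E ws)"
proof (induction ws)
  case (Cons w ws)
  have "lspan E (w # ws) \<subseteq> (\<lambda>(a, z). a * w + z) ` (E \<times> lspan E ws)"
  proof
    fix z assume "z \<in> lspan E (w # ws)"
    then obtain a v where "z = a * w + v" "a \<in> E" "v \<in> lspan E ws" by (rule lspan_ConsE)
    thus "z \<in> (\<lambda>(a, z). a * w + z) ` (E \<times> lspan E ws)" by (intro image_eqI[of _ _ "(a, v)"]) auto
  qed
  thus ?case by (rule countable_subset) (use Cons in simp)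
qed simp

lemma (in base_field) countable_fractions: "countable (fractions e (polys K s))"
proof -
  have "countable (polys K s)"
    unfolding polys_def by (rule countable_UN) (use countable_finite polys_below_finite[OF K' finK] in auto)
  hence "countable ((\<lambda>(f, g). f * iv e g) ` (polys K s \<times> polys K s))" by simp
  moreover have "fractions e (polys K s) \<subseteq> (\<lambda>(f, g). f * iv e g) ` (polys K s \<times> polys K s)"
  proof
    fix z assume "z \<in> fractions e (polys K s)"
    then obtain f g where "z = f * iv e g" "f \<in> polys K s" "g \<in> polys K s" unfolding fractions_def by blast
    thus "z \<in> (\<lambda>(f, g). f * iv e g) ` (polys K s \<times> polys K s)" by (intro image_eqI[of _ _ "(f, g)"]) auto
  qed
  ultimately show ?thesis by (rule countable_subset[rotated])
qed

text \<open>Transport of the ring structure along an injection into the natural numbers, the carrier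
  type over which \<open>max_rational_places\<close> ranges.\<close>

lemma nat_model:
  assumes L: "efield e L" and "countable L"
  obtains R :: "nat ring" and f where "field R" "bij_betw f (carrier R) L" "f \<one>\<^bsub>R\<^esub> = e"
    "\<And>x y. x \<in> carrier R \<Longrightarrow> y \<in> carrier R \<Longrightarrow> f (x \<oplus>\<^bsub>R\<^esub> y) = f x + f y"
    "\<And>x y. x \<in> carrier R \<Longrightarrow> y \<in> carrier R \<Longrightarrow> f (x \<otimes>\<^bsub>R\<^esub> y) = f x * f y"
proof -
  obtain t :: "_ \<Rightarrow> nat" where t: "inj_on t L" using assms(2) by (auto simp: countable_def)
  define f where "f = inv_into L t"
  define R where "R = \<lparr>carrier = t ` L, mult = \<lambda>a b. t (f a * f b), one = t e, zero = t 0, add = \<lambda>a b. t (f a + f b)\<rparr>"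
  have ft: "f (t z) = z" if "z \<in> L" for z using t that by (simp add: f_def)
  note D = esubringD[OF efield_esubring[OF L]]
  have ab: "abelian_group R"
  proof (rule abelian_groupI)
    fix a assume "a \<in> carrier R"
    then obtain z where "z \<in> L" "a = t z" by (auto simp: R_def)
    thus "\<exists>y\<in>carrier R. y \<oplus>\<^bsub>R\<^esub> a = \<zero>\<^bsub>R\<^esub>" using D(4) by (intro bexI[of _ "t (- z)"]) (auto simp: R_def ft)
  qed (auto simp: R_def ft D add_ac)
  have "comm_monoid R"
    by (rule comm_monoidI) (auto simp: R_def ft D mult_ac)
  hence "cring R" by (rule cringI[OF ab]) (auto simp: R_def ft D distrib_right)
  hence "field R"
  proof (rule cring.cring_fieldI)
    have "t z \<in> Units R \<longleftrightarrow> z \<noteq> 0" if z: "z \<in> L" for z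
    proof
      assume "t z \<in> Units R"
      then obtain w where "w \<in> L" "z * w = e" using z inj_onD[OF t] D(1,6) by (auto simp: Units_def R_def ft)
      thus "z \<noteq> 0" using efield_unit_nz[OF L] by auto
    next
      assume "z \<noteq> 0"
      thus "t z \<in> Units R" using efield_iv[OF L z] z by (auto simp: Units_def R_def ft intro!: bexI[of _ "iv e z"])
    qed
    thus "Units R = carrier R - {\<zero>\<^bsub>R\<^esub>}" using inj_onD[OF t _ _ D(8)] by (auto simp: R_def Units_def)
  qed
  moreover have "bij_betw f (carrier R) L" unfolding f_def R_def using bij_betw_inv_into[OF inj_on_imp_bij_betw[OF t]] by simp
  ultimately show thesis by (rule that) (auto simp: R_def ft D)
qed

text \<open>\<open>N\<close> is the length of the pruned basis. It bounds the genus from above and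
  gives N (l - 1) rational places; the last inequality will force the genus to grow with
  \<open>N\<close>.\<close>

lemma (in closed_field) tower_level_invariants:
  assumes l: "l = p ^ j" "j > 0" and r: "Q = l ^ r" "r \<ge> 2" and m: "m > 0"
  shows "\<exists>N n (R :: nat ring) K. m + 1 \<le> Q ^ N \<and> global_function_field R K \<and> card K = Q \<and>
    ring.genus R K = int n \<and> n \<le> N + 1 \<and> N * (l - 1) \<le> ring.num_places R K 1 \<and> N * (l - 1) \<le> Q * (n + 1) + n + 1"
proof -
  define K where "K = fixed Q"
  have Q: "Q = p ^ (j * r)" "j * r > 0" using l r by (simp_all add: power_mult)
  have l2: "l \<ge> 2" by (rule Q2[OF l])
  note Kf = fixed_field[OF Q, folded K_def] and KO = fixed_subset[OF Q, folded K_def]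
  note KD = esubringD[OF efield_esubring[OF Kf(1)]]
  have cardK: "card K = Q" unfolding K_def by (rule fixed_card[OF Q])
  have FK: "fixed l \<subseteq> K"
  proof
    fix z assume z: "z \<in> fixed l"
    have "z ^ (l ^ i) = z" for i by (induction i) (use z in \<open>simp_all add: fixed_def power_mult\<close>)
    thus "z \<in> K" using z by (auto simp: K_def fixed_def r(1))
  qed
  \<comment> \<open>As \<open>r\<close> is at least 2, \<open>K\<close> contains some
    \<open>b\<close> that is not fixed by the l-th power, and this provides a nonzero
    \<open>c\<close>.\<close>
  have "l < Q" using power_strict_increasing[of 1 r l] l2 r by simp
  hence "K \<noteq> fixed l" using cardK fixed_card[OF l] by auto
  then obtain b where b: "b \<in> K" "b \<notin> fixed l" using FK by blast
  define c where "c = b ^ l - b"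
  have c: "c \<in> K" "c \<noteq> 0"
    using b KO KD(7)[OF esubring_power[OF efield_esubring[OF Kf(1)] b(1), of l] b(1)] l2 by (auto simp: c_def fixed_def)
  have tr: "transc K s" unfolding K_def by (rule fixed_transc[OF Q])
  have s0: "s \<noteq> 0" by (rule transc_nz[OF efield_esubring[OF Kf(1)] efield_unit_nz[OF \<Omega>] tr])
  note ivs = efield_iv[OF \<Omega> s(1) s0]
  define as where "as v = (SOME z. z \<in> \<Omega> \<and> z ^ l - z = v)" for v
  have as: "as v \<in> \<Omega>" "as v ^ l - as v = v" if "v \<in> \<Omega>" for v
    using someI_ex[of "\<lambda>z. z \<in> \<Omega> \<and> z ^ l - z = v"] AS_root[OF l that] by (auto simp: as_def)
  define xy where "xy = rec_nat (e, e) (\<lambda>_ (x, y). (as (c * (x - s * y)), as (c * (iv e s * x - y))))"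
  define x y where "x i = fst (xy i)" and "y i = snd (xy i)" for i
  have rec: "x 0 = e" "y 0 = e" "x (Suc i) = as (c * (x i - s * y i))" "y (Suc i) = as (c * (iv e s * x i - y i))" for i
    by (simp_all add: x_def y_def xy_def split_beta)
  have step: "c * (a - s * b) \<in> \<Omega>" "c * (iv e s * a - b) \<in> \<Omega>" if "a \<in> \<Omega>" "b \<in> \<Omega>" for a b
    using \<Omega>D(6)[OF subsetD[OF KO c(1)]] \<Omega>D(6)[OF s(1)] \<Omega>D(6)[OF ivs(1)] \<Omega>D(7) that by auto
  have xy: "x i \<in> \<Omega> \<and> y i \<in> \<Omega>" for i
    by (induction i) (use rec \<Omega>D(1) as(1) step in auto)
  interpret T: tower e \<Omega> K s c l x y
  proof (rule tower.intro[OF base_field.intro[OF \<Omega> Kf(1) KO Kf(2)] _ tower_axioms.intro[OF c(1) tr]])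
    have "x (Suc i) ^ l - x (Suc i) = c * (x i - s * y i)" "y (Suc i) ^ l - y (Suc i) = c * (iv e s * x i - y i)" for i
      unfolding rec(3,4)[of i] using as(2) step xy by auto
    thus "two_seq e \<Omega> s c l x y"
      using \<Omega> s(1) s0 subsetD[OF KO c(1)] l2 rec(1,2) xy by (intro two_seq.intro frobenius_Q[OF l]) auto
  qed
  show ?thesis
  proof (rule T.level_basis[of m])
    fix zs
    assume zs: "triangular T.E zs" "indep T.E (map fst zs)" "T.B m = lspan T.E (map fst zs)"
      "set (map fst zs) \<subseteq> T.B m"
      "\<And>V w. base_field.vring e (T.B m) K V \<Longrightarrow> s \<notin> V \<Longrightarrow> w \<in> set (map fst zs) \<Longrightarrow> w * iv e s \<in> V"
      "\<And>V w. base_field.vring e (T.B m) K V \<Longrightarrow> iv e s \<notin> V \<Longrightarrow> w \<in> set (map snd zs) \<Longrightarrow> w * s \<in> V"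
      "\<And>S. esubring e S \<Longrightarrow> K \<subseteq> S \<Longrightarrow> (\<And>i. i \<le> m \<Longrightarrow> x i \<in> S \<and> y i \<in> S) \<Longrightarrow> set (map fst zs) \<subseteq> S"
    have "countable (T.B m)" unfolding zs(3) by (rule countable_lspan[OF T.countable_fractions])
    then obtain R :: "nat ring" and f where R: "field R" "bij_betw f (carrier R) (T.B m)" "f \<one>\<^bsub>R\<^esub> = e"
      "\<And>x y. x \<in> carrier R \<Longrightarrow> y \<in> carrier R \<Longrightarrow> f (x \<oplus>\<^bsub>R\<^esub> y) = f x + f y"
      "\<And>x y. x \<in> carrier R \<Longrightarrow> y \<in> carrier R \<Longrightarrow> f (x \<otimes>\<^bsub>R\<^esub> y) = f x * f y"
      using nat_model[OF T.B_field] by blast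
    interpret base_field e "T.B m" K
      by (rule base_field.intro[OF T.B_field Kf(1) order_trans[OF T.K_E T.E_B] Kf(2)])
    interpret spanned_field e "T.B m" K s "map fst zs"
      by unfold_locales (use subsetD[OF T.E_B T.s_E(1)] zs(4) zs(3) in auto)
    interpret R: field R by (rule R(1))
    interpret M: field_model e "T.B m" K s "map fst zs" R f
      by unfold_locales (use R in auto)
    have BO: "z \<in> T.B m \<Longrightarrow> z \<in> \<Omega>" for z using T.B_\<Omega> by blast
    interpret tower_level e "T.B m" K s zs M.deg c b l m x y "fixed l"
    proof
      show "x (Suc i) ^ l - x (Suc i) = c * (x i - s * y i)" "y (Suc i) ^ l - y (Suc i) = c * (iv e s * x i - y i)" for i
        by (fact T.x_rec T.y_rec)+
      show "(a + b) ^ l = a ^ l + b ^ l" if "a \<in> T.B m" "b \<in> T.B m" for a b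
        by (rule T.frobenius[OF BO[OF that(1)] BO[OF that(2)]])
      show "z ^ l - z = (\<Prod>a\<in>fixed l. z - a) * e" if "z \<in> T.B m" for z by (rule fixed_prod[OF l BO[OF that]])
    qed (use tr l2 c b T.init T.x_B T.seq_B zs FK in \<open>auto simp: c_def fixed_def\<close>)
    obtain S where S: "finite S" "card S = length zs * card (fixed l - {0})" "\<forall>V\<in>S. vring V \<and> M.deg V = 1"
      using splitting_places by blast
    have "0 \<in> fixed l" using esubringD(8)[OF fixed_ring[OF l]] .
    hence cS: "card S = length zs * (l - 1)" using S(2) fixed_card[OF l] by (simp add: card_Diff_singleton)
    have deg: "m + 1 \<le> Q ^ length zs" using level_degree cardK by simp
    have "length zs \<noteq> 0" using deg m by (cases "length zs") auto
    hence "S \<noteq> {}" using cS l2 by auto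
    then obtain n where n: "global_function_field R M.K0" "R.genus M.K0 = int n" "n \<le> length (map fst zs) + 1"
      "card S \<le> R.num_places M.K0 1" "card S \<le> card K * (n + 1) + n + 1"
      using M.model_invariants[OF tr Riemann_Roch_lower S(1)] S(3) by blast
    show ?thesis
      by (intro exI[of _ "length zs"] exI[of _ n] exI[of _ R] exI[of _ M.K0])
        (use deg n cS cardK M.K0_finite in auto)
  qed
qed

section \<open>Asymptotics\<close>

lemma Ihara_A_ge:
  assumes "\<And>G. \<exists>g\<ge>G. \<exists>(R :: nat ring) K. g > 0 \<and> global_function_field R K \<and> card K = Q \<and> ring.genus R K = int g \<and>
    a * real g \<le> real (ring.num_places R K 1)"
  shows "ereal a \<le> Ihara_A Q"
  unfolding Ihara_A_def limsup_INF_SUP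
proof (rule INF_greatest)
  fix G :: nat
  obtain g and R :: "nat ring" and K where g: "g \<ge> G" "g > 0" "global_function_field R K" "card K = Q"
    "ring.genus R K = int g" "a * real g \<le> real (ring.num_places R K 1)" using assms by blast
  have "ereal (real (ring.num_places R K 1)) \<le> max_rational_places Q g"
    unfolding max_rational_places_def using g by (intro SUP_upper2[of "(R, K)"]) auto
  hence "ereal (a * real g) \<le> max_rational_places Q g" using g(6) by (meson ereal_less_eq(3) order_trans)
  hence "ereal a \<le> max_rational_places Q g / ereal (real g)"
    using g(2) by (subst ereal_le_divide_pos) (simp_all add: mult.commute)
  also have "\<dots> \<le> (SUP g\<in>{G..}. max_rational_places Q g / ereal (real g))" using g(1) by (intro SUP_upper) simp
  finally show "ereal a \<le> (SUP g\<in>{G..}. max_rational_places Q g / ereal (real g))" .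
qed

lemma (in closed_field) Ihara_A_tower:
  assumes l: "l = p ^ j" "j > 0" and r: "Q = l ^ r" "r \<ge> 2"
  shows "ereal (real l - 2) \<le> Ihara_A Q"
proof (rule Ihara_A_ge)
  fix G :: nat
  have l2: "l \<ge> 2" by (rule Q2[OF l])
  have Q0: "Q \<ge> 1" using l2 r by simp
  \<comment> \<open>N > B has two uses: with the bound on places by the genus, the summand (Q + 1)
    (G + 2) forces n > G, and N > l gives (l - 2) (N + 1) at most N (l - 1), absorbing the 1 in n
    \<le> N + 1.\<close>
  define B where "B = (Q + 1) * (G + 2) + l"
  have "Q ^ B > 0" using Q0 by simp
  then obtain N n and R :: "nat ring" and K where N: "Q ^ B + 1 \<le> Q ^ N" "global_function_field R K" "card K = Q"
    "ring.genus R K = int n" "n \<le> N + 1" "N * (l - 1) \<le> ring.num_places R K 1" "N * (l - 1) \<le> Q * (n + 1) + n + 1"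
    using tower_level_invariants[OF l r, of "Q ^ B"] by metis
  have "N > B" using N(1) power_increasing[OF _ Q0, of N B] by (cases "N \<le> B") auto
  have "N \<le> N * (l - 1)" using mult_le_mono2[of 1 "l - 1" N] l2 by force
  hence "(Q + 1) * (G + 2) < (Q + 1) * (n + 1)" using N(7) \<open>N > B\<close> by (simp add: B_def algebra_simps)
  hence nG: "n > G" unfolding mult_less_cancel1 by linarith
  have "(real l - 2) * real n \<le> (real l - 2) * (real N + 1)" using N(5) l2 by (intro mult_left_mono) auto
  also have "\<dots> \<le> real N * (real l - 1)" using \<open>N > B\<close> by (simp add: B_def algebra_simps)
  also have "\<dots> = real (N * (l - 1))" using l2 by (simp add: of_nat_diff)
  also have "\<dots> \<le> real (ring.num_places R K 1)" using N(6) by (simp only: of_nat_le_iff)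
  finally show "\<exists>g\<ge>G. \<exists>(R :: nat ring) K. g > 0 \<and> global_function_field R K \<and> card K = Q \<and> ring.genus R K = int g \<and>
      (real l - 2) * real g \<le> real (ring.num_places R K 1)"
    using N nG by (intro exI[of _ n] conjI exI[of _ R] exI[of _ K]) auto
qed

text \<open>The factor (r - 2)/(r - 1) is at most 1, and with u the square root of
  \<open>q ^ s\<close> the rest is the square of u - sqrt (s/2).\<close>

lemma Ihara_bound_le:
  fixes r s q :: nat
  assumes "r \<ge> 3" "q > 0"
  shows "sqrt 2 * (real r - 2) / (real r - 1) * sqrt (real s) * real q powr (real s / 2) + (- (real s / 2) - 2)
    \<le> real (q ^ s) - 2"
proof -
  define u where "u = sqrt (real (q ^ s))"
  have u: "real q powr (real s / 2) = u" "u\<^sup>2 = real (q ^ s)" "u \<ge> 0"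
    using assms(2) by (simp_all add: u_def powr_half_sqrt[symmetric] powr_realpow[symmetric] powr_powr)
  have "(real r - 2) / (real r - 1) \<le> 1" using assms(1) by (simp add: divide_le_eq)
  moreover have "sqrt 2 * sqrt (real s) * u \<ge> 0" using u(3) by simp
  ultimately have "(real r - 2) / (real r - 1) * (sqrt 2 * sqrt (real s) * u) \<le> sqrt 2 * sqrt (real s) * u"
    using mult_right_mono[of _ 1] by fastforce
  moreover have "0 \<le> (u - sqrt (real s) / sqrt 2)\<^sup>2" by simp
  hence "sqrt 2 * sqrt (real s) * u \<le> u\<^sup>2 + real s / 2"
    by (simp add: power2_diff power_divide real_sqrt_mult field_simps)
  ultimately show ?thesis using u(1,2) by (simp add: mult_ac)
qed

theorem corollary3p4:
  fixes r s :: nat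
  assumes "odd r" "r \<ge> 3" "s > 0" "coprime s r"
  shows "\<exists>h :: nat \<Rightarrow> real. h \<in> O(\<lambda>q. 1) \<and>
    (\<forall>(q :: nat) (F :: nat ring) K.
       primepow q \<and> odd q \<and> rational_function_field F K \<and> card K = q \<and>
       int (ring.num_places F K r) >
         \<lfloor>(3 + real_of_int \<lceil>2 * sqrt (2 * real (ring.num_places F K s) + 1)\<rceil>) / (real r - 2)\<rfloor>
       \<longrightarrow> Ihara_A (q ^ (r * s)) \<ge>
             ereal (sqrt 2 * (real r - 2) / (real r - 1) * sqrt (real s) * real q powr (real s / 2) + h q))"
\<comment> \<open>The error term does not depend on \<open>q\<close>: the 2 comes from the bound l -
  2, and s/2 from completing the square.\<close>
proof (intro exI[of _ "\<lambda>_. - (real s / 2) - 2"] conjI allI impI)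
  show "(\<lambda>_. - (real s / 2) - 2) \<in> O(\<lambda>q. 1 :: real)" by simp
  fix q :: nat and F :: "nat ring" and K
  assume a: "primepow q \<and> odd q \<and> rational_function_field F K \<and> card K = q \<and>
    int (ring.num_places F K r) >
      \<lfloor>(3 + real_of_int \<lceil>2 * sqrt (2 * real (ring.num_places F K s) + 1)\<rceil>) / (real r - 2)\<rfloor>"
  obtain p k where pk: "normalization_semidom_class.prime p" "k > 0" "q = p ^ k" using a by (auto simp: primepow_def)
  obtain x where "field F" "subfield K F" "x \<in> carrier F" "ring.transcendental F K x"
    using a by (auto simp: rational_function_field_def)
  then obtain e :: "((nat list \<times> nat) multiset \<Rightarrow> nat) univ" and \<Omega> t where "closed_field e \<Omega> p t"
    using closed_field_closure[of F K p k x] a pk by blast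
  then interpret closed_field e \<Omega> p t .
  have "ereal (real (q ^ s) - 2) \<le> Ihara_A (q ^ (r * s))"
    by (rule Ihara_A_tower[where j = "k * s" and r = r])
      (use assms pk(2) in \<open>simp_all add: pk(3) power_mult[symmetric] mult_ac\<close>)
  moreover have "q > 0" using pk prime_gt_0_nat by simp
  ultimately show "Ihara_A (q ^ (r * s)) \<ge>
      ereal (sqrt 2 * (real r - 2) / (real r - 1) * sqrt (real s) * real q powr (real s / 2) + (- (real s / 2) - 2))"
    using Ihara_bound_le[OF assms(2), of q s] by (meson ereal_less_eq(3) order_trans)
qed

end
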